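(* Let $g,p:(0,\infty)\to\mathbb{C}$ satisfy $\int_0^\infty(|g(u)|^2+|g'(u)|^2)du<\infty$ and $\int_0^\infty(|p(v)|^2+|p'(v)|^2)dv<\infty$. Put $A(r)=\sqrt r\,g(r^2/2)$ and $B(s)=-\sqrt s\,p'(s^2/2)$ for $r,s>0$. Then $A$ and $B$ are Hankel transforms of order zero of one another, i.e. $A(r)=\int_0^\infty\sqrt{rs}\,J_0(rs)B(s)\,ds$, if and only if there is a finite energy solution $\phi$ of the Klein-Gordon equation with $g(u)=\phi(-u,u)$ for all $u>0$ and $p(v)=\phi(v,v)$ for all $v>0$ (i.e. $g$ and $p$ are the values of $\phi$ on the past and future boundaries of the Rindler wedge $0<|t|<x$). Furthermore, for any such $\phi$ and any $a>0$, the Cauchy data $(\phi(0,x),\partial_t\phi(0,x))$ vanish for all $0<x<2a$ if and only if $g(u)=0$ for all $0<u<a$ and $p(v)=0$ for all $0<v<a$.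
   Context: A finite energy solution is a (complex-valued) solution $\phi$ of $\phi_{tt}-\phi_{xx}+\phi=0$ on $\mathbb{R}^2$ whose Cauchy data at $t=0$ satisfy $\phi(0,\cdot),\partial_x\phi(0,\cdot),\partial_t\phi(0,\cdot)\in L^2(\mathbb{R})$; it is continuous on spacetime. $J_0$ is the Bessel function of order zero; the Hankel transform of order zero is the unitary operator $B\mapsto\int_0^\infty\sqrt{rs}J_0(rs)B(s)ds$ on $L^2(0,\infty)$. *)

theory Defs
  imports "HOL-Analysis.Analysis"
begin

definition J0 :: "real \<Rightarrow> real" where
  "J0 x = (\<Sum>k. (-1) ^ k / (fact k)\<^sup>2 * (x / 2) ^ (2 * k))"

text \<open>Hankel transform of order zero in the L2 sense: A = H B, where H B is the
  L2 limit (R to infinity) of the truncated integrals over (0,R] (which converge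
  absolutely for locally square integrable B).  This is the unitary operator on L2(0,inf).\<close>
definition hankel0_pair :: "(real \<Rightarrow> complex) \<Rightarrow> (real \<Rightarrow> complex) \<Rightarrow> bool" where
  "hankel0_pair A B \<longleftrightarrow>
     ((\<lambda>R. \<integral>\<^sup>+ r\<in>{0<..}. ennreal ((cmod (A r -
          (LINT s:{0<..R}|lborel. complex_of_real (sqrt (r * s) * J0 (r * s)) * B s)))\<^sup>2) \<partial>lborel)
       \<longlongrightarrow> 0) at_top"

definition H1_halfline :: "(real \<Rightarrow> complex) \<Rightarrow> (real \<Rightarrow> complex) \<Rightarrow> bool" where
  "H1_halfline g g' \<longleftrightarrow>
     set_borel_measurable lborel {0<..} g' \<and>
     (\<forall>u v. 0 < u \<and> u \<le> v \<longrightarrow>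
        set_integrable lborel {u..v} g' \<and> g v - g u = (LINT s:{u..v}|lborel. g' s)) \<and>
     (\<integral>\<^sup>+ u\<in>{0<..}. ennreal ((cmod (g u))\<^sup>2 + (cmod (g' u))\<^sup>2) \<partial>lborel) < \<infinity>"

fun dpart :: "nat \<Rightarrow> nat \<Rightarrow> (real \<Rightarrow> real \<Rightarrow> real) \<Rightarrow> real \<Rightarrow> real \<Rightarrow> real" where
  "dpart 0 0 f = f"
| "dpart 0 (Suc j) f = (\<lambda>t x. deriv (\<lambda>y. dpart 0 j f t y) x)"
| "dpart (Suc i) j f = (\<lambda>t x. deriv (\<lambda>s. dpart i j f s x) t)"

definition test_fun :: "(real \<Rightarrow> real \<Rightarrow> real) \<Rightarrow> bool" where
  "test_fun \<psi> \<longleftrightarrow>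
     (\<forall>i j. continuous_on UNIV (\<lambda>z. dpart i j \<psi> (fst z) (snd z)) \<and>
            (\<forall>t x. (\<lambda>s. dpart i j \<psi> s x) differentiable at t \<and>
                   (\<lambda>y. dpart i j \<psi> t y) differentiable at x)) \<and>
     bounded {z. \<psi> (fst z) (snd z) \<noteq> 0}"

text \<open>Finite energy solution of phi_tt - phi_xx + phi = 0 (phi t x): continuous on R^2,
  a distributional solution on R^2, with Cauchy data phi(0,.) in L2, d_x phi(0,.) in L2
  (weak derivative, i.e. phi(0,.) locally absolutely continuous with square integrable
  derivative) and d_t phi(0,.) in L2 (the L2 limit of the time difference quotients).\<close>
definition finite_energy_solution :: "(real \<Rightarrow> real \<Rightarrow> complex) \<Rightarrow> bool" where
  "finite_energy_solution \<phi> \<longleftrightarrow>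
     continuous_on UNIV (\<lambda>z. \<phi> (fst z) (snd z)) \<and>
     (\<forall>\<psi>. test_fun \<psi> \<longrightarrow>
        (LINT z|lborel. \<phi> (fst z) (snd z) *
            complex_of_real (dpart 2 0 \<psi> (fst z) (snd z) - dpart 0 2 \<psi> (fst z) (snd z)
                             + \<psi> (fst z) (snd z))) = 0) \<and>
     (\<integral>\<^sup>+ x. ennreal ((cmod (\<phi> 0 x))\<^sup>2) \<partial>lborel) < \<infinity> \<and>
     (\<exists>d. d \<in> borel_measurable lborel \<and>
          (\<integral>\<^sup>+ x. ennreal ((cmod (d x))\<^sup>2) \<partial>lborel) < \<infinity> \<and>
          (\<forall>x y. x \<le> y \<longrightarrow> set_integrable lborel {x..y} d \<and>
                  \<phi> 0 y - \<phi> 0 x = (LINT s:{x..y}|lborel. d s))) \<and>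
     (\<exists>f1. f1 \<in> borel_measurable lborel \<and>
          (\<integral>\<^sup>+ x. ennreal ((cmod (f1 x))\<^sup>2) \<partial>lborel) < \<infinity> \<and>
          ((\<lambda>h. \<integral>\<^sup>+ x. ennreal ((cmod ((\<phi> h x - \<phi> 0 x) / complex_of_real h - f1 x))\<^sup>2) \<partial>lborel)
             \<longlongrightarrow> 0) (at 0))"

definition dt_vanishes_on :: "(real \<Rightarrow> real \<Rightarrow> complex) \<Rightarrow> real set \<Rightarrow> bool" where
  "dt_vanishes_on \<phi> I \<longleftrightarrow>
     ((\<lambda>h. \<integral>\<^sup>+ x\<in>I. ennreal ((cmod ((\<phi> h x - \<phi> 0 x) / complex_of_real h))\<^sup>2) \<partial>lborel)
        \<longlongrightarrow> 0) (at 0)"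

end

theory Submission
  imports Defs "HOL-Probability.Distributions" "HOL-Real_Asymp.Real_Asymp"
begin

text \<open>
  In characteristic coordinates \<open>F u v = \<phi> (v - u) (u + v)\<close> the equation becomes
  \<open>F\<^sub>u\<^sub>v = F\<close>, in integrated form an identity on characteristic rectangles (\<open>rect\<close>). The functions
  \<open>g\<close> and \<open>p\<close> are then Goursat data on the two axes and the Cauchy line is the diagonal.
  The substitution \<open>u = r\<^sup>2 / 2\<close>, \<open>v = s\<^sup>2 / 2\<close> turns the Hankel relation into an integral operator
  whose Laplace transform is explicit: the relation holds iff
  \<open>\<mu> * (\<integral>g e\<^sup>-\<^sup>\<mu>\<^sup>u du) = - (\<integral>p' e\<^sup>-\<^sup>v\<^sup>/\<^sup>\<mu> dv)\<close> for enough \<open>\<mu> > 0\<close>, because finite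
  exponential sums are dense in \<open>L\<^sup>2(0, \<infinity>)\<close>.
  Green's formula on the sector between an axis and the diagonal, with the solution
  \<open>exp (- \<mu> u - v / \<mu>)\<close>, shows that the integral of \<open>(Y - \<mu> F) exp (- (\<mu> + 1 / \<mu>) w)\<close> along the
  diagonal, where \<open>Y = F\<^sub>v\<close>, is \<open>\<integral>p' e\<^sup>-\<^sup>v\<^sup>/\<^sup>\<mu> dv\<close> for small \<open>\<mu>\<close> and \<open>- F 0 0 - \<integral>g' e\<^sup>-\<^sup>\<mu>\<^sup>u du\<close> for
  large \<open>\<mu>\<close>. Under the Hankel relation both values are the first one; since \<open>\<mu>\<close> and \<open>1 / \<mu>\<close> give the
  same exponential on the diagonal, \<open>F\<close> and \<open>Y\<close> are paired independently with all exponential sums,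
  and duality bounds their norms: the energy is finite. Conversely, finite energy extends the first
  formula to all \<open>\<mu>\<close> by density, and comparison with the second is the Hankel relation.
  The support statement is uniqueness for the Goursat and Cauchy problems.
\<close>

text \<open>The link between Hankel and Laplace is \<open>Laplace_jz\<close>: the kernel
  \<open>jz (u * v)\<close> has transform \<open>exp (- (v / \<mu>)) / \<mu>\<close> in
  \<open>u\<close>. Unitarity of the Hankel transform is not presupposed; Gram matrices replace it.
  Exponentials with rates \<alpha> and \<beta> have inner product 1 / (\<alpha> + \<beta>), so norms
  of exponential sums are compared through identities between fractions: one expresses unitarity,
  another the conservation of energy between a characteristic ray and the Cauchy half line. The
  obstacle is growth. A Goursat solution is a priori only O(exp (2 * (u + v))), hence O(exp (4 * w))
  on the diagonal. Its data are safely paired only with exponentials of rate above 5, and norms have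
  to come out of these pairings by duality. This is the origin of the weight 5, of the bounds
  \<open>\<mu> \<le> 1 / 5\<close> and \<open>5 \<le> \<mu>\<close>, and of the shifted sums
  \<open>ES n N a\<close>. The boundary values leave the left wedge undetermined. Even extension of
  the axis data makes the solution symmetric under point reflection, so that the energy on the
  positive half line controls the negative one.\<close>

abbreviation (input) cor :: "real \<Rightarrow> complex" where
  "cor \<equiv> complex_of_real"

subsection \<open>Square integrable functions\<close>

definition L2 :: "(real \<Rightarrow> complex) \<Rightarrow> bool" where
  "L2 f \<longleftrightarrow> f \<in> borel_measurable borel \<and> integrable lborel (\<lambda>x. (cmod (f x))\<^sup>2)"

definition nsq :: "(real \<Rightarrow> complex) \<Rightarrow> real" where
  "nsq f = (LINT x|lborel. (cmod (f x))\<^sup>2)"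

lemma L2_measurable: "L2 f \<Longrightarrow> f \<in> borel_measurable borel"
  by (simp add: L2_def)

lemma L2_integrable: "L2 f \<Longrightarrow> integrable lborel (\<lambda>x. (cmod (f x))\<^sup>2)"
  by (simp add: L2_def)

lemma nsq_nonneg: "0 \<le> nsq f"
  by (simp add: nsq_def)

lemma L2_bound:
  assumes "f \<in> borel_measurable borel" "L2 g" "\<And>x. cmod (f x) \<le> cmod (g x)"
  shows "L2 f" "nsq f \<le> nsq g"
proof -
  show *: "L2 f" unfolding L2_def
    by (auto intro!: assms Bochner_Integration.integrable_bound[OF L2_integrable[OF assms(2)]] power_mono
        borel_measurable_power measurable_compose[OF _ borel_measurable_norm] simp: assms)
  show "nsq f \<le> nsq g" unfolding nsq_def
    by (rule integral_mono) (use * assms in \<open>auto simp: L2_def intro!: power_mono\<close>)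
qed

lemma L2_zero [simp]: "L2 (\<lambda>x. 0)"
  by (simp add: L2_def)

lemma nsq_zero [simp]: "nsq (\<lambda>x. 0) = 0"
  by (simp add: nsq_def)

lemma cmod_add_sq_le: "(cmod (a + b))\<^sup>2 \<le> 2 * (cmod a)\<^sup>2 + 2 * (cmod b)\<^sup>2"
proof -
  have "(cmod (a + b))\<^sup>2 \<le> (cmod a + cmod b)\<^sup>2"
    by (intro power_mono norm_triangle_ineq) auto
  also have "\<dots> \<le> 2 * (cmod a)\<^sup>2 + 2 * (cmod b)\<^sup>2"
    using zero_le_power2[of "cmod a - cmod b"] by (simp add: power2_eq_square algebra_simps)
  finally show ?thesis .
qed

lemma L2_add:
  assumes "L2 f" "L2 g"
  shows "L2 (\<lambda>x. f x + g x)" "nsq (\<lambda>x. f x + g x) \<le> 2 * nsq f + 2 * nsq g"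
proof -
  have i: "integrable lborel (\<lambda>x. 2 * (cmod (f x))\<^sup>2 + 2 * (cmod (g x))\<^sup>2)"
    using assms by (auto simp: L2_def)
  have [measurable]: "f \<in> borel_measurable borel" "g \<in> borel_measurable borel"
    using assms by (auto simp: L2_def)
  show *: "L2 (\<lambda>x. f x + g x)" unfolding L2_def
    by (auto intro!: Bochner_Integration.integrable_bound[OF i] simp: cmod_add_sq_le)
  have "nsq (\<lambda>x. f x + g x) \<le> (LINT x|lborel. 2 * (cmod (f x))\<^sup>2 + 2 * (cmod (g x))\<^sup>2)"
    unfolding nsq_def
    by (rule integral_mono) (use * i in \<open>auto simp: L2_def cmod_add_sq_le\<close>)
  also have "\<dots> = 2 * nsq f + 2 * nsq g"
    unfolding nsq_def using assms by (subst Bochner_Integration.integral_add) (auto simp: L2_def)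
  finally show "nsq (\<lambda>x. f x + g x) \<le> 2 * nsq f + 2 * nsq g" .
qed

lemma L2_cmul:
  assumes "L2 f"
  shows "L2 (\<lambda>x. c * f x)" "nsq (\<lambda>x. c * f x) = (cmod c)\<^sup>2 * nsq f"
  using assms by (auto simp: L2_def nsq_def norm_mult power_mult_distrib)

lemma L2_minus:
  assumes "L2 f"
  shows "L2 (\<lambda>x. - f x)" "nsq (\<lambda>x. - f x) = nsq f"
  using assms by (auto simp: L2_def nsq_def)

lemma L2_diff:
  assumes "L2 f" "L2 g"
  shows "L2 (\<lambda>x. f x - g x)" "nsq (\<lambda>x. f x - g x) \<le> 2 * nsq f + 2 * nsq g"
  using L2_add[OF assms(1) L2_minus(1)[OF assms(2)]] L2_minus(2)[OF assms(2)] by simp_all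

lemma L2_sum:
  assumes "\<And>i. i \<in> I \<Longrightarrow> L2 (f i)"
  shows "L2 (\<lambda>x. \<Sum>i\<in>I. f i x)"
  using assms by (induction I rule: infinite_finite_induct) (auto intro: L2_add)

lemma nsq_swap: "nsq (\<lambda>x. f x - g x) = nsq (\<lambda>x. g x - f x)"
  by (simp add: nsq_def norm_minus_commute)

lemma L2_cnj:
  assumes "L2 f"
  shows "L2 (\<lambda>x. cnj (f x))" "nsq (\<lambda>x. cnj (f x)) = nsq f"
  using assms by (auto simp: L2_def nsq_def intro!: borel_measurable_continuous_on[OF _ , of cnj] continuous_intros)

lemma L2_restrict:
  assumes "L2 f" "S \<in> sets borel"
  shows "L2 (\<lambda>x. indicator S x * f x)" "nsq (\<lambda>x. indicator S x * f x) \<le> nsq f"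
proof -
  have m: "(\<lambda>x. indicator S x * f x) \<in> borel_measurable borel"
    using assms by (auto simp: L2_def)
  have b: "cmod (indicator S x * f x) \<le> cmod (f x)" for x by (auto split: split_indicator)
  show "L2 (\<lambda>x. indicator S x * f x)" "nsq (\<lambda>x. indicator S x * f x) \<le> nsq f"
    using L2_bound[OF m assms(1) b] by auto
qed

lemma L2_nn:
  assumes "f \<in> borel_measurable borel"
  shows "L2 f \<longleftrightarrow> (\<integral>\<^sup>+x. ennreal ((cmod (f x))\<^sup>2) \<partial>lborel) < \<infinity>"
  using assms by (auto simp: L2_def integrable_iff_bounded)

lemma nsq_nn:
  assumes "L2 f"
  shows "(\<integral>\<^sup>+x. ennreal ((cmod (f x))\<^sup>2) \<partial>lborel) = ennreal (nsq f)"
  unfolding nsq_def using assms by (intro nn_integral_eq_integral) (auto simp: L2_def)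

lemma L2I_le:
  assumes "f \<in> borel_measurable borel" "(\<integral>\<^sup>+x. ennreal ((cmod (f x))\<^sup>2) \<partial>lborel) \<le> ennreal C" "0 \<le> C"
  shows "L2 f" "nsq f \<le> C"
proof -
  show "L2 f" using assms by (auto simp: L2_nn less_top[symmetric] top_unique intro: le_less_trans)
  then show "nsq f \<le> C" using assms nsq_nn[of f] by simp
qed

lemma L2_mult_integrable:
  assumes "L2 f" "L2 g"
  shows "integrable lborel (\<lambda>x. f x * g x)"
proof -
  have i: "integrable lborel (\<lambda>x. (cmod (f x))\<^sup>2 + (cmod (g x))\<^sup>2)"
    using assms by (auto simp: L2_def)
  have [measurable]: "f \<in> borel_measurable borel" "g \<in> borel_measurable borel"
    using assms by (auto simp: L2_def)
  have "a * b \<le> a\<^sup>2 + b\<^sup>2" if "0 \<le> a" "0 \<le> b" for a b :: real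
    using sum_squares_bound[of a b] mult_nonneg_nonneg[OF that] by linarith
  then show ?thesis
    by (intro Bochner_Integration.integrable_bound[OF i]) (auto simp: norm_mult)
qed

lemma L2_Cauchy_Schwarz_real:
  assumes "L2 f" "L2 g"
  shows "(LINT x|lborel. cmod (f x) * cmod (g x))\<^sup>2 \<le> nsq f * nsq g"
proof -
  have [measurable]: "f \<in> borel_measurable borel" "g \<in> borel_measurable borel"
    using assms by (auto simp: L2_def)
  have i: "integrable lborel (\<lambda>x. cmod (f x) * cmod (g x))"
    using integrable_norm[OF L2_mult_integrable[OF assms]] by (simp add: norm_mult)
  have e: "(\<integral>\<^sup>+x. ennreal (cmod (f x)) * ennreal (cmod (g x)) \<partial>lborel) = ennreal (LINT x|lborel. cmod (f x) * cmod (g x))"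
    using nn_integral_eq_integral[OF i] by (simp add: ennreal_mult)
  have "(\<integral>\<^sup>+x. ennreal (cmod (f x)) * ennreal (cmod (g x)) \<partial>lborel)\<^sup>2
      \<le> (\<integral>\<^sup>+x. (ennreal (cmod (f x)))\<^sup>2 \<partial>lborel) * (\<integral>\<^sup>+x. (ennreal (cmod (g x)))\<^sup>2 \<partial>lborel)"
    by (rule Cauchy_Schwarz_nn_integral) auto
  then have "(ennreal (LINT x|lborel. cmod (f x) * cmod (g x)))\<^sup>2 \<le> ennreal (nsq f) * ennreal (nsq g)"
    using nsq_nn[OF assms(1)] nsq_nn[OF assms(2)] e by (simp add: ennreal_power)
  then show ?thesis
    by (simp add: ennreal_power ennreal_mult'[symmetric] nsq_nonneg integral_nonneg_AE)
qed

lemma L2_Cauchy_Schwarz: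
  assumes "L2 f" "L2 g"
  shows "(cmod (LINT x|lborel. f x * g x))\<^sup>2 \<le> nsq f * nsq g"
proof -
  have "cmod (LINT x|lborel. f x * g x) \<le> (LINT x|lborel. cmod (f x) * cmod (g x))"
    by (rule order_trans[OF integral_norm_bound]) (simp add: norm_mult)
  then have "(cmod (LINT x|lborel. f x * g x))\<^sup>2 \<le> (LINT x|lborel. cmod (f x) * cmod (g x))\<^sup>2"
    by (intro power_mono) auto
  with L2_Cauchy_Schwarz_real[OF assms] show ?thesis by linarith
qed

lemma L2_indicator: "L2 (indicator {a..b})" "a \<le> b \<Longrightarrow> nsq (indicator {a..b}) = b - a"
proof -
  have e: "(cmod (indicator {a..b} x))\<^sup>2 = (indicator {a..b} x :: real)" for x
    by (auto split: split_indicator)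
  show "L2 (indicator {a..b})" unfolding L2_def e
    by (auto intro!: integrable_real_indicator simp: emeasure_lborel_Icc_eq)
  show "nsq (indicator {a..b}) = b - a" if "a \<le> b" unfolding nsq_def e using that by simp
qed

lemma L2_set_integrable:
  assumes "L2 f"
  shows "set_integrable lborel {a..b} f"
proof -
  have "indicator {a..b} x *\<^sub>R f x = indicator {a..b} x * f x" for x
    by (auto split: split_indicator)
  then show ?thesis
    using L2_mult_integrable[OF L2_indicator(1) assms, of a b] by (simp add: set_integrable_def)
qed

lemma L2_interval_CS:
  assumes "L2 f" "a \<le> b"
  shows "(LINT x:{a..b}|lborel. cmod (f x))\<^sup>2 \<le> (b - a) * (LINT x:{a..b}|lborel. (cmod (f x))\<^sup>2)"
proof -
  have e: "(LINT x:{a..b}|lborel. cmod (f x)) = (LINT x|lborel. cmod (indicator {a..b} x) * cmod (indicator {a..b} x * f x))"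
    unfolding set_lebesgue_integral_def
    by (intro Bochner_Integration.integral_cong refl) (auto split: split_indicator)
  have e2: "(LINT x:{a..b}|lborel. (cmod (f x))\<^sup>2) = nsq (\<lambda>x. indicator {a..b} x * f x)"
    unfolding nsq_def set_lebesgue_integral_def
    by (intro Bochner_Integration.integral_cong refl) (auto split: split_indicator)
  show ?thesis using L2_Cauchy_Schwarz_real[OF L2_indicator(1) L2_restrict(1)[OF assms(1)], of "{a..b}" a b]
      L2_indicator(2)[OF assms(2)] by (simp add: e e2)
qed

lemma L2_integral_tendsto:
  assumes "L2 f" "L2 h" "\<And>n. L2 (f' n)" "(\<lambda>n. nsq (\<lambda>x. f' n x - f x)) \<longlonglongrightarrow> 0"
  shows "(\<lambda>n. LINT x|lborel. h x * f' n x) \<longlonglongrightarrow> (LINT x|lborel. h x * f x)"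
proof -
  have "(\<lambda>n. (cmod ((LINT x|lborel. h x * f' n x) - (LINT x|lborel. h x * f x)))\<^sup>2) \<longlonglongrightarrow> 0"
  proof (rule tendsto_sandwich[OF _ _ tendsto_const])
    show "(\<lambda>n. nsq h * nsq (\<lambda>x. f' n x - f x)) \<longlonglongrightarrow> 0"
      using tendsto_mult_right_zero[OF assms(4)] by simp
    have "(cmod ((LINT x|lborel. h x * f' n x) - (LINT x|lborel. h x * f x)))\<^sup>2 \<le> nsq h * nsq (\<lambda>x. f' n x - f x)" for n
    proof -
      have "(LINT x|lborel. h x * f' n x) - (LINT x|lborel. h x * f x) = (LINT x|lborel. h x * (f' n x - f x))"
        by (subst Bochner_Integration.integral_diff[symmetric])
          (auto intro!: L2_mult_integrable assms simp: algebra_simps)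
      then show ?thesis using L2_Cauchy_Schwarz[OF assms(2) L2_diff(1)[OF assms(3)[of n] assms(1)]] by simp
    qed
    then show "\<forall>\<^sub>F n in sequentially. (cmod ((LINT x|lborel. h x * f' n x) - (LINT x|lborel. h x * f x)))\<^sup>2 \<le> nsq h * nsq (\<lambda>x. f' n x - f x)"
      by simp
  qed simp
  then have "(\<lambda>n. cmod ((LINT x|lborel. h x * f' n x) - (LINT x|lborel. h x * f x))) \<longlonglongrightarrow> 0"
    using power_tendsto_0_iff[of 2 "\<lambda>n. cmod ((LINT x|lborel. h x * f' n x) - (LINT x|lborel. h x * f x))"] by simp
  then show ?thesis by (simp add: tendsto_norm_zero_iff LIM_zero_iff)
qed

text \<open>Polarisation: the difference of the squared norms, minus the squared norm of the
  difference, is twice the real part of the pairing of \<open>cnj f\<close> with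
  \<open>f' n - f\<close>, which tends to 0 by \<open>L2_integral_tendsto\<close>.\<close>

lemma nsq_tendsto:
  assumes "L2 f" "\<And>n. L2 (f' n)" "(\<lambda>n. nsq (\<lambda>x. f' n x - f x)) \<longlonglongrightarrow> 0"
  shows "(\<lambda>n. nsq (f' n)) \<longlonglongrightarrow> nsq f"
proof -
  have le: "\<bar>nsq (f' n) - nsq f\<bar> \<le> nsq (\<lambda>x. f' n x - f x) +
     2 * cmod ((LINT x|lborel. cnj (f x) * f' n x) - (LINT x|lborel. cnj (f x) * f x))" for n
  proof -
    have "nsq (f' n) - nsq f - nsq (\<lambda>x. f' n x - f x) = (LINT x|lborel. (cmod (f' n x))\<^sup>2 - (cmod (f x))\<^sup>2 - (cmod (f' n x - f x))\<^sup>2)"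
      unfolding nsq_def
      using L2_integrable[OF assms(1)] L2_integrable[OF assms(2)] L2_integrable[OF L2_diff(1)[OF assms(2,1)]]
      by (simp add: Bochner_Integration.integral_diff)
    also have "\<dots> = (LINT x|lborel. 2 * Re (cnj (f x) * f' n x - cnj (f x) * f x))"
      by (intro Bochner_Integration.integral_cong refl)
        (simp only: cmod_power2, simp add: algebra_simps power2_eq_square)
    also have "\<dots> = 2 * Re (LINT x|lborel. (cnj (f x) * f' n x - cnj (f x) * f x))"
      by (subst integral_mult_right_zero, subst integral_Re)
        (auto intro!: Bochner_Integration.integrable_diff L2_mult_integrable assms L2_cnj)
    also have "\<dots> = 2 * Re ((LINT x|lborel. cnj (f x) * f' n x) - (LINT x|lborel. cnj (f x) * f x))"
      by (subst Bochner_Integration.integral_diff) (auto intro!: L2_mult_integrable assms L2_cnj)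
    finally have "\<bar>nsq (f' n) - nsq f - nsq (\<lambda>x. f' n x - f x)\<bar>
        \<le> 2 * cmod ((LINT x|lborel. cnj (f x) * f' n x) - (LINT x|lborel. cnj (f x) * f x))"
      using abs_Re_le_cmod[of "(LINT x|lborel. cnj (f x) * f' n x) - (LINT x|lborel. cnj (f x) * f x)"] by simp
    then show ?thesis using nsq_nonneg[of "\<lambda>x. f' n x - f x"] by linarith
  qed
  have lim: "(\<lambda>n. nsq (\<lambda>x. f' n x - f x) +
     2 * cmod ((LINT x|lborel. cnj (f x) * f' n x) - (LINT x|lborel. cnj (f x) * f x))) \<longlonglongrightarrow> 0 + 2 * 0"
    by (intro tendsto_add tendsto_mult tendsto_const assms tendsto_norm_zero LIM_zero L2_integral_tendsto L2_cnj)
  have "(\<lambda>n. nsq (f' n) - nsq f) \<longlonglongrightarrow> 0"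
    by (rule Lim_null_comparison[OF _ lim[simplified]]) (use le in auto)
  then show ?thesis by (rule LIM_zero_cancel)
qed

section \<open>Density of compactly supported continuous functions in L2\<close>

definition CCs :: "(real \<Rightarrow> complex) \<Rightarrow> bool" where
  "CCs h \<longleftrightarrow> continuous_on UNIV h \<and> (\<exists>B. \<forall>x. B < \<bar>x\<bar> \<longrightarrow> h x = 0)"

lemma CCs_obtain:
  assumes "CCs h"
  obtains B where "0 < B" "\<And>x. B < \<bar>x\<bar> \<Longrightarrow> h x = 0" "\<And>x. cmod (h x) \<le> B"
proof -
  obtain B where B: "\<And>x. B < \<bar>x\<bar> \<Longrightarrow> h x = 0" using assms by (auto simp: CCs_def)
  have "bounded (h ` {-B..B})"
    using assms by (intro compact_imp_bounded compact_continuous_image) (auto simp: CCs_def intro: continuous_on_subset)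
  then obtain M where M: "\<And>x. x \<in> {-B..B} \<Longrightarrow> cmod (h x) \<le> M" unfolding bounded_iff by blast
  show ?thesis
  proof (rule that[of "max 1 (max B M)"])
    fix x show "cmod (h x) \<le> max 1 (max B M)"
    proof (cases "B < \<bar>x\<bar>")
      case False then have "cmod (h x) \<le> M" by (intro M) auto
      then show ?thesis by (simp add: le_max_iff_disj)
    qed (use B in auto)
  qed (use B in auto)
qed

lemma CCs_L2:
  assumes "CCs h" shows "L2 h"
proof -
  obtain B where B: "0 < B" "\<And>x. B < \<bar>x\<bar> \<Longrightarrow> h x = 0" "\<And>x. cmod (h x) \<le> B"
    using CCs_obtain[OF assms] by blast
  have m: "h \<in> borel_measurable borel" using assms by (auto simp: CCs_def intro: borel_measurable_continuous_onI)
  have "cmod (h x) \<le> cmod (of_real B * indicator {-B..B} x)" for x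
    using B(2)[of x] B(3)[of x] B(1) by (auto split: split_indicator simp: norm_mult)
  then show ?thesis by (rule L2_bound(1)[OF m L2_cmul(1)[OF L2_indicator(1)]])
qed

definition CCs_approx :: "(real \<Rightarrow> complex) \<Rightarrow> bool" where
  "CCs_approx f \<longleftrightarrow> (\<forall>e>0. \<exists>h. CCs h \<and> nsq (\<lambda>x. f x - h x) < e)"

lemma CCs_approx_lim:
  assumes "L2 f" "\<And>e. e > 0 \<Longrightarrow> \<exists>g. L2 g \<and> CCs_approx g \<and> nsq (\<lambda>x. f x - g x) < e"
  shows "CCs_approx f"
  unfolding CCs_approx_def
proof (intro allI impI)
  fix e :: real assume "e > 0"
  then obtain g where g: "L2 g" "CCs_approx g" "nsq (\<lambda>x. f x - g x) < e / 4" using assms(2)[of "e/4"] by auto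
  then obtain h where h: "CCs h" "nsq (\<lambda>x. g x - h x) < e / 4"
    using \<open>e > 0\<close> by (auto simp: CCs_approx_def elim!: allE[of _ "e/4"])
  have "nsq (\<lambda>x. (f x - g x) + (g x - h x)) \<le> 2 * nsq (\<lambda>x. f x - g x) + 2 * nsq (\<lambda>x. g x - h x)"
    by (intro L2_add L2_diff assms g CCs_L2 h)
  with g h have "nsq (\<lambda>x. f x - h x) < e" by simp
  with h show "\<exists>h. CCs h \<and> nsq (\<lambda>x. f x - h x) < e" by blast
qed

lemma CCs_add: "CCs f \<Longrightarrow> CCs g \<Longrightarrow> CCs (\<lambda>x. f x + g x)"
  unfolding CCs_def
  apply (auto intro!: continuous_intros)
  subgoal for B B' by (rule exI[of _ "max B B'"]) auto
  done

lemma CCs_cmul: "CCs f \<Longrightarrow> CCs (\<lambda>x. c * f x)"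
  by (auto simp: CCs_def intro!: continuous_intros)

lemma CCs_approx_add:
  assumes "L2 f" "L2 g" "CCs_approx f" "CCs_approx g"
  shows "CCs_approx (\<lambda>x. f x + g x)"
  unfolding CCs_approx_def
proof (intro allI impI)
  fix e :: real assume e: "e > 0"
  obtain h where h: "CCs h" "nsq (\<lambda>x. f x - h x) < e / 4"
    using assms e by (auto simp: CCs_approx_def elim!: allE[of _ "e/4"])
  obtain k where k: "CCs k" "nsq (\<lambda>x. g x - k x) < e / 4"
    using assms e by (auto simp: CCs_approx_def elim!: allE[of _ "e/4"])
  have "nsq (\<lambda>x. (f x - h x) + (g x - k x)) \<le> 2 * nsq (\<lambda>x. f x - h x) + 2 * nsq (\<lambda>x. g x - k x)"
    by (intro L2_add L2_diff assms CCs_L2 h k)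
  then have "nsq (\<lambda>x. f x + g x - (h x + k x)) < e" using h k by (simp add: algebra_simps)
  then show "\<exists>h. CCs h \<and> nsq (\<lambda>x. f x + g x - h x) < e" using CCs_add[OF h(1) k(1)] by blast
qed

lemma CCs_approx_cmul:
  assumes "L2 f" "CCs_approx f"
  shows "CCs_approx (\<lambda>x. c * f x)"
  unfolding CCs_approx_def
proof (intro allI impI)
  fix e :: real assume e: "e > 0"
  define e' where "e' = e / ((cmod c)\<^sup>2 + 1)"
  have e': "e' > 0" unfolding e'_def using e by (intro divide_pos_pos) (auto simp: add_nonneg_pos)
  obtain h where h: "CCs h" "nsq (\<lambda>x. f x - h x) < e'"
    using assms e' by (auto simp: CCs_approx_def)
  have "nsq (\<lambda>x. c * (f x - h x)) = (cmod c)\<^sup>2 * nsq (\<lambda>x. f x - h x)"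
    by (intro L2_cmul L2_diff assms CCs_L2 h)
  also have "\<dots> \<le> (cmod c)\<^sup>2 * e'" using h by (intro mult_left_mono) auto
  also have "\<dots> < ((cmod c)\<^sup>2 + 1) * e'" using e' by (simp add: algebra_simps)
  also have "\<dots> = e" unfolding e'_def by (simp add: add_nonneg_eq_0_iff)
  finally have "nsq (\<lambda>x. c * f x - c * h x) < e" by (simp add: algebra_simps)
  then show "\<exists>h. CCs h \<and> nsq (\<lambda>x. c * f x - h x) < e" using CCs_cmul[OF h(1)] by blast
qed

lemma CCs_approx_indicator:
  assumes "A \<in> sets borel" "A \<subseteq> {-N..N}"
  shows "CCs_approx (\<lambda>x. indicator A x)"
  unfolding CCs_approx_def
proof (intro allI impI)
  fix e :: real assume e: "e > 0"
  have A: "A \<in> sets lebesgue" using assms by auto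
  obtain T where T: "closed T" "T \<subseteq> A" "A - T \<in> lmeasurable" "emeasure lebesgue (A - T) < ennreal (e/4)"
    using sets_lebesgue_inner_closed[OF A, of "e/4"] e by auto
  obtain U where U: "open U" "A \<subseteq> U" "U - A \<in> lmeasurable" "emeasure lebesgue (U - A) < ennreal (e/4)"
    using sets_lebesgue_outer_open[OF A, of "e/4"] e by auto
  \<comment> \<open>Cutting \<open>U\<close> down to a bounded interval keeps it a neighbourhood of
    \<open>A\<close> and gives the Urysohn function compact support. Off \<open>U\<close> the
    function and the indicator both vanish, so the error lives on \<open>A - T\<close> and
    \<open>U - A\<close> only.\<close>
  define V where "V = U \<inter> {-(\<bar>N\<bar>+1)<..<\<bar>N\<bar>+1}"
  have V: "open V" "A \<subseteq> V" using U assms(2) by (auto simp: V_def)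
  have "closed (- V)" using V by auto
  then obtain f :: "real \<Rightarrow> complex" where f: "continuous_on UNIV f" "\<And>x. f x \<in> closed_segment 1 0"
     "\<And>x. x \<in> T \<Longrightarrow> f x = 1" "\<And>x. x \<in> - V \<Longrightarrow> f x = 0"
    using Urysohn[OF T(1), of "-V" "1::complex" 0] T(2) V(2) by blast
  have CCs: "CCs f" unfolding CCs_def
    by (intro conjI f(1) exI[of _ "\<bar>N\<bar>+1"]) (auto intro!: f(4) simp: V_def)
  have f1: "cmod (f x) \<le> 1 \<and> cmod (1 - f x) \<le> 1" for x
  proof -
    obtain s where "0 \<le> s" "s \<le> 1" "f x = cor (1 - s)"
      using f(2)[of x] by (auto simp: closed_segment_def scaleR_conv_of_real)
    moreover have "1 - f x = cor s" by (simp add: \<open>f x = cor (1 - s)\<close>)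
    moreover have "\<bar>1 - s\<bar> \<le> 1" "\<bar>s\<bar> \<le> 1" using \<open>0 \<le> s\<close> \<open>s \<le> 1\<close> by auto
    ultimately show ?thesis by (simp only: norm_of_real)
  qed
  have [measurable]: "A \<in> sets borel" "T \<in> sets borel" "U \<in> sets borel" using assms T U by auto
  have le: "(cmod (indicator A x - f x))\<^sup>2 \<le> indicator (A - T) x + indicator (U - A) x" for x
  proof -
    have "x \<in> A - T \<or> x \<in> T \<or> x \<in> U - A \<or> x \<in> - U" by auto
    moreover have "x \<in> - U \<Longrightarrow> x \<in> -V \<and> x \<notin> A" using U by (auto simp: V_def)
    ultimately show ?thesis using f1[of x] f(3)[of x] f(4)[of x] T(2) U(2)
      by (auto simp: indicator_def power_le_one_iff)
  qed
  have L: "L2 (\<lambda>x. indicator A x - f x)"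
  proof (rule L2_diff(1)[OF _ CCs_L2[OF CCs]])
    have "L2 (\<lambda>x. indicator A x * indicator {-N..N} x :: complex)"
      by (rule L2_restrict[OF L2_indicator(1) assms(1)])
    moreover have "indicator A x * indicator {-N..N} x = (indicator A x :: complex)" for x
      using assms(2) by (auto split: split_indicator)
    ultimately show "L2 (\<lambda>x. indicator A x)" by simp
  qed
  have "ennreal (nsq (\<lambda>x. indicator A x - f x)) = (\<integral>\<^sup>+x. ennreal ((cmod (indicator A x - f x))\<^sup>2) \<partial>lborel)"
    by (rule nsq_nn[OF L, symmetric])
  also have "\<dots> \<le> (\<integral>\<^sup>+x. indicator (A - T) x + indicator (U - A) x \<partial>lborel)"
  proof (intro nn_integral_mono)
    fix x :: real
    have "ennreal ((cmod (indicator A x - f x))\<^sup>2) \<le> ennreal (indicator (A - T) x + indicator (U - A) x)"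
      by (intro ennreal_leI le)
    then show "ennreal ((cmod (indicator A x - f x))\<^sup>2) \<le> indicator (A - T) x + indicator (U - A) x"
      by (auto split: split_indicator)
  qed
  also have "\<dots> = emeasure lborel (A - T) + emeasure lborel (U - A)"
    by (subst nn_integral_add) auto
  also have "\<dots> \<le> ennreal (e/4) + ennreal (e/4)"
    using T(4) U(4) by (intro add_mono) (auto simp: emeasure_completion less_imp_le)
  also have "\<dots> = ennreal (e/2)" using e by (subst ennreal_plus[symmetric]) auto
  finally have "nsq (\<lambda>x. indicator A x - f x) \<le> e/2" using e by (simp add: ennreal_le_iff)
  then show "\<exists>h. CCs h \<and> nsq (\<lambda>x. indicator A x - h x) < e" using CCs e by (intro exI[of _ f]) auto
qed

lemma nsq_LIMSEQ_dominated:
  assumes "L2 f" "L2 g" "\<And>n. f' n \<in> borel_measurable borel" "\<And>n x. cmod (f' n x - f x) \<le> cmod (g x)"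
    "\<And>x. (\<lambda>n. f' n x) \<longlonglongrightarrow> f x"
  shows "(\<lambda>n. nsq (\<lambda>x. f' n x - f x)) \<longlonglongrightarrow> 0"
proof -
  have [measurable]: "f \<in> borel_measurable borel" "f' n \<in> borel_measurable borel" for n
    using assms by (auto simp: L2_def)
  have "(\<lambda>n. LINT x|lborel. (cmod (f' n x - f x))\<^sup>2) \<longlonglongrightarrow> (LINT x::real|lborel. (0::real))"
  proof (rule integral_dominated_convergence)
    show "integrable lborel (\<lambda>x. (cmod (g x))\<^sup>2)" by (rule L2_integrable[OF assms(2)])
    show "AE x in lborel. (\<lambda>n. (cmod (f' n x - f x))\<^sup>2) \<longlonglongrightarrow> 0"
      using tendsto_power[OF tendsto_norm[OF LIM_zero[OF assms(5)]], where n=2] by (intro AE_I2) simp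
    show "AE x in lborel. norm ((cmod (f' n x - f x))\<^sup>2) \<le> (cmod (g x))\<^sup>2" for n
      using assms(4) by (auto intro!: power_mono)
  qed auto
  then show ?thesis by (simp add: nsq_def)
qed

lemma CCs_approx_nonneg:
  fixes f :: "real \<Rightarrow> real"
  assumes "f \<in> borel_measurable borel" "\<And>x. 0 \<le> f x" "L2 (\<lambda>x. cor (f x))"
  shows "CCs_approx (\<lambda>x. cor (f x))"
proof -
  obtain s where s0: "\<And>i. simple_function borel (s i)" "incseq s" "\<And>x. bdd_above (range (\<lambda>i. s i x))"
     "\<And>i x. (0::real) \<le> s i x" "f = (SUP i. s i)"
    using borel_measurable_implies_simple_function_sequence_real[OF assms(1,2)] by metis
  have fs: "f x = (SUP i. s i x)" for x
    unfolding s0(5) by (simp add: image_comp)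
  have inc: "incseq (\<lambda>i. s i x)" for x using s0(2) by (auto simp: incseq_def le_fun_def)
  have le: "s i x \<le> f x" for i x unfolding fs by (rule cSUP_upper[OF _ s0(3)]) simp
  have lims: "(\<lambda>i. s i x) \<longlonglongrightarrow> f x" for x unfolding fs by (rule LIMSEQ_incseq_SUP[OF s0(3) inc])
  note s = s0(1) s0(2) le s0(4) lims
  \<comment> \<open>The cut-off to \<open>[-n, n]\<close> bounds the level sets of the simple
    functions, as \<open>CCs_approx_indicator\<close> demands, and disappears in the limit.\<close>
  define t where "t n x = indicator {- real n..real n} x * cor (s n x)" for n x
  have sm [measurable]: "s n \<in> borel_measurable borel" for n using s(1) by (rule borel_measurable_simple_function)
  have tm: "t n \<in> borel_measurable borel" for n
    unfolding t_def by measurable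
  have tle: "cmod (t n x) \<le> cmod (cor (f x))" for n x
    using s(3)[of n x] s(4)[of n x] assms(2)[of x] by (auto simp: t_def norm_mult split: split_indicator)
  have L: "L2 (t n)" for n
    by (rule L2_bound(1)[OF tm assms(3) tle])
  have app: "CCs_approx (t n)" for n
  proof -
    have "t n = (\<lambda>x. \<Sum>y\<in>s n ` UNIV. cor y * indicator (s n -` {y} \<inter> {- real n..real n}) x)"
    proof
      fix x
      have fin: "finite (range (s n))" using s(1)[of n] by (simp add: simple_function_def)
      have "(\<Sum>y\<in>s n ` UNIV. cor y * indicator (s n -` {y} \<inter> {- real n..real n}) x)
          = (\<Sum>y\<in>s n ` UNIV. if y = s n x then cor y * indicator {- real n..real n} x else 0)"
        by (intro sum.cong refl) (auto split: split_indicator)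
      also have "\<dots> = t n x" using fin by (simp add: t_def mult.commute)
      finally show "t n x = (\<Sum>y\<in>s n ` UNIV. cor y * indicator (s n -` {y} \<inter> {- real n..real n}) x)" by simp
    qed
    moreover have "L2 (\<lambda>x. \<Sum>y\<in>Y. cor y * indicator (s n -` {y} \<inter> {- real n..real n}) x)
       \<and> CCs_approx (\<lambda>x. \<Sum>y\<in>Y. cor y * indicator (s n -` {y} \<inter> {- real n..real n}) x)" for Y
    proof (induction Y rule: infinite_finite_induct)
      case (insert y Y)
      have i: "CCs_approx (\<lambda>x. indicator (s n -` {y} \<inter> {- real n..real n}) x)"
        using measurable_sets_borel[OF sm[of n], of "{y}"] by (intro CCs_approx_indicator[where N="real n"]) auto
      have "L2 (\<lambda>x. indicator (s n -` {y}) x * indicator {-real n..real n} x :: complex)"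
        using measurable_sets_borel[OF sm[of n], of "{y}"] by (intro L2_restrict[OF L2_indicator(1)]) auto
      moreover have "indicator (s n -` {y}) x * indicator {-real n..real n} x = (indicator (s n -` {y} \<inter> {- real n..real n}) x :: complex)" for x
        by (auto split: split_indicator)
      ultimately have l: "L2 (\<lambda>x. indicator (s n -` {y} \<inter> {- real n..real n}) x)" by simp
      show ?case unfolding sum.insert[OF insert.hyps] using insert.IH
        by (intro conjI CCs_approx_add L2_add CCs_approx_cmul L2_cmul i l) simp_all
    qed (auto simp: CCs_approx_def CCs_def intro!: exI[of _ "\<lambda>x. 0"])
    ultimately show ?thesis by simp
  qed
  have lim: "(\<lambda>n. nsq (\<lambda>x. t n x - cor (f x))) \<longlonglongrightarrow> 0"
  proof (rule nsq_LIMSEQ_dominated[OF assms(3) L2_cmul(1)[OF assms(3), of 2] tm])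
    show "cmod (t n x - cor (f x)) \<le> cmod (2 * cor (f x))" for n x
      using norm_triangle_ineq4[of "t n x" "cor (f x)"] tle[of n x] by (simp add: norm_mult)
    show "(\<lambda>n. t n x) \<longlonglongrightarrow> cor (f x)" for x
    proof (rule Lim_transform_eventually[OF tendsto_of_real[OF s(5)]])
      obtain N where "\<bar>x\<bar> \<le> real N" using real_arch_simple by blast
      then have "x \<in> {- real n..real n}" if "N \<le> n" for n
        using that of_nat_mono[of N n, where 'a=real] by (auto simp: abs_le_iff)
      then show "\<forall>\<^sub>F n in sequentially. cor (s n x) = t n x"
        unfolding eventually_sequentially t_def by (intro exI[of _ N]) simp
    qed
  qed
  show ?thesis
  proof (rule CCs_approx_lim[OF assms(3)])
    fix e :: real assume "e > 0"
    then have "\<forall>\<^sub>F n in sequentially. nsq (\<lambda>x. t n x - cor (f x)) < e"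
      using order_tendstoD(2)[OF lim] by auto
    then obtain n where "nsq (\<lambda>x. t n x - cor (f x)) < e" by (auto simp: eventually_sequentially)
    then show "\<exists>g. L2 g \<and> CCs_approx g \<and> nsq (\<lambda>x. cor (f x) - g x) < e"
      using L app nsq_swap by metis
  qed
qed

theorem CCs_dense_L2:
  assumes "L2 f"
  shows "CCs_approx f"
proof -
  have fm [measurable]: "f \<in> borel_measurable borel" using assms by (simp add: L2_def)
  define a where "a x = max 0 (Re (f x))" for x
  define b where "b x = max 0 (- Re (f x))" for x
  define c where "c x = max 0 (Im (f x))" for x
  define d where "d x = max 0 (- Im (f x))" for x
  have m [measurable]: "a \<in> borel_measurable borel" "b \<in> borel_measurable borel" "c \<in> borel_measurable borel" "d \<in> borel_measurable borel"
    unfolding a_def b_def c_def d_def by measurable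
  have le: "\<bar>a x\<bar> \<le> cmod (f x)" "\<bar>b x\<bar> \<le> cmod (f x)" "\<bar>c x\<bar> \<le> cmod (f x)" "\<bar>d x\<bar> \<le> cmod (f x)" for x
    using abs_Re_le_cmod[of "f x"] abs_Im_le_cmod[of "f x"] unfolding a_def b_def c_def d_def by auto
  have L: "L2 (\<lambda>x. cor (k x))" if "k \<in> borel_measurable borel" "\<And>x. \<bar>k x\<bar> \<le> cmod (f x)" for k :: "real \<Rightarrow> real"
    by (rule L2_bound(1)[OF _ assms]) (use that in auto)
  have A: "CCs_approx (\<lambda>x. cor (k x))" if "k \<in> borel_measurable borel" "\<And>x. \<bar>k x\<bar> \<le> cmod (f x)" "\<And>x. 0 \<le> k x" for k :: "real \<Rightarrow> real"
    by (intro CCs_approx_nonneg L that)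
  note LL = L[OF m(1) le(1)] L[OF m(2) le(2)] L[OF m(3) le(3)] L[OF m(4) le(4)]
  have AA: "CCs_approx (\<lambda>x. cor (a x))" "CCs_approx (\<lambda>x. cor (b x))"
    "CCs_approx (\<lambda>x. cor (c x))" "CCs_approx (\<lambda>x. cor (d x))"
    by (intro A m le; simp add: a_def b_def c_def d_def)+
  have "CCs_approx (\<lambda>x. (cor (a x) + (-1) * cor (b x)) + (\<i> * cor (c x) + (-\<i>) * cor (d x)))"
    by (intro CCs_approx_add CCs_approx_cmul L2_add L2_cmul AA LL)
  moreover have "(cor (a x) + (-1) * cor (b x)) + (\<i> * cor (c x) + (-\<i>) * cor (d x)) = f x" for x
    by (auto simp: a_def b_def c_def d_def complex_eq_iff max_def)
  ultimately show ?thesis by simp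
qed

subsection \<open>Translations and averages\<close>

lemma L2_affine:
  assumes "L2 f" "c = 1 \<or> c = -1"
  shows "L2 (\<lambda>x. f (t + c * x))" "nsq (\<lambda>x. f (t + c * x)) = nsq f"
proof -
  have c: "c \<noteq> 0" "\<bar>c\<bar> = 1" using assms(2) by auto
  have [measurable]: "f \<in> borel_measurable borel" using assms by (simp add: L2_def)
  show "L2 (\<lambda>x. f (t + c * x))" unfolding L2_def
  proof (intro conjI)
    show "(\<lambda>x. f (t + c * x)) \<in> borel_measurable borel" by measurable
    show "integrable lborel (\<lambda>x. (cmod (f (t + c * x)))\<^sup>2)"
      using lborel_integrable_real_affine[OF L2_integrable[OF assms(1)] c(1), of t] .
  qed
  show "nsq (\<lambda>x. f (t + c * x)) = nsq f"
    unfolding nsq_def using lborel_integral_real_affine[OF c(1), of "\<lambda>x. (cmod (f x))\<^sup>2" t] c(2) by simp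
qed

lemma L2_translate:
  assumes "L2 f"
  shows "L2 (\<lambda>x. f (x + t))" "nsq (\<lambda>x. f (x + t)) = nsq f"
  using L2_affine[OF assms, of 1 t] by (simp_all add: add.commute)

lemma L2_reflect:
  assumes "L2 f"
  shows "L2 (\<lambda>x. f (- x))" "nsq (\<lambda>x. f (- x)) = nsq f"
  using L2_affine[OF assms, of "-1" 0] by simp_all

lemma set_integral_translate:
  fixes f :: "real \<Rightarrow> complex"
  shows "(LINT s:{w..w+k}|lborel. f s) = (LINT s|lborel. indicator {0..k} s *\<^sub>R f (w + s))"
proof -
  have "(LINT s:{w..w+k}|lborel. f s) = (LINT s|lborel. indicator {w..w+k} (w + 1 * s) *\<^sub>R f (w + 1 * s))"
    unfolding set_lebesgue_integral_def
    by (subst lborel_integral_real_affine[where c=1 and t=w]) simp_all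
  also have "\<dots> = (LINT s|lborel. indicator {0..k} s *\<^sub>R f (w + s))"
    by (intro Bochner_Integration.integral_cong refl) (auto split: split_indicator)
  finally show ?thesis .
qed

text \<open>A case of Young's inequality: Cauchy-Schwarz on each window costs one factor
  \<open>k\<close>, and Tonelli with translation invariance gives the other.\<close>

lemma L2_window:
  assumes "L2 f" "0 < k"
  shows "L2 (\<lambda>w. LINT s:{w..w+k}|lborel. f s)"
    "nsq (\<lambda>w. LINT s:{w..w+k}|lborel. f s) \<le> k\<^sup>2 * nsq f"
proof -
  have fm [measurable]: "f \<in> borel_measurable borel" using assms by (simp add: L2_def)
  have m: "(\<lambda>w. LINT s:{w..w+k}|lborel. f s) \<in> borel_measurable borel"
    unfolding set_integral_translate by measurable
  have pw: "ennreal ((cmod (LINT s:{w..w+k}|lborel. f s))\<^sup>2) \<le> ennreal k * (\<integral>\<^sup>+s. indicator {0..k} s * ennreal ((cmod (f (w + s)))\<^sup>2) \<partial>lborel)" for w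
  proof -
    have "cmod (LINT s:{w..w+k}|lborel. f s) \<le> (LINT s:{w..w+k}|lborel. cmod (f s))"
      by (rule set_integral_norm_bound[OF L2_set_integrable[OF assms(1)]])
    then have "(cmod (LINT s:{w..w+k}|lborel. f s))\<^sup>2 \<le> (LINT s:{w..w+k}|lborel. cmod (f s))\<^sup>2"
      by (intro power_mono) auto
    also have "\<dots> \<le> k * (LINT s:{w..w+k}|lborel. (cmod (f s))\<^sup>2)"
      using L2_interval_CS[OF assms(1), of w "w+k"] assms(2) by simp
    also have "(LINT s:{w..w+k}|lborel. (cmod (f s))\<^sup>2) = (LINT s|lborel. indicator {0..k} s * (cmod (f (w + 1 * s)))\<^sup>2)"
      unfolding set_lebesgue_integral_def
      by (subst lborel_integral_real_affine[where c=1 and t=w])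
        (auto intro!: Bochner_Integration.integral_cong split: split_indicator)
    finally have "ennreal ((cmod (LINT s:{w..w+k}|lborel. f s))\<^sup>2) \<le> ennreal (k * (LINT s|lborel. indicator {0..k} s * (cmod (f (w + s)))\<^sup>2))"
      by (simp add: ennreal_leI)
    also have "\<dots> = ennreal k * ennreal (LINT s|lborel. indicator {0..k} s * (cmod (f (w + s)))\<^sup>2)"
      using assms(2) by (intro ennreal_mult) (auto intro!: Bochner_Integration.integral_nonneg)
    also have "ennreal (LINT s|lborel. indicator {0..k} s * (cmod (f (w + s)))\<^sup>2) = (\<integral>\<^sup>+s. ennreal (indicator {0..k} s * (cmod (f (w + s)))\<^sup>2) \<partial>lborel)"
    proof (rule nn_integral_eq_integral[symmetric])
      have "L2 (\<lambda>s. indicator {0..k} s * f (s + w))"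
        by (intro L2_restrict L2_translate assms) auto
      then have "integrable lborel (\<lambda>s. (cmod (indicator {0..k} s * f (s + w)))\<^sup>2)" by (rule L2_integrable)
      moreover have "(cmod (indicator {0..k} s * f (s + w)))\<^sup>2 = indicator {0..k} s * (cmod (f (w + s)))\<^sup>2" for s
        by (auto split: split_indicator simp: add.commute)
      ultimately show "integrable lborel (\<lambda>s. indicator {0..k} s * (cmod (f (w + s)))\<^sup>2)" by simp
    qed auto
    also have "\<dots> = (\<integral>\<^sup>+s. indicator {0..k} s * ennreal ((cmod (f (w + s)))\<^sup>2) \<partial>lborel)"
      by (intro nn_integral_cong) (auto split: split_indicator)
    finally show ?thesis .
  qed
  have "(\<integral>\<^sup>+w. ennreal ((cmod (LINT s:{w..w+k}|lborel. f s))\<^sup>2) \<partial>lborel)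
     \<le> (\<integral>\<^sup>+w. ennreal k * (\<integral>\<^sup>+s. indicator {0..k} s * ennreal ((cmod (f (w + s)))\<^sup>2) \<partial>lborel) \<partial>lborel)"
    by (intro nn_integral_mono pw)
  also have "\<dots> = ennreal k * (\<integral>\<^sup>+w. (\<integral>\<^sup>+s. indicator {0..k} s * ennreal ((cmod (f (w + s)))\<^sup>2) \<partial>lborel) \<partial>lborel)"
    by (intro nn_integral_cmult) measurable
  also have "(\<integral>\<^sup>+w. (\<integral>\<^sup>+s. indicator {0..k} s * ennreal ((cmod (f (w + s)))\<^sup>2) \<partial>lborel) \<partial>lborel)
     = (\<integral>\<^sup>+s. (\<integral>\<^sup>+w. indicator {0..k} s * ennreal ((cmod (f (w + s)))\<^sup>2) \<partial>lborel) \<partial>lborel)"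
    by (rule lborel_pair.Fubini') measurable
  also have "\<dots> = (\<integral>\<^sup>+s. indicator {0..k} s * ennreal (nsq f) \<partial>lborel)"
  proof (intro nn_integral_cong)
    fix s
    have "(\<integral>\<^sup>+w. indicator {0..k} s * ennreal ((cmod (f (w + s)))\<^sup>2) \<partial>lborel) = indicator {0..k} s * (\<integral>\<^sup>+w. ennreal ((cmod (f (w + s)))\<^sup>2) \<partial>lborel)"
      by (intro nn_integral_cmult) measurable
    also have "\<dots> = indicator {0..k} s * ennreal (nsq f)"
      by (subst nsq_nn[OF L2_translate(1)[OF assms(1)]]) (simp add: L2_translate(2)[OF assms(1)])
    finally show "(\<integral>\<^sup>+w. indicator {0..k} s * ennreal ((cmod (f (w + s)))\<^sup>2) \<partial>lborel) = indicator {0..k} s * ennreal (nsq f)" .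
  qed
  also have "\<dots> = ennreal k * ennreal (nsq f)"
    using assms(2) by (subst nn_integral_multc) auto
  finally have le: "(\<integral>\<^sup>+w. ennreal ((cmod (LINT s:{w..w+k}|lborel. f s))\<^sup>2) \<partial>lborel) \<le> ennreal (k\<^sup>2 * nsq f)"
    using assms(2) nsq_nonneg[of f] by (simp add: ennreal_mult power2_eq_square mult.assoc)
  show "L2 (\<lambda>w. LINT s:{w..w+k}|lborel. f s)" "nsq (\<lambda>w. LINT s:{w..w+k}|lborel. f s) \<le> k\<^sup>2 * nsq f"
    using L2I_le[OF m le] nsq_nonneg[of f] by auto
qed

lemma set_integrable_const_Icc: "set_integrable lborel {a..b::real} (\<lambda>_. c :: 'a::euclidean_space)"
  by (rule borel_integrable_atLeastAtMost') (rule continuous_on_const)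

lemma L2_average_CCs:
  assumes "CCs h" "e > 0"
  shows "\<exists>d>0. \<forall>k. 0 < k \<and> k < d \<longrightarrow> nsq (\<lambda>w. cor (1/k) * (LINT s:{w..w+k}|lborel. h s) - h w) < e"
proof -
  obtain B where B: "0 < B" "\<And>x. B < \<bar>x\<bar> \<Longrightarrow> h x = 0" "\<And>x. cmod (h x) \<le> B"
    using CCs_obtain[OF assms(1)] by blast
  have cont: "continuous_on UNIV h" using assms by (simp add: CCs_def)
  \<comment> \<open>The error will be at most \<open>\<eta>\<close> on \<open>[-(B+1), B+1]\<close>
    and 0 elsewhere, and \<open>\<eta>\<close> is chosen so that \<open>\<eta>\<^sup>2\<close> times
    the length \<open>2 * B + 2\<close> is \<open>e / 2\<close>.\<close>
  define \<eta> where "\<eta> = sqrt (e / (2 * (2 * B + 2)))"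
  have p: "0 < e / (2 * (2 * B + 2))" using B(1) assms(2) by simp
  have "\<eta>\<^sup>2 * (2 * B + 2) = e / 2" using p B(1) unfolding \<eta>_def by (subst real_sqrt_pow2) (auto simp: field_simps)
  then have \<eta>: "\<eta> > 0" "\<eta>\<^sup>2 * (2 * B + 2) < e" using p assms(2) by (simp_all only: \<eta>_def real_sqrt_gt_0_iff)
  \<comment> \<open>One unit of margin on each side: for \<open>k < 1\<close> the window starting at
    a point of \<open>[-(B+1), B+1]\<close> stays in this interval, and a window starting outside
    \<open>[-(B+1), B+1]\<close> misses the support.\<close>
  have "uniformly_continuous_on {-(B+2)..B+2} h"
    by (intro compact_uniformly_continuous continuous_on_subset[OF cont]) auto
  then obtain d where d: "d > 0" "\<And>x y. x \<in> {-(B+2)..B+2} \<Longrightarrow> y \<in> {-(B+2)..B+2} \<Longrightarrow> dist y x < d \<Longrightarrow> dist (h y) (h x) < \<eta>"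
    using \<eta>(1) unfolding uniformly_continuous_on_def by metis
  show ?thesis
  proof (intro exI[of _ "min d 1"] conjI allI impI)
    show "min d 1 > 0" using d by auto
    fix k assume k: "0 < k \<and> k < min d 1"
    define D where "D w = cor (1/k) * (LINT s:{w..w+k}|lborel. h s) - h w" for w
    have L: "L2 D" unfolding D_def using k by (intro L2_diff L2_cmul L2_window CCs_L2 assms) auto
    have si: "set_integrable lborel {a..b} h" for a b by (rule L2_set_integrable[OF CCs_L2[OF assms(1)]])
    have b: "cmod (D w) \<le> cmod (cor \<eta> * indicator {-(B+1)..B+1} w)" for w
    proof -
      have "D w = cor (1/k) * (LINT s:{w..w+k}|lborel. h s - h w)"
        unfolding D_def using k si[of w "w+k"]
        by (subst set_integral_diff(2)) (auto simp: set_integral_const set_integrable_const_Icc algebra_simps scaleR_conv_of_real)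
      moreover have "cmod (LINT s:{w..w+k}|lborel. h s - h w) \<le> (LINT s:{w..w+k}|lborel. (\<eta> * indicator {-(B+1)..B+1} w))"
      proof (rule order_trans[OF set_integral_norm_bound])
        show 1: "set_integrable lborel {w..w+k} (\<lambda>s. h s - h w)"
          using si[of w "w+k"] by (intro set_integral_diff(1) set_integrable_const_Icc)
        show "(LINT s:{w..w+k}|lborel. cmod (h s - h w)) \<le> (LINT s:{w..w+k}|lborel. (\<eta> * indicator {-(B+1)..B+1} w))"
        proof (rule set_integral_mono)
          show "set_integrable lborel {w..w+k} (\<lambda>s. cmod (h s - h w))"
            using 1 by (rule set_integrable_norm)
          show "set_integrable lborel {w..w+k} (\<lambda>s. \<eta> * indicator {-(B+1)..B+1} w)"
            by (rule set_integrable_const_Icc)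
          fix s assume s: "s \<in> {w..w+k}"
          show "cmod (h s - h w) \<le> \<eta> * indicator {-(B+1)..B+1} w"
          proof (cases "w \<in> {-(B+1)..B+1}")
            case True
            then have "dist (h s) (h w) < \<eta>" using s k by (intro d(2)) (auto simp: dist_real_def)
            then show ?thesis using True by (simp add: dist_norm)
          next
            case False
            then have "h w = 0" "h s = 0" using s k by (auto intro!: B(2) simp: abs_if)
            then show ?thesis using \<eta>(1) by simp
          qed
        qed
      qed
      moreover have "(LINT s:{w..w+k}|lborel. (\<eta> * indicator {-(B+1)..B+1} w)) = k * (\<eta> * indicator {-(B+1)..B+1} w)"
        using k by (subst set_integral_const) auto
      ultimately have "cmod (D w) \<le> (1/k) * (k * (\<eta> * indicator {-(B+1)..B+1} w))"
        using k by (auto simp: norm_mult norm_divide pos_divide_le_eq mult_ac)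
      then show ?thesis using k \<eta>(1) by (auto split: split_indicator)
    qed
    have "nsq D \<le> nsq (\<lambda>w. cor \<eta> * indicator {-(B+1)..B+1} w)"
      by (rule L2_bound(2)[OF L2_measurable[OF L] L2_cmul(1)[OF L2_indicator(1)] b])
    also have "\<dots> = \<eta>\<^sup>2 * (2 * B + 2)"
      using B(1) by (subst L2_cmul(2)[OF L2_indicator(1)]) (auto simp: L2_indicator(2))
    finally show "nsq (\<lambda>w. cor (1/k) * (LINT s:{w..w+k}|lborel. h s) - h w) < e"
      using \<eta>(2) by (simp add: D_def[abs_def])
  qed
qed

text \<open>The L2 form of Lebesgue differentiation, from which all derivatives on the diagonal are
  obtained. By \<open>L2_window\<close> the averaging operators are contractions for every
  \<open>k\<close>, so the convergence passes from the dense class of \<open>L2_average_CCs\<close>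
  to all of L2.\<close>

lemma L2_average:
  assumes "L2 f"
  shows "((\<lambda>k. nsq (\<lambda>w. cor (1/k) * (LINT s:{w..w+k}|lborel. f s) - f w)) \<longlongrightarrow> 0) (at_right 0)"
proof (rule tendstoI)
  fix e :: real assume e: "e > 0"
  obtain h where h: "CCs h" "nsq (\<lambda>x. f x - h x) < e / 16"
    using CCs_dense_L2[OF assms] e by (auto simp: CCs_approx_def elim!: allE[of _ "e/16"])
  obtain d where d: "d > 0" "\<And>k. 0 < k \<Longrightarrow> k < d \<Longrightarrow> nsq (\<lambda>w. cor (1/k) * (LINT s:{w..w+k}|lborel. h s) - h w) < e / 16"
    using L2_average_CCs[OF h(1), of "e/16"] e by auto
  have hL: "L2 h" by (rule CCs_L2[OF h(1)])
  have "nsq (\<lambda>w. cor (1/k) * (LINT s:{w..w+k}|lborel. f s) - f w) < e" if k: "0 < k" "k < d" for k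
  proof -
    define a where "a w = cor (1/k) * (LINT s:{w..w+k}|lborel. f s - h s)" for w
    define b where "b w = cor (1/k) * (LINT s:{w..w+k}|lborel. h s) - h w" for w
    have La: "L2 a" "nsq a \<le> nsq (\<lambda>x. f x - h x)"
    proof -
      note w = L2_window[OF L2_diff(1)[OF assms hL] k(1)]
      show "L2 a" unfolding a_def by (intro L2_cmul w)
      have "nsq a = (1/k)\<^sup>2 * nsq (\<lambda>w. LINT s:{w..w+k}|lborel. f s - h s)"
        unfolding a_def by (subst L2_cmul(2)[OF w(1)]) (simp add: norm_divide power_divide)
      also have "\<dots> \<le> (1/k)\<^sup>2 * (k\<^sup>2 * nsq (\<lambda>x. f x - h x))" by (intro mult_left_mono w) auto
      also have "\<dots> = nsq (\<lambda>x. f x - h x)" using k by (simp add: field_simps)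
      finally show "nsq a \<le> nsq (\<lambda>x. f x - h x)" .
    qed
    have Lb: "L2 b" unfolding b_def using k by (intro L2_diff L2_cmul L2_window hL) auto
    have eq: "cor (1/k) * (LINT s:{w..w+k}|lborel. f s) - f w = a w + (b w + (h w - f w))" for w
      unfolding a_def b_def
      by (subst set_integral_diff(2)[OF L2_set_integrable[OF assms] L2_set_integrable[OF hL]]) (simp add: algebra_simps)
    have "nsq (\<lambda>w. cor (1/k) * (LINT s:{w..w+k}|lborel. f s) - f w) = nsq (\<lambda>w. a w + (b w + (h w - f w)))"
      by (simp only: eq)
    also have 1: "\<dots> \<le> 2 * nsq a + 2 * nsq (\<lambda>w. b w + (h w - f w))"
      by (intro L2_add La Lb L2_diff assms hL)
    finally have 1: "nsq (\<lambda>w. cor (1/k) * (LINT s:{w..w+k}|lborel. f s) - f w) \<le> 2 * nsq a + 2 * nsq (\<lambda>w. b w + (h w - f w))" .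
    have "nsq (\<lambda>w. b w + (h w - f w)) \<le> 2 * nsq b + 2 * nsq (\<lambda>w. h w - f w)"
      by (intro L2_add La Lb L2_diff assms hL)
    with 1 show ?thesis using e La(2) h(2) d(2)[OF k, folded b_def] unfolding nsq_swap[of h f] by linarith
  qed
  then show "\<forall>\<^sub>F k in at_right 0. dist (nsq (\<lambda>w. cor (1/k) * (LINT s:{w..w+k}|lborel. f s) - f w)) 0 < e"
    unfolding eventually_at_right_field using d(1) by (intro exI[of _ d]) (auto simp: nsq_nonneg)
qed

lemma set_integral_reflect_interval:
  fixes f :: "real \<Rightarrow> complex"
  shows "(LINT s:{a..b}|lborel. f (- s)) = (LINT s:{-b..-a}|lborel. f s)"
proof -
  have "(LINT s:{-b..-a}|lborel. f s) = (LINT s|lborel. indicator {-b..-a} (0 + (-1) * s) *\<^sub>R f (0 + (-1) * s))"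
    unfolding set_lebesgue_integral_def
    by (subst lborel_integral_real_affine[where c="-1" and t=0]) simp_all
  also have "\<dots> = (LINT s:{a..b}|lborel. f (- s))"
    unfolding set_lebesgue_integral_def
    by (intro Bochner_Integration.integral_cong refl) (auto split: split_indicator)
  finally show ?thesis by simp
qed

lemma L2_average_left:
  assumes "L2 f"
  shows "((\<lambda>k. nsq (\<lambda>w. cor (1/k) * (LINT s:{w-k..w}|lborel. f s) - f w)) \<longlongrightarrow> 0) (at_right 0)"
proof -
  have "nsq (\<lambda>w. cor (1/k) * (LINT s:{w-k..w}|lborel. f s) - f w) =
    nsq (\<lambda>w. cor (1/k) * (LINT s:{w..w+k}|lborel. f (- s)) - f (- w))" if "k > 0" for k
  proof -
    have 1: "(LINT s:{-w-k..-w}|lborel. f s) = (LINT s:{w..w+k}|lborel. f (- s))" for w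
      using set_integral_reflect_interval[of w "w+k" f] by simp
    have L: "L2 (\<lambda>w. cor (1/k) * (LINT s:{w-k..w}|lborel. f s) - f w)"
    proof (intro L2_diff L2_cmul assms)
      show "L2 (\<lambda>w. LINT s:{w-k..w}|lborel. f s)"
        using L2_translate(1)[OF L2_window(1)[OF assms that], of "-k"] by simp
    qed
    show ?thesis using L2_reflect(2)[OF L] by (simp add: 1)
  qed
  then show ?thesis
    by (intro Lim_transform_eventually[OF L2_average[OF L2_reflect(1)[OF assms]]])
      (auto simp: eventually_at_right_field intro!: exI[of _ 1])
qed

section \<open>Exponentials on the half line and their Gram matrices\<close>

lemma nn_integral_power_exp:
  assumes "0 < \<mu>"
  shows "(\<integral>\<^sup>+x. ennreal (x ^ k * exp (- (\<mu> * x))) * indicator {0..} x \<partial>lborel) = ennreal (fact k / \<mu> ^ (k + 1))"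
proof -
  have "ennreal (fact k) = (\<integral>\<^sup>+x. ennreal (x ^ k * exp (- x)) * indicator {0..} x \<partial>lborel)"
    by (simp add: nn_intergal_power_times_exp_Ici)
  also have "\<dots> = ennreal \<bar>\<mu>\<bar> * (\<integral>\<^sup>+x. ennreal ((0 + \<mu> * x) ^ k * exp (- (0 + \<mu> * x))) * indicator {0..} (0 + \<mu> * x) \<partial>lborel)"
    using assms by (intro nn_integral_real_affine) auto
  also have "(\<integral>\<^sup>+x. ennreal ((0 + \<mu> * x) ^ k * exp (- (0 + \<mu> * x))) * indicator {0..} (0 + \<mu> * x) \<partial>lborel)
     = (\<integral>\<^sup>+x. ennreal (\<mu> ^ k) * (ennreal (x ^ k * exp (- (\<mu> * x))) * indicator {0..} x) \<partial>lborel)"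
    using assms by (intro nn_integral_cong)
      (auto split: split_indicator simp: power_mult_distrib ennreal_mult'[symmetric] mult.assoc zero_le_mult_iff)
  also have "\<dots> = ennreal (\<mu> ^ k) * (\<integral>\<^sup>+x. ennreal (x ^ k * exp (- (\<mu> * x))) * indicator {0..} x \<partial>lborel)"
    by (intro nn_integral_cmult) measurable
  finally have *: "ennreal (fact k) = ennreal (\<mu> ^ (k + 1)) * (\<integral>\<^sup>+x. ennreal (x ^ k * exp (- (\<mu> * x))) * indicator {0..} x \<partial>lborel)"
    using assms by (simp add: ennreal_mult mult.assoc abs_of_pos)
  have "ennreal (fact k / \<mu> ^ (k + 1)) = ennreal (1 / \<mu> ^ (k + 1)) * ennreal (fact k)"
    using assms by (subst ennreal_mult[symmetric]) auto
  also have "\<dots> = (ennreal (1 / \<mu> ^ (k + 1)) * ennreal (\<mu> ^ (k + 1))) * (\<integral>\<^sup>+x. ennreal (x ^ k * exp (- (\<mu> * x))) * indicator {0..} x \<partial>lborel)"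
    by (simp only: * mult.assoc)
  also have "ennreal (1 / \<mu> ^ (k + 1)) * ennreal (\<mu> ^ (k + 1)) = 1"
    using assms by (subst ennreal_mult[symmetric]) auto
  finally show ?thesis by simp
qed

text \<open>Extension by zero turns half-line integrals into integrals over the line. The value 0 at
  the origin agrees with the other functions here that are extended from the open half line.\<close>

definition ex :: "real \<Rightarrow> real \<Rightarrow> complex" where
  "ex \<mu> x = indicator {0<..} x * cor (exp (- (\<mu> * x)))"

lemma ex_pos: "0 < x \<Longrightarrow> ex \<mu> x = cor (exp (- (\<mu> * x)))"
  by (simp add: ex_def)

lemma ex_nonpos: "x \<le> 0 \<Longrightarrow> ex \<mu> x = 0"
  by (simp add: ex_def)

lemma ex_measurable [measurable]: "ex \<mu> \<in> borel_measurable borel"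
  unfolding ex_def[abs_def] by measurable

lemma ex_mult: "ex \<mu> x * ex \<nu> x = ex (\<mu> + \<nu>) x"
  by (auto simp: ex_def exp_add[symmetric] algebra_simps split: split_indicator simp flip: of_real_mult)

lemma cnj_ex [simp]: "cnj (ex \<mu> x) = ex \<mu> x"
  by (auto simp: ex_def split: split_indicator)

lemma ex_has_integral:
  assumes "0 < \<mu>"
  shows "integrable lborel (ex \<mu>)" "(LINT x|lborel. ex \<mu> x) = cor (1 / \<mu>)"
proof -
  have "(\<integral>\<^sup>+x. ennreal (indicator {0<..} x * exp (- (\<mu> * x))) \<partial>lborel) = (\<integral>\<^sup>+x. ennreal (x ^ 0 * exp (- (\<mu> * x))) * indicator {0..} x \<partial>lborel)"
    by (intro nn_integral_cong_AE AE_I[where N="{0}"]) (auto simp: indicator_def)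
  also have "\<dots> = ennreal (1 / \<mu>)" using nn_integral_power_exp[OF assms, of 0] by simp
  finally have "has_bochner_integral lborel (\<lambda>x. indicator {0<..} x * exp (- (\<mu> * x))) (1 / \<mu>)"
    using assms by (intro has_bochner_integral_nn_integral) auto
  then have "has_bochner_integral lborel (\<lambda>x. cor (indicator {0<..} x * exp (- (\<mu> * x)))) (cor (1 / \<mu>))"
    by (rule has_bochner_integral_of_real)
  moreover have "cor (indicator {0<..} x * exp (- (\<mu> * x))) = ex \<mu> x" for x
    by (auto simp: ex_def split: split_indicator)
  ultimately have "has_bochner_integral lborel (ex \<mu>) (cor (1 / \<mu>))" by simp
  then show "integrable lborel (ex \<mu>)" "(LINT x|lborel. ex \<mu> x) = cor (1 / \<mu>)"
    by (auto simp: has_bochner_integral_iff)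
qed

lemma L2_ex:
  assumes "0 < \<mu>"
  shows "L2 (ex \<mu>)"
proof -
  have "(cmod (ex \<mu> x))\<^sup>2 = Re (ex (\<mu> + \<mu>) x)" for x
    by (auto simp: ex_def power2_eq_square exp_add[symmetric] algebra_simps split: split_indicator)
  then show ?thesis unfolding L2_def
    using integrable_Re[OF ex_has_integral(1), of "\<mu> + \<mu>"] assms by simp
qed

text \<open>The Gram matrix of exponentials is a Cauchy matrix. Every norm identity between
  exponential sums below is an entrywise identity between such fractions.\<close>

lemma nsq_exp_sum:
  assumes "finite I" "\<And>i. i \<in> I \<Longrightarrow> 0 < \<alpha> i"
  shows "cor (nsq (\<lambda>x. \<Sum>i\<in>I. c i * ex (\<alpha> i) x)) = (\<Sum>i\<in>I. \<Sum>j\<in>I. c i * cnj (c j) / cor (\<alpha> i + \<alpha> j))"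
proof -
  have "cor (nsq (\<lambda>x. \<Sum>i\<in>I. c i * ex (\<alpha> i) x)) = (LINT x|lborel. cor ((cmod (\<Sum>i\<in>I. c i * ex (\<alpha> i) x))\<^sup>2))"
    unfolding nsq_def by (rule integral_complex_of_real[symmetric])
  also have "\<dots> = (LINT x|lborel. (\<Sum>i\<in>I. \<Sum>j\<in>I. c i * cnj (c j) * ex (\<alpha> i + \<alpha> j) x))"
  proof (intro Bochner_Integration.integral_cong refl)
    fix x
    show "cor ((cmod (\<Sum>i\<in>I. c i * ex (\<alpha> i) x))\<^sup>2) = (\<Sum>i\<in>I. \<Sum>j\<in>I. c i * cnj (c j) * ex (\<alpha> i + \<alpha> j) x)"
      unfolding complex_norm_square cnj_sum complex_cnj_mult cnj_ex sum_product
      by (intro sum.cong refl) (simp add: ex_mult[symmetric] algebra_simps)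
  qed
  also have "\<dots> = (\<Sum>i\<in>I. \<Sum>j\<in>I. c i * cnj (c j) * (LINT x|lborel. ex (\<alpha> i + \<alpha> j) x))"
    using assms(2) by (simp add: Bochner_Integration.integral_sum ex_has_integral add_pos_pos)
  also have "\<dots> = (\<Sum>i\<in>I. \<Sum>j\<in>I. c i * cnj (c j) / cor (\<alpha> i + \<alpha> j))"
    using assms(2) by (intro sum.cong refl) (subst ex_has_integral(2), auto intro: add_pos_pos)
  finally show ?thesis .
qed

text \<open>The Hankel transform, in the variables \<open>u\<close> and \<open>v\<close>, takes the
  exponential of rate \<mu> to \<open>1 / \<mu>\<close> times the exponential of rate
  \<open>1 / \<mu>\<close>. This is its unitarity on finite sums: the factors \<mu> cancel in each
  Gram entry.\<close>

lemma nsq_exp_sum_inverse: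
  assumes "finite I" "\<And>i. i \<in> I \<Longrightarrow> 0 < \<mu> i"
  shows "nsq (\<lambda>x. \<Sum>i\<in>I. c i / cor (\<mu> i) * ex (1 / \<mu> i) x) = nsq (\<lambda>x. \<Sum>i\<in>I. c i * ex (\<mu> i) x)"
proof -
  have "cor (nsq (\<lambda>x. \<Sum>i\<in>I. c i / cor (\<mu> i) * ex (1 / \<mu> i) x)) =
    cor (nsq (\<lambda>x. \<Sum>i\<in>I. c i * ex (\<mu> i) x))"
  proof -
    have p: "0 < 1 / \<mu> i" if "i \<in> I" for i using assms(2)[OF that] by simp
    have "cor (nsq (\<lambda>x. \<Sum>i\<in>I. c i / cor (\<mu> i) * ex (1 / \<mu> i) x))
       = (\<Sum>i\<in>I. \<Sum>j\<in>I. c i / cor (\<mu> i) * cnj (c j / cor (\<mu> j)) / cor (1 / \<mu> i + 1 / \<mu> j))"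
      by (rule nsq_exp_sum[OF assms(1)]) (rule p)
    also have "(\<Sum>i\<in>I. \<Sum>j\<in>I. c i / cor (\<mu> i) * cnj (c j / cor (\<mu> j)) / cor (1 / \<mu> i + 1 / \<mu> j))
       = (\<Sum>i\<in>I. \<Sum>j\<in>I. c i * cnj (c j) / (cor (\<mu> i + \<mu> j)))"
    proof (intro sum.cong refl)
      fix i j assume "i \<in> I" "j \<in> I"
      then have p: "0 < \<mu> i" "0 < \<mu> j" using assms(2) by auto
      have "1 / \<mu> i + 1 / \<mu> j = (\<mu> i + \<mu> j) / (\<mu> i * \<mu> j)" using p by (simp add: field_simps)
      then have "cor (1 / \<mu> i + 1 / \<mu> j) = cor (\<mu> i + \<mu> j) / (cor (\<mu> i) * cor (\<mu> j))"
        by (metis of_real_divide of_real_mult)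
      then show "c i / cor (\<mu> i) * cnj (c j / cor (\<mu> j)) / cor (1 / \<mu> i + 1 / \<mu> j) = c i * cnj (c j) / cor (\<mu> i + \<mu> j)"
        using p by simp
    qed
    also have "\<dots> = cor (nsq (\<lambda>x. \<Sum>i\<in>I. c i * ex (\<mu> i) x))"
      by (rule nsq_exp_sum[OF assms, symmetric])
    finally show ?thesis .
  qed
  then show ?thesis by (simp only: of_real_eq_iff)
qed

text \<open>The exponentials \<open>exp (- \<mu> u - v / \<mu>)\<close> solve \<open>F\<^sub>u\<^sub>v = F\<close>; their data on
  the ray \<open>u = 0\<close> and on the diagonal have the same norm.\<close>
lemma nsq_exp_sum_diag:
  assumes "finite I" "\<And>i. i \<in> I \<Longrightarrow> 0 < \<mu> i"
  shows "nsq (\<lambda>x. \<Sum>i\<in>I. - (c i * cor (\<mu> i)) * ex (\<mu> i + 1 / \<mu> i) x) + nsq (\<lambda>x. \<Sum>i\<in>I. c i * ex (\<mu> i + 1 / \<mu> i) x)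
    = nsq (\<lambda>x. \<Sum>i\<in>I. c i * ex (1 / \<mu> i) x)"
proof -
  have p1: "0 < \<mu> i + 1 / \<mu> i" if "i \<in> I" for i using assms(2)[OF that] by (simp add: add_pos_pos)
  have p2: "0 < 1 / \<mu> i" if "i \<in> I" for i using assms(2)[OF that] by simp
  have e: "cor (nsq (\<lambda>x. \<Sum>i\<in>I. d i * ex (\<alpha> i) x)) = (\<Sum>i\<in>I. \<Sum>j\<in>I. d i * cnj (d j) / cor (\<alpha> i + \<alpha> j))"
    if "\<And>i. i \<in> I \<Longrightarrow> 0 < \<alpha> i" for d \<alpha>
    by (rule nsq_exp_sum[OF assms(1) that])
  have e1: "cor (nsq (\<lambda>x. \<Sum>i\<in>I. d i * ex (\<mu> i + 1 / \<mu> i) x)) = (\<Sum>i\<in>I. \<Sum>j\<in>I. d i * cnj (d j) / cor (\<mu> i + 1 / \<mu> i + (\<mu> j + 1 / \<mu> j)))" for d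
    by (rule e) (rule p1)
  have e3: "cor (nsq (\<lambda>x. \<Sum>i\<in>I. c i * ex (1 / \<mu> i) x)) = (\<Sum>i\<in>I. \<Sum>j\<in>I. c i * cnj (c j) / cor (1 / \<mu> i + 1 / \<mu> j))"
    by (rule e) (rule p2)
  have "cor (nsq (\<lambda>x. \<Sum>i\<in>I. - (c i * cor (\<mu> i)) * ex (\<mu> i + 1 / \<mu> i) x)) + cor (nsq (\<lambda>x. \<Sum>i\<in>I. c i * ex (\<mu> i + 1 / \<mu> i) x))
    = (\<Sum>i\<in>I. \<Sum>j\<in>I. (- (c i * cor (\<mu> i))) * cnj (- (c j * cor (\<mu> j))) / cor (\<mu> i + 1 / \<mu> i + (\<mu> j + 1 / \<mu> j)) +
       c i * cnj (c j) / cor (\<mu> i + 1 / \<mu> i + (\<mu> j + 1 / \<mu> j)))"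
    by (simp only: e1 sum.distrib)
  also have "\<dots> = (\<Sum>i\<in>I. \<Sum>j\<in>I. c i * cnj (c j) / cor (1 / \<mu> i + 1 / \<mu> j))"
  proof (intro sum.cong refl)
    fix i j assume "i \<in> I" "j \<in> I"
    then have p: "0 < \<mu> i" "0 < \<mu> j" using assms(2) by auto
    define a b where "a = cor (\<mu> i)" and "b = cor (\<mu> j)"
    have "cor (\<mu> i + \<mu> j) \<noteq> 0" "cor (1 + \<mu> i * \<mu> j) \<noteq> 0"
      unfolding of_real_eq_0_iff using p mult_pos_pos[OF p] by linarith+
    then have ab: "a \<noteq> 0" "b \<noteq> 0" "a + b \<noteq> 0" "1 + a * b \<noteq> 0"
      using p unfolding a_def b_def by simp_all
    \<comment> \<open>Both sums of rates contain the factor \<open>a + b\<close>, and the remaining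
      factor \<open>1 + a * b\<close> of the first is exactly what the two data, value and
      derivative, contribute together in the numerator.\<close>
    have q: "a + 1 / a + (b + 1 / b) = (a + b) * (1 + a * b) / (a * b)" "1 / a + 1 / b = (a + b) / (a * b)"
      using ab by (simp_all add: field_simps)
    have "(- (c i * a)) * cnj (- (c j * b)) / (a + 1 / a + (b + 1 / b)) + c i * cnj (c j) / (a + 1 / a + (b + 1 / b)) = c i * cnj (c j) * ((1 + a * b) / (a + 1 / a + (b + 1 / b)))"
      by (simp add: b_def add_divide_distrib algebra_simps)
    also have "(1 + a * b) / (a + 1 / a + (b + 1 / b)) = 1 / (1 / a + 1 / b)"
      unfolding q using ab by simp
    finally show "(- (c i * cor (\<mu> i))) * cnj (- (c j * cor (\<mu> j))) / cor (\<mu> i + 1 / \<mu> i + (\<mu> j + 1 / \<mu> j)) +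
       c i * cnj (c j) / cor (\<mu> i + 1 / \<mu> i + (\<mu> j + 1 / \<mu> j)) = c i * cnj (c j) / cor (1 / \<mu> i + 1 / \<mu> j)"
      by (simp add: a_def b_def)
  qed
  also have "\<dots> = cor (nsq (\<lambda>x. \<Sum>i\<in>I. c i * ex (1 / \<mu> i) x))"
    by (simp only: e3)
  finally have "cor (nsq (\<lambda>x. \<Sum>i\<in>I. - (c i * cor (\<mu> i)) * ex (\<mu> i + 1 / \<mu> i) x)) + cor (nsq (\<lambda>x. \<Sum>i\<in>I. c i * ex (\<mu> i + 1 / \<mu> i) x))
    = cor (nsq (\<lambda>x. \<Sum>i\<in>I. c i * ex (1 / \<mu> i) x))" .
  then show ?thesis by (simp only: of_real_add[symmetric] of_real_eq_iff)
qed

section \<open>Density of finite exponential sums in L2 of the half line\<close>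

definition ES :: "nat \<Rightarrow> real \<Rightarrow> (nat \<Rightarrow> complex) \<Rightarrow> real \<Rightarrow> complex" where
  "ES n N a x = (\<Sum>k<n. a k * ex (real k + 1 + N) x)"

lemma L2_ES: "0 \<le> N \<Longrightarrow> L2 (ES n N a)"
  unfolding ES_def[abs_def] by (intro L2_sum L2_cmul L2_ex) auto

lemma ES_pad:
  assumes "n \<le> m" shows "ES n N a = ES m N (\<lambda>k. if k < n then a k else 0)"
proof
  fix x
  have "ES m N (\<lambda>k. if k < n then a k else 0) x = (\<Sum>k<m. if k < n then a k * ex (real k + 1 + N) x else 0)"
    unfolding ES_def by (intro sum.cong) auto
  also have "\<dots> = (\<Sum>k\<in>{..<m} \<inter> {k. k < n}. a k * ex (real k + 1 + N) x)" by (simp add: sum.inter_restrict)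
  also have "{..<m} \<inter> {k. k < n} = {..<n}" using assms by auto
  finally show "ES n N a x = ES m N (\<lambda>k. if k < n then a k else 0) x" by (simp add: ES_def)
qed

text \<open>This is the purpose of the parameter \<open>N\<close>: a shifted sum carries the weight
  exp (- N * x) and can be integrated against functions that are square integrable only after
  multiplication by that weight.\<close>

lemma ES_shift: "ES n N a x = cor (exp (- (N * x))) * ES n 0 a x"
  unfolding ES_def sum_distrib_left
  by (intro sum.cong refl) (auto simp: ex_def exp_add[symmetric] algebra_simps split: split_indicator simp flip: of_real_mult)

text \<open>With \<open>y = exp (- x)\<close> an exponential sum is \<open>y\<close> times a
  polynomial in \<open>y\<close>. Since \<open>h\<close> has compact support, \<open>h / y\<close>
  is continuous on \<open>[0, 1]\<close> and vanishes near 0, so Weierstrass applies. The factor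
  \<open>y\<close> returns as exp (- x) and makes the uniform error square integrable.\<close>

lemma real_CCs_ES_approx:
  fixes h :: "real \<Rightarrow> real"
  assumes cont: "continuous_on UNIV h" and supp: "\<And>x. B < \<bar>x\<bar> \<Longrightarrow> h x = 0" and e: "0 < e"
  obtains a n where "\<And>x. 0 < x \<Longrightarrow> \<bar>h x - (\<Sum>k<n. a k * exp (- ((real k + 1) * x)))\<bar> \<le> e * exp (- x)"
proof -
  define q where "q y = (if y \<le> 0 then 0 else h (- ln y) / y)" for y
  have q0: "q y = 0" if "y < exp (- B)" for y
  proof (cases "y \<le> 0")
    case False
    then have "ln y < - B" using that ln_less_cancel_iff[of y "exp (-B)"] by simp
    then show ?thesis using supp[of "- ln y"] by (simp add: q_def)
  qed (simp add: q_def)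
  have "continuous_on ({..<exp (-B)} \<union> {0<..}) q"
  proof (rule continuous_on_open_Un)
    show "continuous_on {..<exp (-B)} q"
      using q0 by (subst continuous_on_cong[where g="\<lambda>_. 0"]) auto
    have "continuous_on {0<..} (\<lambda>y. h (- ln y) / y)"
      by (intro continuous_intros continuous_on_compose2[OF cont]) auto
    then show "continuous_on {0<..} q"
      by (subst continuous_on_cong[where g="\<lambda>y. h (- ln y) / y"]) (auto simp: q_def)
  qed auto
  then have "continuous_on {0..1} q" by (rule continuous_on_subset) (auto simp: less_le_trans[OF exp_gt_zero] not_le)
  then obtain g where g: "real_polynomial_function g" "\<And>y. y \<in> {0..1} \<Longrightarrow> \<bar>q y - g y\<bar> < e"
    using Stone_Weierstrass_real_polynomial_function[of "{0..1}" q e] e by auto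
  then obtain a n where an: "g = (\<lambda>x. \<Sum>i\<le>n. a i * x ^ i)" using real_polynomial_function_iff_sum by auto
  show ?thesis
  proof (rule that[of a "Suc n"])
    fix x :: real assume x: "0 < x"
    have "\<bar>q (exp (- x)) - g (exp (- x))\<bar> \<le> e" using g(2)[of "exp (- x)"] x by auto
    moreover have "q (exp (- x)) = h x / exp (- x)" by (simp add: q_def)
    moreover have "(\<Sum>k<Suc n. a k * exp (- ((real k + 1) * x))) = exp (- x) * g (exp (- x))"
      unfolding an sum_distrib_left lessThan_Suc_atMost
      by (intro sum.cong refl) (simp add: exp_of_nat_mult[symmetric] exp_add[symmetric] algebra_simps)
    ultimately have "exp (- x) * \<bar>h x / exp (- x) - g (exp (- x))\<bar> \<le> exp (- x) * e" by simp
    moreover have "exp (- x) * \<bar>h x / exp (- x) - g (exp (- x))\<bar> = \<bar>exp (- x) * (h x / exp (- x) - g (exp (- x)))\<bar>"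
      by (simp add: abs_mult)
    ultimately show "\<bar>h x - (\<Sum>k<Suc n. a k * exp (- ((real k + 1) * x)))\<bar> \<le> e * exp (- x)"
      using \<open>(\<Sum>k<Suc n. a k * exp (- ((real k + 1) * x))) = exp (- x) * g (exp (- x))\<close>
      by (simp add: right_diff_distrib mult.commute)
  qed
qed

theorem ES_dense_L2:
  assumes "L2 f" "\<And>x. x \<le> 0 \<Longrightarrow> f x = 0" "e > 0"
  obtains n a where "nsq (\<lambda>x. f x - ES n 0 a x) < e"
proof -
  obtain h where h: "CCs h" "nsq (\<lambda>x. f x - h x) < e / 4"
    using CCs_dense_L2[OF assms(1)] assms(3) by (auto simp: CCs_approx_def elim!: allE[of _ "e/4"])
  obtain B where B: "\<And>x. B < \<bar>x\<bar> \<Longrightarrow> h x = 0" using CCs_obtain[OF h(1)] by metis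
  have cont: "continuous_on UNIV (\<lambda>x. Re (h x))" "continuous_on UNIV (\<lambda>x. Im (h x))"
    using h(1) by (auto simp: CCs_def intro!: continuous_intros)
  \<comment> \<open>Real and imaginary parts each contribute an error \<open>d * exp (- x)\<close>,
    and the squared norm of \<open>2 * d * exp (- x)\<close> on the half line is
    \<open>2 * d\<^sup>2 = e / 8\<close>.\<close>
  define d where "d = sqrt (e / 16)"
  have d: "d > 0" "d\<^sup>2 = e / 16" using assms(3) by (auto simp: d_def)
  obtain a n where a: "\<And>x. 0 < x \<Longrightarrow> \<bar>Re (h x) - (\<Sum>k<n. a k * exp (- ((real k + 1) * x)))\<bar> \<le> d * exp (- x)"
    using real_CCs_ES_approx[OF cont(1), of B d] B d(1) by auto
  obtain b m where b: "\<And>x. 0 < x \<Longrightarrow> \<bar>Im (h x) - (\<Sum>k<m. b k * exp (- ((real k + 1) * x)))\<bar> \<le> d * exp (- x)"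
    using real_CCs_ES_approx[OF cont(2), of B d] B d(1) by auto
  define N where "N = max n m"
  define c where "c k = (if k < n then cor (a k) else 0) + \<i> * (if k < m then cor (b k) else 0)" for k
  define h0 where "h0 x = indicator {0<..} x * h x" for x
  have Lh0: "L2 h0" unfolding h0_def by (intro L2_restrict CCs_L2 h) auto
  have ES: "ES N 0 c x = cor (\<Sum>k<n. a k * exp (- ((real k + 1) * x))) + \<i> * cor (\<Sum>k<m. b k * exp (- ((real k + 1) * x)))"
    if "0 < x" for x
  proof -
    have "ES N 0 c x = ES N 0 (\<lambda>k. if k < n then cor (a k) else 0) x + \<i> * ES N 0 (\<lambda>k. if k < m then cor (b k) else 0) x"
      unfolding ES_def c_def sum_distrib_left sum.distrib[symmetric] by (intro sum.cong refl) (simp add: algebra_simps)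
    also have "\<dots> = ES n 0 (\<lambda>k. cor (a k)) x + \<i> * ES m 0 (\<lambda>k. cor (b k)) x"
      using ES_pad[of n N 0 "\<lambda>k. cor (a k)"] ES_pad[of m N 0 "\<lambda>k. cor (b k)"] by (simp add: N_def)
    finally show ?thesis using that by (simp add: ES_def ex_pos)
  qed
  have bd: "cmod (h0 x - ES N 0 c x) \<le> cmod (cor (2 * d) * ex 1 x)" for x
  proof (cases "0 < x")
    case True
    define z where "z = h x - ES N 0 c x"
    have "\<bar>Re z\<bar> \<le> d * exp (- x)" "\<bar>Im z\<bar> \<le> d * exp (- x)"
      using a[OF True] b[OF True] by (simp_all add: z_def ES[OF True])
    then have "cmod z \<le> d * exp (- x) + d * exp (- x)" using cmod_le[of z] by linarith
    then show ?thesis using True d(1) by (simp add: h0_def z_def ex_pos norm_mult)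
  qed (simp add: h0_def ES_def ex_nonpos)
  have "nsq (\<lambda>x. h0 x - ES N 0 c x) \<le> nsq (\<lambda>x. cor (2 * d) * ex 1 x)"
    by (rule L2_bound(2)[OF L2_measurable L2_cmul(1)[OF L2_ex] bd]) (auto intro!: L2_diff Lh0 L2_ES)
  also have "\<dots> = (2 * d)\<^sup>2 * nsq (ex 1)"
    using d by (subst L2_cmul(2)[OF L2_ex]) auto
  also have "nsq (ex 1) = 1 / 2"
  proof -
    have "cor (nsq (ex 1)) = cor (1/2)"
      using nsq_exp_sum[of "{0::nat}" "\<lambda>_. 1" "\<lambda>_. 1"] by simp
    then show ?thesis by (simp only: of_real_eq_iff)
  qed
  also have "(2 * d)\<^sup>2 * (1 / 2) = e / 8" using d(2) by (simp add: power_mult_distrib)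
  finally have 1: "nsq (\<lambda>x. h0 x - ES N 0 c x) \<le> e / 8" .
  have "(\<lambda>x. f x - h0 x) = (\<lambda>x. indicator {0<..} x * (f x - h x))"
    using assms(2) by (auto simp: h0_def fun_eq_iff split: split_indicator)
  then have 2: "nsq (\<lambda>x. f x - h0 x) < e / 4"
    using L2_restrict(2)[OF L2_diff(1)[OF assms(1) CCs_L2[OF h(1)]], of "{0<..}"] h(2) by simp
  have "nsq (\<lambda>x. (f x - h0 x) + (h0 x - ES N 0 c x)) \<le> 2 * nsq (\<lambda>x. f x - h0 x) + 2 * nsq (\<lambda>x. h0 x - ES N 0 c x)"
    by (intro L2_add L2_diff assms Lh0 L2_ES) auto
  also have "\<dots> < e" using 1 2 assms(3) by simp
  finally show ?thesis by (intro that[of N c]) simp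
qed

text \<open>Both approximating sequences share the lengths \<open>n j\<close>, by padding with
  zeros, because \<open>L2_by_duality\<close> tests pairs of coefficient vectors of one
  length.\<close>

lemma ES_dense_seq:
  assumes "L2 f" "\<And>x. x \<le> 0 \<Longrightarrow> f x = 0" "L2 g" "\<And>x. x \<le> 0 \<Longrightarrow> g x = 0"
  obtains n a b where "(\<lambda>j. nsq (\<lambda>x. ES (n j) 0 (a j) x - f x)) \<longlonglongrightarrow> 0"
     "(\<lambda>j. nsq (\<lambda>x. ES (n j) 0 (b j) x - g x)) \<longlonglongrightarrow> 0"
proof -
  have ex: "\<exists>n a b. nsq (\<lambda>x. ES n 0 a x - f x) < inverse (real (Suc j)) \<and> nsq (\<lambda>x. ES n 0 b x - g x) < inverse (real (Suc j))" for j
  proof -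
    have p: "inverse (real (Suc j)) > 0" by simp
    obtain n a where a: "nsq (\<lambda>x. f x - ES n 0 a x) < inverse (real (Suc j))" using ES_dense_L2[OF assms(1,2) p] by blast
    obtain m b where b: "nsq (\<lambda>x. g x - ES m 0 b x) < inverse (real (Suc j))" using ES_dense_L2[OF assms(3,4) p] by blast
    show ?thesis
      using a b ES_pad[of n "max n m" 0 a] ES_pad[of m "max n m" 0 b] nsq_swap by (metis max.cobounded1 max.cobounded2)
  qed
  then obtain n a b where nab: "\<And>j. nsq (\<lambda>x. ES (n j) 0 (a j) x - f x) < inverse (real (Suc j))" "\<And>j. nsq (\<lambda>x. ES (n j) 0 (b j) x - g x) < inverse (real (Suc j))"
    by metis
  show ?thesis
    by (rule that[of n a b]; rule tendsto_sandwich[OF _ _ tendsto_const LIMSEQ_inverse_real_of_nat])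
      (auto intro!: always_eventually nsq_nonneg less_imp_le nab simp del: of_nat_Suc)
qed

text \<open>Riesz duality carried out by hand for a pair that is square integrable only with a
  weight. The data are truncated to \<open>[0, m]\<close>, where the weight is harmless; their
  conjugates are approximated by test functions; the resulting bound is uniform in \<open>m\<close>,
  and monotone convergence removes the truncation.\<close>

theorem L2_by_duality:
  assumes m: "X \<in> borel_measurable borel" "Y \<in> borel_measurable borel"
    and z: "\<And>x. x \<le> 0 \<Longrightarrow> X x = 0" "\<And>x. x \<le> 0 \<Longrightarrow> Y x = 0"
    and N: "0 \<le> N"
    and w: "L2 (\<lambda>x. cor (exp (- (N * x))) * X x)" "L2 (\<lambda>x. cor (exp (- (N * x))) * Y x)"
    and C: "0 \<le> C"
    and pair: "\<And>n a b. (cmod (LINT x|lborel. X x * ES n N a x + Y x * ES n N b x))\<^sup>2 \<le> C * (nsq (ES n N a) + nsq (ES n N b))"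
  shows "L2 X" "L2 Y" "nsq X + nsq Y \<le> C"
proof -
  define R where "R Z m x = indicator {0..real m} x * (Z x :: complex)" for Z :: "real \<Rightarrow> complex" and m :: nat and x
  have RL: "L2 (R Z m)" "L2 (\<lambda>x. cor (exp (N * x)) * cnj (R Z m x))"
    if Z: "Z \<in> borel_measurable borel" "L2 (\<lambda>x. cor (exp (- (N * x))) * Z x)" for Z m
  proof -
    note Z(1) [measurable]
    have b: "cmod (cor (exp (N * x)) * cnj (R Z m x)) \<le> cmod (cor (exp (2 * N * m)) * (cor (exp (- (N * x))) * Z x))" for x
    proof (cases "x \<in> {0..real m}")
      case True
      have "N * x \<le> 2 * N * m + - (N * x)" using True N mult_left_mono[of x "real m" N] by (simp add: algebra_simps)
      then have "exp (N * x) \<le> exp (2 * N * m) * exp (- (N * x))" by (simp add: exp_add[symmetric])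
      then show ?thesis using True by (simp add: R_def norm_mult mult.assoc[symmetric] mult_right_mono)
    qed (simp add: R_def)
    have mm: "R Z m \<in> borel_measurable borel" unfolding R_def[abs_def] by measurable
    have mm2: "(\<lambda>x. cor (exp (N * x)) * cnj (R Z m x)) \<in> borel_measurable borel"
      by (intro borel_measurable_times borel_measurable_continuous_on[OF _ mm, of cnj] continuous_intros) measurable
    show 1: "L2 (\<lambda>x. cor (exp (N * x)) * cnj (R Z m x))"
      by (rule L2_bound(1)[OF mm2 L2_cmul(1)[OF Z(2)] b])
    show "L2 (R Z m)"
    proof (rule L2_bound(1)[OF mm 1])
      fix x show "cmod (R Z m x) \<le> cmod (cor (exp (N * x)) * cnj (R Z m x))"
        using N mult_right_mono[of 1 "exp (N * x)" "cmod (R Z m x)"]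
        by (cases "0 \<le> x") (auto simp: norm_mult R_def)
    qed
  qed
  have key: "nsq (R X m) + nsq (R Y m) \<le> C" for m
  proof -
    \<comment> \<open>The weight is divided out before approximating. If \<open>ES n 0 a\<close> is
      close to \<open>fX\<close>, then \<open>ES n N a\<close> is close to
      \<open>cnj (R X m)\<close>, and its pairing with \<open>X\<close> converges as well, because
      \<open>X\<close> enters through the square integrable product with exp (- N * x).\<close>
    define fX where "fX x = cor (exp (N * x)) * cnj (R X m x)" for x
    define fY where "fY x = cor (exp (N * x)) * cnj (R Y m x)" for x
    have Lf: "L2 fX" "L2 fY" unfolding fX_def fY_def using RL(2) m w by auto
    have zf: "fX x = 0" "fY x = 0" if "x \<le> 0" for x
      using that z by (auto simp: fX_def fY_def R_def)
    obtain n a b where lim: "(\<lambda>j. nsq (\<lambda>x. ES (n j) 0 (a j) x - fX x)) \<longlonglongrightarrow> 0"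
      "(\<lambda>j. nsq (\<lambda>x. ES (n j) 0 (b j) x - fY x)) \<longlonglongrightarrow> 0"
      using ES_dense_seq[OF Lf(1) zf(1) Lf(2) zf(2)] by blast
    have one: "(\<lambda>j. LINT x|lborel. Z x * ES (n j) N (c j) x) \<longlonglongrightarrow> cor (nsq (R Z m))"
      "(\<lambda>j. nsq (ES (n j) N (c j))) \<longlonglongrightarrow> nsq (R Z m)" "\<And>j. integrable lborel (\<lambda>x. Z x * ES (n j) N (c j) x)"
      if Z: "Z \<in> borel_measurable borel" "L2 (\<lambda>x. cor (exp (- (N * x))) * Z x)" "\<And>x. x \<le> 0 \<Longrightarrow> Z x = 0"
       and l: "(\<lambda>j. nsq (\<lambda>x. ES (n j) 0 (c j) x - cor (exp (N * x)) * cnj (R Z m x))) \<longlonglongrightarrow> 0" for Z c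
    proof -
      note RL = RL[OF Z(1,2), of m]
      have eq: "Z x * ES (n j) N (c j) x = (cor (exp (- (N * x))) * Z x) * ES (n j) 0 (c j) x" for x j
        by (subst ES_shift) simp
      have "(\<lambda>j. LINT x|lborel. (cor (exp (- (N * x))) * Z x) * ES (n j) 0 (c j) x) \<longlonglongrightarrow>
         (LINT x|lborel. (cor (exp (- (N * x))) * Z x) * (cor (exp (N * x)) * cnj (R Z m x)))"
        by (rule L2_integral_tendsto[OF RL(2) Z(2) _ l]) (simp add: L2_ES)
      also have "(LINT x|lborel. (cor (exp (- (N * x))) * Z x) * (cor (exp (N * x)) * cnj (R Z m x)))
        = (LINT x|lborel. cor ((cmod (R Z m x))\<^sup>2))"
      proof (intro Bochner_Integration.integral_cong refl)
        fix x
        have "(cor (exp (- (N * x))) * Z x) * (cor (exp (N * x)) * cnj (R Z m x))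
          = cor (exp (- (N * x)) * exp (N * x)) * (Z x * cnj (R Z m x))" by simp
        also have "exp (- (N * x)) * exp (N * x) = 1" by (simp add: exp_add[symmetric])
        also have "Z x * cnj (R Z m x) = cor ((cmod (R Z m x))\<^sup>2)"
          by (simp only: complex_norm_square) (auto simp: R_def split: split_indicator)
        finally show "(cor (exp (- (N * x))) * Z x) * (cor (exp (N * x)) * cnj (R Z m x)) = cor ((cmod (R Z m x))\<^sup>2)" by simp
      qed
      also have "\<dots> = cor (nsq (R Z m))" unfolding nsq_def by (rule integral_complex_of_real)
      finally show "(\<lambda>j. LINT x|lborel. Z x * ES (n j) N (c j) x) \<longlonglongrightarrow> cor (nsq (R Z m))"
        by (simp add: eq)
      show "integrable lborel (\<lambda>x. Z x * ES (n j) N (c j) x)" for j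
        unfolding eq by (intro L2_mult_integrable Z L2_ES) simp
      have "(\<lambda>j. nsq (\<lambda>x. ES (n j) N (c j) x - cnj (R Z m x))) \<longlonglongrightarrow> 0"
      proof (rule tendsto_sandwich[OF _ _ tendsto_const l])
        have "nsq (\<lambda>x. ES (n j) N (c j) x - cnj (R Z m x)) \<le> nsq (\<lambda>x. ES (n j) 0 (c j) x - cor (exp (N * x)) * cnj (R Z m x))" for j
        proof (rule L2_bound(2))
          show "(\<lambda>x. ES (n j) N (c j) x - cnj (R Z m x)) \<in> borel_measurable borel"
            using L2_diff(1)[OF L2_ES[OF N] L2_cnj(1)[OF RL(1)]] by (rule L2_measurable)
          show "L2 (\<lambda>x. ES (n j) 0 (c j) x - cor (exp (N * x)) * cnj (R Z m x))"
            by (intro L2_diff RL L2_ES) simp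
          fix x
          show "cmod (ES (n j) N (c j) x - cnj (R Z m x)) \<le> cmod (ES (n j) 0 (c j) x - cor (exp (N * x)) * cnj (R Z m x))"
          proof (cases "0 < x")
            case True
            have "ES (n j) N (c j) x - cnj (R Z m x) = cor (exp (- (N * x))) * (ES (n j) 0 (c j) x - cor (exp (N * x)) * cnj (R Z m x))"
              by (subst ES_shift) (simp add: algebra_simps exp_minus)
            then show ?thesis using True N
              mult_right_mono[of "exp (- (N * x))" 1 "cmod (ES (n j) 0 (c j) x - cor (exp (N * x)) * cnj (R Z m x))"]
              by (simp add: norm_mult)
          next
            case False then show ?thesis using Z(3)[of x] by (simp add: ES_def ex_nonpos R_def)
          qed
        qed
        then show "\<forall>\<^sub>F j in sequentially. nsq (\<lambda>x. ES (n j) N (c j) x - cnj (R Z m x)) \<le> nsq (\<lambda>x. ES (n j) 0 (c j) x - cor (exp (N * x)) * cnj (R Z m x))" by simp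
      qed (simp add: nsq_nonneg)
      then show "(\<lambda>j. nsq (ES (n j) N (c j))) \<longlonglongrightarrow> nsq (R Z m)"
        using nsq_tendsto[of "\<lambda>x. cnj (R Z m x)" "\<lambda>j. ES (n j) N (c j)"] L2_cnj[OF RL(1)] L2_ES[OF N] by simp
    qed
    note oX = one[OF m(1) w(1) z(1) lim(1)[unfolded fX_def]] and oY = one[OF m(2) w(2) z(2) lim(2)[unfolded fY_def]]
    define S where "S = nsq (R X m) + nsq (R Y m)"
    have "(\<lambda>j. (cmod (LINT x|lborel. X x * ES (n j) N (a j) x + Y x * ES (n j) N (b j) x))\<^sup>2) \<longlonglongrightarrow> (cmod (cor (nsq (R X m)) + cor (nsq (R Y m))))\<^sup>2"
    proof -
      have "(LINT x|lborel. X x * ES (n j) N (a j) x + Y x * ES (n j) N (b j) x) = (LINT x|lborel. X x * ES (n j) N (a j) x) + (LINT x|lborel. Y x * ES (n j) N (b j) x)" for j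
        by (rule Bochner_Integration.integral_add[OF oX(3) oY(3)])
      then show ?thesis using tendsto_power[OF tendsto_norm[OF tendsto_add[OF oX(1) oY(1)]], of 2] by simp
    qed
    moreover have "cmod (cor (nsq (R X m)) + cor (nsq (R Y m))) = S"
      unfolding S_def of_real_add[symmetric] norm_of_real using nsq_nonneg[of "R X m"] nsq_nonneg[of "R Y m"] by simp
    ultimately have l1: "(\<lambda>j. (cmod (LINT x|lborel. X x * ES (n j) N (a j) x + Y x * ES (n j) N (b j) x))\<^sup>2) \<longlonglongrightarrow> S\<^sup>2" by simp
    have l2: "(\<lambda>j. C * (nsq (ES (n j) N (a j)) + nsq (ES (n j) N (b j)))) \<longlonglongrightarrow> C * S"
      unfolding S_def by (intro tendsto_intros oX oY)
    \<comment> \<open>The data are tested with themselves: the two sides of \<open>pair\<close> tend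
      to \<open>S\<^sup>2\<close> and \<open>C * S\<close>, and dividing by \<open>S\<close> bounds
      the truncated norms by \<open>C\<close>.\<close>
    have "S\<^sup>2 \<le> C * S" by (rule LIMSEQ_le[OF l1 l2]) (use pair in auto)
    moreover have "S \<ge> 0" unfolding S_def using nsq_nonneg[of "R X m"] nsq_nonneg[of "R Y m"] by simp
    ultimately have "S \<le> C" using C by (cases "S = 0") (auto simp: power2_eq_square)
    then show "nsq (R X m) + nsq (R Y m) \<le> C" by (simp add: S_def)
  qed
  have up: "(\<lambda>m. \<integral>\<^sup>+x. ennreal ((cmod (R Z m x))\<^sup>2) \<partial>lborel) \<longlonglongrightarrow> (\<integral>\<^sup>+x. ennreal ((cmod (Z x))\<^sup>2) \<partial>lborel)"
    if Z: "Z \<in> borel_measurable borel" "\<And>x. x \<le> 0 \<Longrightarrow> Z x = 0" for Z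
  proof (rule nn_integral_LIMSEQ)
    note Z(1) [measurable]
    show "incseq (\<lambda>m x. ennreal ((cmod (R Z m x))\<^sup>2))"
      by (auto simp: incseq_def le_fun_def R_def split: split_indicator)
    show "(\<lambda>x. ennreal ((cmod (R Z m x))\<^sup>2)) \<in> borel_measurable lborel" for m unfolding R_def by measurable
    fix x
    show "(\<lambda>m. ennreal ((cmod (R Z m x))\<^sup>2)) \<longlonglongrightarrow> ennreal ((cmod (Z x))\<^sup>2)"
    proof (rule tendsto_eventually)
      obtain M where M: "x \<le> real M" using real_arch_simple by blast
      show "\<forall>\<^sub>F m in sequentially. ennreal ((cmod (R Z m x))\<^sup>2) = ennreal ((cmod (Z x))\<^sup>2)"
        unfolding eventually_sequentially
      proof (intro exI[of _ M] allI impI)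
        fix k assume "M \<le> k"
        then have "x \<le> real k" using M by linarith
        then show "ennreal ((cmod (R Z k x))\<^sup>2) = ennreal ((cmod (Z x))\<^sup>2)"
          using Z(2)[of x] by (cases "x \<le> 0") (auto simp: R_def)
      qed
    qed
  qed
  have "(\<lambda>k. (\<integral>\<^sup>+x. ennreal ((cmod (R X k x))\<^sup>2) \<partial>lborel) + (\<integral>\<^sup>+x. ennreal ((cmod (R Y k x))\<^sup>2) \<partial>lborel))
     \<longlonglongrightarrow> (\<integral>\<^sup>+x. ennreal ((cmod (X x))\<^sup>2) \<partial>lborel) + (\<integral>\<^sup>+x. ennreal ((cmod (Y x))\<^sup>2) \<partial>lborel)"
    by (intro tendsto_add up m z)
  moreover have "(\<integral>\<^sup>+x. ennreal ((cmod (R X k x))\<^sup>2) \<partial>lborel) + (\<integral>\<^sup>+x. ennreal ((cmod (R Y k x))\<^sup>2) \<partial>lborel) \<le> ennreal C" for k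
    using key[of k] by (simp add: nsq_nn[OF RL(1)[OF m(1) w(1)]] nsq_nn[OF RL(1)[OF m(2) w(2)]] nsq_nonneg ennreal_plus[symmetric] ennreal_leI del: ennreal_plus)
  ultimately have le: "(\<integral>\<^sup>+x. ennreal ((cmod (X x))\<^sup>2) \<partial>lborel) + (\<integral>\<^sup>+x. ennreal ((cmod (Y x))\<^sup>2) \<partial>lborel) \<le> ennreal C"
    by (intro LIMSEQ_le_const2) auto
  then have "(\<integral>\<^sup>+x. ennreal ((cmod (X x))\<^sup>2) \<partial>lborel) \<le> ennreal C" "(\<integral>\<^sup>+x. ennreal ((cmod (Y x))\<^sup>2) \<partial>lborel) \<le> ennreal C"
    by (auto intro: order_trans[rotated])
  then show LX: "L2 X" and LY: "L2 Y" using L2I_le m C by blast+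
  show "nsq X + nsq Y \<le> C" using le C unfolding nsq_nn[OF LX] nsq_nn[OF LY]
    by (simp add: nsq_nonneg ennreal_plus[symmetric] del: ennreal_plus)
qed

section \<open>The Bessel kernel and its Laplace transform\<close>

text \<open>The entire function with \<open>J0 (2 * sqrt z) = jz z\<close> for \<open>z \<ge> 0\<close>.\<close>
definition jz :: "real \<Rightarrow> real" where
  "jz z = (\<Sum>k. (-1) ^ k / (fact k)\<^sup>2 * z ^ k)"

lemma J0_eq_jz: "J0 x = jz ((x / 2)\<^sup>2)"
  unfolding J0_def jz_def by (simp add: power_mult)

lemma jz_summable_norm: "summable (\<lambda>k. norm ((-1) ^ k / (fact k)\<^sup>2 * z ^ k :: real))"
proof (rule summable_comparison_test'[of "\<lambda>k. inverse (fact k) * \<bar>z\<bar> ^ k" 0])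
  show "summable (\<lambda>k. inverse (fact k) * \<bar>z\<bar> ^ k)" by (rule summable_exp)
  fix k
  have "1 \<le> (fact k :: real)" by (rule fact_ge_1)
  then have "1 / (fact k)\<^sup>2 \<le> inverse (fact k :: real)" by (simp add: field_simps power2_eq_square)
  then show "norm (norm ((-1) ^ k / (fact k)\<^sup>2 * z ^ k :: real)) \<le> inverse (fact k) * \<bar>z\<bar> ^ k"
    using mult_right_mono[of "1 / (fact k)\<^sup>2" "inverse (fact k)" "\<bar>z\<bar> ^ k"] by (simp add: abs_mult power_abs)
qed

lemma jz_continuous: "continuous_on UNIV jz"
  unfolding jz_def[abs_def]
  by (intro continuous_at_imp_continuous_on ballI isCont_powser_converges_everywhere summable_norm_cancel[OF jz_summable_norm])

lemma jz_measurable [measurable]: "jz \<in> borel_measurable borel"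
  by (rule borel_measurable_continuous_onI[OF jz_continuous])

text \<open>Termwise: \<open>(u * v)\<^sup>k / (k!)\<^sup>2\<close> is
  \<open>(e * u)\<^sup>k / k!\<close> times \<open>(v / e)\<^sup>k / k!\<close>, and the second
  factor is at most exp (v / e). The free parameter \<open>e\<close> makes the growth rate in
  \<open>u\<close> as small as desired, at the price of growth in \<open>v\<close>.\<close>

lemma jz_bound:
  assumes "0 \<le> u" "0 \<le> v" "0 < e"
  shows "\<bar>jz (u * v)\<bar> \<le> exp (e * u) * exp (v / e)"
proof -
  have "\<bar>jz (u * v)\<bar> \<le> (\<Sum>k. norm ((-1) ^ k / (fact k)\<^sup>2 * (u * v) ^ k :: real))"
    unfolding jz_def using summable_norm[OF jz_summable_norm] by simp
  also have "\<dots> \<le> (\<Sum>k. exp (v / e) * (inverse (fact k) * (e * u) ^ k))"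
  proof (rule suminf_le[OF _ jz_summable_norm])
    show "summable (\<lambda>k. exp (v / e) * (inverse (fact k) * (e * u) ^ k))" by (intro summable_mult summable_exp)
    fix k
    have "(v / e) ^ k / fact k \<le> exp (v / e)"
    proof -
      have "(\<Sum>i\<in>{k}. inverse (fact i) * (v / e) ^ i) \<le> (\<Sum>i. inverse (fact i) * (v / e) ^ i)"
        using assms by (intro sum_le_suminf summable_exp) auto
      also have "\<dots> = exp (v / e)" by (simp add: exp_def)
      finally show ?thesis by (simp add: field_simps)
    qed
    then have "(v / e) ^ k / fact k * (inverse (fact k) * (e * u) ^ k) \<le> exp (v / e) * (inverse (fact k) * (e * u) ^ k)"
      using assms by (intro mult_right_mono) auto
    moreover have "norm ((-1) ^ k / (fact k)\<^sup>2 * (u * v) ^ k :: real) = (v / e) ^ k / fact k * (inverse (fact k) * (e * u) ^ k)"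
      using assms by (simp add: abs_mult power_abs power_mult_distrib power_divide power2_eq_square divide_simps)
    ultimately show "norm ((-1) ^ k / (fact k)\<^sup>2 * (u * v) ^ k :: real) \<le> exp (v / e) * (inverse (fact k) * (e * u) ^ k)" by simp
  qed
  also have "\<dots> = exp (v / e) * exp (e * u)"
    by (subst suminf_mult[OF summable_exp]) (simp add: exp_def)
  finally show ?thesis by (simp add: mult.commute)
qed

lemma power_ex_integral:
  fixes \<mu> :: real
  assumes "0 < \<mu>"
  shows "integrable lborel (\<lambda>u. indicator {0..} u * (u ^ k * exp (- (\<mu> * u))))"
    "(LINT u|lborel. indicator {0..} u * (u ^ k * exp (- (\<mu> * u)))) = fact k / \<mu> ^ (k + 1)"
proof -
  have "(\<integral>\<^sup>+u. ennreal (indicator {0..} (u::real) * (u ^ k * exp (- (\<mu> * u)))) \<partial>lborel) = (\<integral>\<^sup>+x. ennreal (x ^ k * exp (- (\<mu> * x))) * indicator {0..} x \<partial>lborel)"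
    by (intro nn_integral_cong) (auto split: split_indicator)
  then have "(\<integral>\<^sup>+u. ennreal (indicator {0..} (u::real) * (u ^ k * exp (- (\<mu> * u)))) \<partial>lborel) = ennreal (fact k / \<mu> ^ (k + 1))"
    using nn_integral_power_exp[OF assms, of k] by simp
  then have "has_bochner_integral lborel (\<lambda>u. indicator {0..} u * (u ^ k * exp (- (\<mu> * u)))) (fact k / \<mu> ^ (k + 1))"
    using assms by (intro has_bochner_integral_nn_integral) (auto split: split_indicator)
  then show "integrable lborel (\<lambda>u. indicator {0..} u * (u ^ k * exp (- (\<mu> * u))))"
    "(LINT u|lborel. indicator {0..} u * (u ^ k * exp (- (\<mu> * u)))) = fact k / \<mu> ^ (k + 1)"
    by (auto simp: has_bochner_integral_iff)
qed

text \<open>The transform of the \<open>k\<close>-th power is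
  \<open>fact k / \<mu> ^ (k + 1)\<close>. It removes one of the two factorials of the Bessel
  series, and the exponential series remains. Summation and integration are exchanged because the
  norms sum to an exponential series too.\<close>

lemma Laplace_jz:
  assumes "0 < \<mu>" "0 \<le> v"
  shows "(LINT u|lborel. indicator {0..} u * (jz (u * v) * exp (- (\<mu> * u)))) = exp (- (v / \<mu>)) / \<mu>"
    "integrable lborel (\<lambda>u. indicator {0..} u * (jz (u * v) * exp (- (\<mu> * u))))"
proof -
  define f where "f k u = ((-1) ^ k / (fact k)\<^sup>2 * v ^ k) * (indicator {0..} u * (u ^ k * exp (- (\<mu> * u))))" for k and u :: real
  have int: "integrable lborel (f k)" for k
    unfolding f_def[abs_def] by (intro integrable_mult_right power_ex_integral assms)
  have fs: "f k u = (indicator {0..} u * exp (- (\<mu> * u))) * ((-1) ^ k / (fact k)\<^sup>2 * (u * v) ^ k)" for k u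
    by (simp add: f_def power_mult_distrib)
  have sn: "summable (\<lambda>k. norm (f k u))" for u
    unfolding fs norm_mult[of "indicator {0..} u * exp (- (\<mu> * u))"] by (intro summable_mult jz_summable_norm)
  have n: "(LINT u|lborel. norm (f k u)) = inverse (fact k) * (v / \<mu>) ^ k / \<mu>" for k
  proof -
    have "norm (f k u) = (1 / (fact k)\<^sup>2 * v ^ k) * (indicator {0..} u * (u ^ k * exp (- (\<mu> * u))))" for u
      using assms by (auto simp: f_def abs_mult power_abs split: split_indicator)
    then have "(LINT u|lborel. norm (f k u)) = (1 / (fact k)\<^sup>2 * v ^ k) * (fact k / \<mu> ^ (k + 1))"
      by (simp only: integral_mult_right_zero power_ex_integral(2)[OF assms(1), of k])
    then show ?thesis using assms by (simp add: power_divide power2_eq_square field_simps)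
  qed
  have s2: "summable (\<lambda>k. LINT u|lborel. norm (f k u))"
    unfolding n by (intro summable_divide summable_exp)
  have eq: "(\<Sum>k. f k u) = indicator {0..} u * (jz (u * v) * exp (- (\<mu> * u)))" for u
    unfolding fs jz_def by (subst suminf_mult[OF summable_norm_cancel[OF jz_summable_norm]]) simp
  have sw: "(LINT u|lborel. (\<Sum>k. f k u)) = (\<Sum>k. LINT u|lborel. f k u)"
    by (rule integral_suminf[OF int _ s2]) (use sn in auto)
  have fk: "(LINT u|lborel. f k u) = inverse (fact k) * (- (v / \<mu>)) ^ k / \<mu>" for k
  proof -
    have "(LINT u|lborel. f k u) = ((-1) ^ k / (fact k)\<^sup>2 * v ^ k) * (fact k / \<mu> ^ (k + 1))"
      unfolding f_def by (simp only: integral_mult_right_zero power_ex_integral(2)[OF assms(1), of k])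
    then show ?thesis using assms
      by (simp add: power_minus[of "v / \<mu>"] power_divide power2_eq_square field_simps)
  qed
  have "(\<Sum>k. LINT u|lborel. f k u) = exp (- (v / \<mu>)) / \<mu>"
    unfolding fk using suminf_divide[OF summable_exp[of "- (v / \<mu>)"], of \<mu>] by (simp add: exp_def)
  with sw show "(LINT u|lborel. indicator {0..} u * (jz (u * v) * exp (- (\<mu> * u)))) = exp (- (v / \<mu>)) / \<mu>"
    by (simp add: eq)
  have "integrable lborel (\<lambda>u. \<Sum>k. f k u)"
    by (rule integrable_suminf[OF int _ s2]) (use sn in auto)
  then show "integrable lborel (\<lambda>u. indicator {0..} u * (jz (u * v) * exp (- (\<mu> * u))))"
    by (simp add: eq)
qed

text \<open>The truncated Hankel integral in the variables \<open>u = r\<^sup>2 / 2\<close>,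
  \<open>v = s\<^sup>2 / 2\<close>, up to a factor \<open>sqrt r\<close>: there
  \<open>(r * s / 2)\<^sup>2 = u * v\<close>, so \<open>J0 (r * s) = jz (u * v)\<close>.\<close>

definition TV :: "(real \<Rightarrow> complex) \<Rightarrow> real \<Rightarrow> real \<Rightarrow> complex" where
  "TV b V u = (LINT v|lborel. indicator {0<..V} v * (cor (jz (u * v)) * b v))"

lemma TV_measurable [measurable]:
  assumes [measurable]: "b \<in> borel_measurable borel"
  shows "TV b V \<in> borel_measurable borel"
  unfolding TV_def[abs_def] by measurable

lemma TV_bound:
  assumes "L2 b" "0 \<le> u"
  shows "cmod (TV b V u) \<le> exp u * (LINT v:{0..V}|lborel. exp v * cmod (b v))"
proof -
  have [measurable]: "b \<in> borel_measurable borel" using assms by (simp add: L2_def)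
  have i0: "set_integrable lborel {0..V} (\<lambda>v. cmod (b v))"
    by (intro set_integrable_norm L2_set_integrable assms)
  have i: "integrable lborel (\<lambda>v. indicator {0..V} v * (exp v * cmod (b v)))"
  proof (rule Bochner_Integration.integrable_bound)
    show "integrable lborel (\<lambda>v. exp V * (indicator {0..V} v * cmod (b v)))"
      using i0 by (simp add: set_integrable_def)
    show "AE v in lborel. norm (indicator {0..V} v * (exp v * cmod (b v))) \<le> norm (exp V * (indicator {0..V} v * cmod (b v)))"
      by (auto split: split_indicator simp: abs_mult mult_right_mono)
  qed measurable
  have le: "norm (indicator {0<..V} v * (cor (jz (u * v)) * b v)) \<le> exp u * (indicator {0..V} v * (exp v * cmod (b v)))" for v
    using jz_bound[OF assms(2), of v 1] mult_right_mono[of "\<bar>jz (u * v)\<bar>" "exp u * exp v" "cmod (b v)"]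
    by (auto split: split_indicator simp: norm_mult mult_ac)
  have "cmod (TV b V u) \<le> (LINT v|lborel. norm (indicator {0<..V} v * (cor (jz (u * v)) * b v)))"
    unfolding TV_def by (rule integral_norm_bound)
  also have "\<dots> \<le> (LINT v|lborel. exp u * (indicator {0..V} v * (exp v * cmod (b v))))"
    by (rule integral_mono'[OF integrable_mult_right[OF i]]) (use le in auto)
  finally show ?thesis by (simp add: set_lebesgue_integral_def)
qed

lemma TV_Laplace:
  assumes "L2 b" "0 < \<mu>"
  shows "(LINT u|lborel. ex \<mu> u * TV b V u) = (LINT v|lborel. indicator {0<..V} v * b v * ex (1 / \<mu>) v) / cor \<mu>"
    "integrable lborel (\<lambda>u. ex \<mu> u * TV b V u)"
proof -
  have [measurable]: "b \<in> borel_measurable borel" using assms by (simp add: L2_def)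
  define f where "f = (\<lambda>(v, u). (indicator {0<..V} v * b v) * cor (indicator {0..} u * (jz (u * v) * exp (- (\<mu> * u)))))"
  have fm [measurable]: "f \<in> borel_measurable (lborel \<Otimes>\<^sub>M lborel)"
    unfolding f_def by measurable
  have b1: "integrable lborel (\<lambda>v. indicator {0<..V} v * cmod (b v))"
    using set_integrable_subset[OF set_integrable_norm[OF L2_set_integrable[OF assms(1), of 0 V]], of "{0<..V}"]
    by (auto simp: set_integrable_def greaterThanAtMost_subseteq_atLeastAtMost_iff)
  have int: "integrable (lborel \<Otimes>\<^sub>M lborel) f"
  proof (rule lborel_pair.Fubini_integrable[OF fm])
    show "AE v in lborel. integrable lborel (\<lambda>u. f (v, u))"
    proof (rule AE_I2)
      fix v
      show "integrable lborel (\<lambda>u. f (v, u))"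
      proof (cases "0 < v")
        case True then show ?thesis unfolding f_def
          using integrable_of_real[OF Laplace_jz(2)[OF assms(2), of v], where 'a=complex] by simp
      qed (simp add: f_def)
    qed
    show "integrable lborel (\<lambda>v. LINT u|lborel. norm (f (v, u)))"
    proof (rule Bochner_Integration.integrable_bound)
      show "integrable lborel (\<lambda>v. (exp (2 * \<bar>V\<bar> / \<mu>) * (2 / \<mu>)) * (indicator {0<..V} v * cmod (b v)))"
        using b1 by simp
      show "(\<lambda>v. LINT u|lborel. norm (f (v, u))) \<in> borel_measurable lborel" by measurable
      show "AE v in lborel. norm (LINT u|lborel. norm (f (v, u))) \<le> norm ((exp (2 * \<bar>V\<bar> / \<mu>) * (2 / \<mu>)) * (indicator {0<..V} v * cmod (b v)))"
      proof (rule AE_I2)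
        fix v
        show "norm (LINT u|lborel. norm (f (v, u))) \<le> norm ((exp (2 * \<bar>V\<bar> / \<mu>) * (2 / \<mu>)) * (indicator {0<..V} v * cmod (b v)))"
        proof (cases "v \<in> {0<..V}")
          case True
          \<comment> \<open>\<open>jz_bound\<close> with rate \<open>\<mu> / 2\<close> spends half
            of the decay exp (- \<mu> * u) on the kernel; the other half remains for the integral in
            \<open>u\<close>.\<close>
          have bd: "norm (f (v, u)) \<le> (exp (2 * \<bar>V\<bar> / \<mu>) * cmod (b v)) * (indicator {0..} u * (u ^ 0 * exp (- (\<mu> / 2 * u))))" for u
          proof (cases "0 \<le> u")
            case True
            have "\<bar>jz (u * v)\<bar> \<le> exp (\<mu> / 2 * u) * exp (v / (\<mu> / 2))"
              using True \<open>v \<in> {0<..V}\<close> assms(2) by (intro jz_bound) auto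
            also have "\<dots> \<le> exp (\<mu> / 2 * u) * exp (2 * \<bar>V\<bar> / \<mu>)"
              using \<open>v \<in> {0<..V}\<close> assms(2) by (intro mult_left_mono) (auto simp: divide_right_mono)
            finally have "\<bar>jz (u * v)\<bar> * exp (- (\<mu> * u)) \<le> exp (\<mu> / 2 * u) * exp (2 * \<bar>V\<bar> / \<mu>) * exp (- (\<mu> * u))"
              by (rule mult_right_mono) simp
            also have "\<dots> = exp (2 * \<bar>V\<bar> / \<mu>) * exp (- (\<mu> / 2 * u))"
              by (simp add: exp_add[symmetric])
            finally have "cmod (b v) * (\<bar>jz (u * v)\<bar> * exp (- (\<mu> * u))) \<le> cmod (b v) * (exp (2 * \<bar>V\<bar> / \<mu>) * exp (- (\<mu> / 2 * u)))"
              by (rule mult_left_mono) simp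
            then show ?thesis using True \<open>v \<in> {0<..V}\<close> by (simp add: f_def norm_mult abs_mult mult_ac)
          qed (simp add: f_def)
          have "(LINT u|lborel. norm (f (v, u))) \<le> (LINT u|lborel. (exp (2 * \<bar>V\<bar> / \<mu>) * cmod (b v)) * (indicator {0..} u * (u ^ 0 * exp (- (\<mu> / 2 * u)))))"
            using assms(2) by (intro integral_mono'[OF integrable_mult_right[OF power_ex_integral(1)] bd]) auto
          also have "\<dots> = (exp (2 * \<bar>V\<bar> / \<mu>) * cmod (b v)) * (2 / \<mu>)"
            using power_ex_integral(2)[of "\<mu> / 2" 0] assms(2) by simp
          finally show ?thesis using True assms(2) by (simp add: abs_mult mult_ac)
        qed (simp add: f_def)
      qed
    qed
  qed
  have sw: "(LINT u|lborel. (LINT v|lborel. f (v, u))) = (LINT v|lborel. (LINT u|lborel. f (v, u)))"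
    using lborel_pair.Fubini_integral[of "\<lambda>v u. f (v, u)"] int by simp
  have "(LINT u|lborel. f (v, u)) = (indicator {0<..V} v * b v * ex (1 / \<mu>) v) / cor \<mu>" for v
  proof (cases "0 < v")
    case True
    have "(LINT u|lborel. f (v, u)) = (indicator {0<..V} v * b v) * (LINT u|lborel. cor (indicator {0..} u * (jz (u * v) * exp (- (\<mu> * u)))))"
      unfolding f_def by simp
    also have "(LINT u|lborel. cor (indicator {0..} u * (jz (u * v) * exp (- (\<mu> * u))))) = cor (exp (- (v / \<mu>)) / \<mu>)"
      unfolding integral_complex_of_real using Laplace_jz(1)[OF assms(2), of v] True by simp
    finally show ?thesis using True by (simp add: ex_pos)
  qed (simp add: f_def)
  then have val: "(LINT v|lborel. (LINT u|lborel. f (v, u))) = (LINT v|lborel. indicator {0<..V} v * b v * ex (1 / \<mu>) v) / cor \<mu>"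
    by simp
  \<comment> \<open>The integrand \<open>f\<close> is cut off on the closed half line and
    \<open>ex\<close> on the open one, so the two sides can differ at \<open>u = 0\<close>.\<close>
  have ae: "AE u in lborel. (LINT v|lborel. f (v, u)) = ex \<mu> u * TV b V u"
  proof (rule AE_I[where N="{0}"])
    show "{u \<in> space lborel. (LINT v|lborel. f (v, u)) \<noteq> ex \<mu> u * TV b V u} \<subseteq> {0}"
    proof safe
      fix u :: real assume ne: "(LINT v|lborel. f (v, u)) \<noteq> ex \<mu> u * TV b V u"
      show "u = 0"
      proof (rule ccontr)
        assume "u \<noteq> 0"
        then consider "u < 0" | "0 < u" by linarith
        then have "(LINT v|lborel. f (v, u)) = ex \<mu> u * TV b V u"
        proof cases
          case 1 then show ?thesis by (simp add: f_def ex_nonpos)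
        next
          case 2
          have "f (v, u) = ex \<mu> u * (indicator {0<..V} v * (cor (jz (u * v)) * b v))" for v
            using 2 by (simp add: f_def ex_pos mult_ac)
          then show ?thesis unfolding TV_def by simp
        qed
        with ne show False by simp
      qed
    qed
  qed auto
  have m1: "(\<lambda>u. LINT v|lborel. f (v, u)) \<in> borel_measurable lborel" by measurable
  have m2: "(\<lambda>u. ex \<mu> u * TV b V u) \<in> borel_measurable lborel" by measurable
  show "(LINT u|lborel. ex \<mu> u * TV b V u) = (LINT v|lborel. indicator {0<..V} v * b v * ex (1 / \<mu>) v) / cor \<mu>"
    using integral_cong_AE[OF m1 m2 ae] sw val by simp
  have "integrable lborel (\<lambda>u. LINT v|lborel. f (v, u))"
    using lborel_pair.integrable_snd[of "\<lambda>v u. f (v, u)"] int by simp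
  then show "integrable lborel (\<lambda>u. ex \<mu> u * TV b V u)"
    using integrable_cong_AE[OF m1 m2 ae] by simp
qed

subsection \<open>The Hankel transform in the variables \<open>u\<close> and \<open>v\<close>\<close>

definition half :: "(real \<Rightarrow> complex) \<Rightarrow> real \<Rightarrow> complex" where
  "half f x = indicator {0<..} x * f x"

lemma half_nonpos: "x \<le> 0 \<Longrightarrow> half f x = 0"
  by (simp add: half_def)

lemma half_pos: "0 < x \<Longrightarrow> half f x = f x"
  by (simp add: half_def)

lemma L2_set_integral_eq: "(LINT s:{a..b}|lborel. f s) = (LINT s|lborel. f s * indicator {a..b} s)" for f :: "real \<Rightarrow> complex"
  unfolding set_lebesgue_integral_def
  by (intro Bochner_Integration.integral_cong refl) (auto split: split_indicator)

text \<open>Cauchy-Schwarz against the difference of two interval indicators gives Hoelder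
  continuity of exponent 1/2.\<close>

lemma L2_primitive_continuous:
  assumes "L2 f"
  shows "continuous_on UNIV (\<lambda>u. LINT s:{a..u}|lborel. f s)"
proof -
  have bd: "(cmod ((LINT s:{a..v}|lborel. f s) - (LINT s:{a..u}|lborel. f s)))\<^sup>2 \<le> nsq f * \<bar>v - u\<bar>" for u v
  proof -
    have "(LINT s:{a..v}|lborel. f s) - (LINT s:{a..u}|lborel. f s) = (LINT s|lborel. f s * (indicator {a..v} s - indicator {a..u} s))"
      unfolding L2_set_integral_eq right_diff_distrib
      by (subst Bochner_Integration.integral_diff) (auto intro!: L2_mult_integrable assms L2_indicator)
    then have "(cmod ((LINT s:{a..v}|lborel. f s) - (LINT s:{a..u}|lborel. f s)))\<^sup>2 \<le> nsq f * nsq (\<lambda>s. indicator {a..v} s - indicator {a..u} s)"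
      using L2_Cauchy_Schwarz[OF assms L2_diff(1)[OF L2_indicator(1)[of a v] L2_indicator(1)[of a u]]] by simp
    also have "nsq (\<lambda>s. indicator {a..v} s - indicator {a..u} s) \<le> nsq (indicator {min u v..max u v})"
      by (rule L2_bound(2)[OF L2_measurable[OF L2_diff(1)[OF L2_indicator(1) L2_indicator(1)]] L2_indicator(1)])
        (auto split: split_indicator)
    also have "nsq (indicator {min u v..max u v}) = \<bar>v - u\<bar>" by (subst L2_indicator(2)) auto
    finally show ?thesis using nsq_nonneg[of f] by (auto intro: mult_left_mono)
  qed
  show ?thesis
    unfolding continuous_on_def
  proof safe
    fix u
    have "((\<lambda>v. nsq f * \<bar>v - u\<bar>) \<longlongrightarrow> nsq f * \<bar>u - u\<bar>) (at u)" by (intro tendsto_intros)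
    then have l0: "((\<lambda>v. nsq f * \<bar>v - u\<bar>) \<longlongrightarrow> 0) (at u)"
      by (simp only: diff_self abs_zero mult_zero_right)
    have "norm ((cmod ((LINT s:{a..v}|lborel. f s) - (LINT s:{a..u}|lborel. f s)))\<^sup>2) \<le> nsq f * \<bar>v - u\<bar>" for v
      unfolding real_norm_def abs_power2 by (rule bd)
    then have "((\<lambda>v. (cmod ((LINT s:{a..v}|lborel. f s) - (LINT s:{a..u}|lborel. f s)))\<^sup>2) \<longlongrightarrow> 0) (at u)"
      by (intro Lim_null_comparison[OF always_eventually l0] allI)
    then have "((\<lambda>v. (cmod ((LINT s:{a..v}|lborel. f s) - (LINT s:{a..u}|lborel. f s)))) \<longlongrightarrow> 0) (at u)"
      using power_tendsto_0_iff[of 2 "\<lambda>v. cmod ((LINT s:{a..v}|lborel. f s) - (LINT s:{a..u}|lborel. f s))" "at u"] by (simp only: zero_less_numeral)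
    then show "((\<lambda>v. LINT s:{a..v}|lborel. f s) \<longlongrightarrow> (LINT s:{a..u}|lborel. f s)) (at u)"
      by (rule LIM_zero_cancel[OF tendsto_norm_zero_cancel])
  qed
qed

lemma set_integral_split_Icc:
  fixes f :: "real \<Rightarrow> complex"
  assumes "set_integrable lborel {a..c} f" "a \<le> b" "b \<le> c"
  shows "(LINT s:{a..c}|lborel. f s) = (LINT s:{a..b}|lborel. f s) + (LINT s:{b..c}|lborel. f s)"
proof -
  have "{a..c} = {a..b} \<union> {b..c}" using assms by auto
  moreover have "AE x in lborel. \<not> (x \<in> {a..b} \<and> x \<in> {b..c})"
    by (rule AE_I[where N="{b}"]) auto
  moreover have "set_integrable lborel {a..b} f" "set_integrable lborel {b..c} f"
    using assms by (auto intro: set_integrable_subset[OF assms(1)])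
  ultimately show ?thesis using set_integral_Un_AE[where M=lborel and A="{a..b}" and B="{b..c}" and f=f] by simp
qed

text \<open>The trace at the endpoint. \<open>H1_halfline\<close> constrains positive arguments
  only, and this is the right limit of \<open>g\<close> at 0, computed from the value at 1.\<close>

definition bv :: "(real \<Rightarrow> complex) \<Rightarrow> (real \<Rightarrow> complex) \<Rightarrow> complex" where
  "bv g g' = g 1 - (LINT s:{0..1}|lborel. half g' s)"

lemma H1_L2:
  assumes "H1_halfline g g'"
  shows "L2 (half g')" and "\<And>u. 0 < u \<Longrightarrow> g u = bv g g' + (LINT s:{0..u}|lborel. half g' s)" and "L2 (half g)"
proof -
  have fin: "(\<integral>\<^sup>+ u\<in>{0<..}. ennreal ((cmod (g u))\<^sup>2 + (cmod (g' u))\<^sup>2) \<partial>lborel) < \<infinity>"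
    and ftc: "\<And>u v. 0 < u \<Longrightarrow> u \<le> v \<Longrightarrow> g v - g u = (LINT s:{u..v}|lborel. g' s)"
    using assms by (auto simp: H1_halfline_def)
  have eqi: "half f = (\<lambda>x. indicator {0<..} x *\<^sub>R f x)" for f
    by (auto simp: half_def fun_eq_iff split: split_indicator)
  have m': "half g' \<in> borel_measurable borel"
    using assms unfolding H1_halfline_def set_borel_measurable_def eqi by simp
  show L': "L2 (half g')"
    unfolding L2_nn[OF m']
  proof (rule le_less_trans[OF nn_integral_mono fin])
    show "ennreal ((cmod (half g' x))\<^sup>2) \<le> ennreal ((cmod (g x))\<^sup>2 + (cmod (g' x))\<^sup>2) * indicator {0<..} x" for x
      by (auto simp: half_def ennreal_leI split: split_indicator)
  qed
  have ftc': "g v - g u = (LINT s:{u..v}|lborel. half g' s)" if "0 < u" "u \<le> v" for u v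
    unfolding ftc[OF that] using that(1) by (intro set_lebesgue_integral_cong) (auto simp: half_def)
  show eq: "g u = bv g g' + (LINT s:{0..u}|lborel. half g' s)" if "0 < u" for u
  proof (cases "u \<le> 1")
    case True
    then show ?thesis using ftc'[of u 1] that set_integral_split_Icc[OF L2_set_integrable[OF L'], of 0 u 1]
      by (simp add: bv_def algebra_simps)
  next
    case False
    then show ?thesis using ftc'[of 1 u] that set_integral_split_Icc[OF L2_set_integrable[OF L'], of 0 1 u]
      by (simp add: bv_def algebra_simps)
  qed
  have m: "half g \<in> borel_measurable borel"
  proof -
    have "half g = (\<lambda>x. indicator {0<..} x * (bv g g' + (LINT s:{0..x}|lborel. half g' s)))"
      by (auto simp: half_def fun_eq_iff eq split: split_indicator)
    moreover have "(\<lambda>u. LINT s:{0..u}|lborel. half g' s) \<in> borel_measurable borel"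
      by (rule borel_measurable_continuous_onI[OF L2_primitive_continuous[OF L']])
    ultimately show ?thesis by simp
  qed
  show "L2 (half g)"
    unfolding L2_nn[OF m]
  proof (rule le_less_trans[OF nn_integral_mono fin])
    show "ennreal ((cmod (half g x))\<^sup>2) \<le> ennreal ((cmod (g x))\<^sup>2 + (cmod (g' x))\<^sup>2) * indicator {0<..} x" for x
      by (auto simp: half_def ennreal_leI split: split_indicator)
  qed
qed

text \<open>The substitution rule is applied on \<open>[0, n]\<close>, where
  \<open>s\<^sup>2 / 2\<close> increases, and monotone convergence removes the bound.
  \<open>max 0 s\<close> is the Jacobian, cut off on the negative half line, where the same values
  would be counted again.\<close>

lemma nn_integral_half_square:
  fixes f :: "real \<Rightarrow> ennreal"
  assumes [measurable]: "f \<in> borel_measurable borel"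
  shows "(\<integral>\<^sup>+s. ennreal (max 0 s) * f (s\<^sup>2 / 2) \<partial>lborel) = (\<integral>\<^sup>+x. f x * indicator {0..} x \<partial>lborel)"
proof (rule LIMSEQ_unique)
  show "(\<lambda>n. \<integral>\<^sup>+s. f (s\<^sup>2 / 2) * ennreal s * indicator {0..real (Suc n)} s \<partial>lborel) \<longlonglongrightarrow> (\<integral>\<^sup>+s. ennreal (max 0 s) * f (s\<^sup>2 / 2) \<partial>lborel)"
  proof (rule nn_integral_LIMSEQ)
    show "incseq (\<lambda>n s. f (s\<^sup>2 / 2) * ennreal s * indicator {0..real (Suc n)} s)"
      by (intro incseq_SucI le_funI) (auto split: split_indicator)
    show "(\<lambda>n. f (s\<^sup>2 / 2) * ennreal s * indicator {0..real (Suc n)} s) \<longlonglongrightarrow> ennreal (max 0 s) * f (s\<^sup>2 / 2)" for s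
    proof (rule tendsto_eventually)
      obtain M where M: "s \<le> real M" using real_arch_simple by blast
      have "f (s\<^sup>2 / 2) * ennreal s * indicator {0..real (Suc n)} s = ennreal (max 0 s) * f (s\<^sup>2 / 2)" if "M \<le> n" for n
      proof -
        have "s \<le> real (Suc n)" using M that by simp
        then show ?thesis by (cases "0 \<le> s") (auto simp: mult.commute max_def)
      qed
      then show "\<forall>\<^sub>F n in sequentially. f (s\<^sup>2 / 2) * ennreal s * indicator {0..real (Suc n)} s = ennreal (max 0 s) * f (s\<^sup>2 / 2)"
        unfolding eventually_sequentially by blast
    qed
  qed measurable
  have "(\<integral>\<^sup>+s. f (s\<^sup>2 / 2) * ennreal s * indicator {0..real (Suc n)} s \<partial>lborel) = (\<integral>\<^sup>+x. f x * indicator {0..(real (Suc n))\<^sup>2 / 2} x \<partial>lborel)" for n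
  proof -
    have "((\<lambda>s. s\<^sup>2 / 2) has_real_derivative s) (at s)" for s :: real
      by (auto intro!: derivative_eq_intros)
    then have "(\<integral>\<^sup>+x. f x * indicator {0\<^sup>2 / 2..(real (Suc n))\<^sup>2 / 2} x \<partial>lborel) = (\<integral>\<^sup>+s. f (s\<^sup>2 / 2) * ennreal s * indicator {0..real (Suc n)} s \<partial>lborel)"
      by (intro nn_integral_substitution_aux[where g="\<lambda>s. s\<^sup>2 / 2" and g'="\<lambda>s. s"] assms continuous_on_id) (simp_all del: of_nat_Suc)
    then show ?thesis by (simp only: power_zero_numeral div_0)
  qed
  moreover have "(\<lambda>n. \<integral>\<^sup>+x. f x * indicator {0..(real (Suc n))\<^sup>2 / 2} x \<partial>lborel) \<longlonglongrightarrow> (\<integral>\<^sup>+x. f x * indicator {0..} x \<partial>lborel)"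
  proof (rule nn_integral_LIMSEQ)
    show "incseq (\<lambda>n x. f x * indicator {0..(real (Suc n))\<^sup>2 / 2} x)"
    proof (rule incseq_SucI, rule le_funI)
      fix n x
      have "(real (Suc n))\<^sup>2 \<le> (real (Suc (Suc n)))\<^sup>2" by (intro power_mono) auto
      then have "x \<le> (real (Suc n))\<^sup>2 / 2 \<Longrightarrow> x \<le> (real (Suc (Suc n)))\<^sup>2 / 2" by linarith
      then show "f x * indicator {0..(real (Suc n))\<^sup>2 / 2} x \<le> f x * indicator {0..(real (Suc (Suc n)))\<^sup>2 / 2} x"
        by (auto split: split_indicator simp del: of_nat_Suc)
    qed
    show "(\<lambda>n. f x * indicator {0..(real (Suc n))\<^sup>2 / 2} x) \<longlonglongrightarrow> f x * indicator {0..} x" for x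
    proof (rule tendsto_eventually)
      obtain M where M: "2 * x \<le> real M" using real_arch_simple by blast
      have "f x * indicator {0..(real (Suc n))\<^sup>2 / 2} x = f x * indicator {0..} x" if "M \<le> n" for n
      proof -
        have "2 * x \<le> real (Suc n) * 1" using M that by simp
        also have "\<dots> \<le> (real (Suc n))\<^sup>2" unfolding power2_eq_square by (intro mult_left_mono) auto
        finally show ?thesis by (auto split: split_indicator)
      qed
      then show "\<forall>\<^sub>F n in sequentially. f x * indicator {0..(real (Suc n))\<^sup>2 / 2} x = f x * indicator {0..} x"
        unfolding eventually_sequentially by blast
    qed
  qed measurable
  ultimately show "(\<lambda>n. \<integral>\<^sup>+s. f (s\<^sup>2 / 2) * ennreal s * indicator {0..real (Suc n)} s \<partial>lborel) \<longlonglongrightarrow> (\<integral>\<^sup>+x. f x * indicator {0..} x \<partial>lborel)"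
    by simp
qed

text \<open>The change of variables is stated as an equality of measures, an image measure and a
  density, so the integrals agree without any integrability of \<open>G\<close>.\<close>

lemma integral_half_square:
  fixes G :: "real \<Rightarrow> complex"
  assumes [measurable]: "G \<in> borel_measurable borel"
  shows "(LINT s|lborel. max 0 s *\<^sub>R G (s\<^sup>2 / 2)) = (LINT v|lborel. indicator {0..} v *\<^sub>R G v)"
proof -
  have "distr (density lborel (\<lambda>s. ennreal (max 0 s))) borel (\<lambda>s. s\<^sup>2 / 2) = density lborel (\<lambda>v. ennreal (indicator {0..} v))"
  proof (rule measure_eqI)
    fix A assume "A \<in> sets (distr (density lborel (\<lambda>s. ennreal (max 0 s))) borel (\<lambda>s. s\<^sup>2 / 2))"
    then have A [measurable]: "A \<in> sets borel" by simp
    have "emeasure (distr (density lborel (\<lambda>s. ennreal (max 0 s))) borel (\<lambda>s. s\<^sup>2 / 2)) A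
        = (\<integral>\<^sup>+x. indicator A x \<partial>distr (density lborel (\<lambda>s. ennreal (max 0 s))) borel (\<lambda>s. s\<^sup>2 / 2))"
      by (subst nn_integral_indicator) auto
    also have "\<dots> = (\<integral>\<^sup>+s. ennreal (max 0 s) * indicator A (s\<^sup>2 / 2) \<partial>lborel)"
      by (subst nn_integral_distr, simp, simp, subst nn_integral_density) auto
    also have "\<dots> = (\<integral>\<^sup>+x. indicator A x * indicator {0..} x \<partial>lborel)"
      by (rule nn_integral_half_square) simp
    also have "\<dots> = (\<integral>\<^sup>+x. ennreal (indicator {0..} x) * indicator A x \<partial>lborel)"
      by (intro nn_integral_cong) (auto split: split_indicator)
    also have "\<dots> = emeasure (density lborel (\<lambda>v. ennreal (indicator {0..} v))) A"
      by (subst emeasure_density) auto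
    finally show "emeasure (distr (density lborel (\<lambda>s. ennreal (max 0 s))) borel (\<lambda>s. s\<^sup>2 / 2)) A = emeasure (density lborel (\<lambda>v. ennreal (indicator {0..} v))) A" .
  qed simp
  then have "integral\<^sup>L (distr (density lborel (\<lambda>s. ennreal (max 0 s))) borel (\<lambda>s. s\<^sup>2 / 2)) G = integral\<^sup>L (density lborel (\<lambda>v. ennreal (indicator {0..} v))) G"
    by simp
  then show ?thesis
    by (simp add: integral_distr integral_density)
qed

text \<open>One factor \<open>sqrt s\<close> comes from the kernel and one from the definition of
  \<open>B\<close>; together they are the Jacobian of \<open>v = s\<^sup>2 / 2\<close>. The factor
  \<open>sqrt r\<close> stays outside.\<close>

lemma hankel_inner:
  assumes m: "half q \<in> borel_measurable borel" and r: "0 < r" and R: "0 < R"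
  shows "(LINT s:{0<..R}|lborel. cor (sqrt (r * s) * J0 (r * s)) * (- cor (sqrt s) * q (s\<^sup>2 / 2)))
     = cor (sqrt r) * TV (\<lambda>v. - half q v) (R\<^sup>2 / 2) (r\<^sup>2 / 2)"
proof -
  note m [measurable]
  define G where "G v = indicator {0<..R\<^sup>2 / 2} v * (cor (jz (r\<^sup>2 / 2 * v)) * (- half q v))" for v
  have Gm [measurable]: "G \<in> borel_measurable borel" unfolding G_def[abs_def] by measurable
  have "(LINT s:{0<..R}|lborel. cor (sqrt (r * s) * J0 (r * s)) * (- cor (sqrt s) * q (s\<^sup>2 / 2)))
     = (LINT s|lborel. cor (sqrt r) * (max 0 s *\<^sub>R G (s\<^sup>2 / 2)))"
    unfolding set_lebesgue_integral_def
  proof (intro Bochner_Integration.integral_cong refl)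
    fix s
    show "indicator {0<..R} s *\<^sub>R (cor (sqrt (r * s) * J0 (r * s)) * (- cor (sqrt s) * q (s\<^sup>2 / 2)))
      = cor (sqrt r) * (max 0 s *\<^sub>R G (s\<^sup>2 / 2))"
    proof (cases "0 < s")
      case True
      have J: "J0 (r * s) = jz (r\<^sup>2 / 2 * (s\<^sup>2 / 2))" by (simp add: J0_eq_jz power_divide power_mult_distrib)
      have h: "half q (s\<^sup>2 / 2) = q (s\<^sup>2 / 2)" using True by (simp add: half_def)
      have i: "(s \<in> {0<..R}) \<longleftrightarrow> s\<^sup>2 / 2 \<in> {0<..R\<^sup>2 / 2}"
        using True R by (auto simp: power_mono_iff)
      have s2: "cor (sqrt s) * cor (sqrt s) = cor s"
        using True by (simp flip: of_real_mult)
      have "cor (sqrt (r * s) * J0 (r * s)) * (- cor (sqrt s) * q (s\<^sup>2 / 2))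
        = cor (sqrt r) * ((cor (sqrt s) * cor (sqrt s)) * (cor (jz (r\<^sup>2 / 2 * (s\<^sup>2 / 2))) * (- half q (s\<^sup>2 / 2))))"
        unfolding J h by (simp add: real_sqrt_mult mult_ac)
      then show ?thesis unfolding G_def s2 using i True
        by (auto simp: indicator_def scaleR_conv_of_real)
    qed simp
  qed
  also have "\<dots> = cor (sqrt r) * (LINT s|lborel. max 0 s *\<^sub>R G (s\<^sup>2 / 2))"
    by (rule integral_mult_right_zero)
  also have "(LINT s|lborel. max 0 s *\<^sub>R G (s\<^sup>2 / 2)) = (LINT v|lborel. indicator {0..} v *\<^sub>R G v)"
    by (rule integral_half_square[OF Gm])
  also have "\<dots> = TV (\<lambda>v. - half q v) (R\<^sup>2 / 2) (r\<^sup>2 / 2)"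
    unfolding TV_def G_def by (intro Bochner_Integration.integral_cong refl) (auto split: split_indicator)
  finally show ?thesis .
qed

text \<open>The common factor \<open>sqrt r\<close> of \<open>A\<close> and of the transform
  becomes, after squaring, the Jacobian of \<open>u = r\<^sup>2 / 2\<close>. Hence the error norm in
  \<open>r\<close> with truncation \<open>R\<close> is the error norm in \<open>u\<close> with
  truncation \<open>R\<^sup>2 / 2\<close>.\<close>

lemma hankel0_pair_iff:
  assumes m: "half g \<in> borel_measurable borel" "half q \<in> borel_measurable borel"
  shows "hankel0_pair (\<lambda>r. cor (sqrt r) * g (r\<^sup>2 / 2)) (\<lambda>s. - cor (sqrt s) * q (s\<^sup>2 / 2))
    \<longleftrightarrow> ((\<lambda>V. \<integral>\<^sup>+u. ennreal ((cmod (half (\<lambda>u. g u - TV (\<lambda>v. - half q v) V u) u))\<^sup>2) \<partial>lborel) \<longlongrightarrow> 0) at_top"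
proof -
  note m [measurable]
  define \<Phi> where "\<Phi> V = (\<integral>\<^sup>+u. ennreal ((cmod (half (\<lambda>u. g u - TV (\<lambda>v. - half q v) V u) u))\<^sup>2) \<partial>lborel)" for V
  have eq: "(\<integral>\<^sup>+ r\<in>{0<..}. ennreal ((cmod (cor (sqrt r) * g (r\<^sup>2 / 2) -
          (LINT s:{0<..R}|lborel. cor (sqrt (r * s) * J0 (r * s)) * (- cor (sqrt s) * q (s\<^sup>2 / 2)))))\<^sup>2) \<partial>lborel)
      = \<Phi> (R\<^sup>2 / 2)" if R: "0 < R" for R
  proof -
    define f where "f u = ennreal ((cmod (half g u - half (TV (\<lambda>v. - half q v) (R\<^sup>2 / 2)) u))\<^sup>2)" for u
    have fm [measurable]: "f \<in> borel_measurable borel"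
    proof -
      have "f = (\<lambda>u. ennreal ((cmod (half g u - indicator {0<..} u * TV (\<lambda>v. - half q v) (R\<^sup>2 / 2) u))\<^sup>2))"
        by (simp add: f_def half_def fun_eq_iff)
      also have "\<dots> \<in> borel_measurable borel" by measurable
      finally show ?thesis .
    qed
    have "(\<integral>\<^sup>+ r\<in>{0<..}. ennreal ((cmod (cor (sqrt r) * g (r\<^sup>2 / 2) -
          (LINT s:{0<..R}|lborel. cor (sqrt (r * s) * J0 (r * s)) * (- cor (sqrt s) * q (s\<^sup>2 / 2)))))\<^sup>2) \<partial>lborel)
       = (\<integral>\<^sup>+r. ennreal (max 0 r) * f (r\<^sup>2 / 2) \<partial>lborel)"
    proof (intro nn_integral_cong)
      fix r :: real
      show "ennreal ((cmod (cor (sqrt r) * g (r\<^sup>2 / 2) -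
          (LINT s:{0<..R}|lborel. cor (sqrt (r * s) * J0 (r * s)) * (- cor (sqrt s) * q (s\<^sup>2 / 2)))))\<^sup>2) * indicator {0<..} r
          = ennreal (max 0 r) * f (r\<^sup>2 / 2)"
      proof (cases "0 < r")
        case True
        have "(cmod (cor (sqrt r) * g (r\<^sup>2 / 2) - cor (sqrt r) * TV (\<lambda>v. - half q v) (R\<^sup>2 / 2) (r\<^sup>2 / 2)))\<^sup>2
          = r * (cmod (half g (r\<^sup>2 / 2) - half (TV (\<lambda>v. - half q v) (R\<^sup>2 / 2)) (r\<^sup>2 / 2)))\<^sup>2"
          using True by (simp add: half_def norm_mult power_mult_distrib flip: right_diff_distrib)
        then show ?thesis unfolding hankel_inner[OF m(2) True R] f_def using True
          by (simp add: ennreal_mult)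
      qed simp
    qed
    also have "\<dots> = (\<integral>\<^sup>+x. f x * indicator {0..} x \<partial>lborel)" by (rule nn_integral_half_square[OF fm])
    also have "\<dots> = \<Phi> (R\<^sup>2 / 2)" unfolding \<Phi>_def f_def
      by (intro nn_integral_cong) (auto simp: half_def split: split_indicator)
    finally show ?thesis .
  qed
  have "hankel0_pair (\<lambda>r. cor (sqrt r) * g (r\<^sup>2 / 2)) (\<lambda>s. - cor (sqrt s) * q (s\<^sup>2 / 2))
    \<longleftrightarrow> ((\<lambda>R. \<Phi> (R\<^sup>2 / 2)) \<longlongrightarrow> 0) at_top"
    unfolding hankel0_pair_def
    by (rule filterlim_cong[OF refl refl eventually_mono[OF eventually_gt_at_top eq]])
  also have "\<dots> \<longleftrightarrow> (\<Phi> \<longlongrightarrow> 0) at_top"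
  proof
    assume "(\<Phi> \<longlongrightarrow> 0) at_top"
    moreover have "filterlim (\<lambda>R::real. R\<^sup>2 / 2) at_top at_top" by real_asymp
    ultimately show "((\<lambda>R. \<Phi> (R\<^sup>2 / 2)) \<longlongrightarrow> 0) at_top" by (rule filterlim_compose)
  next
    assume "((\<lambda>R. \<Phi> (R\<^sup>2 / 2)) \<longlongrightarrow> 0) at_top"
    moreover have "filterlim (\<lambda>V::real. sqrt (2 * V)) at_top at_top" by real_asymp
    ultimately have "((\<lambda>V. \<Phi> ((sqrt (2 * V))\<^sup>2 / 2)) \<longlongrightarrow> 0) at_top" by (rule filterlim_compose)
    then show "(\<Phi> \<longlongrightarrow> 0) at_top"
      by (rule Lim_transform_eventually) (use eventually_ge_at_top[of "0::real"] in eventually_elim, simp)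
  qed
  finally show ?thesis by (simp add: \<Phi>_def[abs_def])
qed

context
  fixes g q :: "real \<Rightarrow> complex"
  assumes L: "L2 (half g)" "L2 (half q)"
begin

abbreviation (input) "hb \<equiv> \<lambda>v. - half q v"
abbreviation (input) "hV \<equiv> \<lambda>V. half (\<lambda>u. g u - TV hb V u)"

lemma hV_measurable: "hV V \<in> borel_measurable borel"
proof -
  have [measurable]: "half g \<in> borel_measurable borel" "half q \<in> borel_measurable borel" using L by (auto simp: L2_def)
  have "hV V = (\<lambda>u. half g u - indicator {0<..} u * TV hb V u)" by (auto simp: half_def fun_eq_iff right_diff_distrib)
  also have "\<dots> \<in> borel_measurable borel" by measurable
  finally show ?thesis .
qed

lemma hV_Laplace:
  assumes "0 < \<mu>"
  shows "integrable lborel (\<lambda>u. hV V u * ex \<mu> u)"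
    "(LINT u|lborel. hV V u * ex \<mu> u) = (LINT u|lborel. half g u * ex \<mu> u) - (LINT v|lborel. indicator {0<..V} v * hb v * ex (1 / \<mu>) v) / cor \<mu>"
proof -
  have eq: "hV V u * ex \<mu> u = half g u * ex \<mu> u - ex \<mu> u * TV hb V u" for u
    by (cases "0 < u") (auto simp: half_def ex_nonpos algebra_simps)
  have Lb: "L2 hb" by (rule L2_minus[OF L(2)])
  note i1 = L2_mult_integrable[OF L(1) L2_ex[OF assms]] and i2 = TV_Laplace[OF Lb assms, of V]
  show "integrable lborel (\<lambda>u. hV V u * ex \<mu> u)" unfolding eq by (intro Bochner_Integration.integrable_diff i1 i2)
  show "(LINT u|lborel. hV V u * ex \<mu> u) = (LINT u|lborel. half g u * ex \<mu> u) - (LINT v|lborel. indicator {0<..V} v * hb v * ex (1 / \<mu>) v) / cor \<mu>"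
    unfolding eq Bochner_Integration.integral_diff[OF i1 i2(2)] i2(1) ..
qed

lemma tail_tendsto: "((\<lambda>V. nsq (\<lambda>v. indicator {0<..V} v * hb v - hb v)) \<longlongrightarrow> 0) at_top"
proof (rule tendsto_at_topI_sequentially)
  fix X :: "nat \<Rightarrow> real" assume X: "filterlim X at_top sequentially"
  have Lb: "L2 hb" by (rule L2_minus[OF L(2)])
  show "(\<lambda>n. nsq (\<lambda>v. indicator {0<..X n} v * hb v - hb v)) \<longlonglongrightarrow> 0"
  proof (rule nsq_LIMSEQ_dominated[OF Lb Lb])
    show "(\<lambda>v. indicator {0<..X n} v * hb v) \<in> borel_measurable borel" for n
      by (rule L2_measurable[OF L2_restrict(1)[OF Lb]]) simp
    show "cmod (indicator {0<..X n} x * hb x - hb x) \<le> cmod (hb x)" for n x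
      by (auto split: split_indicator)
    fix x
    have "\<forall>\<^sub>F n in sequentially. x \<le> X n" using X by (simp add: filterlim_at_top)
    then have "\<forall>\<^sub>F n in sequentially. indicator {0<..X n} x * hb x = hb x"
      by eventually_elim (auto simp: half_def split: split_indicator)
    then show "(\<lambda>n. indicator {0<..X n} x * hb x) \<longlonglongrightarrow> hb x" by (rule tendsto_eventually)
  qed
qed

lemma Laplace_if_hankel:
  assumes lim: "((\<lambda>V. \<integral>\<^sup>+u. ennreal ((cmod (hV V u))\<^sup>2) \<partial>lborel) \<longlongrightarrow> 0) at_top" and \<mu>: "0 < \<mu>"
  shows "cor \<mu> * (LINT u|lborel. half g u * ex \<mu> u) = - (LINT v|lborel. half q v * ex (1 / \<mu>) v)"
proof -
  have Lb: "L2 hb" by (rule L2_minus[OF L(2)])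
  \<comment> \<open>The assumed limit makes the integral finite only for large \<open>V\<close>, so
    square integrability of \<open>hV V\<close> is available eventually.\<close>
  have ev: "\<forall>\<^sub>F V in at_top. L2 (hV V)"
    using order_tendstoD(2)[OF lim, of 1] by (rule eventually_mono) (auto simp: L2_nn[OF hV_measurable] less_top[symmetric] intro: order.strict_trans)
  have "\<forall>\<^sub>F V in at_top. (\<integral>\<^sup>+u. ennreal ((cmod (hV V u))\<^sup>2) \<partial>lborel) = ennreal (nsq (hV V))"
    using ev by eventually_elim (rule nsq_nn)
  then have "((\<lambda>V. ennreal (nsq (hV V))) \<longlongrightarrow> ennreal 0) at_top"
    using lim tendsto_cong by fastforce
  then have n0: "((\<lambda>V. nsq (hV V)) \<longlongrightarrow> 0) at_top"
    by (subst (asm) tendsto_ennreal_iff) (auto simp: nsq_nonneg)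
  have "((\<lambda>V. (cmod (LINT u|lborel. hV V u * ex \<mu> u))\<^sup>2) \<longlongrightarrow> 0) at_top"
  proof (rule tendsto_sandwich[OF _ _ tendsto_const])
    show "((\<lambda>V. nsq (hV V) * nsq (ex \<mu>)) \<longlongrightarrow> 0) at_top" using tendsto_mult_left_zero[OF n0] .
    show "\<forall>\<^sub>F V in at_top. (cmod (LINT u|lborel. hV V u * ex \<mu> u))\<^sup>2 \<le> nsq (hV V) * nsq (ex \<mu>)"
      using ev by eventually_elim (rule L2_Cauchy_Schwarz[OF _ L2_ex[OF \<mu>]])
  qed simp
  then have "((\<lambda>V. LINT u|lborel. hV V u * ex \<mu> u) \<longlongrightarrow> 0) at_top"
    by (simp add: power_tendsto_0_iff tendsto_norm_zero_iff)
  moreover have "((\<lambda>V. LINT u|lborel. hV V u * ex \<mu> u) \<longlongrightarrow> (LINT u|lborel. half g u * ex \<mu> u) - (LINT v|lborel. hb v * ex (1 / \<mu>) v) / cor \<mu>) at_top"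
    unfolding hV_Laplace(2)[OF \<mu>]
  proof (intro tendsto_intros)
    show "((\<lambda>V. LINT v|lborel. indicator {0<..V} v * hb v * ex (1 / \<mu>) v) \<longlongrightarrow> (LINT v|lborel. hb v * ex (1 / \<mu>) v)) at_top"
    proof (rule tendsto_at_topI_sequentially)
      fix X :: "nat \<Rightarrow> real" assume X: "filterlim X at_top sequentially"
      have "(\<lambda>n. LINT v|lborel. ex (1 / \<mu>) v * (indicator {0<..X n} v * hb v)) \<longlonglongrightarrow> (LINT v|lborel. ex (1 / \<mu>) v * hb v)"
        by (rule L2_integral_tendsto[OF Lb L2_ex L2_restrict(1)[OF Lb] filterlim_compose[OF tail_tendsto X]]) (use \<mu> in auto)
      then show "(\<lambda>n. LINT v|lborel. indicator {0<..X n} v * hb v * ex (1 / \<mu>) v) \<longlonglongrightarrow> (LINT v|lborel. hb v * ex (1 / \<mu>) v)"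
        by (simp add: mult_ac)
    qed
  qed (use \<mu> in auto)
  ultimately have "(LINT u|lborel. half g u * ex \<mu> u) - (LINT v|lborel. hb v * ex (1 / \<mu>) v) / cor \<mu> = 0"
    by (rule tendsto_unique[OF trivial_limit_at_top_linorder, symmetric])
  then have "(LINT u|lborel. half g u * ex \<mu> u) = (LINT v|lborel. hb v * ex (1 / \<mu>) v) / cor \<mu>"
    by (simp only: right_minus_eq)
  then have "cor \<mu> * (LINT u|lborel. half g u * ex \<mu> u) = (LINT v|lborel. hb v * ex (1 / \<mu>) v)"
    using \<mu> by (simp only:) simp
  then show ?thesis by simp
qed

text \<open>Under \<open>eq\<close> the pairing of \<open>hV V\<close> with an exponential sum is
  the pairing of the tail of \<open>- half q\<close> beyond \<open>V\<close> with the sum of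
  inverted rates, and inversion preserves norms by \<open>nsq_exp_sum_inverse\<close>. Duality then
  bounds the norm of \<open>hV V\<close> by that of the tail, which tends to 0.\<close>

lemma hankel_if_Laplace:
  assumes N: "2 \<le> N"
    and eq: "\<And>k::nat. cor (real k + 1 + N) * (LINT u|lborel. half g u * ex (real k + 1 + N) u) = - (LINT v|lborel. half q v * ex (1 / (real k + 1 + N)) v)"
  shows "((\<lambda>V. \<integral>\<^sup>+u. ennreal ((cmod (hV V u))\<^sup>2) \<partial>lborel) \<longlongrightarrow> 0) at_top"
proof -
  have Lb: "L2 hb" by (rule L2_minus[OF L(2)])
  have bd: "L2 (hV V) \<and> nsq (hV V) \<le> nsq (\<lambda>v. indicator {0<..V} v * hb v - hb v)" for V
  proof -
    define T where "T v = hb v - indicator {0<..V} v * hb v" for v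
    have LT: "L2 T" unfolding T_def by (intro L2_diff L2_restrict Lb) auto
    \<comment> \<open>\<open>TV_bound\<close> allows growth exp (x), so a weight of rate
      \<open>N \<ge> 2\<close> leaves at most exp (- x).\<close>
    have w: "L2 (\<lambda>x. cor (exp (- (N * x))) * hV V x)"
    proof -
      define C where "C = (LINT v:{0..V}|lborel. exp v * cmod (hb v))"
      have C: "0 \<le> C" unfolding C_def set_lebesgue_integral_def by (intro Bochner_Integration.integral_nonneg) auto
      have tm: "(\<lambda>x. ex N x * TV hb V x) \<in> borel_measurable borel"
        using TV_measurable[OF L2_measurable[OF Lb]] by measurable
      have "L2 (\<lambda>x. ex N x * TV hb V x)"
      proof (rule L2_bound(1)[OF tm L2_cmul(1)[OF L2_ex[of 1], of "cor C"]])
        fix x show "cmod (ex N x * TV hb V x) \<le> cmod (cor C * ex 1 x)"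
        proof (cases "0 < x")
          case True
          have "exp (- (N * x)) * cmod (TV hb V x) \<le> exp (- (N * x)) * (exp x * C)"
            unfolding C_def using TV_bound[OF Lb, of x V] True by (intro mult_left_mono) auto
          also have "\<dots> = C * exp (- (N * x) + x)" by (simp only: exp_add mult_ac)
          also have "\<dots> \<le> C * exp (- x)"
            using True N C mult_right_mono[of 2 N x] by (intro mult_left_mono) auto
          finally show ?thesis using True C by (simp add: ex_pos norm_mult)
        qed (simp add: ex_nonpos)
      qed simp
      moreover have "L2 (\<lambda>x. ex N x * half g x)"
      proof (rule L2_bound(1)[OF _ L(1)])
        show "(\<lambda>x. ex N x * half g x) \<in> borel_measurable borel" using L2_measurable[OF L(1)] by measurable
        fix x show "cmod (ex N x * half g x) \<le> cmod (half g x)"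
        proof (cases "0 < x")
          case True then show ?thesis using N mult_right_mono[of "exp (- (N * x))" 1 "cmod (half g x)"]
            by (simp add: ex_pos norm_mult)
        qed (simp add: ex_nonpos)
      qed
      ultimately have "L2 (\<lambda>x. ex N x * half g x - ex N x * TV hb V x)" by (intro L2_diff)
      moreover have "ex N x * half g x - ex N x * TV hb V x = cor (exp (- (N * x))) * hV V x" for x
        by (cases "0 < x") (auto simp: half_def ex_def algebra_simps)
      ultimately show ?thesis by simp
    qed
    have pair: "(cmod (LINT x|lborel. hV V x * ES n N a x + 0 * ES n N b x))\<^sup>2 \<le> nsq T * (nsq (ES n N a) + nsq (ES n N b))" for n a b
    proof -
      define m where "m k = real k + 1 + N" for k :: nat
      have m: "0 < m k" for k using N by (simp add: m_def)
      define S where "S v = (\<Sum>k<n. a k / cor (m k) * ex (1 / m k) v)" for v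
      have LS: "L2 S" unfolding S_def using m by (intro L2_sum L2_cmul L2_ex) auto
      have "(LINT x|lborel. hV V x * ES n N a x) = (\<Sum>k<n. a k * (LINT x|lborel. hV V x * ex (m k) x))"
      proof -
        have "hV V x * ES n N a x = (\<Sum>k<n. a k * (hV V x * ex (m k) x))" for x
          unfolding ES_def m_def sum_distrib_left by (intro sum.cong) auto
        then show ?thesis using hV_Laplace(1)[OF m] by (simp add: Bochner_Integration.integral_sum)
      qed
      also have "\<dots> = (\<Sum>k<n. a k / cor (m k) * (LINT v|lborel. T v * ex (1 / m k) v))"
      proof (intro sum.cong refl)
        fix k
        have l: "0 < 1 / m k" using m by simp
        have "(LINT x|lborel. hV V x * ex (m k) x) = ((LINT v|lborel. hb v * ex (1 / m k) v) - (LINT v|lborel. indicator {0<..V} v * hb v * ex (1 / m k) v)) / cor (m k)"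
          unfolding hV_Laplace(2)[OF m] using eq[of k, folded m_def] m[of k] by (simp add: field_simps)
        also have "(LINT v|lborel. hb v * ex (1 / m k) v) - (LINT v|lborel. indicator {0<..V} v * hb v * ex (1 / m k) v) = (LINT v|lborel. T v * ex (1 / m k) v)"
          unfolding T_def left_diff_distrib
          by (rule Bochner_Integration.integral_diff[symmetric, OF L2_mult_integrable[OF Lb L2_ex[OF l]] L2_mult_integrable[OF L2_restrict(1)[OF Lb] L2_ex[OF l]]]) simp
        finally show "a k * (LINT x|lborel. hV V x * ex (m k) x) = a k / cor (m k) * (LINT v|lborel. T v * ex (1 / m k) v)" by simp
      qed
      also have "\<dots> = (LINT v|lborel. T v * S v)"
      proof -
        have i: "integrable lborel (\<lambda>v. T v * ex (1 / m k) v)" for k using m by (intro L2_mult_integrable LT L2_ex) auto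
        have "T v * S v = (\<Sum>k<n. a k / cor (m k) * (T v * ex (1 / m k) v))" for v
          unfolding S_def sum_distrib_left by (intro sum.cong) auto
        then show ?thesis using i by (simp add: Bochner_Integration.integral_sum)
      qed
      finally have "(cmod (LINT x|lborel. hV V x * ES n N a x))\<^sup>2 \<le> nsq T * nsq S"
        using L2_Cauchy_Schwarz[OF LT LS] by simp
      also have "nsq S = nsq (ES n N a)"
        using nsq_exp_sum_inverse[of "{..<n}" m a] m by (simp add: S_def[abs_def] ES_def[abs_def] m_def)
      finally show ?thesis using nsq_nonneg[of "ES n N b"] nsq_nonneg[of T] by (simp add: distrib_left add_increasing2)
    qed
    \<comment> \<open>The second component of the duality lemma is filled with the zero
      function.\<close>
    have "L2 (hV V) \<and> L2 (\<lambda>x. 0) \<and> nsq (hV V) + nsq (\<lambda>x. 0) \<le> nsq T"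
      using L2_by_duality[OF hV_measurable _ half_nonpos _ _ w _ nsq_nonneg pair] N by simp
    moreover have "nsq T = nsq (\<lambda>v. indicator {0<..V} v * hb v - hb v)" unfolding T_def by (rule nsq_swap)
    ultimately show ?thesis by simp
  qed
  have "((\<lambda>V. nsq (hV V)) \<longlongrightarrow> 0) at_top"
    by (rule tendsto_sandwich[OF _ _ tendsto_const tail_tendsto]) (use bd nsq_nonneg in auto)
  then have "((\<lambda>V. ennreal (nsq (hV V))) \<longlongrightarrow> ennreal 0) at_top" by (rule tendsto_ennrealI)
  then show ?thesis using bd by (simp add: nsq_nn)
qed

end

subsection \<open>The equation on characteristic rectangles\<close>

lemma cont_set_integrable:
  fixes f :: "real \<Rightarrow> complex"
  assumes "continuous_on {a..b} f"
  shows "set_integrable lborel {a..b} f" "(LINT x:{a..b}|lborel. f x) = integral {a..b} f"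
proof -
  show 1: "set_integrable lborel {a..b} f" by (rule borel_integrable_atLeastAtMost'[OF assms])
  show "(LINT x:{a..b}|lborel. f x) = integral {a..b} f" by (rule set_borel_integral_eq_integral(2)[OF 1])
qed

abbreviation jcont :: "(real \<Rightarrow> real \<Rightarrow> 'a::topological_space) \<Rightarrow> bool" where
  "jcont F \<equiv> continuous_on UNIV (\<lambda>z. F (fst z) (snd z))"

lemma jcont_compose:
  assumes "jcont F" "continuous_on S f" "continuous_on S g"
  shows "continuous_on S (\<lambda>x. F (f x) (g x))"
  using continuous_on_compose2[OF assms(1), of S "\<lambda>x. (f x, g x)"] assms(2,3)
  by (simp add: continuous_on_Pair)

lemma jcont_bounded:
  fixes F :: "real \<Rightarrow> real \<Rightarrow> complex"
  assumes "jcont F"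
  obtains M where "0 \<le> M" "\<And>s t. a \<le> s \<Longrightarrow> s \<le> b \<Longrightarrow> c \<le> t \<Longrightarrow> t \<le> d \<Longrightarrow> cmod (F s t) \<le> M"
proof -
  have "compact ((\<lambda>z. F (fst z) (snd z)) ` ({a..b} \<times> {c..d}))"
    by (intro compact_continuous_image continuous_on_subset[OF assms] compact_Times) auto
  then have "bounded ((\<lambda>z. F (fst z) (snd z)) ` ({a..b} \<times> {c..d}))" by (rule compact_imp_bounded)
  then obtain M where M: "\<And>z. z \<in> {a..b} \<times> {c..d} \<Longrightarrow> cmod (F (fst z) (snd z)) \<le> M"
    unfolding bounded_iff by blast
  show ?thesis
    by (rule that[of "max 0 M"]) (use M in \<open>force simp: le_max_iff_disj\<close>)+
qed

text \<open>Fubini on the triangle \<open>a \<le> s \<le> t \<le> b\<close> with factors that are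
  merely integrable. It serves as integration by parts for functions that are only primitives of
  integrable functions.\<close>

lemma triangle_Fubini:
  fixes \<alpha> \<beta> :: "real \<Rightarrow> complex"
  assumes \<alpha>: "set_integrable lborel {a..b} \<alpha>" and \<beta>: "set_integrable lborel {a..b} \<beta>" and k: "jcont k"
  shows "(LINT s:{a..b}|lborel. \<alpha> s * (LINT t:{s..b}|lborel. k s t * \<beta> t)) = (LINT t:{a..b}|lborel. \<beta> t * (LINT s:{a..t}|lborel. k s t * \<alpha> s))"
proof -
  define A where "A s = indicator {a..b} s *\<^sub>R \<alpha> s" for s
  define B where "B s = indicator {a..b} s *\<^sub>R \<beta> s" for s
  have AB: "integrable lborel A" "integrable lborel B"
    using \<alpha> \<beta> by (auto simp: set_integrable_def A_def[abs_def] B_def[abs_def])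
  have [measurable]: "A \<in> borel_measurable borel" "B \<in> borel_measurable borel" using AB by auto
  have km: "(\<lambda>z. k (fst z) (snd z)) \<in> borel_measurable (lborel \<Otimes>\<^sub>M lborel)"
    using borel_measurable_continuous_onI[OF k] by (simp add: lborel_prod)
  obtain M where M: "0 \<le> M" "\<And>s t. a \<le> s \<Longrightarrow> s \<le> b \<Longrightarrow> a \<le> t \<Longrightarrow> t \<le> b \<Longrightarrow> cmod (k s t) \<le> M"
    using jcont_bounded[OF k] by blast
  define f where "f = (\<lambda>z. (if fst z \<le> snd z then 1 else 0) * (A (fst z) * B (snd z) * k (fst z) (snd z)))"
  have fm: "f \<in> borel_measurable (lborel \<Otimes>\<^sub>M lborel)"
    unfolding f_def using km by measurable
  have iAB: "integrable (lborel \<Otimes>\<^sub>M lborel) (\<lambda>z. A (fst z) * B (snd z))"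
  proof (rule lborel_pair.Fubini_integrable)
    show "integrable lborel (\<lambda>x. LINT y|lborel. norm (A (fst (x, y)) * B (snd (x, y))))"
      using AB by (simp add: norm_mult)
    show "AE x in lborel. integrable lborel (\<lambda>y. A (fst (x, y)) * B (snd (x, y)))" using AB by simp
  qed measurable
  have fi: "integrable (lborel \<Otimes>\<^sub>M lborel) f"
  proof (rule Bochner_Integration.integrable_bound[OF integrable_mult_right[OF iAB, of "cor M"] fm])
    have "norm (f (s, t)) \<le> norm (cor M * (A s * B t))" for s t
    proof (cases "s \<in> {a..b} \<and> t \<in> {a..b}")
      case True then show ?thesis using M
        by (auto simp: f_def norm_mult mult.commute[of M] intro!: mult_left_mono)
    qed (auto simp: f_def A_def B_def)
    then show "AE x in lborel \<Otimes>\<^sub>M lborel. norm (f x) \<le> norm (cor M * (A (fst x) * B (snd x)))"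
      by (intro AE_I2) (metis prod.collapse)
  qed
  have "(LINT t|lborel. (LINT s|lborel. f (s, t))) = (LINT s|lborel. (LINT t|lborel. f (s, t)))"
    using lborel_pair.Fubini_integral[of "\<lambda>s t. f (s, t)"] fi by simp
  moreover have "(LINT s|lborel. f (s, t)) = indicator {a..b} t *\<^sub>R (\<beta> t * (LINT s:{a..t}|lborel. k s t * \<alpha> s))" for t
  proof -
    have "f (s, t) = (indicator {a..b} t * \<beta> t) * (indicator {a..t} s *\<^sub>R (k s t * \<alpha> s))" for s
      by (auto simp: f_def A_def B_def split: split_indicator)
    then have "(LINT s|lborel. f (s, t)) = (indicator {a..b} t * \<beta> t) * (LINT s|lborel. indicator {a..t} s *\<^sub>R (k s t * \<alpha> s))"
      by (simp only: integral_mult_right_zero)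
    then show ?thesis unfolding set_lebesgue_integral_def by (simp split: split_indicator)
  qed
  moreover have "(LINT t|lborel. f (s, t)) = indicator {a..b} s *\<^sub>R (\<alpha> s * (LINT t:{s..b}|lborel. k s t * \<beta> t))" for s
  proof -
    have "f (s, t) = (indicator {a..b} s * \<alpha> s) * (indicator {s..b} t *\<^sub>R (k s t * \<beta> t))" for t
      by (auto simp: f_def A_def B_def split: split_indicator)
    then have "(LINT t|lborel. f (s, t)) = (indicator {a..b} s * \<alpha> s) * (LINT t|lborel. indicator {s..b} t *\<^sub>R (k s t * \<beta> t))"
      by (simp only: integral_mult_right_zero)
    then show ?thesis unfolding set_lebesgue_integral_def by (simp split: split_indicator)
  qed
  ultimately show ?thesis unfolding set_lebesgue_integral_def by simp
qed

text \<open>The oriented integral of \<open>f\<close> from 0 to \<open>u\<close>. Written as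
  \<open>u\<close> times a mean over \<open>[0, 1]\<close>, it covers both signs of \<open>u\<close>
  by one formula, and its joint continuity in \<open>u\<close> and a parameter reduces to an
  integral over a fixed interval.\<close>

definition Sg :: "(real \<Rightarrow> complex) \<Rightarrow> real \<Rightarrow> complex" where
  "Sg f u = cor u * integral {0..1} (\<lambda>r. f (r * u))"

lemma Sg_0 [simp]: "Sg f 0 = 0"
  by (simp add: Sg_def)

lemma Sg_diff:
  assumes "continuous_on UNIV f" "a \<le> b"
  shows "Sg f b - Sg f a = integral {a..b} f"
proof -
  define R where "R = \<bar>a\<bar> + \<bar>b\<bar> + 1"
  obtain G where G: "\<And>x. x \<in> {-R..R} \<Longrightarrow> (G has_vector_derivative f x) (at x within {-R..R})"
    using antiderivative_continuous[OF continuous_on_subset[OF assms(1)]] by (metis subset_UNIV)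
  have S: "Sg f u = G u - G 0" if u: "\<bar>u\<bar> \<le> R" for u
  proof -
    have "((\<lambda>r. cor u * f (r * u)) has_integral (G (1 * u) - G (0 * u))) {0..1}"
    proof (rule fundamental_theorem_of_calculus)
      fix r :: real assume r: "r \<in> {0..1}"
      then have "\<bar>r * u\<bar> \<le> 1 * R" unfolding abs_mult using u by (intro mult_mono) auto
      then have "r * u \<in> {-R..R}" by auto
      moreover have "(\<lambda>r. r * u) ` {0..1} \<subseteq> {-R..R}"
      proof safe
        fix r :: real assume "r \<in> {0..1}"
        then have "\<bar>r * u\<bar> \<le> 1 * R" unfolding abs_mult using u by (intro mult_mono) auto
        then show "r * u \<in> {-R..R}" by auto
      qed
      ultimately have "(G has_vector_derivative f (r * u)) (at (r * u) within (\<lambda>r. r * u) ` {0..1})"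
        using has_vector_derivative_within_subset[OF G] by blast
      moreover have "((\<lambda>r. r * u) has_vector_derivative u) (at r within {0..1})"
        by (auto intro!: derivative_eq_intros)
      ultimately have "((G \<circ> (\<lambda>r. r * u)) has_vector_derivative u *\<^sub>R f (r * u)) (at r within {0..1})"
        by (intro vector_diff_chain_within)
      then show "((\<lambda>r. G (r * u)) has_vector_derivative cor u * f (r * u)) (at r within {0..1})"
        by (simp add: o_def scaleR_conv_of_real)
    qed simp
    from integral_unique[OF this] show ?thesis unfolding Sg_def by simp
  qed
  have "(f has_integral (G b - G a)) {a..b}"
  proof (rule fundamental_theorem_of_calculus[OF assms(2)])
    fix x assume "x \<in> {a..b}"
    then show "(G has_vector_derivative f x) (at x within {a..b})"
      by (intro has_vector_derivative_within_subset[OF G]) (auto simp: R_def)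
  qed
  then show ?thesis using S[of a] S[of b] by (simp add: R_def integral_unique)
qed

lemma Sg_nonneg: "continuous_on UNIV f \<Longrightarrow> 0 \<le> u \<Longrightarrow> Sg f u = integral {0..u} f"
  using Sg_diff[of f 0 u] by simp

lemma Sg_nonpos: "continuous_on UNIV f \<Longrightarrow> u \<le> 0 \<Longrightarrow> Sg f u = - integral {u..0} f"
  using Sg_diff[of f u 0] by (metis Sg_0 add.inverse_inverse diff_0)

lemma Sg_jcont:
  assumes "jcont F"
  shows "jcont (\<lambda>u s. Sg (\<lambda>t. F s t) u)" "jcont (\<lambda>u s. Sg (\<lambda>t. F t s) u)"
proof -
  have "continuous_on (UNIV \<times> cbox 0 1) (\<lambda>(x, r). F (snd x) (r * fst x))"
    unfolding split_beta by (intro jcont_compose[OF assms] continuous_intros)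
  from integral_continuous_on_param[OF this] show "jcont (\<lambda>u s. Sg (\<lambda>t. F s t) u)"
    unfolding Sg_def by (intro continuous_intros) simp
  have "continuous_on (UNIV \<times> cbox 0 1) (\<lambda>(x, r). F (r * fst x) (snd x))"
    unfolding split_beta by (intro jcont_compose[OF assms] continuous_intros)
  from integral_continuous_on_param[OF this] show "jcont (\<lambda>u s. Sg (\<lambda>t. F t s) u)"
    unfolding Sg_def by (intro continuous_intros) simp
qed

lemma jcont_sections:
  assumes "jcont F"
  shows "continuous_on S (\<lambda>t. F s t)" "continuous_on S (\<lambda>s. F s t)" "continuous_on S (\<lambda>s. F s s)"
  by (intro jcont_compose[OF assms] continuous_intros)+

definition rect :: "(real \<Rightarrow> real \<Rightarrow> complex) \<Rightarrow> bool" where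
  "rect F \<longleftrightarrow> jcont F \<and> (\<forall>a b c d. a \<le> b \<longrightarrow> c \<le> d \<longrightarrow>
     F b d - F a d - F b c + F a c = integral {a..b} (\<lambda>s. integral {c..d} (\<lambda>t. F s t)))"

lemma rect_jcont: "rect F \<Longrightarrow> jcont F"
  by (simp add: rect_def)

lemma rectD: "rect F \<Longrightarrow> a \<le> b \<Longrightarrow> c \<le> d \<Longrightarrow>
     F b d - F a d - F b c + F a c = integral {a..b} (\<lambda>s. integral {c..d} (\<lambda>t. F s t))"
  by (simp add: rect_def)

lemma jcont_swap: "jcont F \<Longrightarrow> jcont (\<lambda>u v. F v u)"
  by (rule jcont_compose) (auto intro!: continuous_intros)

lemma jcont_integral_swap:
  fixes F :: "real \<Rightarrow> real \<Rightarrow> complex"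
  assumes "jcont F"
  shows "integral {a..b} (\<lambda>s. integral {c..d} (\<lambda>t. F s t)) = integral {c..d} (\<lambda>t. integral {a..b} (\<lambda>s. F s t))"
  using integral_swap_continuous[of a c b d F] continuous_on_subset[OF assms, of "cbox (a, c) (b, d)"]
  by (simp add: split_beta)

lemma rect_swap:
  assumes "rect F"
  shows "rect (\<lambda>u v. F v u)"
  unfolding rect_def
proof (intro conjI allI impI)
  show "jcont (\<lambda>u v. F v u)" by (rule jcont_swap[OF rect_jcont[OF assms]])
  fix a b c d :: real assume "a \<le> b" "c \<le> d"
  then show "F d b - F d a - F c b + F c a = integral {a..b} (\<lambda>s. integral {c..d} (\<lambda>t. F t s))"
    using rectD[OF assms, of c d a b] jcont_integral_swap[OF rect_jcont[OF assms], of c d a b]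
    by (simp add: algebra_simps)
qed

lemma rect_Sg:
  assumes "rect F" "c \<le> d"
  shows "F u d - F 0 d - F u c + F 0 c = integral {c..d} (\<lambda>t. Sg (\<lambda>s. F s t) u)"
proof -
  note jF = rect_jcont[OF assms(1)]
  show ?thesis
  proof (cases "0 \<le> u")
    case True
    have "F u d - F 0 d - F u c + F 0 c = integral {c..d} (\<lambda>t. integral {0..u} (\<lambda>s. F s t))"
      unfolding rectD[OF assms(1) True assms(2)] by (rule jcont_integral_swap[OF jF])
    then show ?thesis by (simp only: Sg_nonneg[OF jcont_sections(2)[OF jF] True])
  next
    case False
    then have u: "u \<le> 0" by simp
    have "F 0 d - F u d - F 0 c + F u c = integral {c..d} (\<lambda>t. integral {u..0} (\<lambda>s. F s t))"
      unfolding rectD[OF assms(1) u assms(2)] by (rule jcont_integral_swap[OF jF])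
    then have "- (F 0 d - F u d - F 0 c + F u c) = integral {c..d} (\<lambda>t. - integral {u..0} (\<lambda>s. F s t))"
      by (simp only: Henstock_Kurzweil_Integration.integral_neg)
    moreover have "- (F 0 d - F u d - F 0 c + F u c) = F u d - F 0 d - F u c + F 0 c" by simp
    ultimately show ?thesis by (simp only: Sg_nonpos[OF jcont_sections(2)[OF jF] u])
  qed
qed

text \<open>Integrating \<open>F\<^sub>u\<^sub>v = F\<close> in \<open>u\<close> from the axis gives
  the derivative in \<open>v\<close> along any vertical line: its value on the axis plus the
  oriented integral of \<open>F\<close>.\<close>

lemma rect_vertical:
  assumes F: "rect F" and uv: "c \<le> d"
    and pd: "set_integrable lborel {c..d} pd" "F 0 d - F 0 c = (LINT s:{c..d}|lborel. pd s)"
  shows "set_integrable lborel {c..d} (\<lambda>t. pd t + Sg (\<lambda>s. F s t) u)"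
    "F u d - F u c = (LINT t:{c..d}|lborel. pd t + Sg (\<lambda>s. F s t) u)"
proof -
  have c: "continuous_on {c..d} (\<lambda>t. Sg (\<lambda>s. F s t) u)"
    by (rule jcont_compose[OF Sg_jcont(2)[OF rect_jcont[OF F]]]) (auto intro!: continuous_intros)
  note i = cont_set_integrable[OF c]
  show "set_integrable lborel {c..d} (\<lambda>t. pd t + Sg (\<lambda>s. F s t) u)" by (intro set_integral_add pd i)
  show "F u d - F u c = (LINT t:{c..d}|lborel. pd t + Sg (\<lambda>s. F s t) u)"
    unfolding set_integral_add(2)[OF pd(1) i(1)] i(2) using rect_Sg[OF F uv, of u] pd(2) by (simp add: algebra_simps)
qed

text \<open>The integral of \<open>F\<close> over the triangle with corners \<open>(u, u)\<close>,
  \<open>(u, v)\<close>, \<open>(v, v)\<close>, which is the domain of dependence of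
  \<open>(u, v)\<close> with respect to data on the diagonal.\<close>

definition tri :: "(real \<Rightarrow> real \<Rightarrow> complex) \<Rightarrow> real \<Rightarrow> real \<Rightarrow> complex" where
  "tri F u v = integral {u..v} (\<lambda>t. integral {u..t} (\<lambda>s. F s t))"

lemma tri_inner:
  assumes "jcont F" "u \<le> t"
  shows "integral {u..t} (\<lambda>s. F s t) = Sg (\<lambda>s. F s t) t - Sg (\<lambda>s. F s t) u"
  using Sg_diff[OF jcont_sections(2)[OF assms(1)] assms(2)] by simp

lemma tri_eq:
  assumes "jcont F"
  shows "tri F u v = integral {u..v} (\<lambda>t. Sg (\<lambda>s. F s t) t - Sg (\<lambda>s. F s t) u)"
  unfolding tri_def by (intro integral_cong) (simp add: tri_inner[OF assms])

text \<open>Integrate the \<open>v\<close>-derivative along the segment from \<open>(u, u)\<close>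
  to \<open>(u, v)\<close>. Replacing it at height \<open>t\<close> by its value at the diagonal
  point \<open>(t, t)\<close> costs the integral of \<open>F\<close> over the horizontal segment
  between them, and these segments sweep out the triangle.\<close>

lemma dAlembert:
  assumes F: "rect F" and uv: "u \<le> v"
    and pd: "set_integrable lborel {u..v} pd" "F 0 v - F 0 u = (LINT s:{u..v}|lborel. pd s)"
  shows "set_integrable lborel {u..v} (\<lambda>t. pd t + Sg (\<lambda>s. F s t) t)"
    "F u v = F u u + (LINT t:{u..v}|lborel. pd t + Sg (\<lambda>s. F s t) t) - tri F u v"
proof -
  note jF = rect_jcont[OF F]
  have c: "continuous_on {u..v} (\<lambda>t. Sg (\<lambda>s. F s t) t)" "continuous_on {u..v} (\<lambda>t. Sg (\<lambda>s. F s t) u)"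
    by (rule jcont_compose[OF Sg_jcont(2)[OF jF]]; auto intro!: continuous_intros)+
  note i = cont_set_integrable[OF c(1)] and j = cont_set_integrable[OF c(2)]
  show "set_integrable lborel {u..v} (\<lambda>t. pd t + Sg (\<lambda>s. F s t) t)" by (intro set_integral_add pd i)
  have "tri F u v = integral {u..v} (\<lambda>t. Sg (\<lambda>s. F s t) t) - integral {u..v} (\<lambda>t. Sg (\<lambda>s. F s t) u)"
    unfolding tri_eq[OF jF] by (intro Henstock_Kurzweil_Integration.integral_diff integrable_continuous_interval c)
  then show "F u v = F u u + (LINT t:{u..v}|lborel. pd t + Sg (\<lambda>s. F s t) t) - tri F u v"
    unfolding set_integral_add(2)[OF pd(1) i(1)] i(2) using rect_Sg[OF F uv, of u] pd(2) by (simp add: algebra_simps)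
qed

lemma tri_swap:
  assumes "jcont F"
  shows "tri F u v = integral {u..v} (\<lambda>s. integral {s..v} (\<lambda>t. F s t))"
proof -
  have c1: "continuous_on {u..v} (\<lambda>t. integral {u..t} (\<lambda>s. F s t))"
  proof (rule continuous_on_eq)
    show "continuous_on {u..v} (\<lambda>t. Sg (\<lambda>s. F s t) t - Sg (\<lambda>s. F s t) u)"
      by (intro continuous_on_diff; rule jcont_compose[OF Sg_jcont(2)[OF assms]]; auto intro!: continuous_intros)
  qed (simp add: tri_inner[OF assms])
  have c2: "continuous_on {u..v} (\<lambda>s. integral {s..v} (\<lambda>t. F s t))"
  proof (rule continuous_on_eq)
    show "continuous_on {u..v} (\<lambda>s. Sg (\<lambda>t. F s t) v - Sg (\<lambda>t. F s t) s)"
      by (intro continuous_on_diff; rule jcont_compose[OF Sg_jcont(1)[OF assms]]; auto intro!: continuous_intros)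
  qed (simp add: Sg_diff[OF jcont_sections(1)[OF assms]])
  have "(LINT s:{u..v}|lborel. 1 * (LINT t:{s..v}|lborel. F s t * 1)) = (LINT t:{u..v}|lborel. 1 * (LINT s:{u..t}|lborel. F s t * 1))"
    by (rule triangle_Fubini[OF set_integrable_const_Icc set_integrable_const_Icc assms])
  then show ?thesis
    by (simp add: cont_set_integrable(2)[OF jcont_sections(1)[OF assms]] cont_set_integrable(2)[OF jcont_sections(2)[OF assms]]
        cont_set_integrable(2)[OF c1] cont_set_integrable(2)[OF c2] tri_def)
qed

lemma dAlembert_horizontal:
  assumes F: "rect F" and uv: "u \<le> v"
    and gd: "set_integrable lborel {u..v} gd" "F v 0 - F u 0 = (LINT s:{u..v}|lborel. gd s)"
  shows "set_integrable lborel {u..v} (\<lambda>s. gd s + Sg (\<lambda>t. F s t) s)"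
    "F v v = F u v + (LINT s:{u..v}|lborel. gd s + Sg (\<lambda>t. F s t) s) + tri F u v"
proof -
  note jF = rect_jcont[OF F]
  have c: "continuous_on {u..v} (\<lambda>s. Sg (\<lambda>t. F s t) s)" "continuous_on {u..v} (\<lambda>s. Sg (\<lambda>t. F s t) v)"
    by (rule jcont_compose[OF Sg_jcont(1)[OF jF]]; auto intro!: continuous_intros)+
  note i = cont_set_integrable[OF c(1)] and j = cont_set_integrable[OF c(2)]
  show "set_integrable lborel {u..v} (\<lambda>s. gd s + Sg (\<lambda>t. F s t) s)" by (intro set_integral_add gd i)
  have "tri F u v = integral {u..v} (\<lambda>s. Sg (\<lambda>t. F s t) v - Sg (\<lambda>t. F s t) s)"
    unfolding tri_swap[OF jF] by (intro integral_cong) (simp add: Sg_diff[OF jcont_sections(1)[OF jF]])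
  also have "\<dots> = integral {u..v} (\<lambda>s. Sg (\<lambda>t. F s t) v) - integral {u..v} (\<lambda>s. Sg (\<lambda>t. F s t) s)"
    by (intro Henstock_Kurzweil_Integration.integral_diff integrable_continuous_interval c)
  finally show "F v v = F u v + (LINT s:{u..v}|lborel. gd s + Sg (\<lambda>t. F s t) s) + tri F u v"
    unfolding set_integral_add(2)[OF gd(1) i(1)] i(2) using rect_Sg[OF rect_swap[OF F] uv, of v] gd(2) by (simp add: algebra_simps)
qed

text \<open>The chain rule on the diagonal. The path runs from \<open>(u, u)\<close> to
  \<open>(u, v)\<close> and on to \<open>(v, v)\<close>; the triangle occurs with opposite signs in
  the two formulas and cancels.\<close>

lemma diagonal_derivative:
  assumes F: "rect F" and uv: "u \<le> v"
    and gd: "set_integrable lborel {u..v} gd" "F v 0 - F u 0 = (LINT s:{u..v}|lborel. gd s)"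
    and pd: "set_integrable lborel {u..v} pd" "F 0 v - F 0 u = (LINT s:{u..v}|lborel. pd s)"
  shows "F v v - F u u = (LINT s:{u..v}|lborel. gd s + Sg (\<lambda>t. F s t) s) + (LINT s:{u..v}|lborel. pd s + Sg (\<lambda>t. F t s) s)"
  using dAlembert(2)[OF F uv pd] dAlembert_horizontal(2)[OF F uv gd] by simp

text \<open>In the weight exp (2 * x) one integration gains a factor 1/2. Two integrations therefore
  contract by 1/4, without any smallness of the interval.\<close>

lemma integral_norm_le_exp:
  fixes f :: "real \<Rightarrow> complex"
  assumes "continuous_on {a..b} f" "a \<le> b" "\<And>x. a \<le> x \<Longrightarrow> x \<le> b \<Longrightarrow> cmod (f x) \<le> m * exp (2 * x)" "0 \<le> m"
  shows "cmod (integral {a..b} f) \<le> m / 2 * exp (2 * b)"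
proof -
  have h: "((\<lambda>x. m * exp (2 * x)) has_integral (m / 2 * exp (2 * b) - m / 2 * exp (2 * a))) {a..b}"
    by (rule fundamental_theorem_of_calculus[OF assms(2)])
      (auto intro!: derivative_eq_intros simp flip: has_real_derivative_iff_has_vector_derivative)
  have "cmod (integral {a..b} f) \<le> integral {a..b} (\<lambda>x. m * exp (2 * x))"
    by (rule integral_norm_bound_integral) (use assms h in \<open>auto intro!: integrable_continuous_interval continuous_intros\<close>)
  also have "\<dots> = m / 2 * exp (2 * b) - m / 2 * exp (2 * a)" using h by (rule integral_unique)
  also have "\<dots> \<le> m / 2 * exp (2 * b)" using assms(4) by simp
  finally show ?thesis .
qed

lemma double_integral_le_exp:
  assumes F: "jcont F" and ab: "a \<le> b" and cd: "c \<le> d" and m: "0 \<le> m"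
    and le: "\<And>s t. a \<le> s \<Longrightarrow> s \<le> b \<Longrightarrow> c \<le> t \<Longrightarrow> t \<le> d \<Longrightarrow> cmod (F s t) \<le> m * exp (2 * (s + t))"
  shows "cmod (integral {a..b} (\<lambda>s. integral {c..d} (\<lambda>t. F s t))) \<le> m / 4 * exp (2 * (b + d))"
proof -
  have c: "continuous_on {a..b} (\<lambda>s. integral {c..d} (\<lambda>t. F s t))"
  proof (rule continuous_on_eq)
    show "continuous_on {a..b} (\<lambda>s. Sg (\<lambda>t. F s t) d - Sg (\<lambda>t. F s t) c)"
      by (intro continuous_on_diff; rule jcont_compose[OF Sg_jcont(1)[OF F]]; auto intro!: continuous_intros)
  qed (simp add: Sg_diff[OF jcont_sections(1)[OF F] cd])
  have i: "cmod (integral {c..d} (\<lambda>t. F s t)) \<le> (m / 2 * exp (2 * d)) * exp (2 * s)" if "a \<le> s" "s \<le> b" for s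
  proof -
    have "cmod (integral {c..d} (\<lambda>t. F s t)) \<le> (m * exp (2 * s)) / 2 * exp (2 * d)"
      by (rule integral_norm_le_exp[OF jcont_sections(1)[OF F] cd]) (use le[OF that] m in \<open>auto simp: exp_add distrib_left mult.assoc\<close>)
    then show ?thesis by (simp add: mult_ac)
  qed
  have "cmod (integral {a..b} (\<lambda>s. integral {c..d} (\<lambda>t. F s t))) \<le> (m / 2 * exp (2 * d)) / 2 * exp (2 * b)"
    by (rule integral_norm_le_exp[OF c ab i]) (use m in auto)
  then show ?thesis by (simp add: exp_add distrib_left mult_ac)
qed

lemma exp_move_iff: "a * exp (- x) \<le> m \<longleftrightarrow> a \<le> m * exp x" for a m x :: real
  by (simp add: exp_minus divide_inverse[symmetric] pos_divide_le_eq)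

text \<open>Let \<open>m\<close> be the maximum of the weighted modulus over the box. The rectangle
  identity gives \<open>m \<le> C + m / 4\<close>, hence \<open>m \<le> 2 * C\<close>. The constant
  does not depend on \<open>R\<close>, so a bound on the axis data becomes a bound on the whole
  quadrant.\<close>

lemma rect_box_bound:
  assumes F: "rect F" and R: "0 \<le> R" and C: "0 \<le> C"
    and b: "\<And>u v. 0 \<le> u \<Longrightarrow> u \<le> R \<Longrightarrow> 0 \<le> v \<Longrightarrow> v \<le> R \<Longrightarrow> cmod (F u 0 + F 0 v - F 0 0) \<le> C * exp (2 * (u + v))"
  shows "\<And>u v. 0 \<le> u \<Longrightarrow> u \<le> R \<Longrightarrow> 0 \<le> v \<Longrightarrow> v \<le> R \<Longrightarrow> cmod (F u v) \<le> 2 * C * exp (2 * (u + v))"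
proof -
  note jF = rect_jcont[OF F]
  define f where "f z = cmod (F (fst z) (snd z)) * exp (- (2 * (fst z + snd z)))" for z
  have "continuous_on ({0..R} \<times> {0..R}) f"
    unfolding f_def by (intro continuous_intros jcont_compose[OF jF])
  then obtain z where z: "z \<in> {0..R} \<times> {0..R}" "\<And>y. y \<in> {0..R} \<times> {0..R} \<Longrightarrow> f y \<le> f z"
  proof -
    have "compact ({0..R} \<times> {0..R})" "{0..R} \<times> {0..R} \<noteq> {}" using R by (auto intro: compact_Times)
    from continuous_attains_sup[OF this \<open>continuous_on ({0..R} \<times> {0..R}) f\<close>] that show ?thesis by blast
  qed
  define m where "m = f z"
  have m0: "0 \<le> m" by (simp add: m_def f_def)
  have le: "cmod (F s t) \<le> m * exp (2 * (s + t))" if "0 \<le> s" "s \<le> R" "0 \<le> t" "t \<le> R" for s t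
  proof -
    have "cmod (F s t) * exp (- (2 * (s + t))) \<le> m" using z(2)[of "(s, t)"] that by (simp add: f_def m_def)
    then show ?thesis by (simp only: exp_move_iff)
  qed
  obtain u v where uv: "z = (u, v)" by (cases z)
  then have uv': "0 \<le> u" "u \<le> R" "0 \<le> v" "v \<le> R" using z(1) by auto
  have "F u v = (F u 0 + F 0 v - F 0 0) + integral {0..u} (\<lambda>s. integral {0..v} (\<lambda>t. F s t))"
    using rectD[OF F, of 0 u 0 v] uv' by (simp add: algebra_simps)
  then have "cmod (F u v) \<le> cmod (F u 0 + F 0 v - F 0 0) + cmod (integral {0..u} (\<lambda>s. integral {0..v} (\<lambda>t. F s t)))"
    by (metis norm_triangle_ineq)
  also have "\<dots> \<le> C * exp (2 * (u + v)) + m / 4 * exp (2 * (u + v))"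
    using uv' by (intro add_mono b double_integral_le_exp jF m0 le) auto
  finally have "cmod (F u v) * exp (- (2 * (u + v))) \<le> C + m / 4"
    by (simp only: exp_move_iff distrib_right)
  then have "m \<le> C + m / 4" by (simp add: m_def f_def uv)
  then have "m \<le> 2 * C" using m0 C by simp
  then show "cmod (F u v) \<le> 2 * C * exp (2 * (u + v))" if "0 \<le> u" "u \<le> R" "0 \<le> v" "v \<le> R" for u v
    by (rule order_trans[OF le[OF that] mult_right_mono]) (use \<open>m \<le> 2 * C\<close> in auto)
qed

text \<open>\<open>rect_box_bound\<close> with the constant \<open>C = 0\<close>.\<close>

lemma Goursat_zero:
  assumes F: "rect F" and "0 \<le> a" "\<And>u. 0 \<le> u \<Longrightarrow> u \<le> a \<Longrightarrow> F u 0 = 0" "\<And>v. 0 \<le> v \<Longrightarrow> v \<le> a \<Longrightarrow> F 0 v = 0"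
    and "0 \<le> u" "u \<le> a" "0 \<le> v" "v \<le> a"
  shows "F u v = 0"
  using rect_box_bound[OF F assms(2) order_refl _ assms(5-8)] assms(2-4) by simp

text \<open>A weighted maximum again, with weight exp (2 * (v - u)): it grows with the distance from
  the diagonal, and integration over the triangle of dependence gains 1/4. The maximum satisfies
  \<open>m \<le> m / 4\<close>.\<close>

lemma Cauchy_zero:
  assumes F: "rect F" and ab: "a \<le> b"
    and eq: "\<And>u v. a \<le> u \<Longrightarrow> u \<le> v \<Longrightarrow> v \<le> b \<Longrightarrow> F u v = - tri F u v"
    and uv: "a \<le> u" "u \<le> v" "v \<le> b"
  shows "F u v = 0"
proof -
  note jF = rect_jcont[OF F]
  define f where "f z = cmod (F (fst z) (snd z)) * exp (- (2 * (snd z - fst z)))" for z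
  define D where "D = ({a..b} \<times> {a..b}) \<inter> {z. fst z \<le> snd z}"
  have cD: "compact D" unfolding D_def
    by (intro compact_Int_closed compact_Times closed_Collect_le continuous_intros) auto
  have "continuous_on D f"
    unfolding f_def by (intro continuous_intros jcont_compose[OF jF])
  then obtain z where z: "z \<in> D" "\<And>y. y \<in> D \<Longrightarrow> f y \<le> f z"
  proof -
    have "(a, a) \<in> D" using ab by (simp add: D_def)
    then have "D \<noteq> {}" by blast
    from continuous_attains_sup[OF cD this \<open>continuous_on D f\<close>] that show ?thesis by blast
  qed
  define m where "m = f z"
  have m0: "0 \<le> m" by (simp add: m_def f_def)
  have le: "cmod (F s t) \<le> m * exp (2 * (t - s))" if "a \<le> s" "s \<le> t" "t \<le> b" for s t
  proof -
    have "cmod (F s t) * exp (- (2 * (t - s))) \<le> m" using z(2)[of "(s, t)"] that by (simp add: f_def m_def D_def)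
    then show ?thesis by (simp only: exp_move_iff)
  qed
  obtain p q where pq: "z = (p, q)" by (cases z)
  then have pq': "a \<le> p" "p \<le> q" "q \<le> b" using z(1) by (auto simp: D_def)
  have inner: "cmod (integral {p..t} (\<lambda>s. F s t)) \<le> (m / 2 * exp (- (2 * p))) * exp (2 * t)" if t: "p \<le> t" "t \<le> q" for t
  proof -
    have h: "((\<lambda>s. m * exp (2 * (t - s))) has_integral (- (m / 2 * exp (2 * (t - t))) - - (m / 2 * exp (2 * (t - p))))) {p..t}"
      by (rule fundamental_theorem_of_calculus[OF t(1)])
        (auto intro!: derivative_eq_intros simp flip: has_real_derivative_iff_has_vector_derivative)
    have "cmod (integral {p..t} (\<lambda>s. F s t)) \<le> integral {p..t} (\<lambda>s. m * exp (2 * (t - s)))"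
      by (rule integral_norm_bound_integral)
        (use le t pq' in \<open>auto intro!: integrable_continuous_interval jcont_sections[OF jF] continuous_intros\<close>)
    also have "\<dots> = m / 2 * exp (2 * (t - p)) - m / 2" using integral_unique[OF h] by simp
    also have "\<dots> \<le> m / 2 * exp (2 * (t - p))" using m0 by simp
    also have "exp (2 * (t - p)) = exp (- (2 * p)) * exp (2 * t)" by (simp add: exp_add[symmetric])
    finally show ?thesis by (simp add: mult_ac)
  qed
  have c1: "continuous_on {p..q} (\<lambda>t. integral {p..t} (\<lambda>s. F s t))"
  proof (rule continuous_on_eq)
    show "continuous_on {p..q} (\<lambda>t. Sg (\<lambda>s. F s t) t - Sg (\<lambda>s. F s t) p)"
      by (intro continuous_on_diff; rule jcont_compose[OF Sg_jcont(2)[OF jF]]; auto intro!: continuous_intros)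
  qed (simp add: tri_inner[OF jF])
  have "cmod (F p q) = cmod (tri F p q)" using eq[OF pq'] by simp
  also have "\<dots> \<le> (m / 2 * exp (- (2 * p))) / 2 * exp (2 * q)"
    unfolding tri_def using m0 by (intro integral_norm_le_exp[OF c1 pq'(2) inner]) auto
  also have "\<dots> = m / 4 * exp (2 * (q - p))"
    by (simp add: exp_add[symmetric] algebra_simps)
  finally have "cmod (F p q) * exp (- (2 * (q - p))) \<le> m / 4"
    by (simp only: exp_move_iff)
  then have "m \<le> m / 4" by (simp add: m_def f_def pq)
  then have "m = 0" using m0 by simp
  then show ?thesis using le[OF uv] by simp
qed

subsection \<open>Laplace transforms of the Cauchy data\<close>

lemma set_integral_tendsto_half:
  fixes f :: "real \<Rightarrow> complex"
  assumes f: "integrable lborel f" and z: "\<And>x. x \<le> 0 \<Longrightarrow> f x = 0"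
  shows "(\<lambda>n. LINT x:{0..real n}|lborel. f x) \<longlonglongrightarrow> (LINT x|lborel. f x)"
  unfolding set_lebesgue_integral_def
proof (rule integral_dominated_convergence[where w="\<lambda>x. norm (f x)"])
  show "AE x in lborel. (\<lambda>n. indicat_real {0..real n} x *\<^sub>R f x) \<longlonglongrightarrow> f x"
  proof (rule AE_I2, rule tendsto_eventually)
    fix x :: real
    obtain M where M: "x \<le> real M" using real_arch_simple by blast
    have "indicat_real {0..real n} x *\<^sub>R f x = f x" if "M \<le> n" for n
      using M that z[of x] by (cases "x \<le> 0") auto
    then show "\<forall>\<^sub>F n in sequentially. indicat_real {0..real n} x *\<^sub>R f x = f x"
      unfolding eventually_sequentially by blast
  qed
qed (use f in \<open>auto split: split_indicator\<close>)

lemma set_integral_half_cong: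
  fixes f h :: "real \<Rightarrow> complex"
  assumes "\<And>x. 0 < x \<Longrightarrow> x \<le> b \<Longrightarrow> f x = h x" "set_borel_measurable lborel {0..b} f" "set_borel_measurable lborel {0..b} h"
  shows "(LINT x:{0..b}|lborel. f x) = (LINT x:{0..b}|lborel. h x)"
  unfolding set_lebesgue_integral_def
proof (rule integral_cong_AE)
  show "AE x in lborel. indicat_real {0..b} x *\<^sub>R f x = indicat_real {0..b} x *\<^sub>R h x"
    using AE_lborel_singleton[of 0]
    by eventually_elim (auto simp: assms(1) split: split_indicator)
qed (use assms(2,3) in \<open>auto simp: set_borel_measurable_def\<close>)

lemma set_integrable_mult_cont:
  fixes q k :: "real \<Rightarrow> complex"
  assumes "set_integrable lborel {a..b} q" "continuous_on {a..b} k"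
  shows "set_integrable lborel {a..b} (\<lambda>x. k x * q x)"
proof -
  have "bounded (k ` {a..b})" by (intro compact_imp_bounded compact_continuous_image assms) auto
  then obtain M where M: "\<And>x. x \<in> {a..b} \<Longrightarrow> cmod (k x) \<le> M" unfolding bounded_iff by blast
  have m: "(\<lambda>x. (indicat_real {a..b} x *\<^sub>R k x) * (indicat_real {a..b} x *\<^sub>R q x)) \<in> borel_measurable lborel"
    using cont_set_integrable(1)[OF assms(2)] assms(1)
    by (intro borel_measurable_times) (auto simp: set_integrable_def)
  have "integrable lborel (\<lambda>x. (indicat_real {a..b} x *\<^sub>R k x) * (indicat_real {a..b} x *\<^sub>R q x))"
  proof (rule Bochner_Integration.integrable_bound[OF _ m])
    show "integrable lborel (\<lambda>x. cor \<bar>M\<bar> * (indicat_real {a..b} x *\<^sub>R q x))"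
      by (rule integrable_mult_right) (use assms(1) in \<open>simp add: set_integrable_def\<close>)
    show "AE x in lborel. norm ((indicat_real {a..b} x *\<^sub>R k x) * (indicat_real {a..b} x *\<^sub>R q x)) \<le> norm (cor \<bar>M\<bar> * (indicat_real {a..b} x *\<^sub>R q x))"
    proof (rule AE_I2)
      fix x show "norm ((indicat_real {a..b} x *\<^sub>R k x) * (indicat_real {a..b} x *\<^sub>R q x)) \<le> norm (cor \<bar>M\<bar> * (indicat_real {a..b} x *\<^sub>R q x))"
        using M[of x] by (auto split: split_indicator simp: norm_mult intro!: mult_right_mono)
    qed
  qed
  then show ?thesis unfolding set_integrable_def
    by (rule Bochner_Integration.integrable_cong[THEN iffD1, rotated -1]) (auto split: split_indicator)
qed

lemma integral_exp_complex:
  assumes "a \<le> b"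
  shows "(LINT t:{a..b}|lborel. - cor \<kappa> * cor (exp (- (\<kappa> * t)))) = cor (exp (- (\<kappa> * b))) - cor (exp (- (\<kappa> * a)))"
proof -
  have c: "continuous_on {a..b} (\<lambda>t. - cor \<kappa> * cor (exp (- (\<kappa> * t))))"
    by (intro continuous_intros)
  have hi: "((\<lambda>t. - cor \<kappa> * cor (exp (- (\<kappa> * t)))) has_integral (cor (exp (- (\<kappa> * b))) - cor (exp (- (\<kappa> * a))))) {a..b}"
  proof (rule fundamental_theorem_of_calculus[OF assms])
    fix t
    have "((\<lambda>t. exp (- (\<kappa> * t))) has_real_derivative (- \<kappa> * exp (- (\<kappa> * t)))) (at t within {a..b})"
      by (auto intro!: derivative_eq_intros)
    then have "((\<lambda>t. cor (exp (- (\<kappa> * t)))) has_vector_derivative cor (- \<kappa> * exp (- (\<kappa> * t)))) (at t within {a..b})"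
      by (rule has_vector_derivative_of_real[unfolded has_real_derivative_iff_has_vector_derivative[symmetric]])
    then show "((\<lambda>t. cor (exp (- (\<kappa> * t)))) has_vector_derivative - cor \<kappa> * cor (exp (- (\<kappa> * t)))) (at t within {a..b})"
      by simp
  qed
  show ?thesis unfolding cont_set_integrable(2)[OF c] by (rule integral_unique[OF hi])
qed

text \<open>Integration by parts for a primitive \<open>Q\<close> of a merely integrable
  \<open>q\<close>: \<open>triangle_Fubini\<close>, with the derivative of the exponential as
  kernel, exchanges the two integrations.\<close>

lemma exp_product_rule:
  fixes q Q :: "real \<Rightarrow> complex"
  assumes ab: "a \<le> b" and q: "set_integrable lborel {a..b} q" and Q: "continuous_on {a..b} Q"
    and eq: "\<And>v. a \<le> v \<Longrightarrow> v \<le> b \<Longrightarrow> Q v = Q a + (LINT s:{a..v}|lborel. q s)"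
  shows "(LINT v:{a..b}|lborel. cor (exp (- (\<kappa> * v))) * (q v - cor \<kappa> * Q v))
    = cor (exp (- (\<kappa> * b))) * Q b - cor (exp (- (\<kappa> * a))) * Q a"
proof -
  let ?E = "\<lambda>v. cor (exp (- (\<kappa> * v)))"
  have cE: "continuous_on S ?E" for S by (intro continuous_intros)
  have i1: "set_integrable lborel {a..b} (\<lambda>v. ?E v * q v)" by (rule set_integrable_mult_cont[OF q cE])
  have i2: "set_integrable lborel {a..b} (\<lambda>v. - cor \<kappa> * ?E v * Q v)"
    by (rule cont_set_integrable) (intro continuous_intros Q)
  have i3: "set_integrable lborel {a..b} (\<lambda>v. - cor \<kappa> * ?E v * Q a)"
    by (rule cont_set_integrable) (intro continuous_intros)
  have "(LINT s:{a..b}|lborel. q s * (LINT t:{s..b}|lborel. - cor \<kappa> * ?E t * 1)) = (LINT t:{a..b}|lborel. 1 * (LINT s:{a..t}|lborel. - cor \<kappa> * ?E t * q s))"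
    by (rule triangle_Fubini[OF q set_integrable_const_Icc]) (intro continuous_intros)
  also have "(LINT s:{a..b}|lborel. q s * (LINT t:{s..b}|lborel. - cor \<kappa> * ?E t * 1)) = (LINT s:{a..b}|lborel. ?E b * q s - ?E s * q s)"
  proof (rule set_lebesgue_integral_cong)
    show "\<forall>x. x \<in> {a..b} \<longrightarrow> q x * (LINT t:{x..b}|lborel. - cor \<kappa> * ?E t * 1) = ?E b * q x - ?E x * q x"
    proof safe
      fix x assume "x \<in> {a..b}"
      then have "(LINT t:{x..b}|lborel. - cor \<kappa> * ?E t * 1) = ?E b - ?E x"
        using integral_exp_complex[of x b \<kappa>] by (simp only: mult_1_right atLeastAtMost_iff)
      then show "q x * (LINT t:{x..b}|lborel. - cor \<kappa> * ?E t * 1) = ?E b * q x - ?E x * q x"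
        by (simp only: left_diff_distrib right_diff_distrib mult.commute)
    qed
  qed simp
  also have "\<dots> = ?E b * (LINT s:{a..b}|lborel. q s) - (LINT s:{a..b}|lborel. ?E s * q s)"
    using q i1 by (subst set_integral_diff(2)) auto
  also have "(LINT t:{a..b}|lborel. 1 * (LINT s:{a..t}|lborel. - cor \<kappa> * ?E t * q s)) = (LINT t:{a..b}|lborel. - cor \<kappa> * ?E t * Q t - - cor \<kappa> * ?E t * Q a)"
  proof (rule set_lebesgue_integral_cong)
    show "\<forall>t. t \<in> {a..b} \<longrightarrow> 1 * (LINT s:{a..t}|lborel. - cor \<kappa> * ?E t * q s) = - cor \<kappa> * ?E t * Q t - - cor \<kappa> * ?E t * Q a"
    proof safe
      fix t assume t: "t \<in> {a..b}"
      have "(LINT s:{a..t}|lborel. - cor \<kappa> * ?E t * q s) = - cor \<kappa> * ?E t * (LINT s:{a..t}|lborel. q s)"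
        by (rule set_integral_mult_right)
      also have "(LINT s:{a..t}|lborel. q s) = Q t - Q a" using eq[of t] t by simp
      finally show "1 * (LINT s:{a..t}|lborel. - cor \<kappa> * ?E t * q s) = - cor \<kappa> * ?E t * Q t - - cor \<kappa> * ?E t * Q a"
        by (simp add: algebra_simps)
    qed
  qed simp
  also have "\<dots> = (LINT t:{a..b}|lborel. - cor \<kappa> * ?E t * Q t) - (LINT t:{a..b}|lborel. - cor \<kappa> * ?E t * Q a)"
    by (rule set_integral_diff(2)[OF i2 i3])
  also have "(LINT t:{a..b}|lborel. - cor \<kappa> * ?E t * Q a) = (?E b - ?E a) * Q a"
    by (subst set_integral_mult_left) (simp only: integral_exp_complex[OF ab])
  finally have 1: "?E b * (LINT s:{a..b}|lborel. q s) - (LINT s:{a..b}|lborel. ?E s * q s) = (LINT t:{a..b}|lborel. - cor \<kappa> * ?E t * Q t) - (?E b - ?E a) * Q a" .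
  have "(LINT v:{a..b}|lborel. ?E v * (q v - cor \<kappa> * Q v)) = (LINT v:{a..b}|lborel. ?E v * q v + - cor \<kappa> * ?E v * Q v)"
    by (rule set_lebesgue_integral_cong) (auto simp: algebra_simps)
  also have "\<dots> = (LINT v:{a..b}|lborel. ?E v * q v) + (LINT v:{a..b}|lborel. - cor \<kappa> * ?E v * Q v)"
    by (rule set_integral_add(2)[OF i1 i2])
  also have "\<dots> = ?E b * (Q a + (LINT s:{a..b}|lborel. q s)) - ?E a * Q a"
    using 1 by (simp add: algebra_simps)
  also have "Q a + (LINT s:{a..b}|lborel. q s) = Q b" using eq[of b] ab by simp
  finally show ?thesis .
qed

lemma Sg_has_vector_derivative:
  assumes "continuous_on UNIV f"
  shows "(Sg f has_vector_derivative f u) (at u within S)"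
proof -
  have "((\<lambda>x. integral {u - 1..x} f) has_vector_derivative f u) (at u within {u - 1..u + 1})"
    by (rule integral_has_vector_derivative) (use assms in \<open>auto intro: continuous_on_subset\<close>)
  then have "((\<lambda>x. integral {u - 1..x} f) has_vector_derivative f u) (at u)"
    by (simp add: at_within_Icc_at)
  then have "((\<lambda>x. Sg f (u - 1) + integral {u - 1..x} f) has_vector_derivative f u) (at u)"
    by (auto intro!: derivative_eq_intros)
  then have "(Sg f has_vector_derivative f u) (at u)"
  proof (rule has_vector_derivative_transform_within_open[of _ _ _ "{u-1<..}"])
    fix x assume "x \<in> {u - 1<..}"
    then show "Sg f (u - 1) + integral {u - 1..x} f = Sg f x" using Sg_diff[OF assms, of "u - 1" x] by (simp add: algebra_simps)
  qed auto
  then show ?thesis by (rule has_vector_derivative_at_within)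
qed

text \<open>Cauchy-Schwarz gives the square root of \<open>u * nsq q\<close>, which the mean
  inequality makes linear in \<open>u\<close>. The generous exponential is the weight used in
  \<open>rect_box_bound\<close>.\<close>

lemma L2_primitive_bound:
  assumes "L2 q" "0 \<le> u"
  shows "cmod (LINT s:{0..u}|lborel. q s) \<le> (1 + nsq q) * exp (2 * u)"
proof -
  have "cmod (LINT s:{0..u}|lborel. q s) \<le> (LINT s:{0..u}|lborel. cmod (q s))"
    by (rule set_integral_norm_bound[OF L2_set_integrable[OF assms(1)]])
  then have "(cmod (LINT s:{0..u}|lborel. q s))\<^sup>2 \<le> (LINT s:{0..u}|lborel. cmod (q s))\<^sup>2"
    by (intro power_mono) auto
  also have "\<dots> \<le> u * (LINT s:{0..u}|lborel. (cmod (q s))\<^sup>2)"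
    using L2_interval_CS[OF assms(1,2)] by simp
  also have "\<dots> \<le> u * nsq q"
  proof (intro mult_left_mono assms)
    have "(LINT s:{0..u}|lborel. (cmod (q s))\<^sup>2) = nsq (\<lambda>s. indicator {0..u} s * q s)"
      unfolding nsq_def set_lebesgue_integral_def by (intro Bochner_Integration.integral_cong refl) (auto split: split_indicator)
    then show "(LINT s:{0..u}|lborel. (cmod (q s))\<^sup>2) \<le> nsq q" using L2_restrict(2)[OF assms(1), of "{0..u}"] by simp
  qed
  also have "\<dots> \<le> ((u + nsq q) / 2)\<^sup>2"
    using zero_le_power2[of "u - nsq q"] by (simp add: power2_eq_square field_simps)
  finally have "cmod (LINT s:{0..u}|lborel. q s) \<le> (u + nsq q) / 2"
    by (rule power2_le_imp_le) (use assms nsq_nonneg[of q] in simp)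
  also have "\<dots> \<le> (1 + 2 * u) + nsq q" using assms nsq_nonneg[of q] by simp
  also have "\<dots> \<le> exp (2 * u) + nsq q * exp (2 * u)"
    using exp_ge_add_one_self[of "2 * u"] mult_left_mono[of 1 "exp (2 * u)" "nsq q"] nsq_nonneg[of q] assms
    by (intro add_mono) auto
  finally show ?thesis by (simp add: distrib_right)
qed

text \<open>\<open>gd\<close> and \<open>pd\<close> are the derivatives of the axis values, extended
  by zero. Only the nonnegative half axes are constrained, so the locale fits both the constructed
  solution and an arbitrary one, whatever it does outside the wedge.\<close>

locale wedge =
  fixes F :: "real \<Rightarrow> real \<Rightarrow> complex" and gd pd :: "real \<Rightarrow> complex"
  assumes rect: "rect F" and Lgd: "L2 gd" and Lpd: "L2 pd"
    and zgd: "\<And>x. x \<le> 0 \<Longrightarrow> gd x = 0" and zpd: "\<And>x. x \<le> 0 \<Longrightarrow> pd x = 0"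
    and Fu: "\<And>u. 0 \<le> u \<Longrightarrow> F u 0 = F 0 0 + (LINT s:{0..u}|lborel. gd s)"
    and Fv: "\<And>v. 0 \<le> v \<Longrightarrow> F 0 v = F 0 0 + (LINT s:{0..v}|lborel. pd s)"

text \<open>Time reversal: exchanging \<open>u\<close> and \<open>v\<close> changes the sign of
  \<open>t\<close>. Every statement about \<open>Y\<close> and \<open>pd\<close> thereby has a
  mirror image about \<open>X\<close> and \<open>gd\<close>.\<close>

lemma wedge_swap: "wedge F gd pd \<Longrightarrow> wedge (\<lambda>u v. F v u) pd gd"
  unfolding wedge_def by (intro conjI; (elim conjE)?; (rule rect_swap)?; assumption)

context wedge
begin

text \<open>\<open>X\<close> and \<open>Y\<close> are the derivatives of \<open>F\<close> in
  \<open>u\<close> and \<open>v\<close> at the diagonal point \<open>(w, w)\<close>, continued from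
  the axes by the equation. In terms of \<phi>, \<open>X + Y\<close> is twice the space derivative
  and \<open>Y - X\<close> twice the time derivative at \<open>(0, 2 * w)\<close>.\<close>

definition "X w = gd w + Sg (\<lambda>t. F w t) w"
definition "Y w = pd w + Sg (\<lambda>s. F s w) w"

lemma jF: "jcont F" by (rule rect_jcont[OF rect])

lemma F_vertical: "0 \<le> c \<Longrightarrow> c \<le> d \<Longrightarrow> F 0 d - F 0 c = (LINT s:{c..d}|lborel. pd s)"
  using Fv[of c] Fv[of d] set_integral_split_Icc[OF L2_set_integrable[OF Lpd], of 0 c d] by simp

lemma F_horizontal: "0 \<le> c \<Longrightarrow> c \<le> d \<Longrightarrow> F d 0 - F c 0 = (LINT s:{c..d}|lborel. gd s)"
  using Fu[of c] Fu[of d] set_integral_split_Icc[OF L2_set_integrable[OF Lgd], of 0 c d] by simp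

lemma XY_measurable: "X \<in> borel_measurable borel" "Y \<in> borel_measurable borel"
proof -
  have "continuous_on UNIV (\<lambda>w. Sg (\<lambda>t. F w t) w)" "continuous_on UNIV (\<lambda>w. Sg (\<lambda>s. F s w) w)"
    by (rule jcont_compose[OF Sg_jcont(1)[OF jF]] jcont_compose[OF Sg_jcont(2)[OF jF]]; intro continuous_intros)+
  then show "X \<in> borel_measurable borel" "Y \<in> borel_measurable borel"
    unfolding X_def[abs_def] Y_def[abs_def]
    by - (intro borel_measurable_add L2_measurable[OF Lgd] L2_measurable[OF Lpd], erule borel_measurable_continuous_onI)+
qed

lemma diag_eq:
  assumes "0 \<le> u" "u \<le> v"
  shows "set_integrable lborel {u..v} X" "set_integrable lborel {u..v} Y"
    "F v v - F u u = (LINT s:{u..v}|lborel. X s) + (LINT s:{u..v}|lborel. Y s)"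
    "F u v = F u u + (LINT s:{u..v}|lborel. Y s) - tri F u v"
  unfolding X_def[abs_def] Y_def[abs_def]
  using dAlembert[OF rect assms(2) L2_set_integrable[OF Lpd] F_vertical[OF assms]]
    dAlembert_horizontal(1)[OF rect assms(2) L2_set_integrable[OF Lgd] F_horizontal[OF assms]]
    diagonal_derivative[OF rect assms(2) L2_set_integrable[OF Lgd] F_horizontal[OF assms] L2_set_integrable[OF Lpd] F_vertical[OF assms]]
  by simp_all

lemma growth: "\<exists>C\<ge>0. \<forall>u v. 0 \<le> u \<longrightarrow> 0 \<le> v \<longrightarrow> cmod (F u v) \<le> C * exp (2 * (u + v))"
proof -
  define C where "C = cmod (F 0 0) + (1 + nsq gd) + (1 + nsq pd)"
  have C: "0 \<le> C" using nsq_nonneg[of gd] nsq_nonneg[of pd] by (simp add: C_def)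
  have b: "cmod (F u 0 + F 0 v - F 0 0) \<le> C * exp (2 * (u + v))" if uv: "0 \<le> u" "0 \<le> v" for u v
  proof -
    have "F u 0 + F 0 v - F 0 0 = F 0 0 + ((LINT s:{0..u}|lborel. gd s) + (LINT s:{0..v}|lborel. pd s))"
      using Fu[OF uv(1)] Fv[OF uv(2)] by simp
    then have "cmod (F u 0 + F 0 v - F 0 0) \<le> cmod (F 0 0) + (cmod (LINT s:{0..u}|lborel. gd s) + cmod (LINT s:{0..v}|lborel. pd s))"
      using norm_triangle_ineq[of "F 0 0"] norm_triangle_ineq[of "LINT s:{0..u}|lborel. gd s"] by (smt (verit))
    also have "\<dots> \<le> cmod (F 0 0) * exp (2 * (u + v)) + ((1 + nsq gd) * exp (2 * (u + v)) + (1 + nsq pd) * exp (2 * (u + v)))"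
    proof (intro add_mono)
      show "cmod (F 0 0) \<le> cmod (F 0 0) * exp (2 * (u + v))" using uv mult_left_mono[of 1 "exp (2 * (u + v))" "cmod (F 0 0)"] by simp
      show "cmod (LINT s:{0..u}|lborel. gd s) \<le> (1 + nsq gd) * exp (2 * (u + v))"
        by (rule order_trans[OF L2_primitive_bound[OF Lgd uv(1)]]) (use uv nsq_nonneg[of gd] in \<open>auto intro!: mult_left_mono\<close>)
      show "cmod (LINT s:{0..v}|lborel. pd s) \<le> (1 + nsq pd) * exp (2 * (u + v))"
        by (rule order_trans[OF L2_primitive_bound[OF Lpd uv(2)]]) (use uv nsq_nonneg[of pd] in \<open>auto intro!: mult_left_mono\<close>)
    qed
    also have "\<dots> = C * exp (2 * (u + v))" by (simp add: C_def algebra_simps)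
    finally show ?thesis .
  qed
  have "cmod (F u v) \<le> 2 * C * exp (2 * (u + v))" if "0 \<le> u" "0 \<le> v" for u v
    by (rule rect_box_bound[OF rect, of "max u v", OF _ C b]) (use that in auto)
  then show ?thesis using C by (intro exI[of _ "2 * C"]) auto
qed

definition Fd where "Fd = half (\<lambda>w. F w w)"
definition Xd where "Xd = half X"
definition Yd where "Yd = half Y"

lemma half_measurable: "f \<in> borel_measurable borel \<Longrightarrow> half f \<in> borel_measurable borel"
  unfolding half_def[abs_def] by measurable

lemma d_measurable: "Fd \<in> borel_measurable borel" "Xd \<in> borel_measurable borel" "Yd \<in> borel_measurable borel"
  unfolding Fd_def Xd_def Yd_def
  by (intro half_measurable XY_measurable borel_measurable_continuous_onI jcont_sections[OF jF])+

text \<open>On the diagonal the bound of \<open>growth\<close> is exp (4 * w), so the weight of rate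
  5 leaves exp (- w). The same holds for the integral term in \<open>Y\<close>.\<close>

lemma Fd_weighted: "L2 (\<lambda>w. cor (exp (- (5 * w))) * Fd w)"
  and Yd_weighted: "L2 (\<lambda>w. cor (exp (- (5 * w))) * Yd w)"
proof -
  obtain C where C: "0 \<le> C" "\<And>u v. 0 \<le> u \<Longrightarrow> 0 \<le> v \<Longrightarrow> cmod (F u v) \<le> C * exp (2 * (u + v))"
    using growth by blast
  have m: "(\<lambda>w. cor (exp (- (5 * w))) * f w) \<in> borel_measurable borel" if "f \<in> borel_measurable borel" for f
    using that by measurable
  have e: "exp (- (5 * w)) * exp (4 * w) = exp (- w)" for w :: real by (simp add: exp_add[symmetric])
  have LC: "L2 (\<lambda>w. cor C * ex 1 w)" by (intro L2_cmul L2_ex) auto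
  have bd: "exp (- (5 * w)) * x \<le> C * exp (- w)" if "x \<le> C * exp (4 * w)" for x w :: real
  proof -
    have "exp (- (5 * w)) * x \<le> exp (- (5 * w)) * (C * exp (4 * w))" using that by (rule mult_left_mono) simp
    also have "\<dots> = C * (exp (- (5 * w)) * exp (4 * w))" by (simp only: mult_ac)
    finally show ?thesis unfolding e .
  qed
  show "L2 (\<lambda>w. cor (exp (- (5 * w))) * Fd w)"
  proof (rule L2_bound(1)[OF m[OF d_measurable(1)] LC])
    fix w show "cmod (cor (exp (- (5 * w))) * Fd w) \<le> cmod (cor C * ex 1 w)"
    proof (cases "0 < w")
      case True
      then show ?thesis using bd[OF C(2)[of w w, simplified mult.assoc[symmetric], simplified]] C(1)
        by (simp add: Fd_def half_pos ex_pos norm_mult)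
    qed (simp add: Fd_def half_nonpos)
  qed
  have S: "L2 (\<lambda>w. cor (exp (- (5 * w))) * half (\<lambda>w. Sg (\<lambda>s. F s w) w) w)"
  proof (rule L2_bound(1)[OF m LC])
    show "half (\<lambda>w. Sg (\<lambda>s. F s w) w) \<in> borel_measurable borel"
      by (intro half_measurable borel_measurable_continuous_onI jcont_compose[OF Sg_jcont(2)[OF jF]] continuous_intros)
    fix w show "cmod (cor (exp (- (5 * w))) * half (\<lambda>w. Sg (\<lambda>s. F s w) w) w) \<le> cmod (cor C * ex 1 w)"
    proof (cases "0 < w")
      case True
      have "cmod (Sg (\<lambda>s. F s w) w) = cmod (integral {0..w} (\<lambda>s. F s w))"
        using True by (simp add: Sg_nonneg[OF jcont_sections(2)[OF jF]])
      also have "\<dots> \<le> (C * exp (2 * w)) / 2 * exp (2 * w)"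
      proof (rule integral_norm_le_exp[OF jcont_sections(2)[OF jF]])
        fix s :: real assume "0 \<le> s"
        then show "cmod (F s w) \<le> C * exp (2 * w) * exp (2 * s)"
          using C(2)[of s w] True by (simp add: exp_add[symmetric] mult.assoc distrib_left add.commute)
      qed (use True C in auto)
      also have "\<dots> = C * exp (4 * w) / 2" by (simp add: exp_add[symmetric])
      also have "\<dots> \<le> C * exp (4 * w)" using C(1) by simp
      finally show ?thesis using True bd[of "cmod (Sg (\<lambda>s. F s w) w)" w] C(1) by (simp add: half_pos ex_pos norm_mult)
    qed (simp add: half_nonpos)
  qed
  have P: "L2 (\<lambda>w. cor (exp (- (5 * w))) * pd w)"
  proof (rule L2_bound(1)[OF m[OF L2_measurable[OF Lpd]] Lpd])
    fix w show "cmod (cor (exp (- (5 * w))) * pd w) \<le> cmod (pd w)"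
      using mult_right_mono[of "exp (- (5 * w))" 1 "cmod (pd w)"] zpd[of w] by (cases "0 < w") (auto simp: norm_mult)
  qed
  have "cor (exp (- (5 * w))) * Yd w = cor (exp (- (5 * w))) * pd w + cor (exp (- (5 * w))) * half (\<lambda>w. Sg (\<lambda>s. F s w) w) w" for w
    using zpd[of w] by (cases "0 < w") (auto simp: Yd_def half_def Y_def algebra_simps)
  then show "L2 (\<lambda>w. cor (exp (- (5 * w))) * Yd w)" using L2_add(1)[OF P S] by simp
qed

lemma weighted_integrable:
  assumes "L2 (\<lambda>w. cor (exp (- (5 * w))) * f w)" "5 < \<kappa>"
  shows "integrable lborel (\<lambda>w. f w * ex \<kappa> w)"
proof -
  have "(cor (exp (- (5 * w))) * f w) * ex (\<kappa> - 5) w = f w * ex \<kappa> w" for w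
    by (cases "0 < w") (auto simp: ex_def exp_add[symmetric] algebra_simps simp flip: of_real_mult)
  moreover have "0 < \<kappa> - 5" using assms(2) by simp
  ultimately show ?thesis using L2_mult_integrable[OF assms(1) L2_ex[of "\<kappa> - 5"]] by (simp only:)
qed

text \<open>The domain is the triangle \<open>0 \<le> u \<le> v \<le> V\<close>. Since exp (- \<mu>
  * u - v / \<mu>) solves the same equation, the interior terms cancel and three sides remain: the
  diagonal, the axis \<open>u = 0\<close>, and the side \<open>v = V\<close>, which is the last
  integral and is disposed of in \<open>diag_small\<close>.\<close>

lemma Green:
  assumes "0 < \<mu>" "0 \<le> V"
  shows "(LINT w:{0..V}|lborel. cor (exp (- ((\<mu> + 1 / \<mu>) * w))) * (Y w - cor \<mu> * F w w))
    = (LINT v:{0..V}|lborel. cor (exp (- (1 / \<mu> * v))) * pd v)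
      - cor \<mu> * integral {0..V} (\<lambda>u. cor (exp (- (\<mu> * u)) * exp (- (1 / \<mu> * V))) * F u V)"
proof -
  define A where "A u = cor (exp (- (\<mu> * u)))" for u
  define B where "B v = cor (exp (- (1 / \<mu> * v)))" for v
  have AB: "cor (exp (- ((\<mu> + 1 / \<mu>) * w))) = A w * B w" for w
    unfolding A_def B_def of_real_mult[symmetric] exp_add[symmetric] by (simp add: algebra_simps)
  have cA: "continuous_on S A" and cB: "continuous_on S B" for S
    unfolding A_def B_def by (intro continuous_intros)+
  have cA2: "continuous_on UNIV (\<lambda>z::real \<times> real. A (fst z))" and cB2: "continuous_on UNIV (\<lambda>z::real \<times> real. B (snd z))"
    unfolding A_def B_def by (intro continuous_intros)+
  let ?m = "cor \<mu>"
  have m0: "?m \<noteq> 0" using assms by simp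
  \<comment> \<open>Multiplying the \<open>v\<close>-derivative of \<open>B v * F u v\<close> by
    \<open>- \<mu> * A u\<close> gives \<open>k1 u v * pd v + k2 u v\<close>. The first kernel is
    the \<open>u\<close>-derivative of \<open>A u * B v\<close>, the second that of
    \<open>A u * B v\<close> times the oriented integral of \<open>F\<close>, so after exchanging
    the order both integrate exactly in \<open>u\<close>.\<close>
  define k1 where "k1 u v = - ?m * A u * B v" for u v
  define k2 where "k2 u v = - ?m * A u * B v * Sg (\<lambda>s. F s v) u + A u * B v * F u v" for u v
  have jk1: "jcont k1" unfolding k1_def by (intro continuous_intros cA2 cB2)
  have jk2: "jcont k2" unfolding k2_def
    by (intro continuous_intros cA2 cB2 jF Sg_jcont(2)[OF jF])
  have step: "(LINT v:{u..V}|lborel. k1 u v * pd v) = - ?m * (A u * B V * F u V - A u * B u * F u u) - integral {u..V} (k2 u)"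
    if u: "0 \<le> u" "u \<le> V" for u
  proof -
    note vert = rect_vertical[OF rect _ L2_set_integrable[OF Lpd] F_vertical, of u _ u]
    have q: "set_integrable lborel {u..V} (\<lambda>t. pd t + Sg (\<lambda>s. F s t) u)" using vert(1)[of V] u by simp
    have "(LINT v:{u..V}|lborel. cor (exp (- (1 / \<mu> * v))) * (pd v + Sg (\<lambda>s. F s v) u - cor (1 / \<mu>) * F u v))
      = B V * F u V - B u * F u u"
      unfolding B_def
    proof (rule exp_product_rule[OF u(2) q jcont_sections(1)[OF jF]])
      fix v assume "u \<le> v" "v \<le> V"
      then show "F u v = F u u + (LINT s:{u..v}|lborel. pd s + Sg (\<lambda>sa. F sa s) u)" using vert(2)[of v] u by (simp add: algebra_simps)
    qed
    then have "- ?m * A u * (LINT v:{u..V}|lborel. B v * (pd v + Sg (\<lambda>s. F s v) u - cor (1 / \<mu>) * F u v)) = - ?m * A u * (B V * F u V - B u * F u u)"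
      by (simp only: B_def)
    also have "- ?m * A u * (LINT v:{u..V}|lborel. B v * (pd v + Sg (\<lambda>s. F s v) u - cor (1 / \<mu>) * F u v))
       = (LINT v:{u..V}|lborel. - ?m * A u * (B v * (pd v + Sg (\<lambda>s. F s v) u - cor (1 / \<mu>) * F u v)))"
      by (rule set_integral_mult_right[symmetric])
    also have "\<dots> = (LINT v:{u..V}|lborel. k1 u v * pd v + k2 u v)"
      by (rule set_lebesgue_integral_cong) (use m0 in \<open>auto simp: k1_def k2_def field_simps\<close>)
    also have "\<dots> = (LINT v:{u..V}|lborel. k1 u v * pd v) + (LINT v:{u..V}|lborel. k2 u v)"
      by (intro set_integral_add(2) set_integrable_mult_cont L2_set_integrable Lpd jcont_sections(1)[OF jk1] cont_set_integrable(1) jcont_sections(1)[OF jk2])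
    also have "(LINT v:{u..V}|lborel. k2 u v) = integral {u..V} (k2 u)" by (rule cont_set_integrable(2)[OF jcont_sections(1)[OF jk2]])
    finally have "(LINT v:{u..V}|lborel. k1 u v * pd v) = - ?m * A u * (B V * F u V - B u * F u u) - integral {u..V} (k2 u)" by (simp add: algebra_simps)
    moreover have "- ?m * A u * (B V * F u V - B u * F u u) = - ?m * (A u * B V * F u V - A u * B u * F u u)" by (simp add: algebra_simps)
    ultimately show ?thesis by simp
  qed
  have cL: "continuous_on {0..V} (\<lambda>u. - ?m * (A u * B V * F u V - A u * B u * F u u))"
    by (intro continuous_intros cA cB jcont_sections[OF jF])
  have cK: "continuous_on {0..V} (\<lambda>u. integral {u..V} (k2 u))"
  proof (rule continuous_on_eq)
    show "continuous_on {0..V} (\<lambda>u. Sg (k2 u) V - Sg (k2 u) u)"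
      by (intro continuous_on_diff; rule jcont_compose[OF Sg_jcont(1)[OF jk2]]; auto intro!: continuous_intros)
  qed (simp add: Sg_diff[OF jcont_sections(1)[OF jk2]])
  have one: "set_integrable lborel {0..V} (\<lambda>_. 1 :: complex)" by (rule set_integrable_const_Icc)
  have "(LINT u:{0..V}|lborel. 1 * (LINT v:{u..V}|lborel. k1 u v * pd v)) = (LINT v:{0..V}|lborel. pd v * (LINT u:{0..v}|lborel. k1 u v * 1))"
    by (rule triangle_Fubini[OF one L2_set_integrable[OF Lpd] jk1])
  also have "\<dots> = (LINT v:{0..V}|lborel. A v * B v * pd v - B v * pd v)"
  proof (rule set_lebesgue_integral_cong)
    show "\<forall>v. v \<in> {0..V} \<longrightarrow> pd v * (LINT u:{0..v}|lborel. k1 u v * 1) = A v * B v * pd v - B v * pd v"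
    proof safe
      fix v assume v: "v \<in> {0..V}"
      have "(LINT u:{0..v}|lborel. k1 u v * 1) = (LINT u:{0..v}|lborel. - ?m * A u * B v)"
        by (simp add: k1_def)
      also have "\<dots> = (LINT u:{0..v}|lborel. - ?m * A u) * B v" by (rule set_integral_mult_left)
      also have "\<dots> = (A v - 1) * B v" unfolding A_def using v by (subst integral_exp_complex) auto
      finally have eq: "(LINT u:{0..v}|lborel. k1 u v * 1) = (A v - 1) * B v" .
      show "pd v * (LINT u:{0..v}|lborel. k1 u v * 1) = A v * B v * pd v - B v * pd v"
        unfolding eq by (simp add: algebra_simps)
    qed
  qed simp
  also have "\<dots> = (LINT v:{0..V}|lborel. A v * B v * pd v) - (LINT v:{0..V}|lborel. B v * pd v)"
    by (intro set_integral_diff(2) set_integrable_mult_cont L2_set_integrable Lpd continuous_intros cA cB)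
  finally have I1: "(LINT u:{0..V}|lborel. 1 * (LINT v:{u..V}|lborel. k1 u v * pd v)) = (LINT v:{0..V}|lborel. A v * B v * pd v) - (LINT v:{0..V}|lborel. B v * pd v)" .
  have "(LINT u:{0..V}|lborel. 1 * (LINT v:{u..V}|lborel. k2 u v * 1)) = (LINT v:{0..V}|lborel. 1 * (LINT u:{0..v}|lborel. k2 u v * 1))"
    by (rule triangle_Fubini[OF one one jk2])
  also have "\<dots> = (LINT v:{0..V}|lborel. A v * B v * Sg (\<lambda>s. F s v) v)"
  proof (rule set_lebesgue_integral_cong)
    show "\<forall>v. v \<in> {0..V} \<longrightarrow> 1 * (LINT u:{0..v}|lborel. k2 u v * 1) = A v * B v * Sg (\<lambda>s. F s v) v"
    proof safe
      fix v assume v: "v \<in> {0..V}"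
      have "((\<lambda>u. k2 u v) has_integral (A v * B v * Sg (\<lambda>s. F s v) v - A 0 * B v * Sg (\<lambda>s. F s v) 0)) {0..v}"
      proof (rule fundamental_theorem_of_calculus)
        fix u
        have "((\<lambda>u. exp (- (\<mu> * u))) has_real_derivative (- \<mu> * exp (- (\<mu> * u)))) (at u within {0..v})"
          by (auto intro!: derivative_eq_intros)
        then have dA: "(A has_vector_derivative cor (- \<mu> * exp (- (\<mu> * u)))) (at u within {0..v})"
          unfolding A_def by (rule has_vector_derivative_of_real[unfolded has_real_derivative_iff_has_vector_derivative[symmetric]])
        have "((\<lambda>u. (A u * Sg (\<lambda>s. F s v) u) * B v) has_vector_derivative (A u * F u v + cor (- \<mu> * exp (- (\<mu> * u))) * Sg (\<lambda>s. F s v) u) * B v) (at u within {0..v})"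
          by (intro has_vector_derivative_mult_left has_vector_derivative_mult dA Sg_has_vector_derivative jcont_sections[OF jF])
        then show "((\<lambda>u. A u * B v * Sg (\<lambda>s. F s v) u) has_vector_derivative k2 u v) (at u within {0..v})"
          by (simp add: k2_def A_def algebra_simps)
      qed (use v in simp)
      then show "1 * (LINT u:{0..v}|lborel. k2 u v * 1) = A v * B v * Sg (\<lambda>s. F s v) v"
        by (simp add: cont_set_integrable(2)[OF jcont_sections(2)[OF jk2]] integral_unique)
    qed
  qed simp
  finally have I2: "(LINT u:{0..V}|lborel. integral {u..V} (k2 u)) = (LINT v:{0..V}|lborel. A v * B v * Sg (\<lambda>s. F s v) v)"
    by (simp add: cont_set_integrable(2)[OF jcont_sections(1)[OF jk2]])
  have "(LINT u:{0..V}|lborel. 1 * (LINT v:{u..V}|lborel. k1 u v * pd v)) = (LINT u:{0..V}|lborel. - ?m * (A u * B V * F u V - A u * B u * F u u) - integral {u..V} (k2 u))"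
    by (rule set_lebesgue_integral_cong) (auto simp: step)
  also have "\<dots> = (LINT u:{0..V}|lborel. - ?m * (A u * B V * F u V - A u * B u * F u u)) - (LINT u:{0..V}|lborel. integral {u..V} (k2 u))"
    by (intro set_integral_diff(2) cont_set_integrable cL cK)
  also have "(LINT u:{0..V}|lborel. - ?m * (A u * B V * F u V - A u * B u * F u u)) = - ?m * ((LINT u:{0..V}|lborel. A u * B V * F u V) - (LINT u:{0..V}|lborel. A u * B u * F u u))"
    unfolding set_integral_mult_right
    by (subst set_integral_diff(2)) (intro cont_set_integrable continuous_intros cA cB jcont_sections[OF jF] refl)+
  finally have main: "(LINT v:{0..V}|lborel. A v * B v * pd v) - (LINT v:{0..V}|lborel. B v * pd v) = - ?m * ((LINT u:{0..V}|lborel. A u * B V * F u V) - (LINT u:{0..V}|lborel. A u * B u * F u u)) - (LINT v:{0..V}|lborel. A v * B v * Sg (\<lambda>s. F s v) v)"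
    unfolding I1 I2 .
  have ip: "set_integrable lborel {0..V} (\<lambda>v. A v * B v * pd v)"
    by (intro set_integrable_mult_cont L2_set_integrable Lpd continuous_intros cA cB)
  have iS: "set_integrable lborel {0..V} (\<lambda>v. A v * B v * Sg (\<lambda>s. F s v) v)"
    by (intro cont_set_integrable continuous_intros cA cB jcont_compose[OF Sg_jcont(2)[OF jF]])
  have iF: "set_integrable lborel {0..V} (\<lambda>v. ?m * (A v * B v * F v v))"
    by (intro cont_set_integrable continuous_intros cA cB jcont_sections[OF jF])
  have "(LINT w:{0..V}|lborel. cor (exp (- ((\<mu> + 1 / \<mu>) * w))) * (Y w - ?m * F w w))
     = (LINT w:{0..V}|lborel. A w * B w * pd w + A w * B w * Sg (\<lambda>s. F s w) w - ?m * (A w * B w * F w w))"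
    unfolding AB Y_def by (rule set_lebesgue_integral_cong) (auto simp: algebra_simps)
  also have "\<dots> = (LINT w:{0..V}|lborel. A w * B w * pd w) + (LINT w:{0..V}|lborel. A w * B w * Sg (\<lambda>s. F s w) w) - ?m * (LINT w:{0..V}|lborel. A w * B w * F w w)"
    unfolding set_integral_diff(2)[OF set_integral_add(1)[OF ip iS] iF] set_integral_add(2)[OF ip iS] set_integral_mult_right ..
  also have "\<dots> = (LINT v:{0..V}|lborel. B v * pd v) - ?m * (LINT u:{0..V}|lborel. A u * B V * F u V)"
    using main by (simp add: algebra_simps)
  also have "(LINT u:{0..V}|lborel. A u * B V * F u V) = integral {0..V} (\<lambda>u. A u * B V * F u V)"
    by (intro cont_set_integrable continuous_intros cA cB jcont_sections[OF jF])
  finally show ?thesis by (simp add: A_def B_def)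
qed

end

lemma set_integral_ex_half:
  fixes f h :: "real \<Rightarrow> complex"
  assumes "\<And>x. 0 < x \<Longrightarrow> cor (exp (- (\<kappa> * x))) * f x = h x * ex \<kappa> x" "f \<in> borel_measurable borel" "h \<in> borel_measurable borel"
  shows "(LINT x:{0..b}|lborel. cor (exp (- (\<kappa> * x))) * f x) = (LINT x:{0..b}|lborel. h x * ex \<kappa> x)"
  by (rule set_integral_half_cong) (use assms in \<open>auto simp: set_borel_measurable_def intro!: borel_measurable_scaleR borel_measurable_times\<close>)

context wedge
begin

text \<open>The rate \<open>\<mu> + 1 / \<mu>\<close> is that of exp (- \<mu> * u - v / \<mu>) at
  \<open>u = v = w\<close>; it is the same for \<mu> and \<open>1 / \<mu>\<close>.\<close>

definition Dg where "Dg \<mu> = (LINT w|lborel. (Yd w - cor \<mu> * Fd w) * ex (\<mu> + 1 / \<mu>) w)"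

lemma kappa_gt:
  fixes \<mu> :: real
  assumes "0 < \<mu>" "\<mu> \<le> 1 / 5 \<or> 5 \<le> \<mu>"
  shows "5 < \<mu> + 1 / \<mu>"
proof (cases "5 \<le> \<mu>")
  case True
  have "0 < 1 / \<mu>" using assms by simp
  with True show ?thesis by linarith
next
  case False
  then have "5 \<le> 1 / \<mu>" using assms by (simp add: field_simps)
  then show ?thesis using assms(1) by linarith
qed

lemma YF_weighted: "L2 (\<lambda>w. cor (exp (- (5 * w))) * (Yd w - c * Fd w))"
proof -
  have "L2 (\<lambda>w. cor (exp (- (5 * w))) * Yd w - c * (cor (exp (- (5 * w))) * Fd w))"
    by (intro L2_diff L2_cmul Yd_weighted Fd_weighted)
  then show ?thesis by (simp add: algebra_simps)
qed

text \<open>On the side \<open>v = V\<close> of Green's formula \<open>F\<close> grows at most like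
  exp (4 * V), while the exponential decays at least like exp (- 5 * V) because
  \<open>1 / \<mu> \<ge> 5\<close>. That side vanishes as \<open>V\<close> tends to
  infinity.\<close>

lemma diag_small:
  assumes "0 < \<mu>" "\<mu> \<le> 1 / 5"
  shows "Dg \<mu> = (LINT v|lborel. pd v * ex (1 / \<mu>) v)"
proof -
  obtain C where C: "0 \<le> C" "\<And>u v. 0 \<le> u \<Longrightarrow> 0 \<le> v \<Longrightarrow> cmod (F u v) \<le> C * exp (2 * (u + v))"
    using growth by blast
  define \<kappa> where "\<kappa> = \<mu> + 1 / \<mu>"
  have \<kappa>: "5 < \<kappa>" unfolding \<kappa>_def using assms by (intro kappa_gt) auto
  have 5: "5 \<le> 1 / \<mu>" using assms by (simp add: field_simps)
  define R where "R n = integral {0..real n} (\<lambda>u. cor (exp (- (\<mu> * u)) * exp (- (1 / \<mu> * real n))) * F u (real n))" for n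
  have m1: "(\<lambda>w. Y w - cor \<mu> * F w w) \<in> borel_measurable borel"
    by (intro borel_measurable_diff XY_measurable borel_measurable_times borel_measurable_const borel_measurable_continuous_onI jcont_sections[OF jF])
  have m2: "(\<lambda>w. Yd w - cor \<mu> * Fd w) \<in> borel_measurable borel"
    by (intro borel_measurable_diff d_measurable borel_measurable_times borel_measurable_const)
  have eq: "(LINT w:{0..real n}|lborel. (Yd w - cor \<mu> * Fd w) * ex \<kappa> w) = (LINT v:{0..real n}|lborel. pd v * ex (1 / \<mu>) v) - cor \<mu> * R n" for n
    using Green[OF assms(1), of "real n"]
      set_integral_ex_half[OF _ m1 m2, of \<kappa> "real n"]
      set_integral_ex_half[OF _ L2_measurable[OF Lpd] L2_measurable[OF Lpd], of "1 / \<mu>" "real n"]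
    by (simp add: R_def \<kappa>_def ex_pos Yd_def Fd_def half_pos mult.commute)
  have R: "R \<longlonglongrightarrow> 0"
  proof (rule Lim_null_comparison)
    show "\<forall>\<^sub>F n in sequentially. norm (R n) \<le> C * real n * exp (- real n)"
    proof (rule always_eventually, rule allI)
      fix n
      have "norm (R n) \<le> integral {0..real n} (\<lambda>u. C * exp (- real n))"
        unfolding R_def
      proof (rule integral_norm_bound_integral)
        show "(\<lambda>u. cor (exp (- (\<mu> * u)) * exp (- (1 / \<mu> * real n))) * F u (real n)) integrable_on {0..real n}"
          by (intro integrable_continuous_interval continuous_intros jcont_sections[OF jF])
        fix u assume u: "u \<in> {0..real n}"
        have h: "5 * real n \<le> 1 / \<mu> * real n" by (rule mult_right_mono[OF 5]) simp
        have "norm (cor (exp (- (\<mu> * u)) * exp (- (1 / \<mu> * real n))) * F u (real n)) = (exp (- (\<mu> * u)) * exp (- (1 / \<mu> * real n))) * cmod (F u (real n))"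
          by (simp add: norm_mult)
        also have "\<dots> \<le> (1 * exp (- (5 * real n))) * (C * exp (2 * (u + real n)))"
          using u assms(1) h C(1) by (intro mult_mono C(2)) (auto intro!: mult_right_mono)
        also have "\<dots> \<le> (1 * exp (- (5 * real n))) * (C * exp (4 * real n))"
          using u C(1) by (intro mult_left_mono) auto
        also have "\<dots> = C * exp (- real n)" by (simp add: exp_add[symmetric])
        finally show "norm (cor (exp (- (\<mu> * u)) * exp (- (1 / \<mu> * real n))) * F u (real n)) \<le> C * exp (- real n)" .
      qed (intro integrable_continuous_interval continuous_intros)
      then show "norm (R n) \<le> C * real n * exp (- real n)" by (simp add: mult_ac)
    qed
    show "(\<lambda>n. C * real n * exp (- real n)) \<longlonglongrightarrow> 0" by real_asymp
  qed
  have l1: "(\<lambda>n. LINT w:{0..real n}|lborel. (Yd w - cor \<mu> * Fd w) * ex \<kappa> w) \<longlonglongrightarrow> Dg \<mu>"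
    unfolding Dg_def \<kappa>_def[symmetric]
    by (rule set_integral_tendsto_half[OF weighted_integrable[OF YF_weighted \<kappa>]]) (simp add: ex_nonpos)
  have l2: "(\<lambda>n. LINT v:{0..real n}|lborel. pd v * ex (1 / \<mu>) v) \<longlonglongrightarrow> (LINT v|lborel. pd v * ex (1 / \<mu>) v)"
    using assms by (intro set_integral_tendsto_half L2_mult_integrable Lpd L2_ex) (auto simp: ex_nonpos)
  have "(\<lambda>n. (LINT v:{0..real n}|lborel. pd v * ex (1 / \<mu>) v) - cor \<mu> * R n) \<longlonglongrightarrow> (LINT v|lborel. pd v * ex (1 / \<mu>) v) - cor \<mu> * 0"
    by (intro tendsto_intros l2 R)
  then show ?thesis using LIMSEQ_unique[OF l1[unfolded eq]] by simp
qed

text \<open>\<open>X + Y\<close> is the derivative of \<open>F w w\<close>, so the integrand is the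
  derivative of exp (- \<kappa> * w) times \<open>F w w\<close>. A rate above 5 removes the
  contribution of infinity.\<close>

lemma XYF_integral:
  assumes "5 < \<kappa>" "integrable lborel (\<lambda>w. (Xd w + Yd w - cor \<kappa> * Fd w) * ex \<kappa> w)"
  shows "(LINT w|lborel. (Xd w + Yd w - cor \<kappa> * Fd w) * ex \<kappa> w) = - F 0 0"
proof -
  obtain C where C: "0 \<le> C" "\<And>u v. 0 \<le> u \<Longrightarrow> 0 \<le> v \<Longrightarrow> cmod (F u v) \<le> C * exp (2 * (u + v))"
    using growth by blast
  have m1: "(\<lambda>w. X w + Y w - cor \<kappa> * F w w) \<in> borel_measurable borel"
    by (intro borel_measurable_diff borel_measurable_add XY_measurable borel_measurable_times borel_measurable_const borel_measurable_continuous_onI jcont_sections[OF jF])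
  have m2: "(\<lambda>w. Xd w + Yd w - cor \<kappa> * Fd w) \<in> borel_measurable borel"
    by (intro borel_measurable_diff borel_measurable_add d_measurable borel_measurable_times borel_measurable_const)
  have eq: "(LINT w:{0..real n}|lborel. (Xd w + Yd w - cor \<kappa> * Fd w) * ex \<kappa> w) = cor (exp (- (\<kappa> * real n))) * F (real n) (real n) - F 0 0" for n
  proof -
    note d = diag_eq[of 0]
    have i: "set_integrable lborel {0..v} X" "set_integrable lborel {0..v} Y" if "0 \<le> v" for v
      using d(1,2)[of v] that by auto
    have "(LINT w:{0..real n}|lborel. cor (exp (- (\<kappa> * w))) * (X w + Y w - cor \<kappa> * F w w)) = cor (exp (- (\<kappa> * real n))) * F (real n) (real n) - cor (exp (- (\<kappa> * 0))) * F 0 0"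
    proof (rule exp_product_rule)
      show "set_integrable lborel {0..real n} (\<lambda>w. X w + Y w)" by (intro set_integral_add i) simp_all
      show "continuous_on {0..real n} (\<lambda>w. F w w)" by (rule jcont_sections[OF jF])
      fix v :: real assume "0 \<le> v"
      then show "F v v = F 0 0 + (LINT w:{0..v}|lborel. X w + Y w)"
        using d(3)[of v] by (simp add: set_integral_add(2)[OF i] algebra_simps)
    qed simp
    then show ?thesis
      using set_integral_ex_half[OF _ m1 m2, of \<kappa> "real n"] by (simp add: ex_pos Xd_def Yd_def Fd_def half_pos mult.commute)
  qed
  have lim: "(\<lambda>n. cor (exp (- (\<kappa> * real n))) * F (real n) (real n)) \<longlonglongrightarrow> 0"
  proof (rule Lim_null_comparison)
    show "\<forall>\<^sub>F n in sequentially. norm (cor (exp (- (\<kappa> * real n))) * F (real n) (real n)) \<le> C * exp (- real n)"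
    proof (rule always_eventually, rule allI)
      fix n
      have "norm (cor (exp (- (\<kappa> * real n))) * F (real n) (real n)) \<le> exp (- (5 * real n)) * (C * exp (2 * (real n + real n)))"
        unfolding norm_mult using assms(1) by (intro mult_mono C(2)) (auto intro!: mult_right_mono)
      also have "\<dots> = C * exp (- real n)" by (simp add: exp_add[symmetric])
      finally show "norm (cor (exp (- (\<kappa> * real n))) * F (real n) (real n)) \<le> C * exp (- real n)" .
    qed
    show "(\<lambda>n. C * exp (- real n)) \<longlonglongrightarrow> 0" by real_asymp
  qed
  have "(\<lambda>n. LINT w:{0..real n}|lborel. (Xd w + Yd w - cor \<kappa> * Fd w) * ex \<kappa> w) \<longlonglongrightarrow> (LINT w|lborel. (Xd w + Yd w - cor \<kappa> * Fd w) * ex \<kappa> w)"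
    by (rule set_integral_tendsto_half[OF assms(2)]) (simp add: ex_nonpos)
  from LIMSEQ_unique[OF this[unfolded eq] tendsto_diff[OF lim tendsto_const]] show ?thesis by simp
qed

lemma swap_wedge: "wedge (\<lambda>u v. F v u) pd gd"
  by (rule wedge_swap) unfold_locales

lemma swap_defs:
  "wedge.X (\<lambda>u v. F v u) pd = Y" "wedge.Y (\<lambda>u v. F v u) gd = X"
  "wedge.Xd (\<lambda>u v. F v u) pd = Yd" "wedge.Yd (\<lambda>u v. F v u) gd = Xd" "wedge.Fd (\<lambda>u v. F v u) = Fd"
proof -
  show 1: "wedge.X (\<lambda>u v. F v u) pd = Y" "wedge.Y (\<lambda>u v. F v u) gd = X"
    using wedge.X_def[OF swap_wedge] wedge.Y_def[OF swap_wedge] by (auto simp: X_def Y_def fun_eq_iff)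
  show "wedge.Xd (\<lambda>u v. F v u) pd = Yd" "wedge.Yd (\<lambda>u v. F v u) gd = Xd" "wedge.Fd (\<lambda>u v. F v u) = Fd"
    using wedge.Xd_def[OF swap_wedge] wedge.Yd_def[OF swap_wedge] wedge.Fd_def[OF swap_wedge] by (simp_all add: 1 Xd_def Yd_def Fd_def)
qed

text \<open>For large \<mu> the estimate of the side \<open>v = V\<close> fails. Time reversal
  replaces \<mu> by \<open>1 / \<mu>\<close>, so \<open>diag_small\<close> evaluates the pairing of
  \<open>X - F / \<mu>\<close> with the same exponential; subtracting it from the total derivative
  \<open>X + Y - (\<mu> + 1 / \<mu>) * F\<close> leaves \<open>Y - \<mu> * F\<close>.\<close>

lemma diag_large:
  assumes "5 \<le> \<mu>"
  shows "Dg \<mu> = - F 0 0 - (LINT u|lborel. gd u * ex \<mu> u)"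
proof -
  have p: "0 < 1 / \<mu>" "1 / \<mu> \<le> 1 / 5" using assms by (auto simp: field_simps)
  define \<kappa> where "\<kappa> = \<mu> + 1 / \<mu>"
  have \<kappa>: "5 < \<kappa>" unfolding \<kappa>_def using assms by (intro kappa_gt) auto
  have s: "(LINT w|lborel. (Xd w - cor (1 / \<mu>) * Fd w) * ex \<kappa> w) = (LINT u|lborel. gd u * ex \<mu> u)"
    using wedge.diag_small[OF swap_wedge p] wedge.Dg_def[OF swap_wedge, of "1 / \<mu>"] by (simp add: swap_defs \<kappa>_def add.commute)
  have iX: "integrable lborel (\<lambda>w. (Xd w - cor (1 / \<mu>) * Fd w) * ex \<kappa> w)"
    using wedge.YF_weighted[OF swap_wedge, of "cor (1 / \<mu>)"] by (intro weighted_integrable[OF _ \<kappa>]) (simp add: swap_defs)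
  have iY: "integrable lborel (\<lambda>w. (Yd w - cor \<mu> * Fd w) * ex \<kappa> w)"
    by (rule weighted_integrable[OF YF_weighted \<kappa>])
  have eq: "(Xd w + Yd w - cor \<kappa> * Fd w) * ex \<kappa> w = (Xd w - cor (1 / \<mu>) * Fd w) * ex \<kappa> w + (Yd w - cor \<mu> * Fd w) * ex \<kappa> w" for w
    unfolding \<kappa>_def of_real_add by (simp add: algebra_simps)
  have "integrable lborel (\<lambda>w. (Xd w + Yd w - cor \<kappa> * Fd w) * ex \<kappa> w)"
    unfolding eq by (intro Bochner_Integration.integrable_add iX iY)
  from XYF_integral[OF \<kappa> this] have "(LINT w|lborel. (Xd w - cor (1 / \<mu>) * Fd w) * ex \<kappa> w) + (LINT w|lborel. (Yd w - cor \<mu> * Fd w) * ex \<kappa> w) = - F 0 0"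
    unfolding eq Bochner_Integration.integral_add[OF iX iY] .
  then show ?thesis unfolding s Dg_def \<kappa>_def[symmetric] by (simp add: algebra_simps)
qed

text \<open>The Laplace form of the Hankel relation after one integration by parts in
  \<open>g\<close>, which replaces \<mu> times the transform of \<open>g\<close> by
  \<open>F 0 0\<close> plus that of \<open>gd\<close>. In this form it is invariant under time
  reversal.\<close>

definition compat where
  "compat \<longleftrightarrow> (\<forall>\<mu>>0. (LINT u|lborel. gd u * ex \<mu> u) + (LINT v|lborel. pd v * ex (1 / \<mu>) v) + F 0 0 = 0)"

text \<open>At both roots of \<open>m + 1 / m = k + 6\<close> the pairing \<open>Dg m\<close> equals
  the pairing with \<open>pd\<close>: by \<open>diag_small\<close> at the small root, by
  \<open>diag_large\<close> and \<open>compat\<close> at the large one. Two equations with different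
  coefficients of \<open>Fd\<close> separate \<open>Fd\<close> from \<open>Yd\<close>, and by
  \<open>nsq_exp_sum_diag\<close> the resulting functional is bounded by \<open>nsq pd\<close> in
  the energy norm.\<close>

lemma energy:
  assumes compat
  shows "L2 Fd" "L2 Yd"
proof -
  \<comment> \<open>The larger root of \<open>m + 1 / m = k + 6\<close>: the exponential on the
    diagonal then has exactly the rate \<open>k + 1 + 5\<close> that occurs in
    \<open>ES n 5\<close>. The smaller root is \<open>1 / mu k\<close>.\<close>
  define mu where "mu k = (real k + 6 + sqrt ((real k + 6)\<^sup>2 - 4)) / 2" for k :: nat
  have mu: "5 \<le> mu k" "mu k + 1 / mu k = real k + 6" for k
  proof -
    define s where "s = sqrt ((real k + 6)\<^sup>2 - 4)"
    have ge: "16 \<le> (real k + 6)\<^sup>2 - 4" by (simp add: power2_eq_square algebra_simps)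
    then have "sqrt 16 \<le> s" unfolding s_def by (rule real_sqrt_le_mono)
    moreover have "sqrt 16 = (4::real)" by (rule real_sqrt_unique) auto
    ultimately have s4: "4 \<le> s" by simp
    then show 1: "5 \<le> mu k" by (simp add: mu_def s_def)
    have "s\<^sup>2 = (real k + 6)\<^sup>2 - 4" unfolding s_def using ge by simp
    then have "mu k * mu k + 1 = (real k + 6) * mu k"
      unfolding mu_def s_def[symmetric] by (simp add: power2_eq_square field_simps)
    then show "mu k + 1 / mu k = real k + 6" using 1 by (simp add: field_simps)
  qed
  have mup: "0 < mu k" for k using mu(1)[of k] by linarith
  define m where "m i = (if snd i then mu (fst i) else 1 / mu (fst i))" for i :: "nat \<times> bool"
  have mp: "0 < m i" for i using mup by (simp add: m_def)
  have mk: "m i + 1 / m i = real (fst i) + 6" for i using mu(2)[of "fst i"] by (auto simp: m_def add.commute)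
  have D: "Dg (m i) = (LINT v|lborel. pd v * ex (1 / m i) v)" for i
  proof (cases "snd i")
    case True
    have "(LINT u|lborel. gd u * ex (m i) u) + (LINT v|lborel. pd v * ex (1 / m i) v) + F 0 0 = 0"
      using assms mp[of i] by (simp add: compat_def)
    moreover have "Dg (m i) = - F 0 0 - (LINT u|lborel. gd u * ex (m i) u)"
      using mu(1) True by (intro diag_large) (simp add: m_def)
    ultimately show ?thesis by algebra
  next
    case False
    then show ?thesis using mp[of i] mu(1)[of "fst i"] by (intro diag_small) (auto simp: m_def field_simps)
  qed
  have pair: "(cmod (LINT x|lborel. Fd x * ES n 5 a x + Yd x * ES n 5 b x))\<^sup>2 \<le> nsq pd * (nsq (ES n 5 a) + nsq (ES n 5 b))" for n a b
  proof -
    \<comment> \<open>The coefficients at the two roots must sum to \<open>b k\<close>, and weighted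
      by minus the roots to \<open>a k\<close>. This is the solution of that linear system, which is
      regular because \<open>mu k \<noteq> 1 / mu k\<close>.\<close>
    define \<alpha> where "\<alpha> k = (a k + b k / cor (mu k)) / cor (1 / mu k - mu k)" for k
    define c where "c i = (if snd i then \<alpha> (fst i) else b (fst i) - \<alpha> (fst i))" for i
    define I where "I = {..<n} \<times> (UNIV :: bool set)"
    have fI: "finite I" by (simp add: I_def)
    have sumI: "(\<Sum>i\<in>I. f i) = (\<Sum>k<n. f (k, True) + f (k, False))" for f :: "nat \<times> bool \<Rightarrow> complex"
    proof -
      have "(\<Sum>i\<in>I. f i) = (\<Sum>k<n. \<Sum>t\<in>UNIV. f (k, t))" unfolding I_def by (simp add: sum.cartesian_product)
      then show ?thesis by (simp add: UNIV_bool add.commute)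
    qed
    have P: "ES n 5 a x = (\<Sum>i\<in>I. - (c i * cor (m i)) * ex (m i + 1 / m i) x)" for x
      unfolding sumI mk ES_def
    proof (intro sum.cong refl)
      fix k
      define z where "z = cor (mu k)"
      have z0: "z \<noteq> 0" using mup[of k] by (simp add: z_def)
      have "1 / mu k - mu k \<noteq> 0"
      proof -
        have "1 / mu k \<le> 1 / 5" using mu(1)[of k] by (simp add: field_simps)
        then show ?thesis using mu(1)[of k] by linarith
      qed
      then have nz: "1 / z - z \<noteq> 0" unfolding z_def by (metis of_real_1 of_real_diff of_real_divide of_real_eq_0_iff)
      have al: "\<alpha> k * (1 / z - z) = a k + b k / z" using nz by (simp add: \<alpha>_def z_def)
      have "- (\<alpha> k * z) - ((b k - \<alpha> k) * (1 / z)) = \<alpha> k * (1 / z - z) - b k / z" using z0 by (simp add: field_simps)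
      also have "\<dots> = a k" unfolding al by simp
      finally have key: "a k = - (\<alpha> k * z) - ((b k - \<alpha> k) * (1 / z))" by simp
      have "a k * ex (real k + 6) x = - (\<alpha> k * z) * ex (real k + 6) x + - ((b k - \<alpha> k) * (1 / z)) * ex (real k + 6) x"
        by (subst key) (simp add: algebra_simps)
      then show "a k * ex (real k + 1 + 5) x = - (c (k, True) * cor (m (k, True))) * ex (real (fst (k, True)) + 6) x + - (c (k, False) * cor (m (k, False))) * ex (real (fst (k, False)) + 6) x"
      proof -
        have e6: "real k + 1 + 5 = real k + 6" by simp
        show ?thesis unfolding e6 using \<open>a k * ex (real k + 6) x = - (\<alpha> k * z) * ex (real k + 6) x + - ((b k - \<alpha> k) * (1 / z)) * ex (real k + 6) x\<close>
          by (simp add: c_def m_def z_def)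
      qed
    qed
    have Q: "ES n 5 b x = (\<Sum>i\<in>I. c i * ex (m i + 1 / m i) x)" for x
      unfolding sumI mk ES_def by (intro sum.cong refl) (simp add: c_def algebra_simps)
    define S where "S v = (\<Sum>i\<in>I. c i * ex (1 / m i) v)" for v
    have LS: "L2 S" unfolding S_def using mp by (intro L2_sum L2_cmul L2_ex) auto
    have iD: "integrable lborel (\<lambda>w. (Yd w - cor (m i) * Fd w) * ex (m i + 1 / m i) w)" for i
      by (rule weighted_integrable[OF YF_weighted]) (simp add: mk)
    have "Fd x * ES n 5 a x + Yd x * ES n 5 b x = (\<Sum>i\<in>I. c i * ((Yd x - cor (m i) * Fd x) * ex (m i + 1 / m i) x))" for x
      unfolding P Q sum_distrib_left sum.distrib[symmetric] by (intro sum.cong refl) (simp add: algebra_simps)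
    then have "(LINT x|lborel. Fd x * ES n 5 a x + Yd x * ES n 5 b x) = (\<Sum>i\<in>I. c i * Dg (m i))"
      using iD by (simp add: Bochner_Integration.integral_sum Dg_def)
    also have "\<dots> = (\<Sum>i\<in>I. c i * (LINT v|lborel. pd v * ex (1 / m i) v))" by (simp only: D)
    also have "\<dots> = (LINT v|lborel. pd v * S v)"
    proof -
      have i: "integrable lborel (\<lambda>v. pd v * ex (1 / m i) v)" for i using mp by (intro L2_mult_integrable Lpd L2_ex) auto
      have "pd v * S v = (\<Sum>i\<in>I. c i * (pd v * ex (1 / m i) v))" for v
        unfolding S_def sum_distrib_left by (intro sum.cong) auto
      then show ?thesis using i by (simp add: Bochner_Integration.integral_sum)
    qed
    finally have "(cmod (LINT x|lborel. Fd x * ES n 5 a x + Yd x * ES n 5 b x))\<^sup>2 \<le> nsq pd * nsq S"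
      using L2_Cauchy_Schwarz[OF Lpd LS] by simp
    also have "nsq S = nsq (ES n 5 a) + nsq (ES n 5 b)"
      using nsq_exp_sum_diag[OF fI, of m c] mp unfolding S_def[abs_def] by (simp add: P[abs_def] Q[abs_def])
    finally show ?thesis .
  qed
  have z: "Fd x = 0" "Yd x = 0" if "x \<le> 0" for x using that by (simp_all add: Fd_def Yd_def half_nonpos)
  show "L2 Fd" "L2 Yd"
    using L2_by_duality(1,2)[OF d_measurable(1,3) z _ Fd_weighted Yd_weighted nsq_nonneg pair] by auto
qed

lemma compat_swap:
  assumes compat
  shows "wedge.compat (\<lambda>u v. F v u) pd gd"
  unfolding wedge.compat_def[OF swap_wedge]
proof (intro allI impI)
  fix \<mu> :: real assume "0 < \<mu>"
  then show "(LINT u|lborel. pd u * ex \<mu> u) + (LINT v|lborel. gd v * ex (1 / \<mu>) v) + F 0 0 = 0"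
    using assms[unfolded compat_def, rule_format, of "1 / \<mu>"] by (simp add: add.commute)
qed

lemma energy_X: "compat \<Longrightarrow> L2 Xd"
  using wedge.energy(2)[OF swap_wedge compat_swap] by (simp add: swap_defs)

text \<open>On finite exponential sums the two sides below agree once the exponents are large; the
  isometry of \<open>nsq_exp_sum_diag\<close> then carries the identity over to every exponent.\<close>
lemma Dg_extend:
  assumes LF: "L2 Fd" and LY: "L2 Yd" and \<mu>: "0 < \<mu>"
  shows "Dg \<mu> = (LINT v|lborel. pd v * ex (1 / \<mu>) v)"
proof -
  define \<nu> where "\<nu> = 1 / \<mu>"
  have \<nu>: "0 < \<nu>" using \<mu> by (simp add: \<nu>_def)
  define K where "K = 2 * (nsq Fd + nsq Yd) + nsq pd"
  have K: "0 \<le> K" unfolding K_def using nsq_nonneg[of Fd] nsq_nonneg[of Yd] nsq_nonneg[of pd] by simp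
  have "(cmod (Dg \<mu> - (LINT v|lborel. pd v * ex (1 / \<mu>) v)))\<^sup>2 \<le> e" if e: "0 < e" for e
  proof -
    define e' where "e' = e / (2 * K + 1)"
    have e': "0 < e'" using e K by (simp add: e'_def)
    \<comment> \<open>The rates of \<open>ES n 4\<close> are \<open>k + 5\<close>. They belong to
      parameters \<open>1 / (k + 5) \<le> 1 / 5\<close>, for which \<open>diag_small\<close> already
      gives the identity.\<close>
    obtain n a where na: "nsq (\<lambda>x. ex \<nu> x - ES n 4 a x) < e'"
    proof -
      obtain M :: nat where M: "nsq (\<lambda>x. indicator {0<..real M} x * ex \<nu> x - ex \<nu> x) < e' / 4"
      proof -
        have "(\<lambda>n. nsq (\<lambda>x. indicator {0<..real n} x * ex \<nu> x - ex \<nu> x)) \<longlonglongrightarrow> 0"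
        proof (rule nsq_LIMSEQ_dominated[OF L2_ex[OF \<nu>] L2_ex[OF \<nu>]])
          show "(\<lambda>n. indicator {0<..real n} x * ex \<nu> x) \<longlonglongrightarrow> ex \<nu> x" for x
          proof (rule tendsto_eventually)
            obtain M where "x \<le> real M" using real_arch_simple by blast
            then show "\<forall>\<^sub>F n in sequentially. indicator {0<..real n} x * ex \<nu> x = ex \<nu> x"
              unfolding eventually_sequentially by (intro exI[of _ M]) (auto simp: ex_def split: split_indicator)
          qed
        qed (auto split: split_indicator)
        then have "\<forall>\<^sub>F n in sequentially. nsq (\<lambda>x. indicator {0<..real n} x * ex \<nu> x - ex \<nu> x) < e' / 4"
          using e' by (intro order_tendstoD(2)) auto
        then show ?thesis using that by (auto simp: eventually_sequentially)
      qed
      \<comment> \<open>The product of exp (4 * x) with the target exponential need not be square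
        integrable, hence the cut at \<open>M\<close> before the density theorem. Returning by the
        factor exp (- 4 * x) only decreases the error.\<close>
      define f where "f x = indicator {0<..real M} x * (cor (exp (4 * x)) * ex \<nu> x)" for x
      have fm: "f \<in> borel_measurable borel" unfolding f_def by measurable
      have Lf: "L2 f"
      proof (rule L2_bound(1)[OF fm L2_cmul(1)[OF L2_ex[OF \<nu>], of "cor (exp (4 * real M))"]])
        show "cmod (f x) \<le> cmod (cor (exp (4 * real M)) * ex \<nu> x)" for x
          by (auto simp: f_def norm_mult split: split_indicator intro!: mult_right_mono)
      qed
      obtain n a where na: "nsq (\<lambda>x. f x - ES n 0 a x) < e' / 4"
        using ES_dense_L2[OF Lf, of "e' / 4"] e' by (auto simp: f_def ex_nonpos)
      have "nsq (\<lambda>x. indicator {0<..real M} x * ex \<nu> x - ES n 4 a x) \<le> nsq (\<lambda>x. f x - ES n 0 a x)"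
      proof (rule L2_bound(2))
        show "(\<lambda>x. indicator {0<..real M} x * ex \<nu> x - ES n 4 a x) \<in> borel_measurable borel"
          using L2_measurable[OF L2_ES[of 4 n a]] by measurable
        show "L2 (\<lambda>x. f x - ES n 0 a x)" by (intro L2_diff Lf L2_ES) simp
        fix x
        show "cmod (indicator {0<..real M} x * ex \<nu> x - ES n 4 a x) \<le> cmod (f x - ES n 0 a x)"
        proof (cases "0 < x")
          case True
          have "indicator {0<..real M} x * ex \<nu> x - ES n 4 a x = cor (exp (- (4 * x))) * (f x - ES n 0 a x)"
            unfolding f_def ES_shift[of n 4] by (simp add: algebra_simps exp_minus)
          then show ?thesis using True mult_right_mono[of "exp (- (4 * x))" 1 "cmod (f x - ES n 0 a x)"] by (simp add: norm_mult)
        qed (simp add: ES_def ex_nonpos)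
      qed
      then have 1: "nsq (\<lambda>x. indicator {0<..real M} x * ex \<nu> x - ES n 4 a x) < e' / 4" using na by simp
      have 2: "nsq (\<lambda>x. ex \<nu> x - indicator {0<..real M} x * ex \<nu> x) < e' / 4"
        using M by (subst nsq_swap)
      have "nsq (\<lambda>x. (ex \<nu> x - indicator {0<..real M} x * ex \<nu> x) + (indicator {0<..real M} x * ex \<nu> x - ES n 4 a x))
         \<le> 2 * nsq (\<lambda>x. ex \<nu> x - indicator {0<..real M} x * ex \<nu> x) + 2 * nsq (\<lambda>x. indicator {0<..real M} x * ex \<nu> x - ES n 4 a x)"
        by (rule L2_add(2)[OF L2_diff(1)[OF L2_ex[OF \<nu>] L2_restrict(1)[OF L2_ex[OF \<nu>]]] L2_diff(1)[OF L2_restrict(1)[OF L2_ex[OF \<nu>]] L2_ES]]) auto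
      then have "nsq (\<lambda>x. ex \<nu> x - ES n 4 a x) < e'" using 1 2 by simp
      then show ?thesis by (rule that)
    qed
    \<comment> \<open>\<open>None\<close> is the exponential to be reached, \<open>Some k\<close> an
      approximant with the opposite sign. So \<open>S\<close> is the approximation error on the ray,
      and the isometry makes the corresponding data \<open>P\<close>, \<open>Q\<close> on the
      diagonal equally small.\<close>
    define I where "I = insert None (Some ` {..<n})"
    define m where "m i = (case i of None \<Rightarrow> \<mu> | Some k \<Rightarrow> 1 / (real k + 5))" for i :: "nat option"
    define c where "c i = (case i of None \<Rightarrow> 1 | Some k \<Rightarrow> - a k)" for i :: "nat option"
    have fI: "finite I" by (simp add: I_def)
    have mp: "0 < m i" for i using \<mu> by (auto simp: m_def split: option.split)
    have sumI: "(\<Sum>i\<in>I. f i) = f None + (\<Sum>k<n. f (Some k))" for f :: "nat option \<Rightarrow> complex"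
      unfolding I_def by (subst sum.insert) (auto simp: sum.reindex)
    define S where "S v = (\<Sum>i\<in>I. c i * ex (1 / m i) v)" for v
    define P where "P x = (\<Sum>i\<in>I. - (c i * cor (m i)) * ex (m i + 1 / m i) x)" for x
    define Q where "Q x = (\<Sum>i\<in>I. c i * ex (m i + 1 / m i) x)" for x
    have kp: "0 < m i + 1 / m i" for i using mp[of i] by (simp add: add_pos_pos)
    have LS: "L2 S" and LP: "L2 P" and LQ: "L2 Q"
      unfolding S_def P_def Q_def using mp kp by (intro L2_sum L2_cmul L2_ex; simp)+
    have Seq: "S = (\<lambda>x. ex \<nu> x - ES n 4 a x)"
      unfolding S_def sumI ES_def by (auto simp: c_def m_def \<nu>_def sum_negf add.commute fun_eq_iff)
    have iso: "nsq P + nsq Q = nsq S"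
      unfolding P_def S_def Q_def by (rule nsq_exp_sum_diag[OF fI mp])
    have iD: "integrable lborel (\<lambda>w. (Yd w - cor (m i) * Fd w) * ex (m i + 1 / m i) w)" for i
      by (intro L2_mult_integrable L2_diff L2_cmul LF LY L2_ex kp)
    have "Fd x * P x + Yd x * Q x = (\<Sum>i\<in>I. c i * ((Yd x - cor (m i) * Fd x) * ex (m i + 1 / m i) x))" for x
      unfolding P_def Q_def sum_distrib_left sum.distrib[symmetric] by (intro sum.cong refl) (simp add: algebra_simps)
    then have "(LINT x|lborel. Fd x * P x + Yd x * Q x) = (\<Sum>i\<in>I. c i * Dg (m i))"
      using iD by (simp add: Bochner_Integration.integral_sum Dg_def)
    then have FY: "(\<Sum>i\<in>I. c i * Dg (m i)) = (LINT x|lborel. Fd x * P x) + (LINT x|lborel. Yd x * Q x)"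
      by (simp add: Bochner_Integration.integral_add[OF L2_mult_integrable[OF LF LP] L2_mult_integrable[OF LY LQ]])
    have pS: "(\<Sum>i\<in>I. c i * (LINT v|lborel. pd v * ex (1 / m i) v)) = (LINT v|lborel. pd v * S v)"
    proof -
      have i: "integrable lborel (\<lambda>v. pd v * ex (1 / m i) v)" for i using mp by (intro L2_mult_integrable Lpd L2_ex) auto
      have "pd v * S v = (\<Sum>i\<in>I. c i * (pd v * ex (1 / m i) v))" for v
        unfolding S_def sum_distrib_left by (intro sum.cong) auto
      then show ?thesis using i by (simp add: Bochner_Integration.integral_sum)
    qed
    have "Dg (m (Some k)) = (LINT v|lborel. pd v * ex (1 / m (Some k)) v)" for k
      using mp[of "Some k"] by (intro diag_small) (auto simp: m_def field_simps)
    then have "Dg \<mu> - (LINT v|lborel. pd v * ex (1 / \<mu>) v) = (\<Sum>i\<in>I. c i * Dg (m i)) - (\<Sum>i\<in>I. c i * (LINT v|lborel. pd v * ex (1 / m i) v))"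
      unfolding sumI by (simp add: c_def m_def)
    also have "\<dots> = ((LINT x|lborel. Fd x * P x) + (LINT x|lborel. Yd x * Q x)) + - (LINT v|lborel. pd v * S v)"
      unfolding FY pS by simp
    finally have "(cmod (Dg \<mu> - (LINT v|lborel. pd v * ex (1 / \<mu>) v)))\<^sup>2 \<le> 2 * (cmod ((LINT x|lborel. Fd x * P x) + (LINT x|lborel. Yd x * Q x)))\<^sup>2 + 2 * (cmod (- (LINT v|lborel. pd v * S v)))\<^sup>2"
      using cmod_add_sq_le by metis
    also have "\<dots> \<le> 2 * (2 * (cmod (LINT x|lborel. Fd x * P x))\<^sup>2 + 2 * (cmod (LINT x|lborel. Yd x * Q x))\<^sup>2) + 2 * (nsq pd * nsq S)"
      using cmod_add_sq_le[of "LINT x|lborel. Fd x * P x" "LINT x|lborel. Yd x * Q x"] L2_Cauchy_Schwarz[OF Lpd LS] by simp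
    also have "\<dots> \<le> 2 * (2 * (nsq Fd * nsq S) + 2 * (nsq Yd * nsq S)) + 2 * (nsq pd * nsq S)"
    proof -
      have "nsq P \<le> nsq S" "nsq Q \<le> nsq S" using iso nsq_nonneg[of P] nsq_nonneg[of Q] by linarith+
      then have "nsq Fd * nsq P \<le> nsq Fd * nsq S" "nsq Yd * nsq Q \<le> nsq Yd * nsq S"
        by (auto intro!: mult_left_mono nsq_nonneg)
      note 1 = order_trans[OF L2_Cauchy_Schwarz[OF LF LP] this(1)] and 2 = order_trans[OF L2_Cauchy_Schwarz[OF LY LQ] this(2)]
      show ?thesis by (intro add_mono mult_left_mono order_refl 1 2) simp_all
    qed
    also have "\<dots> = 2 * K * nsq S" by (simp add: K_def algebra_simps)
    also have "\<dots> \<le> 2 * K * e'" using na K by (intro mult_left_mono) (auto simp: Seq)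
    also have "\<dots> \<le> (2 * K + 1) * e'" using e' by (simp add: algebra_simps)
    also have "\<dots> = e" using K by (simp add: e'_def)
    finally show ?thesis .
  qed
  then have "(cmod (Dg \<mu> - (LINT v|lborel. pd v * ex (1 / \<mu>) v)))\<^sup>2 \<le> 0 + e" if "0 < e" for e
    unfolding add_0_left using that by blast
  then have "(cmod (Dg \<mu> - (LINT v|lborel. pd v * ex (1 / \<mu>) v)))\<^sup>2 \<le> 0" by (rule field_le_epsilon)
  then show ?thesis by simp
qed

text \<open>For \<open>\<mu> \<ge> 5\<close> two evaluations of \<open>Dg \<mu>\<close> hold, the
  extended one and that of \<open>diag_large\<close>; equating them eliminates the diagonal.\<close>

lemma Laplace_relation:
  assumes "L2 Fd" "L2 Yd" "5 \<le> \<mu>"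
  shows "F 0 0 + (LINT u|lborel. gd u * ex \<mu> u) = - (LINT v|lborel. pd v * ex (1 / \<mu>) v)"
proof -
  have "0 < \<mu>" using assms(3) by simp
  from trans[OF sym[OF Dg_extend[OF assms(1,2) this]] diag_large[OF assms(3)]] show ?thesis by simp
qed

end

text \<open>Integration by parts on \<open>[0, n]\<close>. By Cauchy-Schwarz the primitive grows at
  most linearly, so the exponential removes the boundary term at infinity.\<close>

lemma Laplace_derivative:
  assumes "L2 q" "\<And>x. x \<le> 0 \<Longrightarrow> q x = 0" "L2 (half g)" "\<And>u. 0 < u \<Longrightarrow> g u = c + (LINT s:{0..u}|lborel. q s)" "0 < \<mu>"
  shows "cor \<mu> * (LINT u|lborel. half g u * ex \<mu> u) = c + (LINT u|lborel. q u * ex \<mu> u)"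
proof -
  define Q where "Q u = c + (LINT s:{0..u}|lborel. q s)" for u
  have cQ: "continuous_on S Q" for S
    unfolding Q_def by (intro continuous_intros continuous_on_subset[OF L2_primitive_continuous[OF assms(1)]]) auto
  have i1: "integrable lborel (\<lambda>u. half g u * ex \<mu> u)" and i2: "integrable lborel (\<lambda>u. q u * ex \<mu> u)"
    using assms by (auto intro!: L2_mult_integrable L2_ex)
  have i: "integrable lborel (\<lambda>u. (q u - cor \<mu> * half g u) * ex \<mu> u)"
    using Bochner_Integration.integrable_diff[OF i2 integrable_mult_right[OF i1, of "cor \<mu>"]] by (simp add: algebra_simps)
  have m1: "(\<lambda>u. q u - cor \<mu> * Q u) \<in> borel_measurable borel"
    by (intro borel_measurable_diff borel_measurable_times borel_measurable_const L2_measurable[OF assms(1)] borel_measurable_continuous_onI[OF cQ])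
  have m2: "(\<lambda>u. q u - cor \<mu> * half g u) \<in> borel_measurable borel"
    by (intro borel_measurable_diff borel_measurable_times borel_measurable_const L2_measurable[OF assms(1)] L2_measurable[OF assms(3)])
  have Q0: "Q 0 = c"
  proof -
    have "(LINT s:{0..0}|lborel. q s) = 0" unfolding set_lebesgue_integral_def
      using assms(2)[of 0] by (intro integral_eq_zero_AE) (auto split: split_indicator)
    then show ?thesis by (simp add: Q_def)
  qed
  have eq: "(LINT u:{0..real n}|lborel. (q u - cor \<mu> * half g u) * ex \<mu> u) = cor (exp (- (\<mu> * real n))) * Q (real n) - c" for n
  proof -
    have e1: "(LINT u:{0..real n}|lborel. cor (exp (- (\<mu> * u))) * (q u - cor \<mu> * Q u)) = cor (exp (- (\<mu> * real n))) * Q (real n) - cor (exp (- (\<mu> * 0))) * Q 0"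
    proof (rule exp_product_rule[OF _ L2_set_integrable[OF assms(1)] cQ])
      show "Q v = Q 0 + (LINT s:{0..v}|lborel. q s)" for v unfolding Q0 by (simp only: Q_def)
    qed simp
    have e2: "(LINT u:{0..real n}|lborel. cor (exp (- (\<mu> * u))) * (q u - cor \<mu> * Q u)) = (LINT u:{0..real n}|lborel. (q u - cor \<mu> * half g u) * ex \<mu> u)"
    proof (rule set_integral_ex_half[OF _ m1 m2])
      fix u :: real assume u: "0 < u"
      then have "half g u = Q u" by (simp only: half_pos assms(4) Q_def)
      then show "cor (exp (- (\<mu> * u))) * (q u - cor \<mu> * Q u) = (q u - cor \<mu> * half g u) * ex \<mu> u"
        by (simp only: ex_pos[OF u] mult.commute)
    qed
    show ?thesis unfolding e2[symmetric] e1 Q0 by (simp only: mult_zero_right minus_zero exp_zero of_real_1 mult_1_left)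
  qed
  have lim: "(\<lambda>n. cor (exp (- (\<mu> * real n))) * Q (real n)) \<longlonglongrightarrow> 0"
  proof (rule Lim_null_comparison)
    define B where "B = cmod c + nsq q + 1"
    show "\<forall>\<^sub>F n in sequentially. norm (cor (exp (- (\<mu> * real n))) * Q (real n)) \<le> B * (1 + real n) * exp (- (\<mu> * real n))"
    proof (rule always_eventually, rule allI)
      fix n
      have "(cmod (LINT s:{0..real n}|lborel. q s))\<^sup>2 \<le> (nsq q + real n)\<^sup>2"
      proof -
        have "(cmod (LINT s:{0..real n}|lborel. q s))\<^sup>2 \<le> nsq q * nsq (indicator {0..real n})"
          unfolding L2_set_integral_eq by (rule L2_Cauchy_Schwarz[OF assms(1) L2_indicator(1)])
        also have "\<dots> = nsq q * real n" by (simp add: L2_indicator(2))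
        also have "\<dots> \<le> (nsq q + real n)\<^sup>2" using nsq_nonneg[of q] by (simp add: power2_eq_square algebra_simps)
        finally show ?thesis .
      qed
      then have "cmod (LINT s:{0..real n}|lborel. q s) \<le> nsq q + real n"
        by (rule power2_le_imp_le) (simp add: nsq_nonneg)
      then have "cmod (Q (real n)) \<le> cmod c + (nsq q + real n)"
        unfolding Q_def using norm_triangle_ineq[of c "LINT s:{0..real n}|lborel. q s"] by linarith
      also have "\<dots> \<le> B * (1 + real n)" unfolding B_def using nsq_nonneg[of q] by (simp add: algebra_simps)
      finally show "norm (cor (exp (- (\<mu> * real n))) * Q (real n)) \<le> B * (1 + real n) * exp (- (\<mu> * real n))"
        by (simp add: norm_mult mult.commute[of _ "exp (- (\<mu> * real n))"])
    qed
    show "(\<lambda>n. B * (1 + real n) * exp (- (\<mu> * real n))) \<longlonglongrightarrow> 0" using assms(5) by real_asymp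
  qed
  have "(\<lambda>n. LINT u:{0..real n}|lborel. (q u - cor \<mu> * half g u) * ex \<mu> u) \<longlonglongrightarrow> (LINT u|lborel. (q u - cor \<mu> * half g u) * ex \<mu> u)"
    by (rule set_integral_tendsto_half[OF i]) (simp add: ex_nonpos)
  from LIMSEQ_unique[OF this[unfolded eq] tendsto_diff[OF lim tendsto_const]]
  have "(LINT u|lborel. (q u - cor \<mu> * half g u) * ex \<mu> u) = - c" by simp
  moreover have "(LINT u|lborel. (q u - cor \<mu> * half g u) * ex \<mu> u) = (LINT u|lborel. q u * ex \<mu> u) - cor \<mu> * (LINT u|lborel. half g u * ex \<mu> u)"
  proof -
    have "(LINT u|lborel. (q u - cor \<mu> * half g u) * ex \<mu> u) = (LINT u|lborel. q u * ex \<mu> u - cor \<mu> * (half g u * ex \<mu> u))"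
      by (intro Bochner_Integration.integral_cong refl) (simp add: algebra_simps)
    then show ?thesis using i1 i2 by simp
  qed
  ultimately show ?thesis by (simp add: algebra_simps)
qed

text \<open>Letting \<open>\<mu>\<close> tend to infinity in the Laplace identity recovers the matching condition at the vertex.\<close>
lemma hankel_vertex:
  assumes g: "L2 gd" "\<And>x. x \<le> 0 \<Longrightarrow> gd x = 0" "L2 (half g)" "\<And>u. 0 < u \<Longrightarrow> g u = c + (LINT s:{0..u}|lborel. gd s)"
    and p: "L2 pd" "\<And>x. x \<le> 0 \<Longrightarrow> pd x = 0" "L2 (half p)" "\<And>u. 0 < u \<Longrightarrow> p u = d + (LINT s:{0..u}|lborel. pd s)"
    and L: "\<And>\<mu>. 0 < \<mu> \<Longrightarrow> cor \<mu> * (LINT u|lborel. half g u * ex \<mu> u) = - (LINT v|lborel. pd v * ex (1 / \<mu>) v)"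
  shows "c = d"
proof -
  have ns: "nsq (ex \<mu>) = 1 / (2 * \<mu>)" if "0 < \<mu>" for \<mu>
  proof -
    have "cor (nsq (ex \<mu>)) = cor (1 / (2 * \<mu>))"
      using nsq_exp_sum[of "{0::nat}" "\<lambda>_. \<mu>" "\<lambda>_. 1"] that by simp
    then show ?thesis by (simp only: of_real_eq_iff)
  qed
  \<comment> \<open>Integrating by parts on the side of \<open>p\<close> as well produces the second
    trace \<open>d\<close>, and what remains there is a pairing with \<open>p\<close> itself
    carrying the small factor \<open>1 / \<mu>\<close>.\<close>
  have eq: "c - d = - (LINT u|lborel. gd u * ex \<mu> u) - cor (1 / \<mu>) * (LINT v|lborel. half p v * ex (1 / \<mu>) v)" if "0 < \<mu>" for \<mu>
  proof -
    have "0 < 1 / \<mu>" using that by simp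
    have e2: "cor (1 / \<mu>) * (LINT v|lborel. half p v * ex (1 / \<mu>) v) = d + (LINT v|lborel. pd v * ex (1 / \<mu>) v)"
      by (rule Laplace_derivative[OF p \<open>0 < 1 / \<mu>\<close>])
    have "c + (LINT u|lborel. gd u * ex \<mu> u) = - (LINT v|lborel. pd v * ex (1 / \<mu>) v)"
      by (rule trans[OF sym[OF Laplace_derivative[OF g that]] L[OF that]])
    then have B: "(LINT v|lborel. pd v * ex (1 / \<mu>) v) = - (c + (LINT u|lborel. gd u * ex \<mu> u))"
      by (simp only: minus_minus)
    show ?thesis unfolding e2 B by simp
  qed
  \<comment> \<open>The first remainder is small because
    \<open>nsq (ex \<mu>) = 1 / (2 * \<mu>)\<close>. In the second,
    \<open>nsq (ex (1 / \<mu>)) = \<mu> / 2\<close> grows, but the factor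
    \<open>(1 / \<mu>)\<^sup>2\<close> outweighs it.\<close>
  have bd: "(cmod (c - d))\<^sup>2 \<le> (nsq gd + nsq (half p)) * (1 / \<mu>)" if \<mu>: "0 < \<mu>" for \<mu>
  proof -
    have m: "0 < 1 / \<mu>" using \<mu> by simp
    have "c - d = - (LINT u|lborel. gd u * ex \<mu> u) + - (cor (1 / \<mu>) * (LINT v|lborel. half p v * ex (1 / \<mu>) v))"
      using eq[OF \<mu>] by (simp only: diff_conv_add_uminus)
    then have "(cmod (c - d))\<^sup>2 \<le> 2 * (cmod (- (LINT u|lborel. gd u * ex \<mu> u)))\<^sup>2 + 2 * (cmod (- (cor (1 / \<mu>) * (LINT v|lborel. half p v * ex (1 / \<mu>) v))))\<^sup>2"
      using cmod_add_sq_le by metis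
    also have "\<dots> = 2 * (cmod (LINT u|lborel. gd u * ex \<mu> u))\<^sup>2 + 2 * ((1 / \<mu>)\<^sup>2 * (cmod (LINT v|lborel. half p v * ex (1 / \<mu>) v))\<^sup>2)"
      using \<mu> by (simp add: norm_mult norm_divide power_mult_distrib power_divide)
    also have "\<dots> \<le> 2 * (nsq gd * (1 / (2 * \<mu>))) + 2 * ((1 / \<mu>)\<^sup>2 * (nsq (half p) * (1 / (2 * (1 / \<mu>)))))"
      unfolding ns[OF \<mu>, symmetric] ns[OF m, symmetric]
      by (intro add_mono mult_left_mono L2_Cauchy_Schwarz g p L2_ex \<mu> m) auto
    also have "\<dots> = (nsq gd + nsq (half p)) * (1 / \<mu>)"
      using \<mu> by (simp add: field_simps power2_eq_square)
    finally show ?thesis .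
  qed
  have "(\<lambda>n. (nsq gd + nsq (half p)) * (1 / real (Suc n))) \<longlonglongrightarrow> (nsq gd + nsq (half p)) * 0"
    by (intro tendsto_mult tendsto_const LIMSEQ_Suc lim_1_over_n)
  then have "(cmod (c - d))\<^sup>2 \<le> (nsq gd + nsq (half p)) * 0"
    by (rule LIMSEQ_le_const) (use bd in auto)
  then show ?thesis by simp
qed

subsection \<open>Weak solutions\<close>

text \<open>Taylor's formula with Lagrange remainder on either side of \<open>x\<close>; the
  first-order terms cancel.\<close>

lemma second_difference:
  fixes f f' f'' :: "real \<Rightarrow> real"
  assumes d1: "\<And>x. (f has_real_derivative f' x) (at x)" and d2: "\<And>x. (f' has_real_derivative f'' x) (at x)" and e: "0 < e"
  shows "\<exists>s t. s \<in> {x - e..x + e} \<and> t \<in> {x - e..x + e} \<and> f (x + e) + f (x - e) - 2 * f x = e\<^sup>2 / 2 * (f'' s + f'' t)"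
proof -
  define D where "D m = (if m = 0 then f else if m = Suc 0 then f' else f'')" for m :: nat
  have D: "\<forall>m t. m < 2 \<and> x - e \<le> t \<and> t \<le> x + e \<longrightarrow> (D m has_real_derivative D (Suc m) t) (at t)"
    using d1 d2 by (auto simp: D_def less_2_cases_iff)
  obtain s where s: "x < s" "s < x + e" "f (x + e) = (\<Sum>m<2. D m x / fact m * (x + e - x) ^ m) + D 2 s / fact 2 * (x + e - x)\<^sup>2"
    using Taylor_up[of 2 D f "x - e" "x + e" x] D e by (auto simp: D_def)
  obtain t where t: "x - e < t" "t < x" "f (x - e) = (\<Sum>m<2. D m x / fact m * (x - e - x) ^ m) + D 2 t / fact 2 * (x - e - x)\<^sup>2"
    using Taylor_down[of 2 D f "x - e" "x + e" x] D e by (auto simp: D_def)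
  have "f (x + e) = f x + f' x * e + f'' s / 2 * e\<^sup>2" "f (x - e) = f x - f' x * e + f'' t / 2 * e\<^sup>2"
    using s(3) t(3) by (simp_all add: D_def numeral_2_eq_2)
  then have "f (x + e) + f (x - e) - 2 * f x = e\<^sup>2 / 2 * (f'' s + f'' t)" by (simp add: algebra_simps)
  then show ?thesis using s t e by (intro exI[of _ s] exI[of _ t]) auto
qed

lemma abs_diff_sums_le:
  fixes a b c d :: real
  assumes "\<bar>a\<bar> \<le> M" "\<bar>b\<bar> \<le> M" "\<bar>c\<bar> \<le> N" "\<bar>d\<bar> \<le> N"
  shows "\<bar>a + b - (c + d)\<bar> \<le> 2 * (M + N)"
  using assms[THEN abs_le_D1] assms[THEN abs_le_D2] by (intro abs_leI) argo+

lemma compact_support_integrable: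
  fixes f :: "real \<times> real \<Rightarrow> complex"
  assumes "continuous_on UNIV f" "\<And>z. B < norm z \<Longrightarrow> f z = 0"
  shows "integrable lborel f"
proof -
  have "integrable lborel (\<lambda>z. indicator (cball 0 B) z *\<^sub>R f z)"
    by (intro borel_integrable_compact compact_cball continuous_on_subset[OF assms(1)]) auto
  moreover have "indicator (cball 0 B) z *\<^sub>R f z = f z" for z
    using assms(2)[of z] by (auto simp: indicator_def)
  ultimately show ?thesis by simp
qed

lemma lborel_integral_translate:
  fixes f :: "real \<times> real \<Rightarrow> complex"
  assumes "f \<in> borel_measurable borel"
  shows "(LINT z::real \<times> real|lborel. f (c + z)) = (LINT z::real \<times> real|lborel. f z)"
proof -
  have "(LINT z|lborel. f z) = (LINT z|distr lborel borel ((+) c). f z)" by (simp add: lborel_distr_plus)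
  also have "\<dots> = (LINT z|lborel. f (c + z))" using assms by (subst integral_distr) auto
  finally show ?thesis by simp
qed

lemma square_average:
  assumes F: "jcont F" and d: "0 \<le> d" and \<eta>: "\<And>s t. \<bar>s - u\<bar> \<le> d \<Longrightarrow> \<bar>t - v\<bar> \<le> d \<Longrightarrow> cmod (F s t - c) \<le> \<eta>"
  shows "cmod (integral {u - d..u + d} (\<lambda>s. integral {v - d..v + d} (\<lambda>t. F s t)) - cor ((2 * d)\<^sup>2) * c) \<le> (2 * d)\<^sup>2 * \<eta>"
proof -
  have i: "(\<lambda>t. F s t) integrable_on {v - d..v + d}" for s
    by (intro integrable_continuous_interval jcont_sections[OF F])
  have ci: "continuous_on {u - d..u + d} (\<lambda>s. integral {v - d..v + d} (\<lambda>t. F s t))"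
  proof (rule continuous_on_eq)
    show "continuous_on {u - d..u + d} (\<lambda>s. Sg (\<lambda>t. F s t) (v + d) - Sg (\<lambda>t. F s t) (v - d))"
      by (intro continuous_on_diff; rule jcont_compose[OF Sg_jcont(1)[OF F]]; auto intro!: continuous_intros)
  qed (use d in \<open>simp add: Sg_diff[OF jcont_sections(1)[OF F]]\<close>)
  have inner: "cmod (integral {v - d..v + d} (\<lambda>t. F s t) - cor (2 * d) * c) \<le> 2 * d * \<eta>" if "s \<in> {u - d..u + d}" for s
  proof -
    have "integral {v - d..v + d} (\<lambda>t. F s t) - cor (2 * d) * c = integral {v - d..v + d} (\<lambda>t. F s t - c)"
      using d by (subst Henstock_Kurzweil_Integration.integral_diff[OF i]) (auto simp: scaleR_conv_of_real)
    also have "cmod \<dots> \<le> integral {v - d..v + d} (\<lambda>t. \<eta>)"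
      using that \<eta> i by (intro integral_norm_bound_integral Henstock_Kurzweil_Integration.integrable_diff) (auto simp: abs_le_iff)
    finally show ?thesis using d by simp
  qed
  have "integral {u - d..u + d} (\<lambda>s. integral {v - d..v + d} (\<lambda>t. F s t)) - cor ((2 * d)\<^sup>2) * c
    = integral {u - d..u + d} (\<lambda>s. integral {v - d..v + d} (\<lambda>t. F s t) - cor (2 * d) * c)"
    using d by (subst Henstock_Kurzweil_Integration.integral_diff[OF integrable_continuous_interval[OF ci]])
      (auto simp: scaleR_conv_of_real power2_eq_square)
  also have "cmod \<dots> \<le> integral {u - d..u + d} (\<lambda>s. 2 * d * \<eta>)"
    using inner by (intro integral_norm_bound_integral Henstock_Kurzweil_Integration.integrable_diff integrable_continuous_interval[OF ci]) auto
  finally show ?thesis using d by (simp add: power2_eq_square)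
qed

lemma test_fun_derivs:
  assumes "test_fun \<psi>"
  shows "\<And>t x. ((\<lambda>s. \<psi> s x) has_real_derivative dpart 1 0 \<psi> t x) (at t)"
    "\<And>t x. ((\<lambda>s. dpart 1 0 \<psi> s x) has_real_derivative dpart 2 0 \<psi> t x) (at t)"
    "\<And>t x. ((\<lambda>y. \<psi> t y) has_real_derivative dpart 0 1 \<psi> t x) (at x)"
    "\<And>t x. ((\<lambda>y. dpart 0 1 \<psi> t y) has_real_derivative dpart 0 2 \<psi> t x) (at x)"
    "jcont \<psi>" "jcont (dpart 2 0 \<psi>)" "jcont (dpart 0 2 \<psi>)"
proof -
  have c: "jcont (dpart i j \<psi>)" for i j using assms unfolding test_fun_def by blast
  have dt: "((\<lambda>s. dpart i j \<psi> s x) has_real_derivative deriv (\<lambda>s. dpart i j \<psi> s x) t) (at t)" for i j t x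
    using assms unfolding test_fun_def by (simp add: DERIV_deriv_iff_real_differentiable)
  have dx: "((\<lambda>y. dpart i j \<psi> t y) has_real_derivative deriv (\<lambda>y. dpart i j \<psi> t y) x) (at x)" for i j t x
    using assms unfolding test_fun_def by (simp add: DERIV_deriv_iff_real_differentiable)
  show "((\<lambda>s. \<psi> s x) has_real_derivative dpart 1 0 \<psi> t x) (at t)" for t x using dt[of 0 0 x t] by simp
  show "((\<lambda>s. dpart 1 0 \<psi> s x) has_real_derivative dpart 2 0 \<psi> t x) (at t)" for t x using dt[of 1 0 x t] by (simp add: numeral_2_eq_2)
  show "((\<lambda>y. \<psi> t y) has_real_derivative dpart 0 1 \<psi> t x) (at x)" for t x using dx[of 0 0 t x] by simp
  show "((\<lambda>y. dpart 0 1 \<psi> t y) has_real_derivative dpart 0 2 \<psi> t x) (at x)" for t x using dx[of 0 1 t x] by (simp add: numeral_2_eq_2)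
  show "jcont \<psi>" using c[of 0 0] by simp
  show "jcont (dpart 2 0 \<psi>)" "jcont (dpart 0 2 \<psi>)" by (rule c)+
qed

text \<open>Moving the second differences from \<open>\<psi>\<close> to \<open>\<phi>\<close> turns them into integrals of \<open>F\<close> over
  characteristic rectangles, so no mixed derivative of \<open>\<psi>\<close> is needed.\<close>
theorem rect_imp_distributional:
  assumes F: "rect F" and \<psi>: "test_fun \<psi>"
  shows "(LINT z|lborel. F ((snd z - fst z) / 2) ((snd z + fst z) / 2) *
     cor (dpart 2 0 \<psi> (fst z) (snd z) - dpart 0 2 \<psi> (fst z) (snd z) + \<psi> (fst z) (snd z))) = 0"
proof -
  note jF = rect_jcont[OF F] and T = test_fun_derivs[OF \<psi>]
  define \<phi> where "\<phi> z = F ((snd z - fst z) / 2) ((snd z + fst z) / 2)" for z :: "real \<times> real"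
  have c\<phi>: "continuous_on UNIV \<phi>" unfolding \<phi>_def by (intro jcont_compose[OF jF] continuous_intros) auto
  define \<Psi> where "\<Psi> z = cor (\<psi> (fst z) (snd z))" for z :: "real \<times> real"
  have c\<Psi>: "continuous_on UNIV \<Psi>" unfolding \<Psi>_def using T(5) by (intro continuous_intros)
  obtain B where B0: "\<And>z. \<psi> (fst z) (snd z) \<noteq> 0 \<Longrightarrow> norm z \<le> B"
    using \<psi> unfolding test_fun_def bounded_iff by blast
  have B: "\<psi> t x = 0" if "B < norm (t, x)" for t x using B0[of "(t, x)"] that by auto
  define en where "en n = 1 / real (Suc n)" for n
  have en: "0 < en n" "en n \<le> 1" for n by (auto simp: en_def)
  have en0: "en \<longlonglongrightarrow> 0" unfolding en_def by (rule LIMSEQ_Suc[OF lim_1_over_n])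
  \<comment> \<open>The discrete wave operator: the middle terms of the two second differences
    cancel. Divided by \<open>e\<^sup>2\<close> it tends to \<open>W\<close>.\<close>
  define DD where "DD e z = \<psi> (fst z + e) (snd z) + \<psi> (fst z - e) (snd z) - \<psi> (fst z) (snd z + e) - \<psi> (fst z) (snd z - e)" for e and z :: "real \<times> real"
  define W where "W z = dpart 2 0 \<psi> (fst z) (snd z) - dpart 0 2 \<psi> (fst z) (snd z)" for z
  have DDmv: "\<exists>s t p q. \<bar>s - fst z\<bar> \<le> e \<and> \<bar>t - fst z\<bar> \<le> e \<and> \<bar>p - snd z\<bar> \<le> e \<and> \<bar>q - snd z\<bar> \<le> e \<and>
     DD e z = e\<^sup>2 / 2 * ((dpart 2 0 \<psi> s (snd z) + dpart 2 0 \<psi> t (snd z)) - (dpart 0 2 \<psi> (fst z) p + dpart 0 2 \<psi> (fst z) q))"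
    if e: "0 < e" for e z
  proof -
    obtain s t where st: "s \<in> {fst z - e..fst z + e}" "t \<in> {fst z - e..fst z + e}"
       "\<psi> (fst z + e) (snd z) + \<psi> (fst z - e) (snd z) - 2 * \<psi> (fst z) (snd z) = e\<^sup>2 / 2 * (dpart 2 0 \<psi> s (snd z) + dpart 2 0 \<psi> t (snd z))"
      using second_difference[of "\<lambda>s. \<psi> s (snd z)", OF T(1) T(2) e] by blast
    obtain p q where pq: "p \<in> {snd z - e..snd z + e}" "q \<in> {snd z - e..snd z + e}"
       "\<psi> (fst z) (snd z + e) + \<psi> (fst z) (snd z - e) - 2 * \<psi> (fst z) (snd z) = e\<^sup>2 / 2 * (dpart 0 2 \<psi> (fst z) p + dpart 0 2 \<psi> (fst z) q)"
      using second_difference[of "\<lambda>y. \<psi> (fst z) y", OF T(3) T(4) e] by blast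
    have "DD e z = e\<^sup>2 / 2 * ((dpart 2 0 \<psi> s (snd z) + dpart 2 0 \<psi> t (snd z)) - (dpart 0 2 \<psi> (fst z) p + dpart 0 2 \<psi> (fst z) q))"
      unfolding DD_def right_diff_distrib st(3)[symmetric] pq(3)[symmetric] by simp
    then show ?thesis using st(1,2) pq(1,2) by (intro exI[of _ s] exI[of _ t] exI[of _ p] exI[of _ q]) (auto simp: abs_le_iff)
  qed
  have jcc: "jcont (\<lambda>t x. cor (dpart 2 0 \<psi> t x))" "jcont (\<lambda>t x. cor (dpart 0 2 \<psi> t x))"
    using T(6,7) by (auto intro!: continuous_intros)
  \<comment> \<open>\<open>DD e\<close> vanishes outside norm \<open>B + 1\<close>, and its
    intermediate points are at distance at most 1 from the argument; hence the box of half width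
    \<open>B + 2\<close>.\<close>
  obtain M1 where M1: "0 \<le> M1" "\<And>t x. - (B + 2) \<le> t \<Longrightarrow> t \<le> B + 2 \<Longrightarrow> - (B + 2) \<le> x \<Longrightarrow> x \<le> B + 2 \<Longrightarrow> \<bar>dpart 2 0 \<psi> t x\<bar> \<le> M1"
    using jcont_bounded[OF jcc(1)] by (metis norm_of_real)
  obtain M2 where M2: "0 \<le> M2" "\<And>t x. - (B + 2) \<le> t \<Longrightarrow> t \<le> B + 2 \<Longrightarrow> - (B + 2) \<le> x \<Longrightarrow> x \<le> B + 2 \<Longrightarrow> \<bar>dpart 0 2 \<psi> t x\<bar> \<le> M2"
    using jcont_bounded[OF jcc(2)] by (metis norm_of_real)
  have DDsupp: "DD e z = 0" if e: "0 < e" "e \<le> 1" and z: "B + 1 < norm z" for e z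
  proof -
    obtain t x where tx: "z = (t, x)" by (cases z)
    have n: "norm (t + a, x + b) > B" if "norm (a, b) \<le> 1" for a b
    proof -
      have "norm ((t, x) :: real \<times> real) \<le> norm (t + a, x + b) + norm (a, b)"
        using norm_triangle_ineq4[of "(t + a, x + b)" "(a, b)"] by simp
      then show ?thesis using z that by (simp add: tx)
    qed
    have "norm (e, 0::real) \<le> 1" "norm (- e, 0::real) \<le> 1" "norm (0::real, e) \<le> 1" "norm (0::real, - e) \<le> 1"
      using e by (auto simp: norm_Pair)
    from this[THEN n] show ?thesis unfolding DD_def tx by (simp add: B)
  qed
  have DDbd: "\<bar>DD e z\<bar> / e\<^sup>2 \<le> M1 + M2" if e: "0 < e" "e \<le> 1" for e z
  proof (cases "B + 1 < norm z")
    case True then show ?thesis using DDsupp[OF e] M1(1) M2(1) by simp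
  next
    case False
    obtain s t p q where st: "\<bar>s - fst z\<bar> \<le> e" "\<bar>t - fst z\<bar> \<le> e" "\<bar>p - snd z\<bar> \<le> e" "\<bar>q - snd z\<bar> \<le> e"
      and eq: "DD e z = e\<^sup>2 / 2 * ((dpart 2 0 \<psi> s (snd z) + dpart 2 0 \<psi> t (snd z)) - (dpart 0 2 \<psi> (fst z) p + dpart 0 2 \<psi> (fst z) q))"
      using DDmv[OF e(1)] by blast
    have "\<bar>fst z\<bar> \<le> B + 1" "\<bar>snd z\<bar> \<le> B + 1"
      using False norm_fst_le[of "fst z" "snd z"] norm_snd_le[of "snd z" "fst z"] by auto
    then have "\<bar>dpart 2 0 \<psi> s (snd z)\<bar> \<le> M1" "\<bar>dpart 2 0 \<psi> t (snd z)\<bar> \<le> M1" "\<bar>dpart 0 2 \<psi> (fst z) p\<bar> \<le> M2" "\<bar>dpart 0 2 \<psi> (fst z) q\<bar> \<le> M2"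
      using st e(2) by - (intro M1(2) M2(2); linarith)+
    then have "\<bar>(dpart 2 0 \<psi> s (snd z) + dpart 2 0 \<psi> t (snd z)) - (dpart 0 2 \<psi> (fst z) p + dpart 0 2 \<psi> (fst z) q)\<bar> \<le> 2 * (M1 + M2)" by (rule abs_diff_sums_le)
    then have "\<bar>DD e z\<bar> \<le> e\<^sup>2 / 2 * (2 * (M1 + M2))" unfolding eq abs_mult by (intro mult_mono) auto
    also have "\<dots> = (M1 + M2) * e\<^sup>2" by (simp add: algebra_simps)
    finally show ?thesis using e by (simp add: divide_le_eq)
  qed
  have DDlim: "(\<lambda>n. DD (en n) z / (en n)\<^sup>2) \<longlonglongrightarrow> W z" for z
  proof -
    obtain s t p q where st: "\<And>n. \<bar>s n - fst z\<bar> \<le> en n" "\<And>n. \<bar>t n - fst z\<bar> \<le> en n" "\<And>n. \<bar>p n - snd z\<bar> \<le> en n" "\<And>n. \<bar>q n - snd z\<bar> \<le> en n"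
      and eq: "\<And>n. DD (en n) z = (en n)\<^sup>2 / 2 * ((dpart 2 0 \<psi> (s n) (snd z) + dpart 2 0 \<psi> (t n) (snd z)) - (dpart 0 2 \<psi> (fst z) (p n) + dpart 0 2 \<psi> (fst z) (q n)))"
      using DDmv[OF en(1)] by metis
    have l: "r \<longlonglongrightarrow> a" if "\<And>n. \<bar>r n - a\<bar> \<le> en n" for r a
      by (rule LIM_zero_cancel, rule Lim_null_comparison[OF _ en0]) (use that in auto)
    have c1: "isCont (\<lambda>s. dpart 2 0 \<psi> s (snd z)) (fst z)" "isCont (\<lambda>y. dpart 0 2 \<psi> (fst z) y) (snd z)"
      using jcont_compose[OF T(6), of UNIV "\<lambda>s. s" "\<lambda>_. snd z"] jcont_compose[OF T(7), of UNIV "\<lambda>_. fst z" "\<lambda>s. s"]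
      by (auto simp: continuous_on_eq_continuous_at intro: continuous_intros)
    have "(\<lambda>n. ((dpart 2 0 \<psi> (s n) (snd z) + dpart 2 0 \<psi> (t n) (snd z)) - (dpart 0 2 \<psi> (fst z) (p n) + dpart 0 2 \<psi> (fst z) (q n))) / 2)
      \<longlonglongrightarrow> ((dpart 2 0 \<psi> (fst z) (snd z) + dpart 2 0 \<psi> (fst z) (snd z)) - (dpart 0 2 \<psi> (fst z) (snd z) + dpart 0 2 \<psi> (fst z) (snd z))) / 2"
      by (intro tendsto_intros isCont_tendsto_compose[OF c1(1)] isCont_tendsto_compose[OF c1(2)] l st) auto
    moreover have "DD (en n) z / (en n)\<^sup>2 = ((dpart 2 0 \<psi> (s n) (snd z) + dpart 2 0 \<psi> (t n) (snd z)) - (dpart 0 2 \<psi> (fst z) (p n) + dpart 0 2 \<psi> (fst z) (q n))) / 2" for n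
      unfolding eq using en(1)[of n] by simp
    moreover have "((dpart 2 0 \<psi> (fst z) (snd z) + dpart 2 0 \<psi> (fst z) (snd z)) - (dpart 0 2 \<psi> (fst z) (snd z) + dpart 0 2 \<psi> (fst z) (snd z))) / 2 = W z"
      by (simp add: W_def)
    ultimately show ?thesis by (simp only:)
  qed
  obtain M where M: "0 \<le> M" "\<And>s t. - (B + 2) \<le> s \<Longrightarrow> s \<le> B + 2 \<Longrightarrow> - (B + 2) \<le> t \<Longrightarrow> t \<le> B + 2 \<Longrightarrow> cmod (F s t) \<le> M"
    using jcont_bounded[OF jF] by blast
  have half_le: "\<bar>(snd z - fst z) / 2\<bar> \<le> norm z" "\<bar>(snd z + fst z) / 2\<bar> \<le> norm z" for z :: "real \<times> real"
    using norm_fst_le[of "fst z" "snd z"] norm_snd_le[of "snd z" "fst z"] by auto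
  have M\<phi>: "cmod (\<phi> z) \<le> M" if "norm z \<le> B + 2" for z
    unfolding \<phi>_def using half_le[of z] that by (intro M(2)) auto
  have ib: "integrable lborel (\<lambda>z::real \<times> real. indicator (cball 0 (B + 2)) z * K)" for K :: real
  proof -
    have "emeasure lborel (cball (0::real \<times> real) (B + 2)) < \<infinity>" by (rule emeasure_bounded_finite) simp
    then have "integrable lborel (indicator (cball (0::real \<times> real) (B + 2)) :: _ \<Rightarrow> real)" by (intro integrable_real_indicator) auto
    then show ?thesis by (rule integrable_mult_left)
  qed
  have cDD: "continuous_on UNIV (DD e)" for e
    unfolding DD_def by (intro continuous_intros jcont_compose[OF T(5)])
  have lim1: "(\<lambda>n. LINT z|lborel. \<phi> z * cor (DD (en n) z / (en n)\<^sup>2)) \<longlonglongrightarrow> (LINT z|lborel. \<phi> z * cor (W z))"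
  proof (rule integral_dominated_convergence[OF _ _ ib])
    show "(\<lambda>z. \<phi> z * cor (W z)) \<in> borel_measurable lborel"
      unfolding W_def using c\<phi> T(6,7) by (auto intro!: borel_measurable_continuous_onI continuous_intros)
    show "(\<lambda>z. \<phi> z * cor (DD (en n) z / (en n)\<^sup>2)) \<in> borel_measurable lborel" for n
      using c\<phi> cDD[of "en n"] en(1)[of n] by (auto intro!: borel_measurable_continuous_onI continuous_intros)
    show "AE z in lborel. (\<lambda>n. \<phi> z * cor (DD (en n) z / (en n)\<^sup>2)) \<longlonglongrightarrow> \<phi> z * cor (W z)"
      by (intro AE_I2 tendsto_mult tendsto_const tendsto_of_real DDlim)
    show "AE z in lborel. norm (\<phi> z * cor (DD (en n) z / (en n)\<^sup>2)) \<le> indicator (cball 0 (B + 2)) z * (M * (M1 + M2))" for n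
    proof (rule AE_I2)
      fix z
      show "norm (\<phi> z * cor (DD (en n) z / (en n)\<^sup>2)) \<le> indicator (cball 0 (B + 2)) z * (M * (M1 + M2))"
      proof (cases "norm z \<le> B + 2")
        case True
        then show ?thesis using mult_mono[OF M\<phi>[OF True] DDbd[OF en, of n z]] M(1)
          by (simp add: norm_mult norm_divide norm_power)
      next
        case False
        then show ?thesis using DDsupp[OF en, of z n] by (simp add: indicator_def)
      qed
    qed
  qed
  \<comment> \<open>In characteristic coordinates the points reached from \<open>z\<close> by
    shifting time or space by \<open>e\<close> are the corners of a square of side \<open>e\<close>.
    The discrete wave operator of \<phi> is thus minus a rectangle difference of \<open>F\<close>,
    and \<open>rect\<close> turns it into this integral.\<close>
  define AV where "AV e z = integral {(snd z - fst z) / 2 - e / 2..(snd z - fst z) / 2 + e / 2} (\<lambda>s. integral {(snd z + fst z) / 2 - e / 2..(snd z + fst z) / 2 + e / 2} (\<lambda>t. F s t))" for e z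
  have AVeq: "\<phi> (fst z + e, snd z) + \<phi> (fst z - e, snd z) - \<phi> (fst z, snd z + e) - \<phi> (fst z, snd z - e) = - AV e z" if "0 < e" for e z
  proof -
    have "AV e z = F ((snd z - fst z) / 2 + e / 2) ((snd z + fst z) / 2 + e / 2) - F ((snd z - fst z) / 2 - e / 2) ((snd z + fst z) / 2 + e / 2)
       - F ((snd z - fst z) / 2 + e / 2) ((snd z + fst z) / 2 - e / 2) + F ((snd z - fst z) / 2 - e / 2) ((snd z + fst z) / 2 - e / 2)"
      unfolding AV_def using that by (subst rectD[OF F]) auto
    moreover have "(snd z - (fst z + e)) / 2 = (snd z - fst z) / 2 - e / 2" "(snd z + (fst z + e)) / 2 = (snd z + fst z) / 2 + e / 2"
      "(snd z - (fst z - e)) / 2 = (snd z - fst z) / 2 + e / 2" "(snd z + (fst z - e)) / 2 = (snd z + fst z) / 2 - e / 2"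
      "(snd z + e - fst z) / 2 = (snd z - fst z) / 2 + e / 2" "(snd z + e + fst z) / 2 = (snd z + fst z) / 2 + e / 2"
      "(snd z - e - fst z) / 2 = (snd z - fst z) / 2 - e / 2" "(snd z - e + fst z) / 2 = (snd z + fst z) / 2 - e / 2"
      by (simp_all add: field_simps)
    ultimately show ?thesis unfolding \<phi>_def fst_conv snd_conv by (simp only:) simp
  qed
  have cAV: "continuous_on UNIV (AV e)" if "0 < e" for e
  proof -
    have "continuous_on UNIV (\<lambda>z. - (\<phi> (fst z + e, snd z) + \<phi> (fst z - e, snd z) - \<phi> (fst z, snd z + e) - \<phi> (fst z, snd z - e)))"
      by (intro continuous_intros continuous_on_compose2[OF c\<phi>]) auto
    then show ?thesis using AVeq[OF that] by (simp add: minus_equation_iff)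
  qed
  have move: "(LINT z|lborel. \<phi> z * cor (DD e z)) = - (LINT z|lborel. AV e z * \<Psi> z)" if e: "0 < e" "e \<le> 1" for e
  proof -
    have supp: "\<Psi> z = 0" if "B < norm z" for z using B[of "fst z" "snd z"] that by (simp add: \<Psi>_def)
    have s: "(LINT z|lborel. \<phi> z * \<Psi> (c + z)) = (LINT z|lborel. \<phi> (z - c) * \<Psi> z)"
      and i: "integrable lborel (\<lambda>z. \<phi> z * \<Psi> (c + z))" "integrable lborel (\<lambda>z. \<phi> (z - c) * \<Psi> z)" for c :: "real \<times> real"
    proof -
      have cc: "continuous_on UNIV (\<lambda>z. \<phi> (z - c) * \<Psi> z)" "continuous_on UNIV (\<lambda>z. \<phi> z * \<Psi> (c + z))"
        by (intro continuous_intros continuous_on_compose2[OF c\<phi>] continuous_on_compose2[OF c\<Psi>]; auto)+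
      show "(LINT z|lborel. \<phi> z * \<Psi> (c + z)) = (LINT z|lborel. \<phi> (z - c) * \<Psi> z)"
        using lborel_integral_translate[OF borel_measurable_continuous_onI[OF cc(1)], of c] by simp
      show "integrable lborel (\<lambda>z. \<phi> (z - c) * \<Psi> z)" by (rule compact_support_integrable[OF cc(1), of B]) (simp add: supp)
      show "integrable lborel (\<lambda>z. \<phi> z * \<Psi> (c + z))"
      proof (rule compact_support_integrable[OF cc(2), of "B + norm c"])
        fix z :: "real \<times> real" assume "B + norm c < norm z"
        then have "B < norm (c + z)" using norm_triangle_ineq4[of "c + z" c] by simp
        then show "\<phi> z * \<Psi> (c + z) = 0" by (simp add: supp)
      qed
    qed
    have dd: "cor (DD e z) = \<Psi> ((e, 0) + z) + \<Psi> ((- e, 0) + z) - \<Psi> ((0, e) + z) - \<Psi> ((0, - e) + z)" for z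
      by (simp add: DD_def \<Psi>_def add.commute)
    have "(LINT z|lborel. \<phi> z * cor (DD e z)) = (LINT z|lborel. \<phi> z * \<Psi> ((e, 0) + z) + \<phi> z * \<Psi> ((- e, 0) + z) - \<phi> z * \<Psi> ((0, e) + z) - \<phi> z * \<Psi> ((0, - e) + z))"
      unfolding dd by (intro Bochner_Integration.integral_cong refl) (simp add: algebra_simps)
    also have "\<dots> = (LINT z|lborel. \<phi> (z - (e, 0)) * \<Psi> z) + (LINT z|lborel. \<phi> (z - (- e, 0)) * \<Psi> z) - (LINT z|lborel. \<phi> (z - (0, e)) * \<Psi> z) - (LINT z|lborel. \<phi> (z - (0, - e)) * \<Psi> z)"
      by (simp add: Bochner_Integration.integral_diff Bochner_Integration.integral_add i s)
    also have "\<dots> = (LINT z|lborel. \<phi> (z - (e, 0)) * \<Psi> z + \<phi> (z - (- e, 0)) * \<Psi> z - \<phi> (z - (0, e)) * \<Psi> z - \<phi> (z - (0, - e)) * \<Psi> z)"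
      by (simp add: Bochner_Integration.integral_diff Bochner_Integration.integral_add i)
    also have "\<dots> = (LINT z|lborel. - (AV e z * \<Psi> z))"
    proof (intro Bochner_Integration.integral_cong refl)
      fix z :: "real \<times> real"
      have "\<phi> (z - (e, 0)) * \<Psi> z + \<phi> (z - (- e, 0)) * \<Psi> z - \<phi> (z - (0, e)) * \<Psi> z - \<phi> (z - (0, - e)) * \<Psi> z
        = (\<phi> (fst z + e, snd z) + \<phi> (fst z - e, snd z) - \<phi> (fst z, snd z + e) - \<phi> (fst z, snd z - e)) * \<Psi> z"
        by (cases z) (simp add: algebra_simps)
      then show "\<phi> (z - (e, 0)) * \<Psi> z + \<phi> (z - (- e, 0)) * \<Psi> z - \<phi> (z - (0, e)) * \<Psi> z - \<phi> (z - (0, - e)) * \<Psi> z = - (AV e z * \<Psi> z)"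
        by (simp add: AVeq[OF e(1)])
    qed
    finally show ?thesis by simp
  qed
  have AVlim: "(\<lambda>n. AV (en n) z / cor ((en n)\<^sup>2)) \<longlonglongrightarrow> \<phi> z" for z
  proof (rule LIMSEQ_I)
    fix r :: real assume r: "0 < r"
    have "isCont (\<lambda>w. F (fst w) (snd w)) ((snd z - fst z) / 2, (snd z + fst z) / 2)"
      using jF by (simp add: continuous_on_eq_continuous_at)
    then obtain d where d: "0 < d" "\<And>w. dist w ((snd z - fst z) / 2, (snd z + fst z) / 2) < d \<Longrightarrow> dist (F (fst w) (snd w)) (\<phi> z) < r / 2"
      using r unfolding continuous_at_eps_delta \<phi>_def by (metis half_gt_zero fst_conv snd_conv)
    have "\<forall>\<^sub>F n in sequentially. en n < d" using order_tendstoD(2)[OF en0 d(1)] .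
    then obtain N where N: "\<And>n. N \<le> n \<Longrightarrow> en n < d" by (auto simp: eventually_sequentially)
    have "norm (AV (en n) z / cor ((en n)\<^sup>2) - \<phi> z) < r" if "N \<le> n" for n
    proof -
      have "cmod (AV (en n) z - cor ((2 * (en n / 2))\<^sup>2) * \<phi> z) \<le> (2 * (en n / 2))\<^sup>2 * (r / 2)"
        unfolding AV_def
      proof (rule square_average[OF jF])
        fix s t assume st: "\<bar>s - (snd z - fst z) / 2\<bar> \<le> en n / 2" "\<bar>t - (snd z + fst z) / 2\<bar> \<le> en n / 2"
        have "dist (s, t) ((snd z - fst z) / 2, (snd z + fst z) / 2) \<le> \<bar>s - (snd z - fst z) / 2\<bar> + \<bar>t - (snd z + fst z) / 2\<bar>"
          unfolding dist_Pair_Pair dist_real_def power2_abs by (rule sqrt_sum_squares_le_sum_abs)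
        also have "\<dots> < d" using st N[OF that] by linarith
        finally show "cmod (F s t - \<phi> z) \<le> r / 2" using d(2)[of "(s, t)"] by (simp add: dist_norm)
      qed (use en(1)[of n] in simp)
      then have "cmod (AV (en n) z - cor ((en n)\<^sup>2) * \<phi> z) \<le> (en n)\<^sup>2 * (r / 2)" by simp
      moreover have "AV (en n) z / cor ((en n)\<^sup>2) - \<phi> z = (AV (en n) z - cor ((en n)\<^sup>2) * \<phi> z) / cor ((en n)\<^sup>2)"
        using en(1)[of n] by (simp add: field_simps)
      ultimately have "norm (AV (en n) z / cor ((en n)\<^sup>2) - \<phi> z) \<le> r / 2"
        using en(1)[of n] by (simp add: norm_divide norm_power divide_le_eq mult.commute)
      then show ?thesis using r by simp
    qed
    then show "\<exists>N. \<forall>n\<ge>N. norm (AV (en n) z / cor ((en n)\<^sup>2) - \<phi> z) < r" by blast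
  qed
  have AVbd: "cmod (AV (en n) z / cor ((en n)\<^sup>2)) \<le> M" if "norm z \<le> B + 1" for n z
  proof -
    have "cmod (AV (en n) z - cor ((2 * (en n / 2))\<^sup>2) * 0) \<le> (2 * (en n / 2))\<^sup>2 * M"
      unfolding AV_def
    proof (rule square_average[OF jF])
      fix s t assume "\<bar>s - (snd z - fst z) / 2\<bar> \<le> en n / 2" "\<bar>t - (snd z + fst z) / 2\<bar> \<le> en n / 2"
      then show "cmod (F s t - 0) \<le> M" using half_le[of z] that en(2)[of n] unfolding diff_0_right by (intro M(2)) linarith+
    qed (use en(1)[of n] in simp)
    then show ?thesis using en(1)[of n] by (simp add: norm_divide norm_power divide_le_eq mult.commute)
  qed
  have lim2: "(\<lambda>n. LINT z|lborel. (AV (en n) z / cor ((en n)\<^sup>2)) * \<Psi> z) \<longlonglongrightarrow> (LINT z|lborel. \<phi> z * \<Psi> z)"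
  proof (rule integral_dominated_convergence)
    show "(\<lambda>z. \<phi> z * \<Psi> z) \<in> borel_measurable lborel"
      using c\<phi> c\<Psi> by (auto intro!: borel_measurable_continuous_onI continuous_intros)
    show "(\<lambda>z. (AV (en n) z / cor ((en n)\<^sup>2)) * \<Psi> z) \<in> borel_measurable lborel" for n
      using cAV[OF en(1), of n] c\<Psi> en(1)[of n] by (auto intro!: borel_measurable_continuous_onI continuous_intros)
    show "AE z in lborel. (\<lambda>n. (AV (en n) z / cor ((en n)\<^sup>2)) * \<Psi> z) \<longlonglongrightarrow> \<phi> z * \<Psi> z"
      by (intro AE_I2 tendsto_mult tendsto_const AVlim)
    have "integrable lborel (\<lambda>z. M *\<^sub>R \<Psi> z)"
      by (intro integrable_scaleR_right compact_support_integrable[OF c\<Psi>, of B]) (auto simp: \<Psi>_def B)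
    then show "integrable lborel (\<lambda>z. norm (M *\<^sub>R \<Psi> z))" by (rule integrable_norm)
    show "AE z in lborel. norm ((AV (en n) z / cor ((en n)\<^sup>2)) * \<Psi> z) \<le> norm (M *\<^sub>R \<Psi> z)" for n
    proof (rule AE_I2)
      fix z
      show "norm ((AV (en n) z / cor ((en n)\<^sup>2)) * \<Psi> z) \<le> norm (M *\<^sub>R \<Psi> z)"
      proof (cases "norm z \<le> B + 1")
        case True
        show ?thesis unfolding norm_mult norm_scaleR using mult_right_mono[OF AVbd[OF True, of n], of "norm (\<Psi> z)"] M(1) by simp
      next
        case False
        then have "\<Psi> z = 0" using B[of "fst z" "snd z"] by (simp add: \<Psi>_def)
        then show ?thesis by simp
      qed
    qed
  qed
  have "(LINT z|lborel. \<phi> z * cor (DD (en n) z / (en n)\<^sup>2)) = - (LINT z|lborel. (AV (en n) z / cor ((en n)\<^sup>2)) * \<Psi> z)" for n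
    using move[OF en, of n] by (simp add: of_real_divide times_divide_eq_right times_divide_eq_left)
  with lim1 have "(\<lambda>n. - (LINT z|lborel. (AV (en n) z / cor ((en n)\<^sup>2)) * \<Psi> z)) \<longlonglongrightarrow> (LINT z|lborel. \<phi> z * cor (W z))" by simp
  from LIMSEQ_unique[OF this tendsto_minus[OF lim2]]
  have eq: "(LINT z|lborel. \<phi> z * cor (W z)) = - (LINT z|lborel. \<phi> z * \<Psi> z)" .
  have W0: "W z = 0" if "B + 2 < norm z" for z
  proof -
    have d0: "DD (en n) z / (en n)\<^sup>2 = 0" for n using DDsupp[OF en, of z n] that by simp
    show ?thesis using DDlim[of z] unfolding d0 LIMSEQ_const_iff by simp
  qed
  have i1: "integrable lborel (\<lambda>z. \<phi> z * cor (W z))"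
    by (rule compact_support_integrable[where B="B + 2"]) (use c\<phi> T(6,7) W0 in \<open>auto simp: W_def intro!: continuous_intros\<close>)
  have i2: "integrable lborel (\<lambda>z. \<phi> z * \<Psi> z)"
    by (rule compact_support_integrable[where B=B]) (use c\<phi> c\<Psi> in \<open>auto simp: \<Psi>_def B intro!: continuous_intros\<close>)
  have "(LINT z|lborel. F ((snd z - fst z) / 2) ((snd z + fst z) / 2) *
     cor (dpart 2 0 \<psi> (fst z) (snd z) - dpart 0 2 \<psi> (fst z) (snd z) + \<psi> (fst z) (snd z)))
    = (LINT z|lborel. \<phi> z * cor (W z) + \<phi> z * \<Psi> z)"
    unfolding \<phi>_def \<Psi>_def W_def of_real_add distrib_left ..
  also have "\<dots> = 0" unfolding Bochner_Integration.integral_add[OF i1 i2] eq by simp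
  finally show ?thesis .
qed

subsection \<open>Smooth cut-offs\<close>

text \<open>A class closed under differentiation, which makes smoothness a matter of iteration: the
  derivative has the same shape with the exponent raised by 2 and the polynomial replaced by
  \<open>bump_next P n\<close>.\<close>

definition bump :: "real poly \<Rightarrow> nat \<Rightarrow> real \<Rightarrow> real" where
  "bump P n x = (if 0 < x \<and> x < 1 then poly P x / (x * (1 - x)) ^ n * exp (- 1 / (x * (1 - x))) else 0)"

lemma bump_outside: "x \<le> 0 \<or> 1 \<le> x \<Longrightarrow> bump P n x = 0"
  by (auto simp: bump_def)

lemma exp_inverse_bound:
  fixes y :: real
  assumes "0 < y"
  shows "exp (- 1 / y) \<le> fact m * y ^ m"
proof -
  have "(1 / y) ^ m / fact m \<le> exp (1 / y)"
  proof -
    have "(\<Sum>i\<in>{m}. inverse (fact i) * (1 / y) ^ i) \<le> (\<Sum>i. inverse (fact i) * (1 / y) ^ i)"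
      using assms by (intro sum_le_suminf summable_exp) auto
    also have "\<dots> = exp (1 / y)" by (simp add: exp_def)
    finally show ?thesis by (simp add: field_simps)
  qed
  then have "1 / exp (1 / y) \<le> 1 / ((1 / y) ^ m / fact m)" using assms by (intro divide_left_mono) auto
  then show ?thesis using assms by (simp add: exp_minus field_simps power_divide)
qed

text \<open>The exponential beats the power \<open>n + 2\<close> of \<open>x * (1 - x)\<close>. A
  quadratic bound at an endpoint already forces derivative 0 there, and since the derivative is
  again a \<open>bump\<close>, no flatness of higher order has to be proved.\<close>

lemma bump_quadratic_bound:
  obtains C where "\<And>x. \<bar>bump P n x\<bar> \<le> C * x\<^sup>2" "\<And>x. \<bar>bump P n x\<bar> \<le> C * (x - 1)\<^sup>2"
proof -
  have "bounded ((\<lambda>x. poly P x) ` {0..1::real})"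
    by (intro compact_imp_bounded compact_continuous_image continuous_intros) auto
  then obtain M where "\<forall>y\<in>(\<lambda>x. poly P x) ` {0..1}. norm y \<le> M" unfolding bounded_iff by blast
  then have M: "\<bar>poly P x\<bar> \<le> M" if "x \<in> {0..1}" for x using that by auto
  have M0: "0 \<le> M" using M[of 0] by simp
  define C where "C = M * fact (n + 2)"
  have C0: "0 \<le> C" using M0 by (simp add: C_def)
  have key: "\<bar>bump P n x\<bar> \<le> C * (x * (1 - x))\<^sup>2" if "0 < x" "x < 1" for x
  proof -
    define y where "y = x * (1 - x)"
    have y: "0 < y" using that by (simp add: y_def)
    have "\<bar>bump P n x\<bar> = \<bar>poly P x\<bar> * (exp (- 1 / y) / y ^ n)"
      using that y by (simp add: bump_def y_def[symmetric] abs_mult)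
    also have "\<dots> \<le> M * (fact (n + 2) * y ^ (n + 2) / y ^ n)"
      using that y M0 by (intro mult_mono M divide_right_mono exp_inverse_bound) auto
    also have "\<dots> = C * y\<^sup>2" using y by (simp add: C_def power_add power2_eq_square)
    finally show ?thesis by (simp add: y_def)
  qed
  show ?thesis
  proof (rule that[of C])
    fix x :: real
    show "\<bar>bump P n x\<bar> \<le> C * x\<^sup>2"
    proof (cases "0 < x \<and> x < 1")
      case True
      then have "x * (1 - x) \<le> x * 1" by (intro mult_left_mono) auto
      then have "(x * (1 - x))\<^sup>2 \<le> x\<^sup>2" using True by (intro power_mono) auto
      from mult_left_mono[OF this C0] key[of x] True show ?thesis by linarith
    qed (use C0 in \<open>auto simp: bump_def\<close>)
    show "\<bar>bump P n x\<bar> \<le> C * (x - 1)\<^sup>2"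
    proof (cases "0 < x \<and> x < 1")
      case True
      then have "x * (1 - x) \<le> 1 * (1 - x)" by (intro mult_right_mono) auto
      then have "(x * (1 - x))\<^sup>2 \<le> (1 - x)\<^sup>2" using True by (intro power_mono) auto
      then have "(x * (1 - x))\<^sup>2 \<le> (x - 1)\<^sup>2" by (simp add: power2_commute)
      from mult_left_mono[OF this C0] key[of x] True show ?thesis by linarith
    qed (use C0 in \<open>auto simp: bump_def\<close>)
  qed
qed

lemma quadratic_deriv_zero:
  fixes f :: "real \<Rightarrow> real"
  assumes "\<And>x. \<bar>f x\<bar> \<le> C * (x - a)\<^sup>2"
  shows "(f has_real_derivative 0) (at a)"
proof -
  have fa: "f a = 0" using assms[of a] by simp
  have "(\<lambda>h. f (a + h) / h) \<midarrow>0\<rightarrow> 0"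
  proof (rule Lim_null_comparison)
    have "norm (f (a + h) / h) \<le> C * \<bar>h\<bar>" if "h \<noteq> 0" for h
    proof -
      have "\<bar>f (a + h)\<bar> \<le> C * h\<^sup>2" using assms[of "a + h"] by simp
      also have "\<dots> = C * \<bar>h\<bar> * \<bar>h\<bar>" by (simp add: power2_eq_square)
      finally show ?thesis using that by (simp add: divide_le_eq)
    qed
    then show "\<forall>\<^sub>F h in at 0. norm (f (a + h) / h) \<le> C * \<bar>h\<bar>"
      by (auto simp: eventually_at_filter)
    show "((\<lambda>h. C * \<bar>h\<bar>) \<longlongrightarrow> 0) (at 0)" by (auto intro!: tendsto_eq_intros)
  qed
  then show ?thesis unfolding DERIV_def by (simp add: fa)
qed

text \<open>The numerator of the derivative over the denominator \<open>Y ^ (n + 2)\<close>, with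
  \<open>Y = x * (1 - x)\<close> and \<open>Y' = 1 - 2 * x\<close>. Its three terms come from the
  polynomial, the power and the exponential.\<close>

definition bump_next :: "real poly \<Rightarrow> nat \<Rightarrow> real poly" where
  "bump_next P n = (let Y = [:0, 1, -1:]; Y' = [:1, -2:] in
     pderiv P * Y ^ 2 - smult (real n) (P * Y' * Y) + P * Y')"

lemma bump_deriv: "(bump P n has_real_derivative bump (bump_next P n) (n + 2) x) (at x)"
proof -
  consider "x < 0 \<or> 1 < x" | "x = 0" | "x = 1" | "0 < x" "x < 1" by linarith
  then show ?thesis
  proof cases
    case 1
    then have "((\<lambda>_. 0) has_real_derivative bump (bump_next P n) (n + 2) x) (at x)"
      by (auto simp: bump_def)
    moreover have "\<forall>\<^sub>F y in nhds x. (\<lambda>_. 0) y = bump P n y"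
    proof -
      have "open ({..<0} \<union> {1<..} :: real set)" "x \<in> {..<0} \<union> {1<..}" using 1 by auto
      then show ?thesis by (rule eventually_nhds_in_open[THEN eventually_mono]) (auto simp: bump_def)
    qed
    ultimately show ?thesis using DERIV_cong_ev[OF refl _ refl] by (metis (no_types, lifting) eventually_mono)
  next
    case 2
    obtain C where "\<And>x. \<bar>bump P n x\<bar> \<le> C * x\<^sup>2" using bump_quadratic_bound by blast
    then have "\<And>x. \<bar>bump P n x\<bar> \<le> C * (x - 0)\<^sup>2" by simp
    from quadratic_deriv_zero[OF this] 2 show ?thesis by (simp add: bump_outside)
  next
    case 3
    obtain C where "\<And>x. \<bar>bump P n x\<bar> \<le> C * (x - 1)\<^sup>2" using bump_quadratic_bound by blast
    from quadratic_deriv_zero[OF this] 3 show ?thesis by (simp add: bump_outside)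
  next
    case 4
    define y where "y = x * (1 - x)"
    have y: "0 < y" using 4 by (simp add: y_def)
    have d: "((\<lambda>x. poly P x / (x * (1 - x)) ^ n * exp (- 1 / (x * (1 - x)))) has_real_derivative
       ((poly (pderiv P) x * y ^ n - poly P x * (real n * (1 - 2 * x) * y ^ (n - 1))) / (y ^ n * y ^ n) * exp (- 1 / y)
        + poly P x / y ^ n * (exp (- 1 / y) * ((1 - 2 * x) / y\<^sup>2)))) (at x)"
    proof -
      have dY: "((\<lambda>x. x * (1 - x)) has_real_derivative (1 - 2 * x)) (at x)"
        by (auto intro!: derivative_eq_intros simp: algebra_simps)
      have dE: "((\<lambda>x. exp (- 1 / (x * (1 - x)))) has_real_derivative exp (- 1 / y) * ((1 - 2 * x) / y\<^sup>2)) (at x)"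
      proof (rule DERIV_cong[OF DERIV_fun_exp[OF DERIV_divide[OF DERIV_const dY]]])
        show "x * (1 - x) \<noteq> 0" using 4 by simp
      qed (simp add: y_def power2_eq_square)
      have dN: "((\<lambda>x. (x * (1 - x)) ^ n) has_real_derivative real n * (1 - 2 * x) * y ^ (n - 1)) (at x)"
        using DERIV_power[OF dY, of n] by (simp add: y_def mult_ac)
      have nz: "(x * (1 - x)) ^ n \<noteq> 0" using 4 by simp
      show ?thesis
        by (rule DERIV_cong[OF DERIV_mult[OF DERIV_divide[OF poly_DERIV dN nz] dE]]) (simp add: y_def mult_ac)
    qed
    have "(poly (pderiv P) x * y ^ n - poly P x * (real n * (1 - 2 * x) * y ^ (n - 1))) / (y ^ n * y ^ n) * exp (- 1 / y)
        + poly P x / y ^ n * (exp (- 1 / y) * ((1 - 2 * x) / y\<^sup>2)) = bump (bump_next P n) (n + 2) x"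
    proof -
      have Y: "poly [:0, 1, -1:] x = y" "poly [:1, -2:] x = 1 - 2 * x" by (simp_all add: y_def algebra_simps)
      have "poly (bump_next P n) x = poly (pderiv P) x * y\<^sup>2 - real n * (poly P x * (1 - 2 * x) * y) + poly P x * (1 - 2 * x)"
        unfolding bump_next_def Let_def by (simp only: poly_add poly_diff poly_mult poly_smult poly_power Y)
      then have b: "bump (bump_next P n) (n + 2) x = (poly (pderiv P) x * y\<^sup>2 - real n * (poly P x * (1 - 2 * x) * y) + poly P x * (1 - 2 * x)) / (y ^ n * y\<^sup>2) * exp (- 1 / y)"
        using 4 by (simp add: bump_def y_def[symmetric] power_add power2_eq_square)
      have n: "real n * y ^ (n - 1) / (y ^ n * y ^ n) = real n * y / (y ^ n * y\<^sup>2)"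
        using y by (cases n) (auto simp: power2_eq_square)
      have "(poly (pderiv P) x * y ^ n - poly P x * (real n * (1 - 2 * x) * y ^ (n - 1))) / (y ^ n * y ^ n)
        = poly (pderiv P) x / y ^ n - poly P x * (1 - 2 * x) * (real n * y ^ (n - 1) / (y ^ n * y ^ n))"
        using y by (simp add: diff_divide_distrib)
      then have q: "(poly (pderiv P) x * y ^ n - poly P x * (real n * (1 - 2 * x) * y ^ (n - 1))) / (y ^ n * y ^ n)
        = poly (pderiv P) x / y ^ n - poly P x * (1 - 2 * x) * (real n * y / (y ^ n * y\<^sup>2))" unfolding n .
      show ?thesis unfolding q b using y by (simp add: field_simps)
    qed
    with d have d': "((\<lambda>x. poly P x / (x * (1 - x)) ^ n * exp (- 1 / (x * (1 - x)))) has_real_derivative bump (bump_next P n) (n + 2) x) (at x)" by simp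
    have "open {0<..<1::real}" "x \<in> {0<..<1}" using 4 by auto
    then show ?thesis
      by (rule has_field_derivative_transform_within_open[OF d']) (simp add: bump_def)
  qed
qed

text \<open>The normalised primitive of a bump. Its derivatives are carried along as one family
  \<open>S k\<close>, because the test functions built from it need explicit derivatives of every
  order.\<close>

lemma exists_smooth_step:
  obtains S :: "nat \<Rightarrow> real \<Rightarrow> real" where
    "\<And>k x. (S k has_real_derivative S (Suc k) x) (at x)"
    "\<And>x. x \<le> 0 \<Longrightarrow> S 0 x = 0" "\<And>x. 1 \<le> x \<Longrightarrow> S 0 x = 1"
    "\<And>x. 0 \<le> S (Suc 0) x" "\<And>x. x \<le> 0 \<or> 1 \<le> x \<Longrightarrow> S (Suc 0) x = 0"
    "\<And>k x. 0 < k \<Longrightarrow> x \<le> 0 \<or> 1 \<le> x \<Longrightarrow> S k x = 0"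
proof -
  define P where "P k = rec_nat (1 :: real poly) (\<lambda>k Q. bump_next Q (2 * k)) k" for k
  have P: "P 0 = 1" "P (Suc k) = bump_next (P k) (2 * k)" for k by (simp_all add: P_def)
  define D where "D k = bump (P k) (2 * k)" for k
  have dD: "(D k has_real_derivative D (Suc k) x) (at x)" for k x
    using bump_deriv[of "P k" "2 * k" x] by (simp add: D_def P)
  have cD: "continuous_on S (D k)" for S k
    by (intro continuous_at_imp_continuous_on ballI DERIV_isCont[OF dD])
  have D0: "0 \<le> D 0 x" "0 < x \<Longrightarrow> x < 1 \<Longrightarrow> 0 < D 0 x" for x by (auto simp: D_def bump_def P)
  have Dout: "D k x = 0" if "x \<le> 0 \<or> 1 \<le> x" for k x using that by (simp add: D_def bump_outside)
  define f where "f x = cor (D 0 x)" for x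
  have cf: "continuous_on S f" for S unfolding f_def by (intro continuous_intros cD)
  define Z where "Z = Re (Sg f 1)"
  have Zint: "Z = integral {0..1} (D 0)"
    unfolding Z_def using Sg_nonneg[OF cf, of 1] integral_linear[OF integrable_continuous_interval[OF cf] bounded_linear_Re, of 0 1]
    by (simp add: f_def o_def)
  have Zpos: "0 < Z"
  proof -
    have "0 \<le> Z" unfolding Zint by (intro Henstock_Kurzweil_Integration.integral_nonneg integrable_continuous_interval cD) (simp add: D0)
    moreover have "Z \<noteq> 0"
    proof
      assume "Z = 0"
      then have "\<And>x. x \<in> {0..1} \<Longrightarrow> D 0 x = 0"
        unfolding Zint using integral_eq_0_iff[OF cD, of 0 1 0] D0 by auto
      then show False using D0(2)[of "1/2"] by force
    qed
    ultimately show ?thesis by simp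
  qed
  define S where "S k x = (case k of 0 \<Rightarrow> Re (Sg f x) / Z | Suc j \<Rightarrow> D j x / Z)" for k x
  show ?thesis
  proof (rule that[of S])
    show "(S k has_real_derivative S (Suc k) x) (at x)" for k x
    proof (cases k)
      case 0
      have "((\<lambda>x. Re (Sg f x)) has_vector_derivative Re (f x)) (at x)"
        using bounded_linear.has_vector_derivative[OF bounded_linear_Re Sg_has_vector_derivative[OF cf]] .
      then have "((\<lambda>x. Re (Sg f x)) has_real_derivative D 0 x) (at x)"
        by (simp add: f_def has_real_derivative_iff_has_vector_derivative)
      then have "((\<lambda>x. Re (Sg f x) / Z) has_real_derivative D 0 x / Z) (at x)" by (rule DERIV_cdivide)
      moreover have "S 0 = (\<lambda>x. Re (Sg f x) / Z)" "S (Suc 0) = (\<lambda>x. D 0 x / Z)" by (auto simp: S_def fun_eq_iff)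
      ultimately show ?thesis unfolding 0 by simp
    next
      case (Suc j)
      have "S (Suc i) = (\<lambda>x. D i x / Z)" for i by (auto simp: S_def fun_eq_iff)
      then show ?thesis unfolding Suc using DERIV_cdivide[OF dD[of j x], of Z] by simp
    qed
    show "S 0 x = 0" if "x \<le> 0" for x
    proof -
      have "integral {x..0} f = integral {x..0} (\<lambda>_. 0)" by (intro integral_cong) (auto simp: f_def Dout)
      then show ?thesis using Sg_nonpos[OF cf that] by (simp add: S_def)
    qed
    show "S 0 x = 1" if "1 \<le> x" for x
    proof -
      have "integral {1..x} f = integral {1..x} (\<lambda>_. 0)" by (intro integral_cong) (auto simp: f_def Dout)
      then have "Sg f x = Sg f 1" using Sg_diff[OF cf that] by simp
      then show ?thesis using Zpos by (simp add: S_def Z_def)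
    qed
    show "0 \<le> S (Suc 0) x" for x using Zpos D0 by (simp add: S_def)
    show "S (Suc 0) x = 0" if "x \<le> 0 \<or> 1 \<le> x" for x using Dout[OF that] by (simp add: S_def)
    show "S k x = 0" if "0 < k" "x \<le> 0 \<or> 1 \<le> x" for k x using Dout[OF that(2)] that(1) by (cases k) (auto simp: S_def)
  qed
qed

text \<open>Linear combinations of products of derivatives of two functions, one of each
  characteristic variable. Both partial derivatives preserve this class, so every
  \<open>dpart\<close> of such a product stays in it and is continuous and differentiable.\<close>

inductive char_poly :: "(nat \<Rightarrow> real \<Rightarrow> real) \<Rightarrow> (nat \<Rightarrow> real \<Rightarrow> real) \<Rightarrow> (real \<Rightarrow> real \<Rightarrow> real) \<Rightarrow> bool" for A B where
  base: "char_poly A B (\<lambda>t x. c * (A k ((x - t) / 2) * B l ((x + t) / 2)))"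
| add: "char_poly A B f \<Longrightarrow> char_poly A B g \<Longrightarrow> char_poly A B (\<lambda>t x. f t x + g t x)"

context
  fixes A B :: "nat \<Rightarrow> real \<Rightarrow> real"
  assumes dA: "\<And>k x. (A k has_real_derivative A (Suc k) x) (at x)" and dB: "\<And>k x. (B k has_real_derivative B (Suc k) x) (at x)"
begin

lemma char_base_dx: "((\<lambda>y. c * (A k ((y - t) / 2) * B l ((y + t) / 2))) has_real_derivative
    (c / 2 * (A (Suc k) ((x - t) / 2) * B l ((x + t) / 2)) + c / 2 * (A k ((x - t) / 2) * B (Suc l) ((x + t) / 2)))) (at x)"
proof -
  have a: "((\<lambda>y. A k ((y - t) / 2)) has_real_derivative A (Suc k) ((x - t) / 2) * (1 / 2)) (at x)"
    by (rule DERIV_chain2[OF dA]) (auto intro!: derivative_eq_intros)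
  have b: "((\<lambda>y. B l ((y + t) / 2)) has_real_derivative B (Suc l) ((x + t) / 2) * (1 / 2)) (at x)"
    by (rule DERIV_chain2[OF dB]) (auto intro!: derivative_eq_intros)
  show ?thesis by (rule derivative_eq_intros a b refl)+ (simp add: field_simps)
qed

lemma char_base_dt: "((\<lambda>s. c * (A k ((x - s) / 2) * B l ((x + s) / 2))) has_real_derivative
    (- c / 2 * (A (Suc k) ((x - t) / 2) * B l ((x + t) / 2)) + c / 2 * (A k ((x - t) / 2) * B (Suc l) ((x + t) / 2)))) (at t)"
proof -
  have a: "((\<lambda>s. A k ((x - s) / 2)) has_real_derivative A (Suc k) ((x - t) / 2) * (- 1 / 2)) (at t)"
    by (rule DERIV_chain2[OF dA]) (auto intro!: derivative_eq_intros)
  have b: "((\<lambda>s. B l ((x + s) / 2)) has_real_derivative B (Suc l) ((x + t) / 2) * (1 / 2)) (at t)"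
    by (rule DERIV_chain2[OF dB]) (auto intro!: derivative_eq_intros)
  show ?thesis by (rule derivative_eq_intros a b refl)+ (simp add: field_simps)
qed

lemma char_poly_dx: "char_poly A B f \<Longrightarrow> \<exists>f'. char_poly A B f' \<and> (\<forall>t x. ((\<lambda>y. f t y) has_real_derivative f' t x) (at x))"
proof (induction rule: char_poly.induct)
  case (base c k l)
  show ?case
    by (rule exI, rule conjI[rotated], intro allI, rule char_base_dx, intro char_poly.intros)
next
  case (add f g)
  then obtain f' g' where "char_poly A B f'" "\<forall>t x. ((\<lambda>y. f t y) has_real_derivative f' t x) (at x)"
    "char_poly A B g'" "\<forall>t x. ((\<lambda>y. g t y) has_real_derivative g' t x) (at x)" by blast
  then show ?case by (intro exI[of _ "\<lambda>t x. f' t x + g' t x"]) (auto intro!: char_poly.add derivative_eq_intros)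
qed

lemma char_poly_dt: "char_poly A B f \<Longrightarrow> \<exists>f'. char_poly A B f' \<and> (\<forall>t x. ((\<lambda>s. f s x) has_real_derivative f' t x) (at t))"
proof (induction rule: char_poly.induct)
  case (base c k l)
  show ?case
    by (rule exI, rule conjI[rotated], intro allI, rule char_base_dt, intro char_poly.intros)
next
  case (add f g)
  then obtain f' g' where "char_poly A B f'" "\<forall>t x. ((\<lambda>s. f s x) has_real_derivative f' t x) (at t)"
    "char_poly A B g'" "\<forall>t x. ((\<lambda>s. g s x) has_real_derivative g' t x) (at t)" by blast
  then show ?case by (intro exI[of _ "\<lambda>t x. f' t x + g' t x"]) (auto intro!: char_poly.add derivative_eq_intros)
qed

lemma char_poly_jcont: "char_poly A B f \<Longrightarrow> jcont f"
proof (induction rule: char_poly.induct)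
  case (base c k l)
  have "continuous_on UNIV (A k)" "continuous_on UNIV (B l)"
    by (intro continuous_at_imp_continuous_on ballI DERIV_isCont[OF dA] DERIV_isCont[OF dB])+
  note c = this
  show ?case
    by (intro continuous_on_mult continuous_on_const continuous_on_compose2[OF c(1)] continuous_on_compose2[OF c(2)]) (auto intro!: continuous_intros)
next
  case (add f g)
  then show ?case by (intro continuous_on_add)
qed

lemma char_poly_dpart: "char_poly A B f \<Longrightarrow> char_poly A B (dpart i j f)"
proof (induction i)
  case 0
  show ?case
  proof (induction j)
    case 0 then show ?case using \<open>char_poly A B f\<close> by simp
  next
    case (Suc j)
    obtain f' where f': "char_poly A B f'" "\<forall>t x. ((\<lambda>y. dpart 0 j f t y) has_real_derivative f' t x) (at x)"
      using char_poly_dx[OF Suc] by blast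
    then have "dpart 0 (Suc j) f = f'" by (auto simp: fun_eq_iff intro!: DERIV_imp_deriv)
    then show ?case using f' by simp
  qed
next
  case (Suc i)
  obtain f' where f': "char_poly A B f'" "\<forall>t x. ((\<lambda>s. dpart i j f s x) has_real_derivative f' t x) (at t)"
    using char_poly_dt[OF Suc.IH[OF Suc.prems]] by blast
  then have "dpart (Suc i) j f = f'" by (auto simp: fun_eq_iff intro!: DERIV_imp_deriv)
  then show ?case using f' by simp
qed

lemma char_product_test_fun:
  assumes sA: "\<And>x. x < a \<or> b < x \<Longrightarrow> A 0 x = 0" and sB: "\<And>x. x < c \<or> d < x \<Longrightarrow> B 0 x = 0"
  shows "test_fun (\<lambda>t x. A 0 ((x - t) / 2) * B 0 ((x + t) / 2))" (is "test_fun ?\<psi>")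
proof -
  have cp: "char_poly A B (dpart i j ?\<psi>)" for i j
    using char_poly_dpart[OF char_poly.base[of A B 1 0 0]] by simp
  show ?thesis unfolding test_fun_def
  proof (intro conjI allI)
    fix i j t x
    show "jcont (dpart i j ?\<psi>)" by (rule char_poly_jcont[OF cp])
    show "(\<lambda>s. dpart i j ?\<psi> s x) differentiable at t" using char_poly_dt[OF cp, of i j] by (auto simp: real_differentiable_def)
    show "(\<lambda>y. dpart i j ?\<psi> t y) differentiable at x" using char_poly_dx[OF cp, of i j] by (auto simp: real_differentiable_def)
  next
    have "{z. ?\<psi> (fst z) (snd z) \<noteq> 0} \<subseteq> {c - b..d - a} \<times> {a + c..b + d}"
    proof safe
      fix t x assume "A 0 ((snd (t, x) - fst (t, x)) / 2) * B 0 ((snd (t, x) + fst (t, x)) / 2) \<noteq> 0"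
      then have "\<not> ((x - t) / 2 < a \<or> b < (x - t) / 2)" "\<not> ((x + t) / 2 < c \<or> d < (x + t) / 2)"
        using sA sB by force+
      then show "t \<in> {c - b..d - a}" "x \<in> {a + c..b + d}" by auto
    qed
    moreover have "bounded ({c - b..d - a} \<times> {a + c..b + d})" by (intro bounded_Times) auto
    ultimately show "bounded {z. ?\<psi> (fst z) (snd z) \<noteq> 0}" by (rule bounded_subset[rotated])
  qed
qed

text \<open>With \<open>u = (x - t) / 2\<close> and \<open>v = (x + t) / 2\<close> the derivatives
  in \<open>t\<close> and \<open>x\<close> are half the difference and half the sum of those in
  \<open>v\<close> and \<open>u\<close>. The pure second derivatives cancel and minus the mixed one
  remains.\<close>

lemma char_product_wave:
  "dpart 2 0 (\<lambda>t x. A 0 ((x - t) / 2) * B 0 ((x + t) / 2)) t x - dpart 0 2 (\<lambda>t x. A 0 ((x - t) / 2) * B 0 ((x + t) / 2)) t x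
    = - (A (Suc 0) ((x - t) / 2) * B (Suc 0) ((x + t) / 2))"
proof -
  let ?\<psi> = "\<lambda>t x. A 0 ((x - t) / 2) * B 0 ((x + t) / 2)"
  have 1: "dpart 1 0 ?\<psi> = (\<lambda>t x. - 1 / 2 * (A 1 ((x - t) / 2) * B 0 ((x + t) / 2)) + 1 / 2 * (A 0 ((x - t) / 2) * B 1 ((x + t) / 2)))"
    using char_base_dt[of 1 0 _ 0] by (auto simp: fun_eq_iff intro!: DERIV_imp_deriv)
  have 2: "dpart 0 1 ?\<psi> = (\<lambda>t x. 1 / 2 * (A 1 ((x - t) / 2) * B 0 ((x + t) / 2)) + 1 / 2 * (A 0 ((x - t) / 2) * B 1 ((x + t) / 2)))"
    using char_base_dx[of 1 0 _ 0] by (auto simp: fun_eq_iff intro!: DERIV_imp_deriv)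
  have "dpart 2 0 ?\<psi> t x = deriv (\<lambda>s. dpart 1 0 ?\<psi> s x) t" by (simp add: numeral_2_eq_2)
  also have "\<dots> = (- (- 1 / 2) / 2 * (A (Suc 1) ((x - t) / 2) * B 0 ((x + t) / 2)) + (- 1 / 2) / 2 * (A 1 ((x - t) / 2) * B (Suc 0) ((x + t) / 2)))
     + (- (1 / 2) / 2 * (A (Suc 0) ((x - t) / 2) * B 1 ((x + t) / 2)) + (1 / 2) / 2 * (A 0 ((x - t) / 2) * B (Suc 1) ((x + t) / 2)))"
    unfolding 1 by (intro DERIV_imp_deriv DERIV_add char_base_dt)
  finally have a: "dpart 2 0 ?\<psi> t x = \<dots>" .
  have "dpart 0 2 ?\<psi> t x = deriv (\<lambda>y. dpart 0 1 ?\<psi> t y) x" by (simp add: numeral_2_eq_2)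
  also have "\<dots> = ((1 / 2) / 2 * (A (Suc 1) ((x - t) / 2) * B 0 ((x + t) / 2)) + (1 / 2) / 2 * (A 1 ((x - t) / 2) * B (Suc 0) ((x + t) / 2)))
     + ((1 / 2) / 2 * (A (Suc 0) ((x - t) / 2) * B 1 ((x + t) / 2)) + (1 / 2) / 2 * (A 0 ((x - t) / 2) * B (Suc 1) ((x + t) / 2)))"
    unfolding 2 by (intro DERIV_imp_deriv DERIV_add char_base_dx)
  finally have b: "dpart 0 2 ?\<psi> t x = \<dots>" .
  show ?thesis unfolding a b by (simp add: algebra_simps)
qed

end

text \<open>The Jacobian of \<open>t = v - u\<close>, \<open>x = u + v\<close> is 2. The change of
  variables is done one variable at a time: first \<open>x = t + 2 * u\<close>, then, after Fubini,
  \<open>v = t + u\<close>.\<close>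

lemma integral_characteristic:
  fixes f :: "real \<Rightarrow> real \<Rightarrow> complex"
  assumes f: "jcont f" and s: "\<And>u v. K < \<bar>u\<bar> \<or> K < \<bar>v\<bar> \<Longrightarrow> f u v = 0"
  shows "(LINT z|lborel. f ((snd z - fst z) / 2) ((snd z + fst z) / 2)) = 2 * (LINT u|lborel. (LINT v|lborel. f u v))"
proof -
  define g where "g z = f ((snd z - fst z) / 2) ((snd z + fst z) / 2)" for z :: "real \<times> real"
  have cg: "continuous_on UNIV g" unfolding g_def by (intro jcont_compose[OF f] continuous_intros) auto
  have g0: "g z = 0" if "4 * \<bar>K\<bar> < norm z" for z
  proof -
    have "norm z \<le> \<bar>fst z\<bar> + \<bar>snd z\<bar>" using norm_Pair_le[of "fst z" "snd z"] by simp
    also have "\<dots> \<le> \<bar>snd z - fst z\<bar> + \<bar>snd z + fst z\<bar>" by (simp add: abs_if)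
    also have "\<dots> = 2 * (\<bar>(snd z - fst z) / 2\<bar> + \<bar>(snd z + fst z) / 2\<bar>)" by simp
    finally have n: "norm z \<le> 2 * (\<bar>(snd z - fst z) / 2\<bar> + \<bar>(snd z + fst z) / 2\<bar>)" .
    have "K < \<bar>(snd z - fst z) / 2\<bar> \<or> K < \<bar>(snd z + fst z) / 2\<bar>"
    proof (rule ccontr)
      assume "\<not> ?thesis"
      then have "\<bar>(snd z - fst z) / 2\<bar> + \<bar>(snd z + fst z) / 2\<bar> \<le> \<bar>K\<bar> + \<bar>K\<bar>" by (intro add_mono) auto
      then show False using n that by argo
    qed
    then show ?thesis unfolding g_def by (rule s)
  qed
  have ig: "integrable (lborel \<Otimes>\<^sub>M lborel) (\<lambda>(t, x). g (t, x))"
    using compact_support_integrable[OF cg g0] by (simp add: lborel_prod)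
  have "(LINT z|lborel. g z) = (LINT z|(lborel \<Otimes>\<^sub>M lborel). (\<lambda>(t, x). g (t, x)) z)" by (simp add: lborel_prod)
  also have "\<dots> = (LINT t|lborel. (LINT x|lborel. g (t, x)))"
    using lborel_pair.integral_fst[of "\<lambda>t x. g (t, x)"] ig by simp
  also have "\<dots> = (LINT t|lborel. 2 * (LINT u|lborel. f u (t + u)))"
  proof (intro Bochner_Integration.integral_cong refl)
    fix t
    have "(LINT x|lborel. g (t, x)) = \<bar>2\<bar> *\<^sub>R (LINT u|lborel. g (t, t + 2 * u))"
      by (rule lborel_integral_real_affine) simp
    then show "(LINT x|lborel. g (t, x)) = 2 * (LINT u|lborel. f u (t + u))" by (simp add: g_def scaleR_conv_of_real add_divide_distrib)
  qed
  also have "\<dots> = 2 * (LINT t|lborel. (LINT u|lborel. f u (t + u)))" by simp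
  also have "(LINT t|lborel. (LINT u|lborel. f u (t + u))) = (LINT u|lborel. (LINT t|lborel. f u (t + u)))"
  proof -
    define h where "h z = f (snd z) (fst z + snd z)" for z :: "real \<times> real"
    have ch: "continuous_on UNIV h" unfolding h_def by (intro jcont_compose[OF f] continuous_intros)
    have h0: "h z = 0" if "4 * \<bar>K\<bar> < norm z" for z
    proof -
      have "norm z \<le> \<bar>fst z\<bar> + \<bar>snd z\<bar>" using norm_Pair_le[of "fst z" "snd z"] by simp
      moreover have "\<bar>fst z\<bar> \<le> \<bar>fst z + snd z\<bar> + \<bar>snd z\<bar>" by simp
      ultimately have n: "norm z \<le> \<bar>fst z + snd z\<bar> + \<bar>snd z\<bar> + \<bar>snd z\<bar>" by argo
      have "K < \<bar>snd z\<bar> \<or> K < \<bar>fst z + snd z\<bar>"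
      proof (rule ccontr)
        assume "\<not> ?thesis"
        then have "\<bar>fst z + snd z\<bar> \<le> \<bar>K\<bar>" "\<bar>snd z\<bar> \<le> \<bar>K\<bar>" by auto
        then show False using n that by argo
      qed
      then show ?thesis unfolding h_def by (rule s)
    qed
    have "integrable (lborel \<Otimes>\<^sub>M lborel) (case_prod (\<lambda>t u. h (t, u)))"
      using compact_support_integrable[OF ch h0] by (simp add: lborel_prod)
    from lborel_pair.Fubini_integral[OF this] show ?thesis by (simp add: h_def)
  qed
  also have "(LINT u|lborel. (LINT t|lborel. f u (t + u))) = (LINT u|lborel. (LINT v|lborel. f u v))"
  proof (rule Bochner_Integration.integral_cong[OF refl])
    fix u
    have "(LINT v|lborel. f u v) = \<bar>1\<bar> *\<^sub>R (LINT t|lborel. f u (u + 1 * t))" by (rule lborel_integral_real_affine) simp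
    then show "(LINT t|lborel. f u (t + u)) = (LINT v|lborel. f u v)" by (simp add: add.commute)
  qed
  finally show ?thesis by (simp add: g_def)
qed

lemma mollify_bound:
  fixes h :: "real \<Rightarrow> complex" and \<rho> :: "real \<Rightarrow> real"
  assumes \<rho>: "integrable lborel \<rho>" "(LINT s|lborel. \<rho> s) = 1" "\<And>s. 0 \<le> \<rho> s" "\<And>s. s \<le> 0 \<or> 1 \<le> s \<Longrightarrow> \<rho> s = 0"
    and h: "h \<in> borel_measurable borel" "\<And>s. 0 \<le> s \<Longrightarrow> s \<le> 1 \<Longrightarrow> cmod (h s - c) \<le> \<eta>"
  shows "cmod ((LINT s|lborel. h s * cor (\<rho> s)) - c) \<le> \<eta>"
proof -
  have [measurable]: "\<rho> \<in> borel_measurable borel" using \<rho>(1) by auto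
  note h(1) [measurable]
  have bd: "cmod ((h s - c) * cor (\<rho> s)) \<le> \<eta> * \<rho> s" for s
  proof (cases "0 \<le> s \<and> s \<le> 1")
    case True then show ?thesis using h(2)[of s] \<rho>(3)[of s] by (simp add: norm_mult mult_right_mono)
  next
    case False then show ?thesis using \<rho>(4)[of s] by auto
  qed
  have i1: "integrable lborel (\<lambda>s. (h s - c) * cor (\<rho> s))"
  proof (rule Bochner_Integration.integrable_bound[OF integrable_mult_right[OF \<rho>(1), of \<eta>]])
    show "AE s in lborel. norm ((h s - c) * cor (\<rho> s)) \<le> norm (\<eta> * \<rho> s)"
      by (intro AE_I2 order_trans[OF bd]) simp
  qed measurable
  have i2: "integrable lborel (\<lambda>s. c * cor (\<rho> s))"
    by (intro integrable_mult_right integrable_of_real \<rho>)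
  have "(LINT s|lborel. h s * cor (\<rho> s)) = (LINT s|lborel. (h s - c) * cor (\<rho> s) + c * cor (\<rho> s))"
    by (intro Bochner_Integration.integral_cong refl) (simp add: algebra_simps)
  also have "\<dots> = (LINT s|lborel. (h s - c) * cor (\<rho> s)) + c"
    using \<rho>(2) by (simp add: Bochner_Integration.integral_add[OF i1 i2])
  finally have "(LINT s|lborel. h s * cor (\<rho> s)) - c = (LINT s|lborel. (h s - c) * cor (\<rho> s))" by simp
  also have "cmod \<dots> \<le> (LINT s|lborel. \<eta> * \<rho> s)"
    by (rule order_trans[OF integral_norm_bound integral_mono[OF integrable_norm[OF i1] integrable_mult_right[OF \<rho>(1)] bd]])
  also have "\<dots> = \<eta>" using \<rho>(2) by simp
  finally show ?thesis .
qed

text \<open>The test functions are products of smoothed indicators of \<open>[a, b]\<close> and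
  \<open>[c, d]\<close> in characteristic coordinates. Their wave operator is a combination of four
  approximate point masses at the corners, while they themselves tend to the indicator of the
  rectangle; the weak equation turns into the rectangle identity.\<close>

theorem distributional_imp_rect:
  assumes c\<phi>: "jcont \<phi>"
    and dist: "\<And>\<psi>. test_fun \<psi> \<Longrightarrow> (LINT z|lborel. \<phi> (fst z) (snd z) *
            cor (dpart 2 0 \<psi> (fst z) (snd z) - dpart 0 2 \<psi> (fst z) (snd z) + \<psi> (fst z) (snd z))) = 0"
  shows "rect (\<lambda>u v. \<phi> (v - u) (u + v))"
proof -
  define F where "F u v = \<phi> (v - u) (u + v)" for u v
  have jF: "jcont F" unfolding F_def by (intro jcont_compose[OF c\<phi>] continuous_intros)
  obtain S :: "nat \<Rightarrow> real \<Rightarrow> real" where S: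
    "\<And>k x. (S k has_real_derivative S (Suc k) x) (at x)"
    "\<And>x. x \<le> 0 \<Longrightarrow> S 0 x = 0" "\<And>x. 1 \<le> x \<Longrightarrow> S 0 x = 1"
    "\<And>x. 0 \<le> S (Suc 0) x" "\<And>x. x \<le> 0 \<or> 1 \<le> x \<Longrightarrow> S (Suc 0) x = 0"
    by (rule exists_smooth_step) blast
  have cS: "continuous_on X (S k)" for X k
    by (intro continuous_at_imp_continuous_on ballI DERIV_isCont[OF S(1)])
  have S01: "0 \<le> S 0 x" "S 0 x \<le> 1" for x
  proof -
    have mono: "S 0 x \<le> S 0 y" if "x \<le> y" for x y
      by (rule DERIV_nonneg_imp_nondecreasing[OF that]) (use S(1,4) in blast)
    show "0 \<le> S 0 x" using mono[of "min x 0" x] S(2)[of "min x 0"] by simp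
    show "S 0 x \<le> 1" using mono[of x "max x 1"] S(3)[of "max x 1"] by simp
  qed
  define \<rho> where "\<rho> = S (Suc 0)"
  have \<rho>i: "has_bochner_integral lborel \<rho> 1"
  proof -
    have h: "(\<rho> has_integral (S 0 1 - S 0 0)) {0..1}"
      by (rule fundamental_theorem_of_calculus) (auto simp: \<rho>_def has_real_derivative_iff_has_vector_derivative[symmetric] intro: has_field_derivative_at_within S(1))
    have si: "set_integrable lborel {0..1} \<rho>" unfolding \<rho>_def by (rule borel_integrable_atLeastAtMost'[OF cS])
    have "(LINT x:{0..1}|lborel. \<rho> x) = 1" using set_borel_integral_eq_integral(2)[OF si] h S(2)[of 0] S(3)[of 1] by (simp add: integral_unique)
    moreover have i: "indicator {0..1} x *\<^sub>R \<rho> x = \<rho> x" for x using S(5)[of x] by (cases "x \<le> 0 \<or> 1 \<le> x") (auto simp: \<rho>_def)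
    ultimately show ?thesis using si unfolding set_integrable_def set_lebesgue_integral_def i has_bochner_integral_iff by blast
  qed
  have \<rho>: "integrable lborel \<rho>" "(LINT s|lborel. \<rho> s) = 1" "\<And>s. 0 \<le> \<rho> s" "\<And>s. s \<le> 0 \<or> 1 \<le> s \<Longrightarrow> \<rho> s = 0"
    using \<rho>i S(4,5) by (auto simp: has_bochner_integral_iff \<rho>_def)
  have c\<rho>: "continuous_on X \<rho>" for X unfolding \<rho>_def by (rule cS)
  define en where "en n = 1 / real (Suc n)" for n
  have en: "0 < en n" "en n \<le> 1" for n by (auto simp: en_def)
  have en0: "en \<longlonglongrightarrow> 0" unfolding en_def by (rule LIMSEQ_Suc[OF lim_1_over_n])
  \<comment> \<open>A mollified point evaluation: the mean of \<open>F\<close> against a probability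
    density supported in the square of side \<open>e\<close> whose lower left corner is
    \<open>(p, q)\<close>.\<close>
  define Q where "Q e p q = (LINT u|lborel. (LINT v|lborel. F u v * cor (\<rho> ((u - p) / e) / e * (\<rho> ((v - q) / e) / e))))" for e p q
  have jQ: "jcont (\<lambda>u v. F u v * cor (\<rho> ((u - p) / e) / e * (\<rho> ((v - q) / e) / e)))" if "0 < e" for e p q
    using that by (intro continuous_intros jF continuous_on_compose2[OF c\<rho>[of UNIV]]) auto
  have Qlim: "(\<lambda>n. Q (en n) p q) \<longlonglongrightarrow> F p q" for p q
  proof (rule LIMSEQ_I)
    fix r :: real assume r: "0 < r"
    have "isCont (\<lambda>w. F (fst w) (snd w)) (p, q)" using jF by (simp add: continuous_on_eq_continuous_at)
    then obtain d where d: "0 < d" "\<And>w. dist w (p, q) < d \<Longrightarrow> dist (F (fst w) (snd w)) (F p q) < r / 2"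
      using r unfolding continuous_at_eps_delta by (metis half_gt_zero fst_conv snd_conv)
    have "\<forall>\<^sub>F n in sequentially. en n < d / 2" using d(1) by (intro order_tendstoD(2)[OF en0]) simp
    then obtain N where N: "\<And>n. N \<le> n \<Longrightarrow> en n < d / 2" by (auto simp: eventually_sequentially)
    have "norm (Q (en n) p q - F p q) < r" if "N \<le> n" for n
    proof -
      define e where "e = en n"
      have e: "0 < e" "e < d / 2" using N[OF that] en by (auto simp: e_def)
      have inner: "(LINT v|lborel. F u v * cor (\<rho> ((u - p) / e) / e * (\<rho> ((v - q) / e) / e))) =
         cor (\<rho> ((u - p) / e) / e) * (LINT t|lborel. F u (q + e * t) * cor (\<rho> t))" for u
      proof -
        have "(LINT v|lborel. F u v * cor (\<rho> ((u - p) / e) / e * (\<rho> ((v - q) / e) / e)))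
          = \<bar>e\<bar> *\<^sub>R (LINT t|lborel. F u (q + e * t) * cor (\<rho> ((u - p) / e) / e * (\<rho> ((q + e * t - q) / e) / e)))"
          using e by (intro lborel_integral_real_affine) simp
        also have "\<dots> = \<bar>e\<bar> *\<^sub>R (LINT t|lborel. cor (\<rho> ((u - p) / e) / e * (1 / e)) * (F u (q + e * t) * cor (\<rho> t)))"
          using e by (intro arg_cong[where f="\<lambda>x. \<bar>e\<bar> *\<^sub>R x"] Bochner_Integration.integral_cong refl) (simp add: field_simps)
        also have "\<dots> = cor (\<rho> ((u - p) / e) / e) * (LINT t|lborel. F u (q + e * t) * cor (\<rho> t))"
          using e unfolding integral_mult_right_zero by (simp add: scaleR_conv_of_real)
        finally show ?thesis .
      qed
      have "Q e p q = \<bar>e\<bar> *\<^sub>R (LINT s|lborel. cor (\<rho> ((p + e * s - p) / e) / e) * (LINT t|lborel. F (p + e * s) (q + e * t) * cor (\<rho> t)))"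
        unfolding Q_def inner using e by (intro lborel_integral_real_affine) simp
      also have "\<dots> = \<bar>e\<bar> *\<^sub>R (LINT s|lborel. cor (1 / e) * ((LINT t|lborel. F (p + e * s) (q + e * t) * cor (\<rho> t)) * cor (\<rho> s)))"
        using e by (intro arg_cong[where f="\<lambda>x. \<bar>e\<bar> *\<^sub>R x"] Bochner_Integration.integral_cong refl) (simp add: field_simps)
      also have "\<dots> = (LINT s|lborel. (LINT t|lborel. F (p + e * s) (q + e * t) * cor (\<rho> t)) * cor (\<rho> s))"
        using e unfolding integral_mult_right_zero by (simp add: scaleR_conv_of_real)
      finally have Qe: "Q e p q = (LINT s|lborel. (LINT t|lborel. F (p + e * s) (q + e * t) * cor (\<rho> t)) * cor (\<rho> s))" .
      have close: "cmod (F (p + e * s) (q + e * t) - F p q) \<le> r / 2" if "0 \<le> s" "s \<le> 1" "0 \<le> t" "t \<le> 1" for s t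
      proof -
        have "dist (p + e * s, q + e * t) (p, q) \<le> \<bar>e * s\<bar> + \<bar>e * t\<bar>"
          unfolding dist_Pair_Pair dist_real_def power2_abs using sqrt_sum_squares_le_sum_abs[of "e * s" "e * t"] by simp
        also have "\<dots> \<le> e * 1 + e * 1" using e that by (intro add_mono) (auto simp: abs_mult mult_left_le)
        also have "\<dots> < d" using e by simp
        finally show ?thesis using d(2)[of "(p + e * s, q + e * t)"] by (simp add: dist_norm)
      qed
      have m2: "(\<lambda>s. LINT t|lborel. F (p + e * s) (q + e * t) * cor (\<rho> t)) \<in> borel_measurable borel"
      proof -
        have "(\<lambda>z. F (p + e * fst z) (q + e * snd z) * cor (\<rho> (snd z))) \<in> borel_measurable (borel \<Otimes>\<^sub>M borel)"
          unfolding borel_prod by (intro borel_measurable_continuous_onI continuous_intros jcont_compose[OF jF] continuous_on_compose2[OF c\<rho>[of UNIV]]) auto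
        then have "(\<lambda>(s, t). F (p + e * s) (q + e * t) * cor (\<rho> t)) \<in> borel_measurable (borel \<Otimes>\<^sub>M lborel)"
          by (simp add: split_beta)
        then show ?thesis by (rule lborel.borel_measurable_lebesgue_integral)
      qed
      have m1: "(\<lambda>t. F (p + e * s) (q + e * t)) \<in> borel_measurable borel" for s
        by (intro borel_measurable_continuous_onI jcont_compose[OF jF] continuous_intros)
      have "cmod (Q e p q - F p q) \<le> r / 2"
        unfolding Qe by (intro mollify_bound[OF \<rho>] m1 m2 close)
      then show ?thesis using r by (simp add: e_def)
    qed
    then show "\<exists>N. \<forall>n\<ge>N. norm (Q (en n) p q - F p q) < r" by blast
  qed
  show ?thesis
    unfolding F_def[symmetric] rect_def
  proof (intro conjI allI impI jF)
    fix a b c d :: real assume ab: "a \<le> b" and cd: "c \<le> d"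
    \<comment> \<open>The \<open>k\<close>-th derivative of the difference of two smooth steps, one
      rising just after \<open>a\<close> and one just after \<open>b\<close>. For
      \<open>k = 1\<close> it is the mollifier at \<open>a\<close> minus the one at
      \<open>b\<close>.\<close>
    define A where "A n a b k s = (S k ((s - a) / en n) - S k ((s - b) / en n)) / en n ^ k" for n a b k s
    have dA: "(A n a b k has_real_derivative A n a b (Suc k) x) (at x)" for n a b k x
    proof -
      have 1: "((\<lambda>s. S k ((s - a) / en n)) has_real_derivative S (Suc k) ((x - a) / en n) * (1 / en n)) (at x)" for a
        by (rule DERIV_chain2[OF S(1)]) (use en(1)[of n] in \<open>auto intro!: derivative_eq_intros\<close>)
      show ?thesis unfolding A_def
        by (rule DERIV_cong[OF DERIV_cdivide[OF DERIV_diff[OF 1 1]]]) (use en(1)[of n] in \<open>simp add: field_simps\<close>)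
    qed
    have A0supp: "A n a b 0 s = 0" if "a \<le> b" "s < a \<or> b + 1 < s" for n a b s
    proof (cases "s < a")
      case True then show ?thesis using that en(1)[of n] by (simp add: A_def S(2) divide_nonpos_pos)
    next
      case False
      then have "en n \<le> s - b" "en n \<le> s - a" using that en(2)[of n] by auto
      then have "1 \<le> (s - b) / en n" "1 \<le> (s - a) / en n" using en(1)[of n] by auto
      then show ?thesis by (simp add: A_def S(3))
    qed
    have A0bd: "\<bar>A n a b 0 s\<bar> \<le> 2" for n a b s
      using S01[of "(s - a) / en n"] S01[of "(s - b) / en n"] by (simp add: A_def abs_if)
    have cA: "continuous_on X (A n a b k)" for n a b k X
      by (intro continuous_at_imp_continuous_on ballI DERIV_isCont[OF dA])
    \<comment> \<open>The steps rise to the right of their points. Hence the limit is the indicator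
      of a half-open interval, equal to that of the closed one up to a null set, and the supports
      extend beyond \<open>b\<close> by at most 1.\<close>
    have A0lim: "(\<lambda>n. A n a b 0 s) \<longlonglongrightarrow> indicator {a<..b} s" if "a \<le> b" for a b s
    proof -
      have l: "\<forall>\<^sub>F n in sequentially. S 0 ((s - a) / en n) = indicator {a<..} s" for a
      proof (cases "a < s")
        case True
        then have "\<forall>\<^sub>F n in sequentially. en n < s - a" by (intro order_tendstoD(2)[OF en0]) simp
        then show ?thesis
        proof eventually_elim
          case (elim n)
          then have "1 \<le> (s - a) / en n" using en(1)[of n] by simp
          then show ?case using True by (simp add: S(3))
        qed
      next
        case False
        then show ?thesis using en(1) by (intro always_eventually allI) (simp add: S(2) divide_nonpos_pos)
      qed
      have "\<forall>\<^sub>F n in sequentially. A n a b 0 s = indicator {a<..b} s"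
        using l[of a] l[of b] by eventually_elim (use that in \<open>auto simp: A_def indicator_def\<close>)
      then show ?thesis by (rule tendsto_eventually)
    qed
    define f0 where "f0 n u v = F u v * cor (A n a b 0 u * A n c d 0 v)" for n u v
    define g where "g n p q u v = F u v * cor (\<rho> ((u - p) / en n) / en n * (\<rho> ((v - q) / en n) / en n))" for n p q u v
    define R where "R = \<bar>a\<bar> + \<bar>b\<bar> + \<bar>c\<bar> + \<bar>d\<bar> + 1"
    have jf0: "jcont (f0 n)" for n unfolding f0_def
      by (intro continuous_intros jF continuous_on_compose2[OF cA[of UNIV]]) auto
    have jg: "jcont (g n p q)" for n p q unfolding g_def by (rule jQ[OF en(1)])
    have sf0: "f0 n u v = 0" if "R < \<bar>u\<bar> \<or> R < \<bar>v\<bar>" for n u v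
    proof -
      have "u < a \<or> b + 1 < u \<or> v < c \<or> d + 1 < v" using that unfolding R_def by (auto simp: abs_if split: if_splits)
      then show ?thesis using A0supp[OF ab, of u n] A0supp[OF cd, of v n] by (auto simp: f0_def)
    qed
    have \<rho>0: "\<rho> ((u - p) / en n) = 0" if "\<bar>p\<bar> + 1 < \<bar>u\<bar>" for u p n
    proof -
      have "u \<le> p \<or> 1 + p \<le> u" using that by (auto simp: abs_if split: if_splits)
      then have "(u - p) / en n \<le> 0 \<or> 1 \<le> (u - p) / en n"
        using en[of n] by (auto simp: divide_nonpos_pos le_divide_eq)
      then show ?thesis by (rule \<rho>(4))
    qed
    have sg: "g n p q u v = 0" if "R < \<bar>u\<bar> \<or> R < \<bar>v\<bar>" "p = a \<or> p = b" "q = c \<or> q = d" for n p q u v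
    proof -
      have "\<bar>p\<bar> + 1 \<le> R" "\<bar>q\<bar> + 1 \<le> R" using that(2,3) unfolding R_def by auto
      then show ?thesis using that(1) \<rho>0[of p u n] \<rho>0[of q v n] by (auto simp: g_def)
    qed
    define ch where "ch f z = f ((snd z - fst z) / 2) ((snd z + fst z) / 2)" for f :: "real \<Rightarrow> real \<Rightarrow> complex" and z :: "real \<times> real"
    have ich: "integrable lborel (ch f)" if "jcont f" "\<And>u v. R < \<bar>u\<bar> \<or> R < \<bar>v\<bar> \<Longrightarrow> f u v = 0" for f
    proof (rule compact_support_integrable[where B="4 * R"])
      show "continuous_on UNIV (ch f)" unfolding ch_def by (intro jcont_compose[OF that(1)] continuous_intros) auto
      fix z :: "real \<times> real" assume z: "4 * R < norm z"
      have "norm z \<le> \<bar>fst z\<bar> + \<bar>snd z\<bar>" using norm_Pair_le[of "fst z" "snd z"] by simp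
      also have "\<dots> \<le> \<bar>snd z - fst z\<bar> + \<bar>snd z + fst z\<bar>" by (simp add: abs_if)
      also have "\<dots> = 2 * (\<bar>(snd z - fst z) / 2\<bar> + \<bar>(snd z + fst z) / 2\<bar>)" by simp
      finally have n: "norm z \<le> 2 * (\<bar>(snd z - fst z) / 2\<bar> + \<bar>(snd z + fst z) / 2\<bar>)" .
      have "R < \<bar>(snd z - fst z) / 2\<bar> \<or> R < \<bar>(snd z + fst z) / 2\<bar>"
      proof (rule ccontr)
        assume "\<not> ?thesis"
        then have "\<bar>(snd z - fst z) / 2\<bar> + \<bar>(snd z + fst z) / 2\<bar> \<le> R + R" by (intro add_mono) auto
        then show False using n z by argo
      qed
      then show "ch f z = 0" unfolding ch_def by (rule that(2))
    qed
    have ig: "integrable lborel (ch (g n p q))" if "p = a \<or> p = b" "q = c \<or> q = d" for n p q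
      using that by (intro ich jg sg)
    have ig': "integrable lborel (ch (g n a c))" "integrable lborel (ch (g n a d))" "integrable lborel (ch (g n b c))" "integrable lborel (ch (g n b d))" for n
      by (intro ig; simp)+
    have if0: "integrable lborel (ch (f0 n))" for n by (intro ich jf0 sf0)
    have iQ: "(LINT z|lborel. ch (g n p q) z) = 2 * Q (en n) p q" if "p = a \<or> p = b" "q = c \<or> q = d" for n p q
      unfolding ch_def using integral_characteristic[OF jg, of R n p q] sg[of _ _ p q n] that by (simp add: Q_def g_def)
    have Fz: "F ((snd z - fst z) / 2) ((fst z + snd z) / 2) = \<phi> (fst z) (snd z)" for z :: "real \<times> real"
      by (simp add: F_def add_divide_distrib diff_divide_distrib)
    have main: "Q (en n) a c - Q (en n) a d - Q (en n) b c + Q (en n) b d = (LINT u|lborel. (LINT v|lborel. f0 n u v))" for n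
    proof -
      define \<psi> where "\<psi> = (\<lambda>t x. A n a b 0 ((x - t) / 2) * A n c d 0 ((x + t) / 2))"
      have tf: "test_fun \<psi>" unfolding \<psi>_def by (rule char_product_test_fun[where A = "A n a b" and B = "A n c d", OF dA dA A0supp[OF ab] A0supp[OF cd]])
      have w: "dpart 2 0 \<psi> t x - dpart 0 2 \<psi> t x = - (A n a b (Suc 0) ((x - t) / 2) * A n c d (Suc 0) ((x + t) / 2))" for t x
        unfolding \<psi>_def by (rule char_product_wave[where A = "A n a b" and B = "A n c d"]; rule dA)
      have A1: "A n p q (Suc 0) s = \<rho> ((s - p) / en n) / en n - \<rho> ((s - q) / en n) / en n" for p q s
        by (simp add: A_def \<rho>_def diff_divide_distrib)
      have "0 = (LINT z|lborel. \<phi> (fst z) (snd z) * cor (dpart 2 0 \<psi> (fst z) (snd z) - dpart 0 2 \<psi> (fst z) (snd z) + \<psi> (fst z) (snd z)))"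
        using dist[OF tf] by simp
      also have "\<dots> = (LINT z|lborel. ch (f0 n) z - (ch (g n a c) z - ch (g n a d) z - ch (g n b c) z + ch (g n b d) z))"
        unfolding w A1 by (intro Bochner_Integration.integral_cong refl)
          (simp add: ch_def f0_def g_def \<psi>_def Fz algebra_simps)
      also have "\<dots> = (LINT z|lborel. ch (f0 n) z) - ((LINT z|lborel. ch (g n a c) z) - (LINT z|lborel. ch (g n a d) z) - (LINT z|lborel. ch (g n b c) z) + (LINT z|lborel. ch (g n b d) z))"
        by (simp add: Bochner_Integration.integral_diff Bochner_Integration.integral_add if0 ig')
      also have "(LINT z|lborel. ch (f0 n) z) = 2 * (LINT u|lborel. (LINT v|lborel. f0 n u v))"
        unfolding ch_def by (rule integral_characteristic[OF jf0 sf0])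
      finally have "2 * (Q (en n) a c - Q (en n) a d - Q (en n) b c + Q (en n) b d) = 2 * (LINT u|lborel. (LINT v|lborel. f0 n u v))"
        by (simp add: iQ algebra_simps)
      then show ?thesis unfolding mult_cancel_left by simp
    qed
    have lim1: "(\<lambda>n. Q (en n) a c - Q (en n) a d - Q (en n) b c + Q (en n) b d) \<longlonglongrightarrow> F a c - F a d - F b c + F b d"
      by (intro tendsto_intros Qlim)
    obtain M where M: "0 \<le> M" "\<And>s t. a \<le> s \<Longrightarrow> s \<le> b + 1 \<Longrightarrow> c \<le> t \<Longrightarrow> t \<le> d + 1 \<Longrightarrow> cmod (F s t) \<le> M"
      using jcont_bounded[OF jF] by blast
    define In where "In n u = (LINT v|lborel. F u v * cor (A n c d 0 v))" for n u
    have mF: "(\<lambda>v. F u v) \<in> borel_measurable borel" for u by (intro borel_measurable_continuous_onI jcont_sections[OF jF])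
    have mA: "A n p q 0 \<in> borel_measurable borel" for n p q by (rule borel_measurable_continuous_onI[OF cA])
    have ibox: "integrable lborel (\<lambda>v::real. K * indicator {p..q} v)" for K p q :: real
      by (intro integrable_mult_right integrable_real_indicator) (auto simp: emeasure_lborel_Icc_eq)
    have bdF: "cmod (F u v * cor (A n c d 0 v)) \<le> (2 * M) * indicator {c..d + 1} v" if "a \<le> u" "u \<le> b + 1" for u v n
    proof (cases "v \<in> {c..d + 1}")
      case True
      then show ?thesis using mult_mono[OF M(2)[OF that, of v] A0bd[of n c d v]] M(1) by (simp add: norm_mult mult.commute)
    next
      case False then show ?thesis using A0supp[OF cd, of v n] by auto
    qed
    have Inlim: "(\<lambda>n. In n u) \<longlonglongrightarrow> integral {c..d} (F u)" if u: "a \<le> u" "u \<le> b + 1" for u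
    proof -
      have "(\<lambda>n. In n u) \<longlonglongrightarrow> (LINT v|lborel. F u v * cor (indicator {c<..d} v))"
        unfolding In_def
      proof (rule integral_dominated_convergence[OF _ _ ibox[of "2 * M" c "d + 1"]])
        show "AE v in lborel. (\<lambda>n. F u v * cor (A n c d 0 v)) \<longlonglongrightarrow> F u v * cor (indicator {c<..d} v)"
          by (intro AE_I2 tendsto_mult tendsto_const tendsto_of_real A0lim cd)
        show "AE v in lborel. norm (F u v * cor (A n c d 0 v)) \<le> 2 * M * indicator {c..d + 1} v" for n
          by (intro AE_I2 bdF u)
      qed (use mF mA in measurable)
      also have "(LINT v|lborel. F u v * cor (indicator {c<..d} v)) = (LINT v:{c..d}|lborel. F u v)"
        unfolding set_lebesgue_integral_def
      proof (rule integral_cong_AE)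
        show "AE v in lborel. F u v * cor (indicator {c<..d} v) = indicat_real {c..d} v *\<^sub>R F u v"
          using AE_lborel_singleton[of c] by eventually_elim (auto split: split_indicator)
      qed (use mF in measurable)
      also have "\<dots> = integral {c..d} (F u)" by (rule cont_set_integrable(2)[OF jcont_sections(1)[OF jF]])
      finally show ?thesis .
    qed
    have Inbd: "cmod (In n u) \<le> 2 * M * (d + 1 - c)" if u: "a \<le> u" "u \<le> b + 1" for n u
    proof -
      have "cmod (In n u) \<le> (LINT v|lborel. (2 * M) * indicator {c..d + 1} v)"
        unfolding In_def
        by (rule order_trans[OF integral_norm_bound integral_mono'[OF ibox bdF[OF u]]]) (use M in auto)
      then show ?thesis using cd by simp
    qed
    have mIn: "In n \<in> borel_measurable borel" for n
    proof -
      have "(\<lambda>z. F (fst z) (snd z) * cor (A n c d 0 (snd z))) \<in> borel_measurable (borel \<Otimes>\<^sub>M borel)"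
        unfolding borel_prod by (intro borel_measurable_continuous_onI continuous_intros jF continuous_on_compose2[OF cA[of UNIV]]) auto
      then have "(\<lambda>(s, t). F s t * cor (A n c d 0 t)) \<in> borel_measurable (borel \<Otimes>\<^sub>M lborel)"
        by (simp add: split_beta)
      then show ?thesis unfolding In_def[abs_def] by (rule lborel.borel_measurable_lebesgue_integral)
    qed
    have ci: "continuous_on UNIV (\<lambda>u. integral {c..d} (F u))"
    proof (rule continuous_on_eq)
      show "continuous_on UNIV (\<lambda>s. Sg (\<lambda>t. F s t) d - Sg (\<lambda>t. F s t) c)"
        by (intro continuous_on_diff; rule jcont_compose[OF Sg_jcont(1)[OF jF]]; auto intro!: continuous_intros)
    qed (simp add: Sg_diff[OF jcont_sections(1)[OF jF] cd])
    have f0In: "(LINT v|lborel. f0 n u v) = cor (A n a b 0 u) * In n u" for n u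
    proof -
      have "f0 n u v = cor (A n a b 0 u) * (F u v * cor (A n c d 0 v))" for v by (simp add: f0_def)
      then show ?thesis unfolding In_def by simp
    qed
    have "(\<lambda>n. LINT u|lborel. cor (A n a b 0 u) * In n u) \<longlonglongrightarrow> (LINT u|lborel. cor (indicator {a<..b} u) * integral {c..d} (F u))"
    proof (rule integral_dominated_convergence[OF _ _ ibox[of "2 * (2 * M * (d + 1 - c))" a "b + 1"]])
      show "AE u in lborel. (\<lambda>n. cor (A n a b 0 u) * In n u) \<longlonglongrightarrow> cor (indicator {a<..b} u) * integral {c..d} (F u)"
      proof (rule AE_I2)
        fix u show "(\<lambda>n. cor (A n a b 0 u) * In n u) \<longlonglongrightarrow> cor (indicator {a<..b} u) * integral {c..d} (F u)"
        proof (cases "a \<le> u \<and> u \<le> b + 1")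
          case True then show ?thesis by (intro tendsto_mult tendsto_of_real A0lim ab Inlim) auto
        next
          case False then show ?thesis using A0supp[OF ab, of u] by (auto simp: indicator_def)
        qed
      qed
      show "AE u in lborel. norm (cor (A n a b 0 u) * In n u) \<le> 2 * (2 * M * (d + 1 - c)) * indicator {a..b + 1} u" for n
      proof (rule AE_I2)
        fix u show "norm (cor (A n a b 0 u) * In n u) \<le> 2 * (2 * M * (d + 1 - c)) * indicator {a..b + 1} u"
        proof (cases "u \<in> {a..b + 1}")
          case True
          then show ?thesis using mult_mono[OF A0bd[of n a b u] Inbd[of u n]] by (simp add: norm_mult)
        next
          case False then show ?thesis using A0supp[OF ab, of u n] by auto
        qed
      qed
      show "(\<lambda>u. cor (indicator {a<..b} u) * integral {c..d} (F u)) \<in> borel_measurable lborel"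
        using borel_measurable_continuous_onI[OF ci] by measurable
    qed (use mIn mA in measurable)
    also have "(LINT u|lborel. cor (indicator {a<..b} u) * integral {c..d} (F u)) = (LINT u:{a..b}|lborel. integral {c..d} (F u))"
      unfolding set_lebesgue_integral_def
    proof (rule integral_cong_AE)
      show "AE u in lborel. cor (indicator {a<..b} u) * integral {c..d} (F u) = indicat_real {a..b} u *\<^sub>R integral {c..d} (F u)"
        using AE_lborel_singleton[of a] by eventually_elim (auto split: split_indicator)
    qed (use borel_measurable_continuous_onI[OF ci] in measurable)
    also have "\<dots> = integral {a..b} (\<lambda>u. integral {c..d} (F u))"
      by (rule cont_set_integrable(2)[OF continuous_on_subset[OF ci]]) simp
    finally have lim2: "(\<lambda>n. LINT u|lborel. (LINT v|lborel. f0 n u v)) \<longlonglongrightarrow> integral {a..b} (\<lambda>u. integral {c..d} (F u))"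
      by (simp only: f0In)
    have "F a c - F a d - F b c + F b d = integral {a..b} (\<lambda>u. integral {c..d} (F u))"
      by (rule LIMSEQ_unique[OF lim1 lim2[folded main]])
    then show "F b d - F a d - F b c + F a c = integral {a..b} (\<lambda>s. integral {c..d} (\<lambda>t. F s t))"
      by (simp add: algebra_simps)
  qed
qed

subsection \<open>Existence for the Goursat problem\<close>

lemma Sg_reflect: "Sg (\<lambda>s. f (- s)) (- u) = - Sg f u"
  by (simp add: Sg_def)

lemma Sg_uminus: "Sg (\<lambda>s. - f s) u = - Sg f u"
  by (simp add: Sg_def)

lemma Sg_minus_fun:
  assumes "continuous_on UNIV f" "continuous_on UNIV g"
  shows "Sg (\<lambda>s. f s - g s) u = Sg f u - Sg g u"
proof -
  have "(\<lambda>r. f (r * u)) integrable_on {0..1}" "(\<lambda>r. g (r * u)) integrable_on {0..1}"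
    by (intro integrable_continuous_interval continuous_on_compose2[OF assms(1)] continuous_on_compose2[OF assms(2)] continuous_intros; simp)+
  then show ?thesis
    by (simp add: Sg_def Henstock_Kurzweil_Integration.integral_diff right_diff_distrib)
qed

lemma Sg_exp_bound:
  assumes f: "continuous_on UNIV f" and le: "\<And>s. cmod (f s) \<le> m * exp (2 * \<bar>s\<bar>)"
  shows "cmod (Sg f u) \<le> m / 2 * exp (2 * \<bar>u\<bar>)"
proof -
  have m: "0 \<le> m" using order_trans[OF norm_ge_zero le[of 0]] by simp
  have pos: "cmod (Sg k v) \<le> m / 2 * exp (2 * v)"
    if "continuous_on UNIV k" "\<And>s. cmod (k s) \<le> m * exp (2 * \<bar>s\<bar>)" "0 \<le> v" for k v
    unfolding Sg_nonneg[OF that(1,3)]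
  proof (rule integral_norm_le_exp)
    fix x :: real assume "0 \<le> x"
    then show "cmod (k x) \<le> m * exp (2 * x)" using that(2)[of x] by simp
  qed (use that m in \<open>auto intro: continuous_on_subset\<close>)
  show ?thesis
  proof (cases "0 \<le> u")
    case True then show ?thesis using pos[OF f le, of u] by simp
  next
    case False
    have c: "continuous_on UNIV (\<lambda>s. f (- s))" by (intro continuous_on_compose2[OF f] continuous_intros) auto
    have b: "cmod (f (- s)) \<le> m * exp (2 * \<bar>s\<bar>)" for s using le[of "- s"] by simp
    show ?thesis using pos[OF c b, of "- u"] False Sg_reflect[of f u] by simp
  qed
qed

text \<open>Each oriented integration halves the constant in front of the weight. The resulting
  factor 1/4 drives both uniqueness and existence below.\<close>

lemma Sg_Sg_bound:
  assumes F: "jcont F" and le: "\<And>s t. cmod (F s t) \<le> m * exp (2 * (\<bar>s\<bar> + \<bar>t\<bar>))"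
  shows "cmod (Sg (\<lambda>s. Sg (F s) v) u) \<le> m / 4 * exp (2 * (\<bar>u\<bar> + \<bar>v\<bar>))"
proof -
  have c: "continuous_on UNIV (\<lambda>s. Sg (F s) v)"
    using jcont_sections(1)[OF Sg_jcont(1)[OF F], of UNIV v] by simp
  have "cmod (Sg (F s) v) \<le> (m / 2 * exp (2 * \<bar>v\<bar>)) * exp (2 * \<bar>s\<bar>)" for s
  proof -
    have "cmod (Sg (F s) v) \<le> (m * exp (2 * \<bar>s\<bar>)) / 2 * exp (2 * \<bar>v\<bar>)"
      by (rule Sg_exp_bound[OF jcont_sections(1)[OF F]]) (use le[of s] in \<open>simp add: exp_add distrib_left mult_ac\<close>)
    then show ?thesis by (simp add: mult_ac)
  qed
  from Sg_exp_bound[OF c this, of u] show ?thesis by (simp add: exp_add distrib_left mult_ac)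
qed

text \<open>Feeding the bound into the equation divides its constant by 4, and this can be
  iterated.\<close>

lemma Goursat_unique:
  assumes F: "jcont F" and le: "\<And>s t. cmod (F s t) \<le> m * exp (2 * (\<bar>s\<bar> + \<bar>t\<bar>))"
    and eq: "\<And>u v. F u v = Sg (\<lambda>s. Sg (F s) v) u"
  shows "F u v = 0"
proof -
  have b: "cmod (F u v) \<le> m / 4 ^ n * exp (2 * (\<bar>u\<bar> + \<bar>v\<bar>))" for n u v
  proof (induction n arbitrary: u v)
    case (Suc n)
    show ?case using Sg_Sg_bound[OF F Suc.IH, of v u] eq[of u v] by simp
  qed (use le in simp)
  have "(\<lambda>n. m * (1 / 4) ^ n * exp (2 * (\<bar>u\<bar> + \<bar>v\<bar>))) \<longlonglongrightarrow> m * 0 * exp (2 * (\<bar>u\<bar> + \<bar>v\<bar>))"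
    by (intro tendsto_intros LIMSEQ_power_zero) simp
  then have "cmod (F u v) \<le> m * 0 * exp (2 * (\<bar>u\<bar> + \<bar>v\<bar>))"
  proof (rule LIMSEQ_le_const)
    have "cmod (F u v) \<le> m * (1 / 4) ^ n * exp (2 * (\<bar>u\<bar> + \<bar>v\<bar>))" for n
      using b[of u v n] by (simp only: power_one_over times_divide_eq_right mult_1_right)
    then show "\<exists>N. \<forall>n\<ge>N. cmod (F u v) \<le> m * (1 / 4) ^ n * exp (2 * (\<bar>u\<bar> + \<bar>v\<bar>))" by blast
  qed
  then show ?thesis by simp
qed

text \<open>Banach's fixed point theorem for \<open>W = F / e\<close>, a bounded continuous
  function. The exponential weight \<open>e\<close> makes the integral operator a contraction by 1/4
  on the whole plane at once, so no continuation from small squares is needed.\<close>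

lemma Goursat_exists:
  assumes h: "jcont h" and b: "\<And>u v. cmod (h u v) \<le> C * exp (2 * (\<bar>u\<bar> + \<bar>v\<bar>))"
  obtains F m where "jcont F" "\<And>u v. cmod (F u v) \<le> m * exp (2 * (\<bar>u\<bar> + \<bar>v\<bar>))"
    "\<And>u v. F u v = h u v + Sg (\<lambda>s. Sg (F s) v) u"
proof -
  define e where "e u v = cor (exp (2 * (\<bar>u\<bar> + \<bar>v\<bar>)))" for u v :: real
  define E where "E W u v = e u v * apply_bcontfun W (u, v)" for W :: "(real \<times> real) \<Rightarrow>\<^sub>C complex" and u v
  have e0: "e u v \<noteq> 0" for u v by (simp add: e_def)
  have ce: "cmod (e u v) = exp (2 * (\<bar>u\<bar> + \<bar>v\<bar>))" for u v by (simp add: e_def)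
  have je: "jcont e" unfolding e_def by (intro continuous_intros)
  have cW: "continuous_on UNIV (apply_bcontfun W)" for W :: "(real \<times> real) \<Rightarrow>\<^sub>C complex"
    using apply_bcontfun[of W] by (auto simp: bcontfun_def)
  have jE: "jcont (E W)" for W
    unfolding E_def using cW[of W] by (intro continuous_on_mult je) simp
  have Eb: "cmod (E W u v) \<le> norm W * exp (2 * (\<bar>u\<bar> + \<bar>v\<bar>))" for W u v
    using norm_bounded[of W "(u, v)"] by (simp add: E_def norm_mult ce mult_ac)
  define K where "K F u v = h u v + Sg (\<lambda>s. Sg (F s) v) u" for F u v
  have jK: "jcont (K F)" if "jcont F" for F
  proof -
    have "jcont (\<lambda>s v. Sg (F s) v)"
      using jcont_swap[OF Sg_jcont(1)[OF that]] by simp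
    from Sg_jcont(2)[OF this] show ?thesis unfolding K_def by (intro continuous_on_add h)
  qed
  have Kb: "cmod (K F u v) \<le> (C + m / 4) * exp (2 * (\<bar>u\<bar> + \<bar>v\<bar>))"
    if "jcont F" "\<And>s t. cmod (F s t) \<le> m * exp (2 * (\<bar>s\<bar> + \<bar>t\<bar>))" for F m u v
    using norm_triangle_le[OF add_mono[OF b[of u v] Sg_Sg_bound[OF that, of v u]]]
    by (simp add: K_def distrib_right)
  define T where "T W = Bcontfun (\<lambda>z. K (E W) (fst z) (snd z) / e (fst z) (snd z))" for W
  have T: "apply_bcontfun (T W) z = K (E W) (fst z) (snd z) / e (fst z) (snd z)" for W z
  proof -
    have "(\<lambda>z. K (E W) (fst z) (snd z) / e (fst z) (snd z)) \<in> bcontfun"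
    proof (rule bcontfun_normI)
      show "continuous_on UNIV (\<lambda>z. K (E W) (fst z) (snd z) / e (fst z) (snd z))"
        by (intro continuous_on_divide jK jE je) (simp add: e0)
      show "norm (K (E W) (fst z) (snd z) / e (fst z) (snd z)) \<le> C + norm W / 4" for z
        using Kb[OF jE Eb, of W "fst z" "snd z"] by (simp add: norm_divide ce divide_le_eq)
    qed
    then show ?thesis unfolding T_def by (simp add: Bcontfun_inverse)
  qed
  have contr: "dist (T V) (T W) \<le> 1 / 4 * dist V W" for V W
  proof (rule dist_bound)
    fix z :: "real \<times> real"
    obtain u v where z: "z = (u, v)" by fastforce
    have jD: "jcont (\<lambda>s t. E V s t - E W s t)" by (intro continuous_on_diff jE)
    have bD: "cmod (E V s t - E W s t) \<le> dist V W * exp (2 * (\<bar>s\<bar> + \<bar>t\<bar>))" for s t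
    proof -
      have "E V s t - E W s t = e s t * (apply_bcontfun V (s, t) - apply_bcontfun W (s, t))"
        by (simp add: E_def right_diff_distrib)
      then show ?thesis using dist_bounded[of V "(s, t)" W] by (simp add: norm_mult ce dist_norm mult_ac)
    qed
    have "K (E V) u v - K (E W) u v = Sg (\<lambda>s. Sg (\<lambda>t. E V s t - E W s t) v) u"
    proof -
      have c: "continuous_on UNIV (\<lambda>s. Sg (E Z s) v)" for Z
        using jcont_sections(1)[OF Sg_jcont(1)[OF jE], of UNIV Z v] by simp
      show ?thesis
        by (simp add: K_def Sg_minus_fun[OF jcont_sections(1)[OF jE] jcont_sections(1)[OF jE]] Sg_minus_fun[OF c c])
    qed
    then have "cmod (K (E V) u v - K (E W) u v) \<le> dist V W / 4 * exp (2 * (\<bar>u\<bar> + \<bar>v\<bar>))"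
      using Sg_Sg_bound[OF jD bD, of v u] by simp
    then show "dist (apply_bcontfun (T V) z) (apply_bcontfun (T W) z) \<le> 1 / 4 * dist V W"
      by (simp add: T z dist_norm flip: diff_divide_distrib) (simp add: norm_divide ce divide_le_eq)
  qed
  obtain W where W: "T W = W" using banach_fix_type[of "1 / 4" T] contr by auto
  show ?thesis
  proof (rule that[of "E W" "norm W"])
    fix u v
    have "E W u v = e u v * apply_bcontfun (T W) (u, v)" by (simp add: E_def W)
    then show "E W u v = h u v + Sg (\<lambda>s. Sg (E W s) v) u" by (simp add: T e0 K_def)
  qed (intro jE Eb)+
qed

text \<open>The axis data depend on \<open>\<bar>u\<bar>\<close> and \<open>\<bar>v\<bar>\<close>,
  so the reflected function solves the same integral equation and uniqueness gives the symmetry. The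
  symmetry carries the energy bound from the right half of the Cauchy line to the left.\<close>

lemma Goursat_even:
  assumes gd: "L2 gd" and pd: "L2 pd"
  obtains F where "rect F" "\<And>u v. F (- u) (- v) = F u v"
    "\<And>u. F u 0 = c + (LINT s:{0..\<bar>u\<bar>}|lborel. gd s)" "\<And>v. F 0 v = c + (LINT s:{0..\<bar>v\<bar>}|lborel. pd s)"
proof -
  define h where "h u v = c + (LINT s:{0..\<bar>u\<bar>}|lborel. gd s) + (LINT s:{0..\<bar>v\<bar>}|lborel. pd s)" for u v
  have jh: "jcont h"
    unfolding h_def
    by (intro continuous_on_add continuous_on_const continuous_on_compose2[OF L2_primitive_continuous[OF gd]]
        continuous_on_compose2[OF L2_primitive_continuous[OF pd]] continuous_intros) auto
  have hb: "cmod (h u v) \<le> (cmod c + (1 + nsq gd) + (1 + nsq pd)) * exp (2 * (\<bar>u\<bar> + \<bar>v\<bar>))" for u v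
  proof -
    let ?e = "exp (2 * (\<bar>u\<bar> + \<bar>v\<bar>))"
    have "cmod (h u v) \<le> cmod c * ?e + (1 + nsq gd) * ?e + (1 + nsq pd) * ?e"
      unfolding h_def
    proof (intro norm_triangle_le[OF add_mono] order_trans[OF L2_primitive_bound] mult_left_mono gd pd)
      show "cmod c \<le> cmod c * ?e" using mult_left_mono[of 1 ?e "cmod c"] by simp
    qed (auto simp: nsq_nonneg)
    then show ?thesis by (simp add: distrib_right)
  qed
  obtain F m where jF: "jcont F" and Fb: "\<And>u v. cmod (F u v) \<le> m * exp (2 * (\<bar>u\<bar> + \<bar>v\<bar>))"
    and Fe: "\<And>u v. F u v = h u v + Sg (\<lambda>s. Sg (F s) v) u"
    using Goursat_exists[OF jh hb] by blast
  have cS: "continuous_on A (\<lambda>s. Sg (F s) v)" for A v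
    using jcont_sections(1)[OF Sg_jcont(1)[OF jF], of A v] by simp
  have rF: "rect F"
    unfolding rect_def
  proof (intro conjI allI impI jF)
    fix a b' c' d :: real assume ab: "a \<le> b'" and cd: "c' \<le> d"
    have "F b' d - F a d - F b' c' + F a c' = (Sg (\<lambda>s. Sg (F s) d) b' - Sg (\<lambda>s. Sg (F s) d) a) - (Sg (\<lambda>s. Sg (F s) c') b' - Sg (\<lambda>s. Sg (F s) c') a)"
      by (simp add: Fe[of b' d] Fe[of a d] Fe[of b' c'] Fe[of a c'] h_def)
    also have "\<dots> = integral {a..b'} (\<lambda>s. Sg (F s) d) - integral {a..b'} (\<lambda>s. Sg (F s) c')"
      by (simp only: Sg_diff[OF cS ab])
    also have "\<dots> = integral {a..b'} (\<lambda>s. Sg (F s) d - Sg (F s) c')"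
      by (intro Henstock_Kurzweil_Integration.integral_diff[symmetric] integrable_continuous_interval cS)
    also have "\<dots> = integral {a..b'} (\<lambda>s. integral {c'..d} (\<lambda>t. F s t))"
      by (intro integral_cong) (simp add: Sg_diff[OF jcont_sections(1)[OF jF] cd])
    finally show "F b' d - F a d - F b' c' + F a c' = integral {a..b'} (\<lambda>s. integral {c'..d} (\<lambda>t. F s t))" .
  qed
  have even: "F (- u) (- v) = F u v" for u v
  proof -
    define G where "G u v = F (- u) (- v)" for u v
    have jG: "jcont G" unfolding G_def by (intro jcont_compose[OF jF] continuous_intros)
    have cG: "continuous_on A (\<lambda>s. Sg (G s) v)" for A v
      using jcont_sections(1)[OF Sg_jcont(1)[OF jG], of A v] by simp
    have Ge: "G u v = h u v + Sg (\<lambda>s. Sg (G s) v) u" for u v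
    proof -
      have 1: "Sg (G s) v = - Sg (F (- s)) (- v)" for s v
        using Sg_reflect[of "F (- s)" "- v"] by (simp add: G_def[abs_def])
      have 2: "Sg (\<lambda>s. Sg (G s) v) u = - Sg (\<lambda>s. Sg (F (- s)) (- v)) u" unfolding 1 by (rule Sg_uminus)
      have 3: "Sg (\<lambda>s. Sg (F (- s)) (- v)) u = - Sg (\<lambda>s. Sg (F s) (- v)) (- u)"
        using Sg_reflect[of "\<lambda>s. Sg (F s) (- v)" "- u"] by simp
      show ?thesis unfolding 2 3 using Fe[of "- u" "- v"] by (simp add: G_def h_def)
    qed
    have "F u v - G u v = 0"
    proof (rule Goursat_unique[where F = "\<lambda>u v. F u v - G u v" and m = "2 * m"])
      show "jcont (\<lambda>u v. F u v - G u v)" by (intro continuous_on_diff jF jG)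
      show "cmod (F s t - G s t) \<le> 2 * m * exp (2 * (\<bar>s\<bar> + \<bar>t\<bar>))" for s t
        using norm_triangle_ineq4[of "F s t" "G s t"] Fb[of s t] Fb[of "- s" "- t"] by (simp add: G_def)
      show "F u v - G u v = Sg (\<lambda>s. Sg (\<lambda>t. F s t - G s t) v) u" for u v
        using Fe[of u v] Ge[of u v]
        by (simp add: Sg_minus_fun[OF jcont_sections(1)[OF jF] jcont_sections(1)[OF jG]] Sg_minus_fun[OF cS cG])
    qed
    then show ?thesis by (simp add: G_def)
  qed
  have S0: "(LINT s:{0..0}|lborel. q s) = 0" for q :: "real \<Rightarrow> complex"
    unfolding set_lebesgue_integral_def
    by (rule integral_eq_zero_AE) (use AE_lborel_singleton[of 0] in \<open>auto elim!: eventually_mono\<close>)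
  show ?thesis
  proof (rule that[OF rF even])
    show "F u 0 = c + (LINT s:{0..\<bar>u\<bar>}|lborel. gd s)" for u
      using Fe[of u 0] by (simp add: h_def Sg_def[of "\<lambda>_. 0"] S0[simplified])
    show "F 0 v = c + (LINT s:{0..\<bar>v\<bar>}|lborel. pd s)" for v
      using Fe[of 0 v] by (simp add: h_def S0[simplified])
  qed
qed

subsection \<open>Difference quotients on the diagonal\<close>

lemma L2_scale:
  assumes "L2 f" "c \<noteq> 0"
  shows "L2 (\<lambda>x. f (c * x))"
proof -
  have [measurable]: "f \<in> borel_measurable borel" by (rule L2_measurable[OF assms(1)])
  show ?thesis
    using lborel_integrable_real_affine[OF L2_integrable[OF assms(1)] assms(2), of 0] by (simp add: L2_def)
qed

lemma nn_integral_scale: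
  fixes f :: "real \<Rightarrow> ennreal"
  assumes "f \<in> borel_measurable borel"
  shows "(\<integral>\<^sup>+x. f x \<partial>lborel) = 2 * (\<integral>\<^sup>+w. f (2 * w) \<partial>lborel)"
  using nn_integral_real_affine[OF assms, of 2 0] by simp

lemma set_integral_scale:
  fixes f :: "real \<Rightarrow> complex"
  shows "(LINT s:{2 * x..2 * y}|lborel. f s) = 2 * (LINT s:{x..y}|lborel. f (2 * s))"
proof -
  have "(LINT s:{2 * x..2 * y}|lborel. f s) = \<bar>2\<bar> *\<^sub>R (LINT s|lborel. indicator {2 * x..2 * y} (0 + 2 * s) *\<^sub>R f (0 + 2 * s))"
    unfolding set_lebesgue_integral_def by (rule lborel_integral_real_affine) simp
  also have "(LINT s|lborel. indicator {2 * x..2 * y} (0 + 2 * s) *\<^sub>R f (0 + 2 * s)) = (LINT s:{x..y}|lborel. f (2 * s))"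
    unfolding set_lebesgue_integral_def by (intro Bochner_Integration.integral_cong refl) (auto split: split_indicator)
  finally show ?thesis by (simp add: scaleR_conv_of_real)
qed

lemma L2_AE_cong:
  assumes "L2 f" "g \<in> borel_measurable borel" "AE x in lborel. g x = f x"
  shows "L2 g"
proof -
  have [measurable]: "f \<in> borel_measurable borel" by (rule L2_measurable[OF assms(1)])
  note [measurable] = assms(2)
  have "integrable lborel (\<lambda>x. (cmod (g x))\<^sup>2) \<longleftrightarrow> integrable lborel (\<lambda>x. (cmod (f x))\<^sup>2)"
    by (rule integrable_cong_AE) (use assms(3) in \<open>auto elim!: eventually_mono\<close>)
  then show ?thesis using assms by (simp add: L2_def)
qed

lemma nsq_zero_AE:
  assumes "L2 f" "nsq f = 0"
  shows "AE x in lborel. f x = 0"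
proof -
  have "AE x in lborel. (cmod (f x))\<^sup>2 = 0"
    using integral_nonneg_eq_0_iff_AE[OF L2_integrable[OF assms(1)]] assms(2) by (simp add: nsq_def)
  then show ?thesis by simp
qed

lemma L2_window_left:
  assumes "L2 f" "0 < k"
  shows "L2 (\<lambda>w. LINT s:{w-k..w}|lborel. f s)"
  using L2_translate(1)[OF L2_window(1)[OF assms], of "- k"] by simp

lemma L2_average_difference:
  assumes X: "L2 X" and Y: "L2 Y"
  shows "((\<lambda>k. nsq (\<lambda>w. cor (1 / k) * ((LINT s:{w..w+k}|lborel. Y s) - (LINT s:{w-k..w}|lborel. X s)) - (Y w - X w))) \<longlongrightarrow> 0) (at_right 0)"
proof (rule tendsto_sandwich[OF _ _ tendsto_const])
  let ?A = "\<lambda>k w. cor (1 / k) * (LINT s:{w..w+k}|lborel. Y s) - Y w"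
  let ?B = "\<lambda>k w. cor (1 / k) * (LINT s:{w-k..w}|lborel. X s) - X w"
  show "\<forall>\<^sub>F k in at_right 0. nsq (\<lambda>w. cor (1 / k) * ((LINT s:{w..w+k}|lborel. Y s) - (LINT s:{w-k..w}|lborel. X s)) - (Y w - X w)) \<le> 2 * nsq (?A k) + 2 * nsq (?B k)"
    using eventually_at_right_less[of 0]
  proof eventually_elim
    case (elim k)
    have "L2 (?A k)" "L2 (?B k)"
      by (intro L2_diff(1) L2_cmul(1) L2_window(1) L2_window_left X Y elim)+
    from L2_diff(2)[OF this] show ?case by (simp add: algebra_simps)
  qed
  show "((\<lambda>k. 2 * nsq (?A k) + 2 * nsq (?B k)) \<longlongrightarrow> 0) (at_right 0)"
    by (rule tendsto_eq_rhs[OF tendsto_add[OF tendsto_mult[OF tendsto_const L2_average[OF Y]] tendsto_mult[OF tendsto_const L2_average_left[OF X]]]]) simp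
qed (simp add: nsq_nonneg)

text \<open>For \<open>c < b\<close> and \<open>k < b - c\<close> the averages over
  \<open>[w, w + k]\<close> vanish for \<open>w\<close> in \<open>[a, c]\<close>, and by
  \<open>L2_average\<close> they tend to \<open>f\<close>. The intervals
  \<open>[a, b - 1 / (n + 1)]\<close> exhaust \<open>[a, b)\<close>.\<close>

lemma zero_AE_if_integral_zero:
  assumes f: "L2 f" and z: "\<And>u v. a \<le> u \<Longrightarrow> u \<le> v \<Longrightarrow> v \<le> b \<Longrightarrow> (LINT s:{u..v}|lborel. f s) = 0"
  shows "AE w in lborel. a \<le> w \<and> w < b \<longrightarrow> f w = 0"
proof -
  have c: "AE w in lborel. indicator {a..c} w * f w = 0" if "c < b" for c
  proof -
    let ?A = "\<lambda>k w. cor (1 / k) * (LINT s:{w..w+k}|lborel. f s) - f w"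
    have L: "L2 (\<lambda>w. indicator {a..c} w * f w)" by (rule L2_restrict(1)[OF f]) simp
    have pos: "0 < b - c" using that by simp
    have "\<forall>\<^sub>F k in at_right 0. nsq (\<lambda>w. indicator {a..c} w * f w) \<le> nsq (?A k)"
      using eventually_at_right_real[OF pos]
    proof eventually_elim
      case k: (elim k)
      have LA: "L2 (?A k)" by (intro L2_diff(1) L2_cmul(1) L2_window(1) f) (use k in auto)
      show ?case
      proof (rule L2_bound(2)[OF L2_measurable[OF L] LA])
        fix w show "cmod (indicator {a..c} w * f w) \<le> cmod (?A k w)"
          using z[of w "w + k"] k by (cases "w \<in> {a..c}") auto
      qed
    qed
    then have "nsq (\<lambda>w. indicator {a..c} w * f w) \<le> 0"
      by (intro tendsto_le[OF _ L2_average[OF f] tendsto_const]) auto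
    then have "nsq (\<lambda>w. indicator {a..c} w * f w) = 0" using nsq_nonneg by (rule antisym)
    from nsq_zero_AE[OF L this] show ?thesis .
  qed
  have "AE w in lborel. \<forall>n::nat. indicator {a..b - 1 / real (Suc n)} w * f w = 0"
    unfolding AE_all_countable by (intro allI c) simp
  then show ?thesis
  proof eventually_elim
    case (elim w)
    show ?case
    proof
      assume w: "a \<le> w \<and> w < b"
      then obtain n where "inverse (real (Suc n)) < b - w" using reals_Archimedean[of "b - w"] by auto
      then have "w \<in> {a..b - 1 / real (Suc n)}" using w by (simp add: inverse_eq_divide del: of_nat_Suc)
      then show "f w = 0" using spec[OF elim, of n] by (simp del: of_nat_Suc)
    qed
  qed
qed

lemma tri_le:
  assumes F: "jcont F" and uv: "u \<le> v" and M: "0 \<le> M" "\<And>s t. u \<le> s \<Longrightarrow> s \<le> t \<Longrightarrow> t \<le> v \<Longrightarrow> cmod (F s t) \<le> M"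
  shows "cmod (tri F u v) \<le> (v - u)\<^sup>2 * M"
proof -
  have c: "continuous_on {u..v} (\<lambda>t. integral {u..t} (\<lambda>s. F s t))"
  proof (rule continuous_on_eq)
    show "continuous_on {u..v} (\<lambda>t. Sg (\<lambda>s. F s t) t - Sg (\<lambda>s. F s t) u)"
      by (intro continuous_on_diff; rule jcont_compose[OF Sg_jcont(2)[OF F]]; intro continuous_intros)
  qed (simp add: tri_inner[OF F])
  have "cmod (tri F u v) \<le> (M * (v - u)) * (v - u)"
    unfolding tri_def
  proof (rule integral_bound[OF uv c])
    fix t assume t: "t \<in> {u..v}"
    have "cmod (integral {u..t} (\<lambda>s. F s t)) \<le> M * (t - u)"
      by (rule integral_bound[OF _ jcont_sections(2)[OF F]]) (use t M in auto)
    also have "\<dots> \<le> M * (v - u)" using t M(1) by (intro mult_left_mono) auto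
    finally show "cmod (integral {u..t} (\<lambda>s. F s t)) \<le> M * (v - u)" .
  qed
  then show ?thesis by (simp add: power2_eq_square mult_ac)
qed

text \<open>What the two d'Alembert formulas say about an interval \<open>I\<close> of the diagonal.
  It is used with \<open>I = UNIV\<close> for the constructed solution and with
  \<open>I = {0..b}\<close> for an arbitrary one, whose derivatives are then cut off
  outside.\<close>

locale diagonal_data =
  fixes F :: "real \<Rightarrow> real \<Rightarrow> complex" and X Y :: "real \<Rightarrow> complex" and I :: "real set"
  assumes F: "jcont F" and LX: "L2 X" and LY: "L2 Y"
    and diag: "\<And>u v. {u..v} \<subseteq> I \<Longrightarrow> u \<le> v \<Longrightarrow> F v v - F u u = (LINT s:{u..v}|lborel. X s) + (LINT s:{u..v}|lborel. Y s)"
    and dal: "\<And>u v. {u..v} \<subseteq> I \<Longrightarrow> u \<le> v \<Longrightarrow> F u v = F u u + (LINT s:{u..v}|lborel. Y s) - tri F u v"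
begin

text \<open>In terms of \<phi> the point \<open>(w - k, w + k)\<close> lies at time
  \<open>2 * k\<close> over the position \<open>2 * w\<close>, so this is a time increment.
  Subtracting the diagonal increment from \<open>w - k\<close> to \<open>w\<close> leaves
  \<open>Y\<close> ahead of \<open>w\<close> and \<open>X\<close> behind it.\<close>

lemma increment:
  assumes I: "{w-k..w+k} \<subseteq> I" and k: "0 < k"
  shows "F (w - k) (w + k) - F w w = (LINT s:{w..w+k}|lborel. Y s) - (LINT s:{w-k..w}|lborel. X s) - tri F (w - k) (w + k)"
proof -
  have "{w-k..w} \<subseteq> I" using k by (intro subset_trans[OF _ I]) auto
  then show ?thesis
    using dal[OF I] diag[of "w - k" w] set_integral_split_Icc[OF L2_set_integrable[OF LY], of "w - k" w "w + k"] k by (simp add: algebra_simps)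
qed

text \<open>A global L2 estimate needs a bound that is square integrable in \<open>w\<close>, which
  a supremum over the plane does not give. The maximum of the modulus of \<open>F\<close> over the
  triangle is bounded by diagonal quantities plus a \<open>tri\<close> term, and the latter is
  absorbed because \<open>(v - u)\<^sup>2 \<le> 1 / 4\<close>.\<close>

lemma tri_small:
  assumes I: "{u..v} \<subseteq> I" and w: "u \<le> w" "w \<le> v" and uv: "v - u \<le> 1 / 2"
  shows "cmod (tri F u v) \<le> (v - u)\<^sup>2 * (2 * cmod (F w w) + 4 * (LINT s:{u..v}|lborel. cmod (X s) + cmod (Y s)))"
proof -
  define J where "J = (LINT s:{u..v}|lborel. cmod (X s) + cmod (Y s))"
  have iN: "set_integrable lborel {a..b} (\<lambda>s. cmod (X s) + cmod (Y s))" for a b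
    by (intro set_integral_add(1) set_integrable_norm L2_set_integrable LX LY)
  have sub: "cmod (LINT s:{a..b}|lborel. X s) + cmod (LINT s:{a..b}|lborel. Y s) \<le> J" if "u \<le> a" "b \<le> v" for a b
  proof -
    have "cmod (LINT s:{a..b}|lborel. X s) + cmod (LINT s:{a..b}|lborel. Y s) \<le> (LINT s:{a..b}|lborel. cmod (X s)) + (LINT s:{a..b}|lborel. cmod (Y s))"
      by (intro add_mono set_integral_norm_bound L2_set_integrable LX LY)
    also have "\<dots> = (LINT s:{a..b}|lborel. cmod (X s) + cmod (Y s))"
      by (intro set_integral_add(2)[symmetric] set_integrable_norm L2_set_integrable LX LY)
    also have "\<dots> \<le> J"
      unfolding J_def set_lebesgue_integral_def
      using iN[of a b] iN[of u v] that unfolding set_integrable_def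
      by (intro integral_mono) (auto split: split_indicator)
    finally show ?thesis .
  qed
  have J0: "0 \<le> J" using order_trans[OF add_nonneg_nonneg[OF norm_ge_zero norm_ge_zero] sub[of u v]] by simp
  have dF: "cmod (F s s) \<le> cmod (F w w) + J" if s: "u \<le> s" "s \<le> v" for s
  proof -
    have le: "cmod ((LINT r:{a..b}|lborel. X r) + (LINT r:{a..b}|lborel. Y r)) \<le> J" if "u \<le> a" "b \<le> v" for a b
      by (rule order_trans[OF norm_triangle_ineq sub[OF that]])
    show ?thesis
    proof (cases "s \<le> w")
      case True
      then have "{s..w} \<subseteq> I" using s w by (intro subset_trans[OF _ I]) auto
      from diag[OF this True] have "F s s = F w w - ((LINT r:{s..w}|lborel. X r) + (LINT r:{s..w}|lborel. Y r))" by (simp add: algebra_simps)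
      then show ?thesis using norm_triangle_ineq4[of "F w w" "(LINT r:{s..w}|lborel. X r) + (LINT r:{s..w}|lborel. Y r)"] le[of s w] s w by simp
    next
      case False
      then have "{w..s} \<subseteq> I" using s w by (intro subset_trans[OF _ I]) auto
      from diag[OF this] False have "F s s = F w w + ((LINT r:{w..s}|lborel. X r) + (LINT r:{w..s}|lborel. Y r))" by (simp add: algebra_simps)
      then show ?thesis using norm_triangle_ineq[of "F w w" "(LINT r:{w..s}|lborel. X r) + (LINT r:{w..s}|lborel. Y r)"] le[of w s] s w by simp
    qed
  qed
  define D where "D = ({u..v} \<times> {u..v}) \<inter> {z. fst z \<le> snd z}"
  have "compact D" unfolding D_def
    by (intro compact_Int_closed compact_Times compact_Icc closed_Collect_le continuous_intros)
  moreover have "(w, w) \<in> D" using w by (simp add: D_def)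
  moreover have "continuous_on D (\<lambda>z. cmod (F (fst z) (snd z)))" by (intro continuous_intros jcont_compose[OF F])
  ultimately obtain z where z: "z \<in> D" "\<And>y. y \<in> D \<Longrightarrow> cmod (F (fst y) (snd y)) \<le> cmod (F (fst z) (snd z))"
    using continuous_attains_sup[of D] by blast
  define m where "m = cmod (F (fst z) (snd z))"
  have m: "cmod (F s t) \<le> m" if "u \<le> s" "s \<le> t" "t \<le> v" for s t
    using z(2)[of "(s, t)"] that by (simp add: D_def m_def)
  obtain s t where st: "z = (s, t)" by fastforce
  then have s: "u \<le> s" "s \<le> t" "t \<le> v" using z(1) by (auto simp: D_def)
  have "{s..t} \<subseteq> I" using s by (intro subset_trans[OF _ I]) auto
  from dal[OF this s(2)] have "m \<le> cmod (F s s) + cmod (LINT r:{s..t}|lborel. Y r) + cmod (tri F s t)"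
    using norm_triangle_ineq4[of "F s s + (LINT r:{s..t}|lborel. Y r)" "tri F s t"] norm_triangle_ineq[of "F s s" "LINT r:{s..t}|lborel. Y r"]
    by (simp add: m_def st)
  also have "cmod (tri F s t) \<le> (t - s)\<^sup>2 * m"
    by (rule tri_le[OF F s(2)]) (use m s in \<open>auto simp: m_def\<close>)
  also have "(t - s)\<^sup>2 * m \<le> (1 / 2)\<^sup>2 * m" using s uv by (intro mult_right_mono power_mono) (auto simp: m_def)
  also have "(1 / 2)\<^sup>2 * m \<le> m / 2" by (simp add: power2_eq_square m_def)
  finally have "m \<le> 2 * cmod (F s s) + 2 * cmod (LINT r:{s..t}|lborel. Y r)" by simp
  also have "\<dots> \<le> 2 * (cmod (F w w) + J) + 2 * J"
    using order_trans[OF le_add_same_cancel2[THEN iffD2, OF norm_ge_zero] sub[OF s(1,3)]] dF[of s] s by (intro add_mono mult_left_mono) auto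
  finally have mle: "m \<le> 2 * cmod (F w w) + 4 * J" by simp
  have "cmod (tri F u v) \<le> (v - u)\<^sup>2 * (2 * cmod (F w w) + 4 * J)"
    by (rule tri_le[OF F]) (use w J0 order_trans[OF m mle] in auto)
  then show ?thesis by (simp add: J_def)
qed

lemma remainder_measurable:
  assumes "0 < k"
  shows "(\<lambda>w. (LINT s:{w..w+k}|lborel. Y s) - (LINT s:{w-k..w}|lborel. X s) - (F (w - k) (w + k) - F w w)) \<in> borel_measurable borel"
proof -
  have "(\<lambda>w. F (w - k) (w + k)) \<in> borel_measurable borel" "(\<lambda>w. F w w) \<in> borel_measurable borel"
    by (intro borel_measurable_continuous_onI jcont_compose[OF F] continuous_intros)+
  moreover have "(\<lambda>w. LINT s:{w..w+k}|lborel. Y s) \<in> borel_measurable borel" "(\<lambda>w. LINT s:{w-k..w}|lborel. X s) \<in> borel_measurable borel"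
    by (intro L2_measurable L2_window(1) L2_window_left LX LY assms)+
  ultimately show ?thesis by simp
qed

abbreviation (input) "avg k w \<equiv> cor (1 / k) * ((LINT s:{w..w+k}|lborel. Y s) - (LINT s:{w-k..w}|lborel. X s)) - (Y w - X w)"
abbreviation (input) "quot k w \<equiv> cor (1 / k) * (F (w - k) (w + k) - F w w) - (Y w - X w)"
abbreviation (input) "rest k w \<equiv> (LINT s:{w..w+k}|lborel. Y s) - (LINT s:{w-k..w}|lborel. X s) - (F (w - k) (w + k) - F w w)"

lemma avg_L2: "0 < k \<Longrightarrow> L2 (\<lambda>w. avg k w)"
  by (intro L2_diff(1) L2_cmul(1) L2_window(1) L2_window_left LX LY)

text \<open>Near a bounded interval \<open>F\<close> has a bound \<open>M\<close>, so after division
  by \<open>k\<close> the triangle contributes at most \<open>4 * k * M\<close>; the rest is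
  \<open>L2_average_difference\<close>.\<close>

lemma quotient_local:
  assumes I: "{a - r..b + r} \<subseteq> I" and r: "0 < r" and ab: "a \<le> b"
  shows "((\<lambda>k. nsq (\<lambda>w. indicator {a..b} w * quot k w)) \<longlongrightarrow> 0) (at_right 0)"
proof -
  obtain M where M: "0 \<le> M" "\<And>s t. a - r \<le> s \<Longrightarrow> s \<le> b + r \<Longrightarrow> a - r \<le> t \<Longrightarrow> t \<le> b + r \<Longrightarrow> cmod (F s t) \<le> M"
    using jcont_bounded[OF F] by blast
  have le: "\<forall>\<^sub>F k in at_right 0. nsq (\<lambda>w. indicator {a..b} w * quot k w) \<le> 2 * nsq (\<lambda>w. avg k w) + 2 * ((4 * k * M)\<^sup>2 * (b - a))"
    using eventually_at_right_real[OF r]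
  proof eventually_elim
    case (elim k)
    then have k: "0 < k" "k < r" by auto
    have Lr: "L2 (\<lambda>w. cor (4 * k * M) * indicator {a..b} w)" by (intro L2_cmul(1) L2_indicator)
    note [measurable] = remainder_measurable[OF k(1)]
    have m: "(\<lambda>w. indicator {a..b} w * (cor (1 / k) * rest k w)) \<in> borel_measurable borel"
      by (intro borel_measurable_times remainder_measurable[OF k(1)] borel_measurable_const borel_measurable_indicator) simp
    have b: "cmod (indicator {a..b} w * (cor (1 / k) * rest k w)) \<le> cmod (cor (4 * k * M) * indicator {a..b} w)" for w
    proof (cases "w \<in> {a..b}")
      case True
      have "rest k w = tri F (w - k) (w + k)"
        using increment[of w k] True k I by (simp add: subset_trans[OF _ I])
      moreover have "cmod (tri F (w - k) (w + k)) \<le> (w + k - (w - k))\<^sup>2 * M"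
        by (rule tri_le[OF F]) (use True k M in auto)
      ultimately have "cmod (rest k w) \<le> 4 * k * M * k" by (simp add: power2_eq_square mult_ac)
      then have "cmod (rest k w) / k \<le> 4 * k * M" using k by (simp add: divide_le_eq)
      then show ?thesis using True k M(1) by (simp add: norm_mult norm_divide)
    qed simp
    have "nsq (\<lambda>w. indicator {a..b} w * (cor (1 / k) * rest k w)) \<le> nsq (\<lambda>w. cor (4 * k * M) * indicator {a..b} w)"
      by (rule L2_bound(2)[OF m Lr b])
    also have "\<dots> = (4 * k * M)\<^sup>2 * (b - a)"
      using L2_cmul(2)[OF L2_indicator(1), of "cor (4 * k * M)" a b] L2_indicator(2)[OF ab] k M(1) by (simp add: norm_mult)
    finally have 2: "nsq (\<lambda>w. indicator {a..b} w * (cor (1 / k) * rest k w)) \<le> (4 * k * M)\<^sup>2 * (b - a)" .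
    have 1: "nsq (\<lambda>w. indicator {a..b} w * avg k w) \<le> nsq (\<lambda>w. avg k w)"
      by (rule L2_restrict(2)[OF avg_L2[OF k(1)]]) simp
    have e: "indicator {a..b} w * quot k w = indicator {a..b} w * avg k w - indicator {a..b} w * (cor (1 / k) * rest k w)" for w
      by (simp add: algebra_simps)
    have "nsq (\<lambda>w. indicator {a..b} w * quot k w) \<le> 2 * nsq (\<lambda>w. indicator {a..b} w * avg k w) + 2 * nsq (\<lambda>w. indicator {a..b} w * (cor (1 / k) * rest k w))"
      unfolding e by (intro L2_diff(2) L2_restrict(1) avg_L2[OF k(1)] L2_bound(1)[OF m Lr b]) simp
    with 1 2 show ?case by linarith
  qed
  have "((\<lambda>k. 2 * nsq (\<lambda>w. avg k w) + 2 * ((4 * k * M)\<^sup>2 * (b - a))) \<longlongrightarrow> 2 * 0 + 2 * ((4 * 0 * M)\<^sup>2 * (b - a))) (at_right 0)"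
    by (intro tendsto_intros L2_average_difference LX LY)
  then have lim: "((\<lambda>k. 2 * nsq (\<lambda>w. avg k w) + 2 * ((4 * k * M)\<^sup>2 * (b - a))) \<longlongrightarrow> 0) (at_right 0)" by simp
  show ?thesis by (rule tendsto_sandwich[OF _ le tendsto_const lim]) (simp add: nsq_nonneg)
qed

text \<open>Here the triangle is controlled by \<open>tri_small\<close>: after division by
  \<open>k\<close> the prefactor is \<open>(2 * k)\<^sup>2 / k = 4 * k\<close>, and it multiplies
  functions of \<open>w\<close> whose norms stay bounded by \<open>L2_window\<close>. The bound
  \<open>k \<le> 1 / 4\<close> makes the side \<open>2 * k\<close> admissible there.\<close>

lemma quotient_global:
  assumes I: "I = UNIV" and D: "L2 (\<lambda>w. F w w)"
  shows "0 < k \<Longrightarrow> k \<le> 1 / 4 \<Longrightarrow> L2 (\<lambda>w. quot k w)" "((\<lambda>k. nsq (\<lambda>w. quot k w)) \<longlongrightarrow> 0) (at_right 0)"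
proof -
  define N where "N s = cor (cmod (X s) + cmod (Y s))" for s
  have LN: "L2 N"
  proof -
    have m: "(\<lambda>s. cor (cmod (Z s))) \<in> borel_measurable borel" if "L2 Z" for Z
      using L2_measurable[OF that] by measurable
    have "L2 (\<lambda>s. cor (cmod (X s)) + cor (cmod (Y s)))"
      by (intro L2_add(1) L2_bound(1)[OF m LX] L2_bound(1)[OF m LY] LX LY) auto
    then show ?thesis by (simp add: N_def[abs_def])
  qed
  have mD: "L2 (\<lambda>w. cor (cmod (F w w)))"
    using L2_measurable[OF D] by (intro L2_bound(1)[OF _ D]) auto
  define G where "G k w = cor (4 * k) * (2 * cor (cmod (F w w)) + 4 * (LINT s:{w-k..w+k}|lborel. N s))" for k w
  have win: "L2 (\<lambda>w. LINT s:{w-k..w+k}|lborel. N s)" "nsq (\<lambda>w. LINT s:{w-k..w+k}|lborel. N s) \<le> (2 * k)\<^sup>2 * nsq N" if "0 < k" for k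
    using L2_translate[OF L2_window(1)[OF LN, of "2 * k"], of "- k"] L2_window(2)[OF LN, of "2 * k"] that
    by (simp_all add: algebra_simps)
  have LG: "L2 (G k)" "nsq (G k) \<le> (4 * k)\<^sup>2 * (2 * (4 * nsq (\<lambda>w. cor (cmod (F w w)))) + 2 * (16 * ((2 * k)\<^sup>2 * nsq N)))" if k: "0 < k" for k
  proof -
    let ?a = "\<lambda>w. 2 * cor (cmod (F w w))" and ?b = "\<lambda>w. 4 * (LINT s:{w-k..w+k}|lborel. N s)"
    have L: "L2 ?a" "L2 ?b" by (intro L2_cmul(1) mD win(1)[OF k])+
    show "L2 (G k)" unfolding G_def[abs_def] by (intro L2_cmul(1) L2_add(1) L)
    have "nsq (G k) = (4 * k)\<^sup>2 * nsq (\<lambda>w. ?a w + ?b w)"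
      unfolding G_def[abs_def] L2_cmul(2)[OF L2_add(1)[OF L]] by (simp add: norm_mult power_mult_distrib)
    also have "nsq (\<lambda>w. ?a w + ?b w) \<le> 2 * nsq ?a + 2 * nsq ?b" by (rule L2_add(2)[OF L])
    also have "nsq ?a = 4 * nsq (\<lambda>w. cor (cmod (F w w)))" by (simp only: L2_cmul(2)[OF mD]) simp
    also have "nsq ?b = 16 * nsq (\<lambda>w. LINT s:{w-k..w+k}|lborel. N s)" by (simp only: L2_cmul(2)[OF win(1)[OF k]]) simp
    also have "nsq (\<lambda>w. LINT s:{w-k..w+k}|lborel. N s) \<le> (2 * k)\<^sup>2 * nsq N" by (rule win(2)[OF k])
    finally show "nsq (G k) \<le> (4 * k)\<^sup>2 * (2 * (4 * nsq (\<lambda>w. cor (cmod (F w w)))) + 2 * (16 * ((2 * k)\<^sup>2 * nsq N)))"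
      by (simp add: mult_left_mono)
  qed
  have b: "cmod (cor (1 / k) * rest k w) \<le> cmod (G k w)" if k: "0 < k" "k \<le> 1 / 4" for k w
  proof -
    define J where "J = (LINT s:{w-k..w+k}|lborel. cmod (X s) + cmod (Y s))"
    have J: "(LINT s:{w-k..w+k}|lborel. N s) = cor J"
      unfolding N_def J_def by (rule set_integral_complex_of_real)
    have J0: "0 \<le> J" unfolding J_def set_lebesgue_integral_def by (intro integral_nonneg_AE) auto
    have "rest k w = tri F (w - k) (w + k)" using increment[of w k] k I by simp
    then have "cmod (rest k w) \<le> (w + k - (w - k))\<^sup>2 * (2 * cmod (F w w) + 4 * J)"
      using tri_small[of "w - k" "w + k" w] k I by (simp add: J_def)
    then have "cmod (rest k w) \<le> 4 * k * (2 * cmod (F w w) + 4 * J) * k" by (simp add: power2_eq_square mult_ac)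
    then have "cmod (rest k w) / k \<le> 4 * k * (2 * cmod (F w w) + 4 * J)" using k by (simp add: divide_le_eq)
    moreover have "cmod (G k w) = 4 * k * (2 * cmod (F w w) + 4 * J)"
    proof -
      have "G k w = cor (4 * k * (2 * cmod (F w w) + 4 * J))" by (simp add: G_def J)
      then show ?thesis using k J0 by (simp only: norm_of_real) simp
    qed
    ultimately show ?thesis using k by (simp add: norm_mult norm_divide)
  qed
  have m: "(\<lambda>w. cor (1 / k) * rest k w) \<in> borel_measurable borel" if "0 < k" for k
    by (intro borel_measurable_times remainder_measurable[OF that] borel_measurable_const)
  have e: "quot k w = avg k w - cor (1 / k) * rest k w" for k w by (simp add: algebra_simps)
  show "L2 (\<lambda>w. quot k w)" if "0 < k" "k \<le> 1 / 4" for k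
    unfolding e by (intro L2_diff(1) avg_L2 L2_bound(1)[OF m LG(1) b] that)
  show "((\<lambda>k. nsq (\<lambda>w. quot k w)) \<longlongrightarrow> 0) (at_right 0)"
  proof (rule tendsto_sandwich[OF _ _ tendsto_const])
    let ?R = "\<lambda>k. (4 * k)\<^sup>2 * (2 * (4 * nsq (\<lambda>w. cor (cmod (F w w)))) + 2 * (16 * ((2 * k)\<^sup>2 * nsq N)))"
    have "0 < (1 / 4 :: real)" by simp
    from eventually_at_right_real[OF this]
    show "\<forall>\<^sub>F k in at_right 0. nsq (\<lambda>w. quot k w) \<le> 2 * nsq (\<lambda>w. avg k w) + 2 * ?R k"
    proof eventually_elim
      case (elim k)
      then have k: "0 < k" "k \<le> 1 / 4" by auto
      have "nsq (\<lambda>w. quot k w) \<le> 2 * nsq (\<lambda>w. avg k w) + 2 * nsq (\<lambda>w. cor (1 / k) * rest k w)"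
        unfolding e by (rule L2_diff(2)[OF avg_L2[OF k(1)] L2_bound(1)[OF m[OF k(1)] LG(1)[OF k(1)] b[OF k]]])
      then show ?case using L2_bound(2)[OF m[OF k(1)] LG(1)[OF k(1)] b[OF k]] LG(2)[OF k(1)] by linarith
    qed
    have "((\<lambda>k. 2 * nsq (\<lambda>w. avg k w) + 2 * ?R k) \<longlongrightarrow> 2 * 0 + 2 * ((4 * 0)\<^sup>2 * (2 * (4 * nsq (\<lambda>w. cor (cmod (F w w)))) + 2 * (16 * ((2 * 0)\<^sup>2 * nsq N))))) (at_right 0)"
      by (intro tendsto_intros L2_average_difference LX LY)
    then show "((\<lambda>k. 2 * nsq (\<lambda>w. avg k w) + 2 * ?R k) \<longlongrightarrow> 0) (at_right 0)" by simp
  qed (simp add: nsq_nonneg)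
qed

end

lemma set_integral_Icc_same: "(LINT s:{a..a::real}|lborel. q s) = 0" for q :: "real \<Rightarrow> complex"
  unfolding set_lebesgue_integral_def
  by (rule integral_eq_zero_AE) (use AE_lborel_singleton[of a] in \<open>auto elim!: eventually_mono\<close>)

lemma set_integral_zero_fun:
  fixes q :: "real \<Rightarrow> complex"
  assumes "\<And>s. s \<in> A \<Longrightarrow> q s = 0"
  shows "(LINT s:A|lborel. q s) = 0"
proof -
  have "(\<lambda>s. indicat_real A s *\<^sub>R q s) = (\<lambda>s. 0)" using assms by (auto simp: fun_eq_iff indicator_def)
  then show ?thesis by (simp add: set_lebesgue_integral_def)
qed

text \<open>The even extension of a primitive has the odd extension of \<open>q\<close> as its
  derivative. The proof compares both with \<open>H\<close>, the primitive that vanishes on the left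
  half line.\<close>

lemma even_primitive:
  assumes q: "L2 q" "\<And>x. x \<le> 0 \<Longrightarrow> q x = 0" and uv: "u \<le> v"
  shows "(LINT s:{0..\<bar>v\<bar>}|lborel. q s) - (LINT s:{0..\<bar>u\<bar>}|lborel. q s) = (LINT s:{u..v}|lborel. q s - q (- s))"
proof -
  define H where "H x = (LINT s:{0..x}|lborel. q s)" for x
  have H0: "H x = 0" if "x \<le> 0" for x
    using that set_integral_Icc_same[of 0 q] by (cases "x = 0") (auto simp: H_def set_lebesgue_integral_def)
  have d: "(LINT s:{u..v}|lborel. q s) = H v - H u" if "u \<le> v" for u v
  proof (cases "0 \<le> u")
    case True
    then show ?thesis using set_integral_split_Icc[OF L2_set_integrable[OF q(1)], of 0 u v] that by (simp add: H_def)
  next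
    case False
    have z: "(LINT s:{u..min 0 v}|lborel. q s) = 0" by (rule set_integral_zero_fun) (use q(2) in auto)
    show ?thesis
    proof (cases "0 \<le> v")
      case True
      then show ?thesis using set_integral_split_Icc[OF L2_set_integrable[OF q(1)], of u 0 v] False z H0[of u] by (simp add: H_def)
    next
      case v: False
      then show ?thesis using z H0[of u] H0[of v] that by simp
    qed
  qed
  have a: "(LINT s:{0..\<bar>x\<bar>}|lborel. q s) = H x + H (- x)" for x
    using H0[of x] H0[of "- x"] by (cases "0 \<le> x") (auto simp: H_def)
  have "(LINT s:{u..v}|lborel. q s - q (- s)) = (LINT s:{u..v}|lborel. q s) - (LINT s:{u..v}|lborel. q (- s))"
    by (intro set_integral_diff(2) L2_set_integrable q(1) L2_reflect(1))
  also have "\<dots> = (H v - H u) - (H (- u) - H (- v))"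
    using uv by (simp add: set_integral_reflect_interval d)
  finally show ?thesis by (simp add: a)
qed

lemma diagonal_data_rect:
  assumes F: "rect F" and "L2 X" "L2 Y" and g: "L2 gd" and p: "L2 pd"
    and gd: "\<And>u v. u \<le> v \<Longrightarrow> F v 0 - F u 0 = (LINT s:{u..v}|lborel. gd s)"
    and pd: "\<And>u v. u \<le> v \<Longrightarrow> F 0 v - F 0 u = (LINT s:{u..v}|lborel. pd s)"
    and X: "\<And>w. X w = gd w + Sg (\<lambda>t. F w t) w" and Y: "\<And>w. Y w = pd w + Sg (\<lambda>s. F s w) w"
  shows "diagonal_data F X Y UNIV"
proof
  fix u v :: real assume uv: "u \<le> v"
  show "F v v - F u u = (LINT s:{u..v}|lborel. X s) + (LINT s:{u..v}|lborel. Y s)"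
    unfolding X Y by (rule diagonal_derivative[OF F uv L2_set_integrable[OF g] gd[OF uv] L2_set_integrable[OF p] pd[OF uv]])
  show "F u v = F u u + (LINT s:{u..v}|lborel. Y s) - tri F u v"
    unfolding Y by (rule dAlembert(2)[OF F uv L2_set_integrable[OF p] pd[OF uv]])
qed (use assms rect_jcont in auto)

lemma nn_integral_diagonal:
  assumes q: "L2 q" and r: "\<And>x. cmod (r x) = cmod (q (x / 2)) / 2"
  shows "(\<integral>\<^sup>+x. ennreal ((cmod (r x))\<^sup>2) \<partial>lborel) = ennreal (nsq q / 2)"
proof -
  note [measurable] = L2_measurable[OF q]
  have "(\<integral>\<^sup>+x. ennreal ((cmod (r x))\<^sup>2) \<partial>lborel) = (\<integral>\<^sup>+x. ennreal ((cmod (q (x / 2)) / 2)\<^sup>2) \<partial>lborel)"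
    by (simp only: r)
  also have "\<dots> = 2 * (\<integral>\<^sup>+w. ennreal ((cmod (q (2 * w / 2)) / 2)\<^sup>2) \<partial>lborel)"
    by (rule nn_integral_scale) measurable
  also have "(\<integral>\<^sup>+w. ennreal ((cmod (q (2 * w / 2)) / 2)\<^sup>2) \<partial>lborel) = (\<integral>\<^sup>+w. ennreal (1 / 4) * ennreal ((cmod (q w))\<^sup>2) \<partial>lborel)"
    by (intro nn_integral_cong) (simp add: power_divide flip: ennreal_mult')
  also have "\<dots> = ennreal (1 / 4) * ennreal (nsq q)"
    by (simp add: nn_integral_cmult nsq_nn[OF q])
  also have "2 * (ennreal (1 / 4) * ennreal (nsq q)) = ennreal (2 * (1 / 4 * nsq q))"
    by (simp only: ennreal_mult'[symmetric] ennreal_numeral[symmetric] nsq_nonneg zero_le_numeral zero_le_divide_1_iff zero_le_mult_iff)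
  finally show ?thesis by simp
qed

text \<open>A time step \<open>h\<close> at position \<open>x\<close> moves the characteristic
  coordinates \<open>x / 2\<close> by \<open>h / 2\<close> in opposite directions, so
  \<open>k = h / 2\<close>. The change of variable \<open>x = 2 * w\<close> affects the norm only by
  a constant.\<close>

lemma tendsto_quotient_half:
  assumes D: "diagonal_data F X Y UNIV" and L: "L2 (\<lambda>w. F w w)"
    and r: "\<And>h x. 0 < h \<Longrightarrow> cmod (r h x) = cmod (cor (1 / (h / 2)) * (F (x / 2 - h / 2) (x / 2 + h / 2) - F (x / 2) (x / 2)) - (Y (x / 2) - X (x / 2))) / 2"
  shows "((\<lambda>h. \<integral>\<^sup>+x. ennreal ((cmod (r h x))\<^sup>2) \<partial>lborel) \<longlongrightarrow> 0) (at_right 0)"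
proof -
  define q where "q k w = cor (1 / k) * (F (w - k) (w + k) - F w w) - (Y w - X w)" for k w
  note Q = diagonal_data.quotient_global[OF D refl L, folded q_def]
  have h2: "filterlim (\<lambda>h::real. h / 2) (at_right 0) (at_right 0)"
    unfolding filterlim_at by (auto intro!: tendsto_eq_intros simp: eventually_at_filter)
  have "((\<lambda>h. ennreal (nsq (q (h / 2)) / 2)) \<longlongrightarrow> ennreal (0 / 2)) (at_right 0)"
    by (intro tendsto_ennrealI tendsto_divide tendsto_const filterlim_compose[OF Q(2) h2]) simp
  then have l: "((\<lambda>h. ennreal (nsq (q (h / 2)) / 2)) \<longlongrightarrow> 0) (at_right 0)" by simp
  have "0 < (1 / 2 :: real)" by simp
  from eventually_at_right_real[OF this]
  have "\<forall>\<^sub>F h in at_right 0. (\<integral>\<^sup>+x. ennreal ((cmod (r h x))\<^sup>2) \<partial>lborel) = ennreal (nsq (q (h / 2)) / 2)"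
  proof eventually_elim
    case (elim h)
    then have h: "0 < h" "h / 2 \<le> 1 / 4" by auto
    show ?case
    proof (rule nn_integral_diagonal)
      show "L2 (q (h / 2))" using Q(1)[of "h / 2"] h by simp
    qed (unfold q_def, rule r[OF h(1)])
  qed
  then show ?thesis using l by (rule tendsto_cong[THEN iffD2])
qed

lemma finite_energy_from_diagonal:
  assumes F: "rect F" and D: "diagonal_data F X Y UNIV" and D': "diagonal_data (\<lambda>u v. F v u) Y X UNIV"
    and L: "L2 (\<lambda>w. F w w)"
  shows "finite_energy_solution (\<lambda>t x. F ((x - t) / 2) ((x + t) / 2))"
proof -
  interpret D: diagonal_data F X Y UNIV by (rule D)
  let ?\<phi> = "\<lambda>t x. F ((x - t) / 2) ((x + t) / 2)"
  \<comment> \<open>These are the space and the time derivative of \<phi> at time 0: their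
    difference and sum are the derivatives of \<open>F\<close> in \<open>u\<close> and
    \<open>v\<close>, that is \<open>X\<close> and \<open>Y\<close>, at
    \<open>w = x / 2\<close>.\<close>
  define d where "d x = (X (x / 2) + Y (x / 2)) / 2" for x
  define f1 where "f1 x = (Y (x / 2) - X (x / 2)) / 2" for x
  have alg: "(a - b) / cor h - (y - x) / 2 = (1 / 2) * (cor (1 / (h / 2)) * (a - b) - (y - x))"
    "(a - b) / cor (- h) - (y - x) / 2 = (- 1 / 2) * (cor (1 / (h / 2)) * (a - b) - (x - y))" for a b x y h
    by (simp_all add: right_diff_distrib diff_divide_distrib)
  have half_scale: "L2 (\<lambda>x. f (x / 2))" if "L2 f" for f using L2_scale[OF that, of "1 / 2"] by simp
  have Ld: "L2 d"
    using L2_cmul(1)[OF L2_add(1)[OF half_scale[OF D.LX] half_scale[OF D.LY]], of "1 / 2"] by (simp add: d_def[abs_def])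
  have Lf: "L2 f1"
    using L2_cmul(1)[OF L2_diff(1)[OF half_scale[OF D.LY] half_scale[OF D.LX]], of "1 / 2"] by (simp add: f1_def[abs_def])
  have fin: "f \<in> borel_measurable lborel \<and> (\<integral>\<^sup>+x. ennreal ((cmod (f x))\<^sup>2) \<partial>lborel) < \<infinity>" if "L2 f" for f
    using that L2_nn[OF L2_measurable[OF that]] L2_measurable[OF that] by simp
  have dI: "?\<phi> 0 y - ?\<phi> 0 x = (LINT s:{x..y}|lborel. d s)" if xy: "x \<le> y" for x y
  proof -
    have "(LINT s:{x..y}|lborel. d s) = (LINT s:{2 * (x / 2)..2 * (y / 2)}|lborel. d s)" by simp
    also have "\<dots> = 2 * (LINT s:{x / 2..y / 2}|lborel. d (2 * s))" by (rule set_integral_scale)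
    also have "\<dots> = 2 * (LINT s:{x / 2..y / 2}|lborel. (1 / 2) * (X s + Y s))" by (simp add: d_def)
    also have "\<dots> = (LINT s:{x / 2..y / 2}|lborel. X s + Y s)" by (subst set_integral_mult_right) simp
    also have "\<dots> = (LINT s:{x / 2..y / 2}|lborel. X s) + (LINT s:{x / 2..y / 2}|lborel. Y s)"
      by (intro set_integral_add(2) L2_set_integrable D.LX D.LY)
    also have "\<dots> = F (y / 2) (y / 2) - F (x / 2) (x / 2)" using D.diag[of "x / 2" "y / 2"] xy by simp
    finally show ?thesis by simp
  qed
  have pos: "((\<lambda>h. \<integral>\<^sup>+x. ennreal ((cmod ((?\<phi> h x - ?\<phi> 0 x) / cor h - f1 x))\<^sup>2) \<partial>lborel) \<longlongrightarrow> 0) (at_right 0)"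
  proof (rule tendsto_quotient_half[OF D L])
    fix h x :: real assume h: "0 < h"
    have "(?\<phi> h x - ?\<phi> 0 x) / cor h - f1 x
      = (1 / 2) * (cor (1 / (h / 2)) * (F (x / 2 - h / 2) (x / 2 + h / 2) - F (x / 2) (x / 2)) - (Y (x / 2) - X (x / 2)))"
    proof -
      have "?\<phi> h x = F (x / 2 - h / 2) (x / 2 + h / 2)" "?\<phi> 0 x = F (x / 2) (x / 2)" by (simp_all add: add_divide_distrib diff_divide_distrib)
      then show ?thesis unfolding f1_def by (simp only: alg(1))
    qed
    then show "cmod ((?\<phi> h x - ?\<phi> 0 x) / cor h - f1 x)
      = cmod (cor (1 / (h / 2)) * (F (x / 2 - h / 2) (x / 2 + h / 2) - F (x / 2) (x / 2)) - (Y (x / 2) - X (x / 2))) / 2"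
      by (simp only: norm_mult) simp
  qed
  \<comment> \<open>A negative time step is a positive one for the time-reversed solution, whose
    diagonal data are \<open>X\<close> and \<open>Y\<close> exchanged.\<close>
  have neg: "((\<lambda>h. \<integral>\<^sup>+x. ennreal ((cmod ((?\<phi> (- h) x - ?\<phi> 0 x) / cor (- h) - f1 x))\<^sup>2) \<partial>lborel) \<longlongrightarrow> 0) (at_right 0)"
  proof (rule tendsto_quotient_half[OF D' L])
    fix h x :: real assume h: "0 < h"
    have "(?\<phi> (- h) x - ?\<phi> 0 x) / cor (- h) - f1 x
      = (- 1 / 2) * (cor (1 / (h / 2)) * (F (x / 2 + h / 2) (x / 2 - h / 2) - F (x / 2) (x / 2)) - (X (x / 2) - Y (x / 2)))"
    proof -
      have "?\<phi> (- h) x = F (x / 2 + h / 2) (x / 2 - h / 2)" "?\<phi> 0 x = F (x / 2) (x / 2)" by (simp_all add: add_divide_distrib diff_divide_distrib)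
      then show ?thesis unfolding f1_def by (simp only: alg(2))
    qed
    then show "cmod ((?\<phi> (- h) x - ?\<phi> 0 x) / cor (- h) - f1 x)
      = cmod (cor (1 / (h / 2)) * (F (x / 2 + h / 2) (x / 2 - h / 2) - F (x / 2) (x / 2)) - (X (x / 2) - Y (x / 2))) / 2"
      by (simp only: norm_mult) simp
  qed
  have lim: "((\<lambda>h. \<integral>\<^sup>+x. ennreal ((cmod ((?\<phi> h x - ?\<phi> 0 x) / cor h - f1 x))\<^sup>2) \<partial>lborel) \<longlongrightarrow> 0) (at 0)"
    by (rule filterlim_split_at[OF _ pos]) (use neg in \<open>simp add: filterlim_at_left_to_right\<close>)
  have L0: "L2 (?\<phi> 0)" using half_scale[OF L] by simp
  show ?thesis
    unfolding finite_energy_solution_def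
  proof (intro conjI allI impI)
    show "jcont ?\<phi>" by (intro jcont_compose[OF rect_jcont[OF F]] continuous_intros) auto
    show "(LINT z|lborel. ?\<phi> (fst z) (snd z) * cor (dpart 2 0 \<psi> (fst z) (snd z) - dpart 0 2 \<psi> (fst z) (snd z) + \<psi> (fst z) (snd z))) = 0"
      if "test_fun \<psi>" for \<psi>
      using rect_imp_distributional[OF F that] by simp
    show "(\<integral>\<^sup>+x. ennreal ((cmod (?\<phi> 0 x))\<^sup>2) \<partial>lborel) < \<infinity>" using fin[OF L0] by blast
    show "\<exists>d. d \<in> borel_measurable lborel \<and> (\<integral>\<^sup>+ x. ennreal ((cmod (d x))\<^sup>2) \<partial>lborel) < \<infinity> \<and>
      (\<forall>x y. x \<le> y \<longrightarrow> set_integrable lborel {x..y} d \<and> ?\<phi> 0 y - ?\<phi> 0 x = (LINT s:{x..y}|lborel. d s))"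
      using fin[OF Ld] dI L2_set_integrable[OF Ld] by blast
    show "\<exists>f1. f1 \<in> borel_measurable lborel \<and> (\<integral>\<^sup>+ x. ennreal ((cmod (f1 x))\<^sup>2) \<partial>lborel) < \<infinity> \<and>
      ((\<lambda>h. \<integral>\<^sup>+x. ennreal ((cmod ((?\<phi> h x - ?\<phi> 0 x) / cor h - f1 x))\<^sup>2) \<partial>lborel) \<longlongrightarrow> 0) (at 0)"
      using fin[OF Lf] lim by blast
  qed
qed

text \<open>Point symmetry of \<open>F\<close> makes the integral term odd in \<open>w\<close>, like
  \<open>q w - q (- w)\<close>. Hence the diagonal derivatives on the negative half line are, up to
  sign, those on the positive one and have the same norm.\<close>

lemma odd_extension:
  assumes ev: "\<And>u v. F (- u) (- v) = F u v" and z: "\<And>x. x \<le> 0 \<Longrightarrow> q x = 0"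
  shows "q w - q (- w) + Sg (\<lambda>t. F w t) w
    = half (\<lambda>w. q w + Sg (\<lambda>t. F w t) w) w - half (\<lambda>w. q w + Sg (\<lambda>t. F w t) w) (- w)"
proof -
  consider "0 < w" | "w = 0" | "w < 0" by linarith
  then show ?thesis
  proof cases
    case 3
    have "Sg (\<lambda>t. F (- w) t) (- w) = - Sg (\<lambda>t. F w t) w"
      using Sg_reflect[of "\<lambda>t. F w t" w] ev[of w] by (metis (no_types, lifting) ev ext minus_minus)
    then show ?thesis using 3 z[of w] by (simp add: half_pos half_nonpos)
  qed (use z[of w] z[of "- w"] in \<open>auto simp: half_pos half_nonpos\<close>)
qed

lemma solution_if_hankel:
  assumes hg: "H1_halfline g g'" and hp: "H1_halfline p p'"
    and H: "hankel0_pair (\<lambda>r. cor (sqrt r) * g (r\<^sup>2 / 2)) (\<lambda>s. - cor (sqrt s) * p' (s\<^sup>2 / 2))"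
  shows "\<exists>\<phi>. finite_energy_solution \<phi> \<and> (\<forall>u>0. g u = \<phi> (- u) u) \<and> (\<forall>v>0. p v = \<phi> v v)"
proof -
  note G = H1_L2[OF hg] and P = H1_L2[OF hp]
  have Lap: "cor \<mu> * (LINT u|lborel. half g u * ex \<mu> u) = - (LINT v|lborel. half p' v * ex (1 / \<mu>) v)" if "0 < \<mu>" for \<mu> :: real
    by (rule Laplace_if_hankel[OF G(3) P(1) hankel0_pair_iff[THEN iffD1, OF L2_measurable[OF G(3)] L2_measurable[OF P(1)] H] that])
  define c where "c = bv g g'"
  \<comment> \<open>Goursat data must be continuous at the vertex. That the two traces agree is not
    assumed; the Hankel relation forces it.\<close>
  have cp: "c = bv p p'" unfolding c_def
    by (rule hankel_vertex[OF G(1) half_nonpos G(3,2) P(1) half_nonpos P(3,2) Lap])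
  obtain F where F: "rect F" "\<And>u v. F (- u) (- v) = F u v"
    and axis_u: "\<And>u. F u 0 = c + (LINT s:{0..\<bar>u\<bar>}|lborel. half g' s)" and axis_v: "\<And>v. F 0 v = c + (LINT s:{0..\<bar>v\<bar>}|lborel. half p' s)"
    using Goursat_even[OF G(1) P(1)] by blast
  have F0: "F 0 0 = c" using axis_u[of 0] set_integral_Icc_same[of 0 "half g'"] by simp
  interpret wedge F "half g'" "half p'"
    by standard (use F G P F0 axis_u axis_v in \<open>auto simp: half_nonpos\<close>)
  have compat
    unfolding compat_def
  proof (intro allI impI)
    fix \<mu> :: real assume \<mu>: "0 < \<mu>"
    have "cor \<mu> * (LINT u|lborel. half g u * ex \<mu> u) = c + (LINT u|lborel. half g' u * ex \<mu> u)"
      by (rule Laplace_derivative[OF G(1) half_nonpos G(3) _ \<mu>]) (simp_all add: c_def G(2))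
    with Lap[OF \<mu>] have "c + (LINT u|lborel. half g' u * ex \<mu> u) = - (LINT v|lborel. half p' v * ex (1 / \<mu>) v)" by (simp only:)
    then show "(LINT u|lborel. half g' u * ex \<mu> u) + (LINT v|lborel. half p' v * ex (1 / \<mu>) v) + F 0 0 = 0"
      unfolding F0 by (simp add: add.commute add.left_commute eq_neg_iff_add_eq_0)
  qed
  note E = energy[OF \<open>compat\<close>] energy_X[OF \<open>compat\<close>]
  \<comment> \<open>The derivatives of the even axis values on the whole line. With them the
    diagonal derivatives become odd reflections of \<open>Xd\<close> and \<open>Yd\<close>, whose
    norms \<open>energy\<close> has shown to be finite.\<close>
  define gh ph where "gh s = half g' s - half g' (- s)" and "ph s = half p' s - half p' (- s)" for s
  define Xh Yh where "Xh w = gh w + Sg (\<lambda>t. F w t) w" and "Yh w = ph w + Sg (\<lambda>s. F s w) w" for w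
  have Xe: "Xh w = Xd w - Xd (- w)" for w
    unfolding Xh_def gh_def Xd_def X_def[abs_def] by (rule odd_extension[where F = F and q = "half g'", OF F(2) half_nonpos])
  have Ye: "Yh w = Yd w - Yd (- w)" for w
    unfolding Yh_def ph_def Yd_def Y_def[abs_def]
    by (rule odd_extension[where F = "\<lambda>u v. F v u" and q = "half p'", OF F(2) half_nonpos])
  have LX: "L2 Xh" unfolding Xe[abs_def] by (intro L2_diff(1) L2_reflect(1) E)
  have LY: "L2 Yh" unfolding Ye[abs_def] by (intro L2_diff(1) L2_reflect(1) E)
  have Lgh: "L2 gh" unfolding gh_def[abs_def] by (intro L2_diff(1) L2_reflect(1) G)
  have Lph: "L2 ph" unfolding ph_def[abs_def] by (intro L2_diff(1) L2_reflect(1) P)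
  have gI: "F v 0 - F u 0 = (LINT s:{u..v}|lborel. gh s)" if "u \<le> v" for u v
    using even_primitive[OF G(1) half_nonpos that] by (simp add: axis_u gh_def)
  have pI: "F 0 v - F 0 u = (LINT s:{u..v}|lborel. ph s)" if "u \<le> v" for u v
    using even_primitive[OF P(1) half_nonpos that] by (simp add: axis_v ph_def)
  have D: "diagonal_data F Xh Yh UNIV"
    by (rule diagonal_data_rect[OF F(1) LX LY Lgh Lph gI pI Xh_def Yh_def])
  have D': "diagonal_data (\<lambda>u v. F v u) Yh Xh UNIV"
    by (rule diagonal_data_rect[OF rect_swap[OF F(1)] LY LX Lph Lgh pI gI Yh_def Xh_def])
  have LD: "L2 (\<lambda>w. F w w)"
  proof (rule L2_AE_cong[OF L2_add(1)[OF E(1) L2_reflect(1)[OF E(1)]]])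
    show "(\<lambda>w. F w w) \<in> borel_measurable borel" by (intro borel_measurable_continuous_onI jcont_sections[OF jF])
    show "AE w in lborel. F w w = Fd w + Fd (- w)"
      using AE_lborel_singleton[of 0]
    proof eventually_elim
      case (elim w)
      then show ?case using F(2)[of w w] by (cases "0 < w") (auto simp: Fd_def half_pos half_nonpos)
    qed
  qed
  show ?thesis
    by (rule exI[of _ "\<lambda>t x. F ((x - t) / 2) ((x + t) / 2)"])
      (use finite_energy_from_diagonal[OF F(1) D D' LD] in \<open>auto simp: axis_u axis_v G(2) P(2) c_def[symmetric] cp[symmetric]\<close>)
qed

subsection \<open>Recovering the boundary relation from a solution\<close>

lemma L2_continuous_Icc:
  assumes "continuous_on UNIV f"
  shows "L2 (\<lambda>w. indicator {a..b} w * f w)"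
proof -
  have "bounded (f ` {a..b})" by (intro compact_imp_bounded compact_continuous_image continuous_on_subset[OF assms]) auto
  then obtain M where M: "\<And>x. x \<in> {a..b} \<Longrightarrow> cmod (f x) \<le> M" unfolding bounded_iff by blast
  show ?thesis
  proof (rule L2_bound(1)[OF _ L2_cmul(1)[OF L2_indicator(1)]])
    show "(\<lambda>w. indicator {a..b} w * f w) \<in> borel_measurable borel"
      using borel_measurable_continuous_onI[OF assms] by measurable
    show "cmod (indicator {a..b} x * f x) \<le> cmod (cor \<bar>M\<bar> * indicator {a..b} x)" for x
      using M[of x] by (auto simp: norm_mult indicator_def)
  qed
qed

context wedge
begin

lemma L2_local: "L2 (\<lambda>w. indicator {a..b} w * X w)" "L2 (\<lambda>w. indicator {a..b} w * Y w)"
proof -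
  have c: "continuous_on UNIV (\<lambda>w. Sg (\<lambda>t. F w t) w)" "continuous_on UNIV (\<lambda>w. Sg (\<lambda>s. F s w) w)"
    by (rule jcont_compose[OF Sg_jcont(1)[OF jF]] jcont_compose[OF Sg_jcont(2)[OF jF]]; intro continuous_intros)+
  have "L2 (\<lambda>w. indicator {a..b} w * gd w + indicator {a..b} w * Sg (\<lambda>t. F w t) w)"
    "L2 (\<lambda>w. indicator {a..b} w * pd w + indicator {a..b} w * Sg (\<lambda>s. F s w) w)"
    by (intro L2_add(1) L2_continuous_Icc c L2_restrict(1) Lgd Lpd; simp)+
  then show "L2 (\<lambda>w. indicator {a..b} w * X w)" "L2 (\<lambda>w. indicator {a..b} w * Y w)"
    by (simp_all add: X_def Y_def distrib_left)
qed

lemma set_integral_local: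
  fixes f :: "real \<Rightarrow> complex"
  assumes "{u..v} \<subseteq> {a..b}"
  shows "(LINT s:{u..v}|lborel. indicator {a..b} s * f s) = (LINT s:{u..v}|lborel. f s)"
  by (rule set_lebesgue_integral_cong) (use assms in \<open>auto simp: indicator_def\<close>)

text \<open>The cut-off makes the derivatives square integrable on the whole line, as
  \<open>diagonal_data\<close> demands, without changing integrals over subintervals of
  \<open>[0, b]\<close>.\<close>

lemma local_data: "diagonal_data F (\<lambda>w. indicator {0..b} w * X w) (\<lambda>w. indicator {0..b} w * Y w) {0..b}"
proof
  fix u v :: real assume s: "{u..v} \<subseteq> {0..b}" and uv: "u \<le> v"
  then have u: "0 \<le> u" by auto
  show "F v v - F u u = (LINT s:{u..v}|lborel. indicator {0..b} s * X s) + (LINT s:{u..v}|lborel. indicator {0..b} s * Y s)"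
    unfolding set_integral_local[OF s] by (rule diag_eq(3)[OF u uv])
  show "F u v = F u u + (LINT s:{u..v}|lborel. indicator {0..b} s * Y s) - tri F u v"
    unfolding set_integral_local[OF s] by (rule diag_eq(4)[OF u uv])
qed (intro jF L2_local)+

text \<open>The same difference quotient has two L2 limits over a compact interval:
  \<open>quotient_local\<close> yields \<open>Y - X\<close>, the assumption yields
  \<open>2 * f\<close>. Their difference \<open>Z\<close> is therefore null. The condition
  \<open>0 < a\<close> keeps the points \<open>w - k\<close> inside the wedge for small
  \<open>k\<close>.\<close>

lemma time_derivative_diagonal:
  assumes ab: "0 < a" "a \<le> b" and f: "f \<in> borel_measurable borel"
    and lim: "((\<lambda>h. \<integral>\<^sup>+x\<in>{2 * a..2 * b}. ennreal ((cmod ((F ((x - h) / 2) ((x + h) / 2) - F (x / 2) (x / 2)) / cor h - f x))\<^sup>2) \<partial>lborel) \<longlongrightarrow> 0) (at_right 0)"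
  shows "AE w in lborel. w \<in> {a..b} \<longrightarrow> Y w - X w = 2 * f (2 * w)"
proof -
  \<comment> \<open>A margin of \<open>a / 2\<close> on either side:
    \<open>[a / 2, b + a / 2]\<close> lies in \<open>[0, R]\<close>.\<close>
  define R where "R = b + a / 2"
  define X1 where "X1 w = indicator {0..R} w * X w" for w
  define Y1 where "Y1 w = indicator {0..R} w * Y w" for w
  interpret D: diagonal_data F X1 Y1 "{0..R}" unfolding X1_def[abs_def] Y1_def[abs_def] by (rule local_data)
  define q where "q k w = cor (1 / k) * (F (w - k) (w + k) - F w w) - (Y1 w - X1 w)" for k w
  have ql: "((\<lambda>k. nsq (\<lambda>w. indicator {a..b} w * q k w)) \<longlongrightarrow> 0) (at_right 0)"
    unfolding q_def by (rule D.quotient_local[of _ "a / 2"]) (use ab in \<open>auto simp: R_def\<close>)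
  have Lq: "L2 (\<lambda>w. indicator {a..b} w * q k w)" for k
  proof -
    have c: "continuous_on UNIV (\<lambda>w. cor (1 / k) * (F (w - k) (w + k) - F w w))"
      by (intro continuous_intros jcont_compose[OF jF])
    have "L2 (\<lambda>w. indicator {a..b} w * (cor (1 / k) * (F (w - k) (w + k) - F w w)) - indicator {a..b} w * (Y1 w - X1 w))"
      by (intro L2_diff(1) L2_continuous_Icc c L2_restrict(1) D.LX D.LY) simp
    then show ?thesis by (simp add: q_def right_diff_distrib)
  qed
  define Z where "Z w = indicator {a..b} w * (Y1 w - X1 w - 2 * f (2 * w))" for w
  note [measurable] = f L2_measurable[OF D.LX] L2_measurable[OF D.LY] L2_measurable[OF Lq]
  have mF: "(\<lambda>x. F ((x - h) / 2) ((x + h) / 2)) \<in> borel_measurable borel" for h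
    by (intro borel_measurable_continuous_onI jcont_compose[OF jF] continuous_intros) auto
  have mF0: "(\<lambda>x. F (x / 2) (x / 2)) \<in> borel_measurable borel" using mF[of 0] by simp
  note [measurable] = mF mF0
  define r where "r h x = (F ((x - h) / 2) ((x + h) / 2) - F (x / 2) (x / 2)) / cor h - f x" for h x
  have mr [measurable]: "r h \<in> borel_measurable borel" for h unfolding r_def[abs_def] by measurable
  define I where "I h = (\<integral>\<^sup>+x\<in>{2 * a..2 * b}. ennreal ((cmod (r h x))\<^sup>2) \<partial>lborel)" for h
  have Zle: "(\<integral>\<^sup>+w. ennreal ((cmod (Z w))\<^sup>2) \<partial>lborel) \<le> 2 * ennreal (nsq (\<lambda>w. indicator {a..b} w * q k w)) + 4 * I (2 * k)" if k: "0 < k" for k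
  proof -
    have e: "Z w = 2 * (indicator {a..b} w * r (2 * k) (2 * w)) - indicator {a..b} w * q k w" for w
    proof -
      have F: "F ((2 * w - 2 * k) / 2) ((2 * w + 2 * k) / 2) = F (w - k) (w + k)" by (simp add: add_divide_distrib diff_divide_distrib)
      have "2 * ((F (w - k) (w + k) - F w w) / cor (2 * k)) = cor (1 / k) * (F (w - k) (w + k) - F w w)"
        using k by (simp add: field_simps)
      then show ?thesis unfolding Z_def r_def q_def F by (simp add: right_diff_distrib indicator_def)
    qed
    have "(\<integral>\<^sup>+w. ennreal ((cmod (Z w))\<^sup>2) \<partial>lborel) \<le> (\<integral>\<^sup>+w. 2 * ennreal ((cmod (indicator {a..b} w * q k w))\<^sup>2) + 8 * (ennreal ((cmod (r (2 * k) (2 * w)))\<^sup>2) * indicator {2 * a..2 * b} (2 * w)) \<partial>lborel)"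
    proof (intro nn_integral_mono)
      \<comment> \<open>The constant 8 is 2 from the square of a sum times 4 from the factor 2 in
        front of \<open>r\<close>. The substitution \<open>x = 2 * w\<close> afterwards halves it to
        4.\<close>
      fix w
      have "(cmod (Z w))\<^sup>2 \<le> 2 * (cmod (2 * (indicator {a..b} w * r (2 * k) (2 * w))))\<^sup>2 + 2 * (cmod (indicator {a..b} w * q k w))\<^sup>2"
        using cmod_add_sq_le[of "2 * (indicator {a..b} w * r (2 * k) (2 * w))" "- (indicator {a..b} w * q k w)"] unfolding e by simp
      also have "\<dots> = 2 * (cmod (indicator {a..b} w * q k w))\<^sup>2 + 8 * ((cmod (r (2 * k) (2 * w)))\<^sup>2 * indicator {2 * a..2 * b} (2 * w))"
        by (auto simp: indicator_def norm_mult power_mult_distrib)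
      finally have "ennreal ((cmod (Z w))\<^sup>2) \<le> ennreal (2 * (cmod (indicator {a..b} w * q k w))\<^sup>2 + 8 * ((cmod (r (2 * k) (2 * w)))\<^sup>2 * indicator {2 * a..2 * b} (2 * w)))"
        by (rule ennreal_leI)
      then show "ennreal ((cmod (Z w))\<^sup>2) \<le> 2 * ennreal ((cmod (indicator {a..b} w * q k w))\<^sup>2) + 8 * (ennreal ((cmod (r (2 * k) (2 * w)))\<^sup>2) * indicator {2 * a..2 * b} (2 * w))"
        by (simp add: ennreal_plus ennreal_mult ennreal_indicator)
    qed
    also have "\<dots> = 2 * (\<integral>\<^sup>+w. ennreal ((cmod (indicator {a..b} w * q k w))\<^sup>2) \<partial>lborel) + 8 * (\<integral>\<^sup>+w. ennreal ((cmod (r (2 * k) (2 * w)))\<^sup>2) * indicator {2 * a..2 * b} (2 * w) \<partial>lborel)"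
      by (subst nn_integral_add) (auto simp: nn_integral_cmult)
    also have "(\<integral>\<^sup>+w. ennreal ((cmod (indicator {a..b} w * q k w))\<^sup>2) \<partial>lborel) = ennreal (nsq (\<lambda>w. indicator {a..b} w * q k w))"
      by (rule nsq_nn[OF Lq])
    also have "8 * (\<integral>\<^sup>+w. ennreal ((cmod (r (2 * k) (2 * w)))\<^sup>2) * indicator {2 * a..2 * b} (2 * w) \<partial>lborel) = 4 * I (2 * k)"
    proof -
      have "I (2 * k) = 2 * (\<integral>\<^sup>+w. ennreal ((cmod (r (2 * k) (2 * w)))\<^sup>2) * indicator {2 * a..2 * b} (2 * w) \<partial>lborel)"
        unfolding I_def by (rule nn_integral_scale) measurable
      then have "4 * I (2 * k) = (4 * 2) * (\<integral>\<^sup>+w. ennreal ((cmod (r (2 * k) (2 * w)))\<^sup>2) * indicator {2 * a..2 * b} (2 * w) \<partial>lborel)"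
        by (simp only: mult.assoc)
      then show ?thesis by simp
    qed
    finally show ?thesis .
  qed
  have d2: "filterlim (\<lambda>k::real. 2 * k) (at_right 0) (at_right 0)"
    unfolding filterlim_at by (auto intro!: tendsto_eq_intros simp: eventually_at_filter)
  have I0: "((\<lambda>k. I (2 * k)) \<longlongrightarrow> 0) (at_right 0)"
    by (rule filterlim_compose[OF _ d2]) (use lim in \<open>simp add: I_def[abs_def] r_def\<close>)
  have "((\<lambda>k. 2 * ennreal (nsq (\<lambda>w. indicator {a..b} w * q k w)) + 4 * I (2 * k)) \<longlongrightarrow> 2 * ennreal 0 + 4 * 0) (at_right 0)"
    by (intro tendsto_add ennreal_tendsto_cmult tendsto_ennrealI ql I0) auto
  then have "((\<lambda>k. 2 * ennreal (nsq (\<lambda>w. indicator {a..b} w * q k w)) + 4 * I (2 * k)) \<longlongrightarrow> 0) (at_right 0)" by simp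
  then have "(\<integral>\<^sup>+w. ennreal ((cmod (Z w))\<^sup>2) \<partial>lborel) \<le> 0"
    by (rule tendsto_lowerbound)
      (use eventually_at_right_less[of "0::real"] Zle in \<open>auto elim: eventually_mono\<close>)
  then have "(\<integral>\<^sup>+w. ennreal ((cmod (Z w))\<^sup>2) \<partial>lborel) = 0" by simp
  moreover have "(\<lambda>w. ennreal ((cmod (Z w))\<^sup>2)) \<in> borel_measurable lborel" unfolding Z_def[abs_def] by measurable
  ultimately have "AE w in lborel. ennreal ((cmod (Z w))\<^sup>2) = 0" by (simp add: nn_integral_0_iff_AE)
  then show ?thesis
  proof eventually_elim
    case (elim w)
    then have "Z w = 0" by (simp add: ennreal_eq_0_iff)
    then show ?case using ab by (auto simp: Z_def X1_def Y1_def R_def)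
  qed
qed

text \<open>Both sides are densities of the same increment of \<open>F w w\<close>, so their
  integrals agree over all subintervals and \<open>zero_AE_if_integral_zero\<close> applies to the
  difference.\<close>

lemma space_derivative_diagonal:
  assumes d: "L2 d" "\<And>x y. x \<le> y \<Longrightarrow> F (y / 2) (y / 2) - F (x / 2) (x / 2) = (LINT s:{x..y}|lborel. d s)"
  shows "AE w in lborel. 0 \<le> w \<and> w < b \<longrightarrow> X w + Y w = 2 * d (2 * w)"
proof -
  interpret D: diagonal_data F "\<lambda>w. indicator {0..b} w * X w" "\<lambda>w. indicator {0..b} w * Y w" "{0..b}" by (rule local_data)
  let ?f = "\<lambda>w. indicator {0..b} w * X w + indicator {0..b} w * Y w - 2 * d (2 * w)"
  have Ld: "L2 (\<lambda>w. 2 * d (2 * w))" by (intro L2_cmul(1) L2_scale d) simp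
  have "AE w in lborel. 0 \<le> w \<and> w < b \<longrightarrow> ?f w = 0"
  proof (rule zero_AE_if_integral_zero)
    show "L2 ?f" by (intro L2_diff(1) L2_add(1) D.LX D.LY Ld)
    fix u v assume uv: "0 \<le> u" "u \<le> v" "v \<le> b"
    have "(LINT s:{u..v}|lborel. ?f s) = (LINT s:{u..v}|lborel. indicator {0..b} s * X s) + (LINT s:{u..v}|lborel. indicator {0..b} s * Y s) - (LINT s:{u..v}|lborel. 2 * d (2 * s))"
      by (simp only: set_integral_diff(2)[OF set_integral_add(1)[OF L2_set_integrable[OF D.LX] L2_set_integrable[OF D.LY]] L2_set_integrable[OF Ld]]
          set_integral_add(2)[OF L2_set_integrable[OF D.LX] L2_set_integrable[OF D.LY]])
    also have "(LINT s:{u..v}|lborel. 2 * d (2 * s)) = (LINT s:{2 * u..2 * v}|lborel. d s)"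
      unfolding set_integral_scale by (rule set_integral_mult_right)
    also have "\<dots> = F v v - F u u" using d(2)[of "2 * u" "2 * v"] uv by simp
    finally show "(LINT s:{u..v}|lborel. ?f s) = 0" using D.diag[of u v] uv by auto
  qed
  then show ?thesis by eventually_elim auto
qed

end

text \<open>The boundary relations concern positive arguments only. At the vertex, continuity of
  \<phi> along each axis identifies \<open>\<phi> 0 0\<close> with the traces of both
  \<open>g\<close> and \<open>p\<close>.\<close>

lemma wedge_of_solution:
  assumes \<phi>: "finite_energy_solution \<phi>" and hg: "H1_halfline g g'" and hp: "H1_halfline p p'"
    and g: "\<And>u. 0 < u \<Longrightarrow> g u = \<phi> (- u) u" and p: "\<And>v. 0 < v \<Longrightarrow> p v = \<phi> v v"
  shows "wedge (\<lambda>u v. \<phi> (v - u) (u + v)) (half g') (half p')" "\<phi> 0 0 = bv g g'"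
proof -
  define F where "F u v = \<phi> (v - u) (u + v)" for u v
  have rF: "rect F" unfolding F_def[abs_def]
    by (rule distributional_imp_rect) (use \<phi> in \<open>auto simp: finite_energy_solution_def\<close>)
  note jF = rect_jcont[OF rF]
  have vertex: "f 0 = bv h h'" if h: "H1_halfline h h'" and f: "continuous_on UNIV f" "\<And>u. 0 < u \<Longrightarrow> f u = h u" for f h h'
  proof -
    define k where "k u = bv h h' + (LINT s:{0..u}|lborel. half h' s)" for u
    have k: "continuous_on UNIV k" unfolding k_def
      by (intro continuous_on_add continuous_on_const L2_primitive_continuous H1_L2(1)[OF h])
    have t: "(f \<longlongrightarrow> f 0) (at_right 0)" "(k \<longlongrightarrow> k 0) (at_right 0)"
      using f(1) k by (auto simp: continuous_on_def intro: Lim_at_imp_Lim_at_within)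
    have "\<forall>\<^sub>F u in at_right 0. f u = k u"
      using eventually_at_right_less[of "0::real"] by eventually_elim (simp add: f(2) H1_L2(2)[OF h] k_def)
    then have "(k \<longlongrightarrow> f 0) (at_right 0)" using t(1) by (rule tendsto_cong[THEN iffD1])
    then have "f 0 = k 0" using t(2) by (intro tendsto_unique[of "at_right (0::real)"]) auto
    then show ?thesis by (simp only: k_def set_integral_Icc_same add_0_right)
  qed
  have g0: "F 0 0 = bv g g'"
    using vertex[OF hg jcont_sections(2)[OF jF, of UNIV 0]] g by (simp add: F_def)
  have p0: "F 0 0 = bv p p'"
    using vertex[OF hp jcont_sections(1)[OF jF, of UNIV 0]] p by (simp add: F_def)
  show "wedge (\<lambda>u v. \<phi> (v - u) (u + v)) (half g') (half p')"
    unfolding F_def[abs_def, symmetric]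
  proof
    fix u :: real assume "0 \<le> u"
    then show "F u 0 = F 0 0 + (LINT s:{0..u}|lborel. half g' s)"
      using g[of u] H1_L2(2)[OF hg, of u] g0 set_integral_Icc_same[of 0 "half g'"] by (cases "u = 0") (auto simp: F_def)
  next
    fix v :: real assume "0 \<le> v"
    then show "F 0 v = F 0 0 + (LINT s:{0..v}|lborel. half p' s)"
      using p[of v] H1_L2(2)[OF hp, of v] p0 set_integral_Icc_same[of 0 "half p'"] by (cases "v = 0") (auto simp: F_def)
  qed (use rF H1_L2(1)[OF hg] H1_L2(1)[OF hp] half_nonpos in auto)
  show "\<phi> 0 0 = bv g g'" using g0 by (simp add: F_def)
qed

lemma tendsto_set_nn_integral_zero:
  assumes "((\<lambda>h. \<integral>\<^sup>+x. q h x \<partial>lborel) \<longlongrightarrow> 0) (at (0::real))"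
  shows "((\<lambda>h. \<integral>\<^sup>+x\<in>S. q h x \<partial>lborel) \<longlongrightarrow> 0) (at 0)"
proof (rule tendsto_sandwich[OF _ _ tendsto_const assms])
  show "\<forall>\<^sub>F h in at 0. (\<integral>\<^sup>+x\<in>S. q h x \<partial>lborel) \<le> (\<integral>\<^sup>+x. q h x \<partial>lborel)"
    by (intro always_eventually allI nn_integral_mono) (auto simp: indicator_def)
qed simp

lemma exhaust_positive:
  assumes "0 < w"
  obtains n :: nat where "w \<in> {1 / real (Suc n)..real (Suc n)}"
proof -
  obtain n where n: "inverse (real (Suc n)) < w" using reals_Archimedean[OF assms] by blast
  obtain m where m: "w \<le> real m" using real_arch_simple by blast
  have "1 / real (Suc (max n m)) \<le> 1 / real (Suc n)" by (intro divide_left_mono) auto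
  then have "w \<in> {1 / real (Suc (max n m))..real (Suc (max n m))}" using n m by (auto simp: inverse_eq_divide)
  then show ?thesis by (rule that)
qed

lemma hankel_if_solution:
  assumes hg: "H1_halfline g g'" and hp: "H1_halfline p p'" and \<phi>: "finite_energy_solution \<phi>"
    and g: "\<And>u. 0 < u \<Longrightarrow> g u = \<phi> (- u) u" and p: "\<And>v. 0 < v \<Longrightarrow> p v = \<phi> v v"
  shows "hankel0_pair (\<lambda>r. cor (sqrt r) * g (r\<^sup>2 / 2)) (\<lambda>s. - cor (sqrt s) * p' (s\<^sup>2 / 2))"
proof -
  note G = H1_L2[OF hg] and P = H1_L2[OF hp]
  define F where "F u v = \<phi> (v - u) (u + v)" for u v
  have F\<phi>: "F ((x - h) / 2) ((x + h) / 2) = \<phi> h x" for h x by (simp add: F_def add_divide_distrib diff_divide_distrib)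
  have F\<phi>0: "F (x / 2) (x / 2) = \<phi> 0 x" for x using F\<phi>[of x 0] by simp
  interpret wedge F "half g'" "half p'"
    unfolding F_def[abs_def] by (rule wedge_of_solution(1)[OF \<phi> hg hp g p])
  have F0: "F 0 0 = bv g g'" using wedge_of_solution(2)[OF \<phi> hg hp g p] by (simp add: F_def)
  have mL: "L2 f" if "f \<in> borel_measurable lborel" "(\<integral>\<^sup>+x. ennreal ((cmod (f x))\<^sup>2) \<partial>lborel) < \<infinity>" for f
    using that L2_nn[of f] by simp
  obtain d where d: "L2 d" "\<And>x y. x \<le> y \<Longrightarrow> \<phi> 0 y - \<phi> 0 x = (LINT s:{x..y}|lborel. d s)"
    using \<phi> mL unfolding finite_energy_solution_def by blast
  obtain f1 where f1: "L2 f1" and lim: "((\<lambda>h. \<integral>\<^sup>+ x. ennreal ((cmod ((\<phi> h x - \<phi> 0 x) / cor h - f1 x))\<^sup>2) \<partial>lborel) \<longlongrightarrow> 0) (at 0)"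
    using \<phi> mL unfolding finite_energy_solution_def by blast
  \<comment> \<open>\<open>time_derivative_diagonal\<close> needs compact intervals away from 0;
    countably many of them exhaust the open half line.\<close>
  have "AE w in lborel. \<forall>n. w \<in> {1 / real (Suc n)..real (Suc n)} \<longrightarrow> Y w - X w = 2 * f1 (2 * w)"
    unfolding AE_all_countable
  proof
    fix n
    have "1 / real (Suc n) \<le> 1" by (subst divide_le_eq_1_pos) auto
    then have "1 / real (Suc n) \<le> real (Suc n)" by (rule order_trans) simp
    then show "AE w in lborel. w \<in> {1 / real (Suc n)..real (Suc n)} \<longrightarrow> Y w - X w = 2 * f1 (2 * w)"
      by (intro time_derivative_diagonal L2_measurable[OF f1])
        (auto simp: F\<phi> F\<phi>0 simp del: of_nat_Suc intro!: Lim_at_imp_Lim_at_within[OF tendsto_set_nn_integral_zero[OF lim]])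
  qed
  moreover have "AE w in lborel. \<forall>n. 0 \<le> w \<and> w < real n \<longrightarrow> X w + Y w = 2 * d (2 * w)"
    unfolding AE_all_countable by (intro allI space_derivative_diagonal d(1)) (simp add: F\<phi>0 d(2))
  ultimately have "AE w in lborel. Yd w = half (\<lambda>w. d (2 * w) + f1 (2 * w)) w"
  proof eventually_elim
    case (elim w)
    show ?case
    proof (cases "0 < w")
      case True
      obtain n where n: "w \<in> {1 / real (Suc n)..real (Suc n)}" using exhaust_positive[OF True] by blast
      then have "w < real (n + 2)" by simp
      then have "X w + Y w = 2 * d (2 * w)" using elim(2) True by (meson less_imp_le)
      moreover have "Y w - X w = 2 * f1 (2 * w)" using elim(1) n by blast
      ultimately have "2 * Y w = 2 * (d (2 * w) + f1 (2 * w))" by (simp add: algebra_simps)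
      then have "Y w = d (2 * w) + f1 (2 * w)" by (rule mult_left_cancel[THEN iffD1, rotated]) simp
      then show ?thesis using True by (simp add: Yd_def half_pos)
    qed (simp add: Yd_def half_nonpos)
  qed
  moreover have "L2 (half (\<lambda>w. d (2 * w) + f1 (2 * w)))"
    unfolding half_def[abs_def] by (intro L2_restrict(1) L2_add(1) L2_scale d f1) auto
  ultimately have LY: "L2 Yd" by (intro L2_AE_cong[OF _ d_measurable(3)])
  have "L2 (\<phi> 0)"
  proof (rule mL)
    have "continuous_on UNIV (\<lambda>x. \<phi> (fst (0::real, x)) (snd (0::real, x)))"
      by (rule continuous_on_compose2[of UNIV]) (use \<phi> in \<open>auto simp: finite_energy_solution_def intro!: continuous_intros\<close>)
    then show "\<phi> 0 \<in> borel_measurable lborel" using borel_measurable_continuous_onI by simp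
  qed (use \<phi> in \<open>auto simp: finite_energy_solution_def\<close>)
  then have "L2 (half (\<lambda>w. \<phi> 0 (2 * w)))"
    unfolding half_def[abs_def] by (intro L2_restrict(1) L2_scale) auto
  then have LF: "L2 Fd" by (simp add: Fd_def F_def)
  \<comment> \<open>These rates are at least 5, as \<open>Laplace_relation\<close> requires, and are
    the ones tested by \<open>hankel_if_Laplace\<close> with \<open>N = 5\<close>.\<close>
  have "cor (real k + 1 + 5) * (LINT u|lborel. half g u * ex (real k + 1 + 5) u) = - (LINT v|lborel. half p' v * ex (1 / (real k + 1 + 5)) v)" for k :: nat
  proof -
    have "cor (real k + 1 + 5) * (LINT u|lborel. half g u * ex (real k + 1 + 5) u) = F 0 0 + (LINT u|lborel. half g' u * ex (real k + 1 + 5) u)"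
      unfolding F0 by (rule Laplace_derivative[OF G(1) half_nonpos G(3,2)]) auto
    also have "\<dots> = - (LINT v|lborel. half p' v * ex (1 / (real k + 1 + 5)) v)"
      by (rule Laplace_relation[OF LF LY]) simp
    finally show ?thesis .
  qed
  then show ?thesis
    unfolding hankel0_pair_iff[OF L2_measurable[OF G(3)] L2_measurable[OF P(1)]]
    by (intro hankel_if_Laplace[where N = 5] G P) auto
qed

text \<open>If \<open>F w w\<close> vanishes, so do the integrals of \<open>X + Y\<close>; equality
  of the integrals of \<open>X\<close> and \<open>Y\<close> then makes those of \<open>Y\<close>
  vanish too. The d'Alembert formula reduces to \<open>F = - tri\<close>, which
  \<open>Cauchy_zero\<close> settles for \<open>u > 0\<close>, and continuity reaches the
  axis.\<close>

lemma (in wedge) Cauchy_zero_wedge: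
  assumes z: "\<And>w. 0 < w \<Longrightarrow> w < a \<Longrightarrow> F w w = 0"
    and XY: "\<And>u v. 0 < u \<Longrightarrow> u \<le> v \<Longrightarrow> v < a \<Longrightarrow> (LINT s:{u..v}|lborel. X s) = (LINT s:{u..v}|lborel. Y s)"
    and v: "0 < v" "v < a"
  shows "F 0 v = 0"
proof -
  have Fz: "F u v = 0" if u: "0 < u" "u < v" for u
  proof (rule Cauchy_zero[OF rect, of u v])
    fix s t assume st: "u \<le> s" "s \<le> t" "t \<le> v"
    have "F t t = 0" "F s s = 0" using z st u v by auto
    then have "(LINT s:{s..t}|lborel. Y s) = 0"
      using diag_eq(3)[of s t] XY[of s t] st u v by simp
    then show "F s t = - tri F s t" using diag_eq(4)[of s t] st u \<open>F s s = 0\<close> by simp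
  qed (use u in auto)
  have "((\<lambda>u. F u v) \<longlongrightarrow> F 0 v) (at_right 0)"
    using jcont_sections(2)[OF jF, of UNIV v] by (auto simp: continuous_on_def intro: Lim_at_imp_Lim_at_within)
  moreover have ev: "\<forall>\<^sub>F u in at_right 0. F u v = 0"
    using eventually_at_right_real[OF v(1)] by eventually_elim (simp add: Fz)
  ultimately have "((\<lambda>u::real. 0) \<longlongrightarrow> F 0 v) (at_right 0)" using tendsto_cong[OF ev] by blast
  then show ?thesis by (simp add: tendsto_const_iff)
qed

lemma support_iff:
  assumes hg: "H1_halfline g g'" and hp: "H1_halfline p p'" and \<phi>: "finite_energy_solution \<phi>"
    and g: "\<And>u. 0 < u \<Longrightarrow> g u = \<phi> (- u) u" and p: "\<And>v. 0 < v \<Longrightarrow> p v = \<phi> v v" and a: "0 < a"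
  shows "(\<forall>x\<in>{0<..<2 * a}. \<phi> 0 x = 0) \<and> dt_vanishes_on \<phi> {0<..<2 * a} \<longleftrightarrow>
    (\<forall>u\<in>{0<..<a}. g u = 0) \<and> (\<forall>v\<in>{0<..<a}. p v = 0)"
proof -
  define F where "F u v = \<phi> (v - u) (u + v)" for u v
  have F\<phi>: "F ((x - h) / 2) ((x + h) / 2) = \<phi> h x" for h x by (simp add: F_def add_divide_distrib diff_divide_distrib)
  have F\<phi>0: "F (x / 2) (x / 2) = \<phi> 0 x" for x using F\<phi>[of x 0] by simp
  have Fd: "F w w = \<phi> 0 (2 * w)" for w by (simp add: F_def)
  interpret wedge F "half g'" "half p'"
    unfolding F_def[abs_def] by (rule wedge_of_solution(1)[OF \<phi> hg hp g p])
  have gF: "g u = F u 0" "p u = F 0 u" if "0 < u" for u using g[OF that] p[OF that] by (simp_all add: F_def)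
  show ?thesis
  proof
    assume z: "(\<forall>x\<in>{0<..<2 * a}. \<phi> 0 x = 0) \<and> dt_vanishes_on \<phi> {0<..<2 * a}"
    have dt: "((\<lambda>h. \<integral>\<^sup>+ x\<in>{0<..<2 * a}. ennreal ((cmod ((\<phi> h x - \<phi> 0 x) / cor h))\<^sup>2) \<partial>lborel) \<longlongrightarrow> 0) (at 0)"
      using z by (simp add: dt_vanishes_on_def)
    have dz: "F w w = 0" if "0 < w" "w < a" for w using z that by (simp add: Fd)
    have XY: "(LINT s:{u..v}|lborel. X s) = (LINT s:{u..v}|lborel. Y s)" if uv: "0 < u" "u \<le> v" "v < a" for u v
    proof -
      have "((\<lambda>h. \<integral>\<^sup>+ x\<in>{2 * u..2 * v}. ennreal ((cmod ((\<phi> h x - \<phi> 0 x) / cor h))\<^sup>2) \<partial>lborel) \<longlongrightarrow> 0) (at 0)"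
      proof (rule tendsto_sandwich[OF _ _ tendsto_const dt])
        show "\<forall>\<^sub>F h in at 0. (\<integral>\<^sup>+ x\<in>{2 * u..2 * v}. ennreal ((cmod ((\<phi> h x - \<phi> 0 x) / cor h))\<^sup>2) \<partial>lborel)
          \<le> (\<integral>\<^sup>+ x\<in>{0<..<2 * a}. ennreal ((cmod ((\<phi> h x - \<phi> 0 x) / cor h))\<^sup>2) \<partial>lborel)"
          using uv by (intro always_eventually allI nn_integral_mono) (auto simp: indicator_def)
      qed simp
      then have lim: "((\<lambda>h. \<integral>\<^sup>+ x\<in>{2 * u..2 * v}. ennreal ((cmod ((F ((x - h) / 2) ((x + h) / 2) - F (x / 2) (x / 2)) / cor h - 0))\<^sup>2) \<partial>lborel) \<longlongrightarrow> 0) (at_right 0)"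
        unfolding F\<phi> F\<phi>0 diff_0_right by (rule Lim_at_imp_Lim_at_within)
      have "AE w in lborel. w \<in> {u..v} \<longrightarrow> Y w - X w = 2 * 0"
        by (rule time_derivative_diagonal[where f = "\<lambda>_. 0", OF uv(1,2) _ lim]) simp
      then have "AE w in lborel. indicat_real {u..v} w *\<^sub>R X w = indicat_real {u..v} w *\<^sub>R Y w"
        by eventually_elim (auto simp: indicator_def)
      then show ?thesis unfolding set_lebesgue_integral_def
        by (intro integral_cong_AE) (use XY_measurable in auto)
    qed
    have pz: "F 0 v = 0" if "0 < v" "v < a" for v by (rule Cauchy_zero_wedge[OF dz XY that])
    have gz: "F u 0 = 0" if "0 < u" "u < a" for u
      by (rule wedge.Cauchy_zero_wedge[OF swap_wedge, unfolded swap_defs, OF dz XY[symmetric] that])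
    show "(\<forall>u\<in>{0<..<a}. g u = 0) \<and> (\<forall>v\<in>{0<..<a}. p v = 0)" using gF pz gz by simp
  next
    assume z: "(\<forall>u\<in>{0<..<a}. g u = 0) \<and> (\<forall>v\<in>{0<..<a}. p v = 0)"
    have axis: "F u 0 = 0" "F 0 u = 0" if "0 < u" "u < a" for u using z that gF[of u] by auto
    have "((\<lambda>u. F u 0) \<longlongrightarrow> F 0 0) (at_right 0)"
      using jcont_sections(2)[OF jF, of UNIV 0] by (auto simp: continuous_on_def intro: Lim_at_imp_Lim_at_within)
    moreover have ev: "\<forall>\<^sub>F u in at_right 0. F u 0 = 0"
      using eventually_at_right_real[OF a] by eventually_elim (simp add: axis)
    ultimately have "((\<lambda>u::real. 0) \<longlongrightarrow> F 0 0) (at_right 0)" using tendsto_cong[OF ev] by blast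
    then have F00: "F 0 0 = 0" by (simp add: tendsto_const_iff)
    have axis': "F u 0 = 0" "F 0 u = 0" if "0 \<le> u" "u < a" for u using axis[of u] F00 that by (cases "u = 0"; simp)+
    have Fz: "F u v = 0" if uv: "0 \<le> u" "u < a" "0 \<le> v" "v < a" for u v
      by (rule Goursat_zero[OF rect, of "max u v"]) (use uv axis' in auto)
    have \<phi>z: "\<phi> h x = 0" if "\<bar>h\<bar> \<le> x" "x + \<bar>h\<bar> < 2 * a" for h x
      unfolding F\<phi>[symmetric] by (rule Fz) (use that in auto)
    obtain f1 where f1: "f1 \<in> borel_measurable lborel" and lim: "((\<lambda>h. \<integral>\<^sup>+ x. ennreal ((cmod ((\<phi> h x - \<phi> 0 x) / cor h - f1 x))\<^sup>2) \<partial>lborel) \<longlongrightarrow> 0) (at 0)"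
      using \<phi> unfolding finite_energy_solution_def by blast
    \<comment> \<open>For a fixed time \<open>h\<close> the solution is known to vanish only for
      \<open>\<bar>h\<bar> \<le> x\<close> and \<open>x + \<bar>h\<bar> < 2 * a\<close>, which falls
      short of both ends of the interval. So the time derivative \<open>f1\<close> is shown to
      vanish first, on smaller intervals.\<close>
    have f1z: "AE x in lborel. x \<in> {e..2 * a - e} \<longrightarrow> f1 x = 0" if e: "0 < e" for e
    proof -
      let ?I = "\<integral>\<^sup>+ x\<in>{e..2 * a - e}. ennreal ((cmod (f1 x))\<^sup>2) \<partial>lborel"
      have lim': "((\<lambda>h. \<integral>\<^sup>+ x. ennreal ((cmod ((\<phi> h x - \<phi> 0 x) / cor h - f1 x))\<^sup>2) \<partial>lborel) \<longlongrightarrow> 0) (at_right 0)"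
        by (rule Lim_at_imp_Lim_at_within[OF lim])
      have "?I \<le> 0"
      proof (rule tendsto_lowerbound[OF lim'])
        show "\<forall>\<^sub>F h in at_right 0. ?I \<le> (\<integral>\<^sup>+ x. ennreal ((cmod ((\<phi> h x - \<phi> 0 x) / cor h - f1 x))\<^sup>2) \<partial>lborel)"
          using eventually_at_right_real[OF e]
        proof eventually_elim
          case (elim h)
          show ?case
          proof (rule nn_integral_mono)
            fix x
            show "ennreal ((cmod (f1 x))\<^sup>2) * indicator {e..2 * a - e} x \<le> ennreal ((cmod ((\<phi> h x - \<phi> 0 x) / cor h - f1 x))\<^sup>2)"
              using \<phi>z[of h x] \<phi>z[of 0 x] elim e by (cases "x \<in> {e..2 * a - e}") auto
          qed
        qed
      qed simp
      then have "?I = 0" by simp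
      moreover have "(\<lambda>x. ennreal ((cmod (f1 x))\<^sup>2) * indicator {e..2 * a - e} x) \<in> borel_measurable lborel" using f1 by measurable
      ultimately have "AE x in lborel. ennreal ((cmod (f1 x))\<^sup>2) * indicator {e..2 * a - e} x = 0" by (simp add: nn_integral_0_iff_AE)
      then show ?thesis by eventually_elim (auto simp: indicator_def ennreal_eq_0_iff)
    qed
    have "AE x in lborel. \<forall>n. x \<in> {1 / real (Suc n)..2 * a - 1 / real (Suc n)} \<longrightarrow> f1 x = 0"
      unfolding AE_all_countable by (intro allI f1z) simp
    then have f1I: "AE x in lborel. x \<in> {0<..<2 * a} \<longrightarrow> f1 x = 0"
    proof eventually_elim
      case (elim x)
      show ?case
      proof
        assume x: "x \<in> {0<..<2 * a}"
        then obtain n where "inverse (real (Suc n)) < min x (2 * a - x)" using reals_Archimedean[of "min x (2 * a - x)"] by auto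
        then have "x \<in> {1 / real (Suc n)..2 * a - 1 / real (Suc n)}" by (auto simp: inverse_eq_divide simp del: of_nat_Suc)
        then show "f1 x = 0" using elim by blast
      qed
    qed
    \<comment> \<open>With \<open>f1 = 0\<close> almost everywhere on the whole interval, the
      quotient there equals the quotient minus \<open>f1\<close>, whose norm over the entire line
      tends to 0. This covers the strips near the ends as well.\<close>
    have "dt_vanishes_on \<phi> {0<..<2 * a}"
      unfolding dt_vanishes_on_def
    proof (rule tendsto_sandwich[OF _ _ tendsto_const lim])
      show "\<forall>\<^sub>F h in at 0. (\<integral>\<^sup>+ x\<in>{0<..<2 * a}. ennreal ((cmod ((\<phi> h x - \<phi> 0 x) / cor h))\<^sup>2) \<partial>lborel)
        \<le> (\<integral>\<^sup>+ x. ennreal ((cmod ((\<phi> h x - \<phi> 0 x) / cor h - f1 x))\<^sup>2) \<partial>lborel)"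
      proof (rule always_eventually, rule allI, rule nn_integral_mono_AE)
        fix h
        show "AE x in lborel. ennreal ((cmod ((\<phi> h x - \<phi> 0 x) / cor h))\<^sup>2) * indicator {0<..<2 * a} x \<le> ennreal ((cmod ((\<phi> h x - \<phi> 0 x) / cor h - f1 x))\<^sup>2)"
          using f1I by eventually_elim (auto simp: indicator_def)
      qed
    qed simp
    moreover have "\<forall>x\<in>{0<..<2 * a}. \<phi> 0 x = 0" using \<phi>z[of 0] by auto
    ultimately show "(\<forall>x\<in>{0<..<2 * a}. \<phi> 0 x = 0) \<and> dt_vanishes_on \<phi> {0<..<2 * a}" by blast
  qed
qed

theorem theorem2:
  fixes g g' p p' :: "real \<Rightarrow> complex"
  assumes hg: "H1_halfline g g'"
    and hp: "H1_halfline p p'"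
  shows "(hankel0_pair (\<lambda>r. complex_of_real (sqrt r) * g (r\<^sup>2 / 2))
                       (\<lambda>s. - complex_of_real (sqrt s) * p' (s\<^sup>2 / 2))
          \<longleftrightarrow> (\<exists>\<phi>. finite_energy_solution \<phi> \<and>
                   (\<forall>u>0. g u = \<phi> (-u) u) \<and> (\<forall>v>0. p v = \<phi> v v)))
       \<and> (\<forall>\<phi> a. finite_energy_solution \<phi> \<and> (\<forall>u>0. g u = \<phi> (-u) u) \<and>
                (\<forall>v>0. p v = \<phi> v v) \<and> a > 0 \<longrightarrow>
           (((\<forall>x\<in>{0<..<2*a}. \<phi> 0 x = 0) \<and> dt_vanishes_on \<phi> {0<..<2*a})
            \<longleftrightarrow> ((\<forall>u\<in>{0<..<a}. g u = 0) \<and> (\<forall>v\<in>{0<..<a}. p v = 0))))"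
proof (rule conjI)
  show "hankel0_pair (\<lambda>r. complex_of_real (sqrt r) * g (r\<^sup>2 / 2)) (\<lambda>s. - complex_of_real (sqrt s) * p' (s\<^sup>2 / 2))
    \<longleftrightarrow> (\<exists>\<phi>. finite_energy_solution \<phi> \<and> (\<forall>u>0. g u = \<phi> (-u) u) \<and> (\<forall>v>0. p v = \<phi> v v))"
    using solution_if_hankel[OF hg hp] hankel_if_solution[OF hg hp] by blast
qed (intro allI impI support_iff[OF hg hp]; blast)

end
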